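(* Let $\Pi$ be a decision problem on graphs and let $H$ be a crossover gadget that is useful for $\Pi$. Then there is a polynomial-time algorithm that, given an instance $(G,t)$ of $\Pi$ and a linear layout $\pi$ of $G$, outputs an instance $(G',t')$ of $\Pi$ and a linear layout $\pi'$ of $G'$ such that: (1) $G'$ is planar; (2) $\mathrm{ctw}_{\pi'}(G') \le \mathrm{ctw}_\pi(G) + \mathrm{ctw}(H) + 4$; and (3) $(G,t)$ is a yes-instance of $\Pi$ if and only if $(G',t')$ is a yes-instance of $\Pi$.
   Context: All graphs are finite, simple and undirected. A decision problem on graphs is a decision problem whose instances are pairs $(G,t)$ of a graph $G$ and an integer $t$. For an $n$-vertex graph $G$, a linear layout is a bijection $\pi\colon V(G)\to[n]$; its cutwidth is $\mathrm{ctw}_\pi(G)=\max_{1\le i<n}|\{\{u,v\}\in E(G): \pi(u)\le i<\pi(v)\}|$, and $\mathrm{ctw}(G)$ is the minimum of $\mathrm{ctw}_\pi(G)$ over all linear layouts $\pi$. A drawing of a graph assigns distinct points to vertices and curves to edges (with the edge's endpoints as curve endpoints, no vertex in the interior of an edge curve, no three edge curves through a common interior point, and any two edge curves meeting in at most one interior point); it is planar if edge curves have pairwise disjoint interiors, and a graph is planar if it has a planar drawing. A crossover gadget is a graph $H$ with four terminal vertices $u,u',v,v'$ such that (i) $H$ has a planar drawing $\psi$ in which all terminals lie on the outer face, and (ii) there is a closed curve intersecting the drawing $\psi$ only in the terminals which visits them in the order $u,v,u',v'$. For disjoint edges $\{a,b\},\{c,d\}$ of a graph $G$, replacing $\{\{a,b\},\{c,d\}\}$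 by $H$ means: remove the edges $\{a,b\}$ and $\{c,d\}$, add a new disjoint copy of $H$, and add the edges $\{a,u\},\{u',b\},\{c,v\},\{v',d\}$. A crossover gadget $H$ is useful for a decision problem $\Pi$ on graphs if there is an integer $c_\Pi$ such that for every instance $(G,t)$ of $\Pi$ and every pair of disjoint edges $\{a,b\},\{c,d\}$ of $G$, if $G'$ is obtained by replacing these edges by $H$, then $(G,t)$ is a yes-instance of $\Pi$ if and only if $(G',t+c_\Pi)$ is a yes-instance of $\Pi$.
   Formalization: In condition (ii) of a crossover gadget the closed curve is taken to be simple and to enclose the drawing of H; without this, two disjoint edges uu', vv' would be a gadget useful for planarity testing and the claim would fail for K5. *)

theory Defs
  imports
    "HOL-Analysis.Analysis"
    "HOL-Library.Log_Nat"
    "HOL-Computational_Algebra.Polynomial"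
begin

section \<open>Graphs, linear layouts and cutwidth\<close>

datatype 'a graph = Graph (verts: "'a set") (edges: "'a set set")

definition simple_graph :: "'a graph \<Rightarrow> bool" where
  "simple_graph G \<longleftrightarrow> finite (verts G) \<and> (\<forall>e\<in>edges G. e \<subseteq> verts G \<and> card e = 2)"

definition linear_layout :: "'a graph \<Rightarrow> ('a \<Rightarrow> nat) \<Rightarrow> bool" where
  "linear_layout G \<pi> \<longleftrightarrow> bij_betw \<pi> (verts G) {1..card (verts G)}"

definition cut_edges :: "'a graph \<Rightarrow> ('a \<Rightarrow> nat) \<Rightarrow> nat \<Rightarrow> 'a set set" where
  "cut_edges G \<pi> i = {e \<in> edges G. \<exists>u v. e = {u, v} \<and> \<pi> u \<le> i \<and> i < \<pi> v}"

(* The inserted 0 only matters for graphs with at most one vertex,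
   where the maximum ranges over the empty set. *)
definition layout_cutwidth :: "'a graph \<Rightarrow> ('a \<Rightarrow> nat) \<Rightarrow> nat" where
  "layout_cutwidth G \<pi> = Max (insert 0 ((\<lambda>i. card (cut_edges G \<pi> i)) ` {1..<card (verts G)}))"

definition cutwidth :: "'a graph \<Rightarrow> nat" where
  "cutwidth G = (INF \<pi>\<in>{\<pi>. linear_layout G \<pi>}. layout_cutwidth G \<pi>)"

section \<open>Drawings in the plane\<close>

definition curve_interior :: "(real \<Rightarrow> complex) \<Rightarrow> complex set" where
  "curve_interior g = g ` {0<..<1}"

definition drawing :: "'a graph \<Rightarrow> ('a \<Rightarrow> complex) \<Rightarrow> ('a set \<Rightarrow> real \<Rightarrow> complex) \<Rightarrow> bool" where
  "drawing G p \<gamma> \<longleftrightarrow>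
     inj_on p (verts G) \<and>
     (\<forall>e\<in>edges G. arc (\<gamma> e) \<and> {pathstart (\<gamma> e), pathfinish (\<gamma> e)} = p ` e) \<and>
     (\<forall>e\<in>edges G. \<forall>x\<in>verts G. p x \<notin> curve_interior (\<gamma> e)) \<and>
     (\<forall>e\<in>edges G. \<forall>f\<in>edges G. \<forall>g\<in>edges G. e \<noteq> f \<longrightarrow> f \<noteq> g \<longrightarrow> e \<noteq> g \<longrightarrow>
        curve_interior (\<gamma> e) \<inter> curve_interior (\<gamma> f) \<inter> curve_interior (\<gamma> g) = {}) \<and>
     (\<forall>e\<in>edges G. \<forall>f\<in>edges G. e \<noteq> f \<longrightarrow>
        (\<forall>x y. x \<in> curve_interior (\<gamma> e) \<inter> curve_interior (\<gamma> f) \<longrightarrow>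
               y \<in> curve_interior (\<gamma> e) \<inter> curve_interior (\<gamma> f) \<longrightarrow> x = y))"

definition planar_drawing ::
  "'a graph \<Rightarrow> ('a \<Rightarrow> complex) \<Rightarrow> ('a set \<Rightarrow> real \<Rightarrow> complex) \<Rightarrow> bool" where
  "planar_drawing G p \<gamma> \<longleftrightarrow>
     drawing G p \<gamma> \<and>
     (\<forall>e\<in>edges G. \<forall>f\<in>edges G. e \<noteq> f \<longrightarrow> curve_interior (\<gamma> e) \<inter> curve_interior (\<gamma> f) = {})"

definition planar :: "'a graph \<Rightarrow> bool" where
  "planar G \<longleftrightarrow> simple_graph G \<and> (\<exists>p \<gamma>. planar_drawing G p \<gamma>)"

definition drawing_points ::
  "'a graph \<Rightarrow> ('a \<Rightarrow> complex) \<Rightarrow> ('a set \<Rightarrow> real \<Rightarrow> complex) \<Rightarrow> complex set" where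
  "drawing_points G p \<gamma> = p ` verts G \<union> (\<Union>e\<in>edges G. path_image (\<gamma> e))"

section \<open>Crossover gadgets\<close>

(* The outer face of a drawing with point set D is outside D, the unbounded component of
   the complement of D; a vertex lies on it if it is drawn on its boundary.
   The closed curve c is a Jordan curve that encloses the drawing. Without the enclosure,
   two disjoint edges u-u' and v-v' would form a gadget: draw one of them inside c
   and the other one outside. *)
definition crossover_gadget :: "'a graph \<Rightarrow> 'a \<Rightarrow> 'a \<Rightarrow> 'a \<Rightarrow> 'a \<Rightarrow> bool" where
  "crossover_gadget H u u' v v' \<longleftrightarrow>
     simple_graph H \<and> {u, u', v, v'} \<subseteq> verts H \<and> distinct [u, u', v, v'] \<and>
     (\<exists>p \<gamma>. planar_drawing H p \<gamma> \<and>
        p ` {u, u', v, v'} \<subseteq> frontier (outside (drawing_points H p \<gamma>)) \<and>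
        (\<exists>c. simple_path c \<and> pathfinish c = pathstart c \<and>
           path_image c \<inter> drawing_points H p \<gamma> = p ` {u, u', v, v'} \<and>
           drawing_points H p \<gamma> \<subseteq> path_image c \<union> inside (path_image c) \<and>
           (\<exists>s1 s2 s3 s4. 0 \<le> s1 \<and> s1 < s2 \<and> s2 < s3 \<and> s3 < s4 \<and> s4 < 1 \<and>
              c s1 = p u \<and> c s2 = p v \<and> c s3 = p u' \<and> c s4 = p v')))"

(* The map \<phi> embeds H as a copy that is disjoint from G. *)
definition replacement ::
  "'h graph \<Rightarrow> 'h \<Rightarrow> 'h \<Rightarrow> 'h \<Rightarrow> 'h \<Rightarrow> 'a graph \<Rightarrow> 'a \<Rightarrow> 'a \<Rightarrow> 'a \<Rightarrow> 'a \<Rightarrow> 'a graph \<Rightarrow> bool" where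
  "replacement H u u' v v' G a b c d G' \<longleftrightarrow>
     {a, b} \<in> edges G \<and> {c, d} \<in> edges G \<and> {a, b} \<inter> {c, d} = {} \<and>
     (\<exists>\<phi>. inj_on \<phi> (verts H) \<and> \<phi> ` verts H \<inter> verts G = {} \<and>
        G' = Graph (verts G \<union> \<phi> ` verts H)
               ((edges G - {{a, b}, {c, d}}) \<union> (\<lambda>e. \<phi> ` e) ` edges H \<union>
                {{a, \<phi> u}, {\<phi> u', b}, {c, \<phi> v}, {\<phi> v', d}}))"

(* A decision problem on graphs is given by the set of its yes-instances.  Every finite graph
   has a copy with vertices in nat. *)
type_synonym graph_problem = "(nat graph \<times> int) set"

definition useful :: "'h graph \<Rightarrow> 'h \<Rightarrow> 'h \<Rightarrow> 'h \<Rightarrow> 'h \<Rightarrow> graph_problem \<Rightarrow> bool" where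
  "useful H u u' v v' P \<longleftrightarrow>
     (\<exists>k. \<forall>G t a b c d G'. simple_graph G \<longrightarrow> replacement H u u' v v' G a b c d G' \<longrightarrow>
        ((G, t) \<in> P \<longleftrightarrow> (G', t + k) \<in> P))"

section \<open>Polynomial time\<close>

text \<open>
  The machine model is a random access machine with addition, truncated subtraction and
  indirect addressing under the logarithmic cost criterion, presented with structured control
  flow.  Its polynomial-time functions are those of Turing machines.  A state consists of
  the registers (named by the program), the memory (addressed indirectly) and the output
  written so far; every number that takes part in a step is charged for its binary length.
\<close>

datatype com =
    Skip
  | Const nat nat
  | Add nat nat nat
  | Sub nat nat nat
  | Load nat nat
  | Store nat nat
  | Write nat
  | Seq com com
  | IfNZ nat com com
  | WhileNZ nat com

type_synonym state = "(nat \<Rightarrow> nat) \<times> (nat \<Rightarrow> nat) \<times> nat list"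

definition len :: "nat \<Rightarrow> nat" where
  "len n = 1 + floorlog 2 n"

inductive exec :: "com \<Rightarrow> state \<Rightarrow> nat \<Rightarrow> state \<Rightarrow> bool" where
  Skip: "exec Skip s 1 s"
| Const: "exec (Const x k) (r, m, ys) (len k) (r(x := k), m, ys)"
| Add: "exec (Add x y z) (r, m, ys) (len (r y) + len (r z)) (r(x := r y + r z), m, ys)"
| Sub: "exec (Sub x y z) (r, m, ys) (len (r y) + len (r z)) (r(x := r y - r z), m, ys)"
| Load: "exec (Load x y) (r, m, ys) (len (r y) + len (m (r y))) (r(x := m (r y)), m, ys)"
| Store: "exec (Store x y) (r, m, ys) (len (r x) + len (r y)) (r, m(r x := r y), ys)"
| Write: "exec (Write x) (r, m, ys) (len (r x)) (r, m, ys @ [r x])"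
| Seq: "exec c1 s1 i s2 \<Longrightarrow> exec c2 s2 j s3 \<Longrightarrow> exec (Seq c1 c2) s1 (i + j) s3"
| If_nonzero: "fst s x \<noteq> 0 \<Longrightarrow> exec c1 s i s' \<Longrightarrow> exec (IfNZ x c1 c2) s (len (fst s x) + i) s'"
| If_zero: "fst s x = 0 \<Longrightarrow> exec c2 s i s' \<Longrightarrow> exec (IfNZ x c1 c2) s (len (fst s x) + i) s'"
| While_zero: "fst s x = 0 \<Longrightarrow> exec (WhileNZ x c) s (len (fst s x)) s"
| While_nonzero: "fst s1 x \<noteq> 0 \<Longrightarrow> exec c s1 i s2 \<Longrightarrow> exec (WhileNZ x c) s2 j s3 \<Longrightarrow>
    exec (WhileNZ x c) s1 (len (fst s1 x) + i + j) s3"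

inductive_cases exec_elims:
  "exec Skip s i s'"
  "exec (Const x k) s i s'"
  "exec (Add x y z) s i s'"
  "exec (Sub x y z) s i s'"
  "exec (Load x y) s i s'"
  "exec (Store x y) s i s'"
  "exec (Write x) s i s'"
  "exec (Seq c1 c2) s i s'"
  "exec (IfNZ x c1 c2) s i s'"
  "exec (WhileNZ x c) s i s'"

lemma exec_deterministic:
  "exec c s i s' \<Longrightarrow> exec c s j s'' \<Longrightarrow> i = j \<and> s' = s''"
proof (induction arbitrary: j s'' rule: exec.induct)
  case (Seq c1 s1 i s2 c2 i' s3)
  from Seq.prems show ?case by (rule exec_elims(8)) (metis Seq.IH)
next
  case (If_nonzero s x c1 i s' c2)
  from If_nonzero.prems If_nonzero.hyps(1) obtain k where "j = len (fst s x) + k" "exec c1 s k s''"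
    by (auto elim: exec_elims(9))
  with If_nonzero.IH show ?case by blast
next
  case (If_zero s x c2 i s' c1)
  from If_zero.prems If_zero.hyps(1) obtain k where "j = len (fst s x) + k" "exec c2 s k s''"
    by (auto elim: exec_elims(9))
  with If_zero.IH show ?case by blast
next
  case (While_zero s x c)
  from While_zero.prems show ?case
    by (rule exec_elims(10)) (use While_zero.hyps in simp_all)
next
  case (While_nonzero s1 x c i s2 i' s3)
  from While_nonzero.prems show ?case
    by (rule exec_elims(10)) (metis While_nonzero.IH While_nonzero.hyps(1))+
qed (auto elim: exec_elims(1-7))

(* Initially register 0 holds the length of the input word, whose entries are stored in memory
   from address 0 onwards; everything else is 0. *)
definition initial_state :: "nat list \<Rightarrow> state" where
  "initial_state w = ((\<lambda>_. 0)(0 := length w), (\<lambda>i. if i < length w then w ! i else 0), [])"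

definition word_size :: "nat list \<Rightarrow> nat" where
  "word_size w = (\<Sum>n\<leftarrow>w. len n)"

(* F is computed by a polynomial-time algorithm on the words in D; nothing is required of
   the algorithm on other words. *)
definition polytime_on :: "nat list set \<Rightarrow> (nat list \<Rightarrow> nat list) \<Rightarrow> bool" where
  "polytime_on D F \<longleftrightarrow>
     (\<exists>(c :: com) (q :: nat poly). \<forall>w\<in>D. \<exists>T r m.
        exec c (initial_state w) T (r, m, F w) \<and> T \<le> poly q (word_size w))"

(* w describes the instance (G, t) together with the values of \<pi> on the vertices of G.
   The vertices and the edges may be listed in any order. *)
definition encodes :: "nat list \<Rightarrow> nat graph \<Rightarrow> int \<Rightarrow> (nat \<Rightarrow> nat) \<Rightarrow> bool" where
  "encodes w G t \<pi> \<longleftrightarrow>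
     (\<exists>vs es. distinct vs \<and> set vs = verts G \<and>
        distinct (map (\<lambda>(a, b). {a, b}) es) \<and> (\<lambda>(a, b). {a, b}) ` set es = edges G \<and>
        w = [length vs, length es, if t < 0 then 1 else 0, nat \<bar>t\<bar>]
              @ vs @ map \<pi> vs @ concat (map (\<lambda>(a, b). [a, b]) es))"

lemma encodes_unique:
  assumes "encodes w G t \<pi>" and "encodes w G' t' \<pi>'"
  shows "G = G' \<and> t = t' \<and> (\<forall>x\<in>verts G. \<pi> x = \<pi>' x)"
proof -
  have inj: "es = es'" if "concat (map (\<lambda>(a, b). [a, b]) es) = concat (map (\<lambda>(a, b). [a, b]) es')"
    for es es' :: "(nat \<times> nat) list"
    using that
  proof (induction es arbitrary: es')
    case Nil then show ?case by (cases es') auto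
  next
    case (Cons e es) then show ?case by (cases e; cases es') auto
  qed
  obtain vs es where 1: "set vs = verts G" "(\<lambda>(a, b). {a, b}) ` set es = edges G"
    "w = [length vs, length es, if t < 0 then 1 else 0, nat \<bar>t\<bar>]
           @ vs @ map \<pi> vs @ concat (map (\<lambda>(a, b). [a, b]) es)"
    using assms(1) unfolding encodes_def by blast
  obtain vs' es' where 2: "set vs' = verts G'" "(\<lambda>(a, b). {a, b}) ` set es' = edges G'"
    "w = [length vs', length es', if t' < 0 then 1 else 0, nat \<bar>t'\<bar>]
           @ vs' @ map \<pi>' vs' @ concat (map (\<lambda>(a, b). [a, b]) es')"
    using assms(2) unfolding encodes_def by blast
  note w = trans [OF 1(3) [symmetric] 2(3)]
  have l: "length vs = length vs'" and t: "t = t'"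
    using w by (auto split: if_splits)
  have vs: "vs = vs'" and \<pi>: "\<forall>x\<in>set vs. \<pi> x = \<pi>' x"
    and ces: "concat (map (\<lambda>(a, b). [a, b]) es) = concat (map (\<lambda>(a, b). [a, b]) es')"
    using w l by auto
  have es: "es = es'" by (rule inj [OF ces])
  have "G = G'"
    using 1(1,2) 2(1,2) vs es by (intro graph.expand) simp
  moreover have "\<forall>x\<in>verts G. \<pi> x = \<pi>' x"
    using vs \<pi> unfolding 1(1)[symmetric] by simp
  ultimately show ?thesis
    using t by blast
qed

end

theory Submission
  imports Defs "HOL-Complex_Analysis.Complex_Analysis"
begin

text \<open>
  Place the vertices along a line in the order of the layout and route the edges so that two edges cross
  at most once, namely when their spans interleave.  Treat the crossings by increasing right end of
  the edge that ends first, and along each edge from left to right.  Usefulness allows to replace every crossing by a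
  copy of the gadget, which changes the parameter by a constant.  The copy for a crossing of \<open>(a, b)\<close> and \<open>(c, d)\<close>
  with \<open>a < c < b < d\<close> is inserted into the layout as a block immediately before \<open>b\<close>, in an order of
  minimal cutwidth.  A cut meets at most one block, and away from its four attaching edges it is met
  by at most one piece of each edge that spans the cut in the given layout; this gives the bound.

  For planarity one needs the gadget drawn in a disc with its terminals joined to four points on the boundary,
  in the order \<open>u, v, u', v'\<close>.  From the Jordan curve through the terminals one gets disjoint arcs to a
  surrounding circle: after an inversion they run in the inside of a Jordan curve, where they come from
  accessible boundary points and the Riemann map.  Crossing chords fix their cyclic order.
\<close>

section \<open>Arcs from a Jordan curve to a circle\<close>

text \<open>The order of the crossings serves three purposes at once. A replacement always cuts the
  last piece of each of its two edges, so one current left end per edge is all that must be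
  remembered. The blocks stand in the layout in the order in which they are created, so vertices can
  be written in layout order and the layout values as 1, 2, 3 and so on. And the crossings on one
  edge come in the order in which its drawn curve meets them, so the pieces made by the replacements
  are the drawn pieces.

  The enclosing curve of a gadget is an arbitrary Jordan curve. The accessibility argument gives a
  dense set of its points, which may miss the terminals. Therefore an arc from a terminal first
  follows the curve itself to a nearby accessible point and leaves it there; this is harmless
  because the drawing meets the curve in the terminals only. The cyclic order of the arc ends
  matters because the gadget is inserted where one edge passes from top to bottom and the other from
  left to right.\<close>

lemma finite_separated:
  fixes q :: "nat \<Rightarrow> 'a::metric_space"
  assumes "\<And>i j. i < k \<Longrightarrow> j < k \<Longrightarrow> i \<noteq> j \<Longrightarrow> q i \<noteq> q j"
  obtains \<epsilon> where "\<epsilon> > 0" "\<And>i j. i < k \<Longrightarrow> j < k \<Longrightarrow> i \<noteq> j \<Longrightarrow> ball (q i) \<epsilon> \<inter> ball (q j) \<epsilon> = {}"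
proof -
  define M where "M = insert 1 ((\<lambda>(i, j). dist (q i) (q j)) ` {(i, j). i < k \<and> j < k \<and> i \<noteq> j})"
  have "finite {(i, j). i < k \<and> j < k \<and> i \<noteq> j}"
    by (rule finite_subset[of _ "{..<k} \<times> {..<k}"]) auto
  then have fin: "finite M" by (simp add: M_def)
  have pos: "Min M > 0"
    using fin assms by (subst Min_gr_iff) (auto simp: M_def)
  show ?thesis
  proof (rule that[of "Min M / 2"])
    show "Min M / 2 > 0" using pos by simp
    fix i j assume ij: "i < k" "j < k" "i \<noteq> j"
    then have "dist (q i) (q j) \<in> M" by (auto simp: M_def)
    then have "Min M \<le> dist (q i) (q j)" using fin by simp
    then show "ball (q i) (Min M / 2) \<inter> ball (q j) (Min M / 2) = {}"
      by (intro disjoint_ballI) simp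
  qed
qed

text \<open>The complement of the inside is the closure of the outside and hence connected; for
  bounded connected open sets in the plane this is simple connectivity.\<close>

lemma inside_Jordan_simply_connected:
  fixes c :: "real \<Rightarrow> complex"
  assumes "simple_path c" "pathfinish c = pathstart c"
  shows "simply_connected (inside (path_image c))"
proof -
  note J = Jordan_inside_outside[OF assms]
  have "inside (path_image c) \<union> outside (path_image c) = - path_image c"
    "inside (path_image c) \<inter> outside (path_image c) = {}"
    "frontier (outside (path_image c)) = path_image c"
    using J by blast+
  then have "- inside (path_image c) = closure (outside (path_image c))"
    unfolding closure_Un_frontier by blast
  then show ?thesis
    using J by (simp add: simply_connected_iff_simple connected_imp_connected_closure)
qed

text \<open>A common point other than \<open>z\<close> would make \<open>a - z\<close> and
  \<open>b - z\<close> positive multiples of each other, say with \<open>b\<close> the nearer one.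
  Then \<open>b\<close> is a proper convex combination of \<open>a\<close> and the interior point
  \<open>z\<close>, so its norm is below \<open>r\<close>.\<close>

lemma segments_from_interior_point_meet:
  fixes z :: "'a::real_inner"
  assumes "norm z < r" "norm a = r" "norm b = r" "a \<noteq> b"
  shows "closed_segment a z \<inter> closed_segment b z = {z}"
proof -
  have seg: "\<exists>s. 0 \<le> s \<and> s \<le> 1 \<and> w - z = s *\<^sub>R (a - z)" if wa: "w \<in> closed_segment a z" for w a
  proof -
    obtain s where "0 \<le> s" "s \<le> 1" "w = (1 - s) *\<^sub>R a + s *\<^sub>R z"
      using wa by (auto simp: in_segment)
    then show ?thesis by (intro exI[of _ "1 - s"]) (simp add: algebra_simps)
  qed
  have "w = z" if w: "w \<in> closed_segment a z" "w \<in> closed_segment b z" for w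
  proof (rule ccontr)
    assume "w \<noteq> z"
    obtain s where s: "0 \<le> s" "s \<le> 1" "w - z = s *\<^sub>R (a - z)"
      using seg[OF w(1)] by blast
    obtain t where t: "0 \<le> t" "t \<le> 1" "w - z = t *\<^sub>R (b - z)"
      using seg[OF w(2)] by blast
    have "s \<noteq> 0" "t \<noteq> 0"
      using s(3) t(3) \<open>w \<noteq> z\<close> by fastforce+
    then have pos: "s > 0" "t > 0"
      using s(1) t(1) by simp_all
    have *: "False" if st: "s > 0" "t \<ge> s" "s *\<^sub>R (a - z) = t *\<^sub>R (b - z)" "norm a = r" "norm b = r" "a \<noteq> b" for a b s t
    proof -
      define l where "l = s / t"
      have "b - z = l *\<^sub>R (a - z)"
      proof -
        have "t \<noteq> 0" using st(1,2) by simp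
        moreover from this have "t *\<^sub>R (l *\<^sub>R (a - z)) = s *\<^sub>R (a - z)"
          by (simp add: l_def)
        then have "t *\<^sub>R (b - z) = t *\<^sub>R (l *\<^sub>R (a - z))"
          using st(3) by simp
        ultimately show ?thesis by (meson real_vector.scale_left_imp_eq)
      qed
      then have b: "b = l *\<^sub>R a + (1 - l) *\<^sub>R z" by (simp add: algebra_simps)
      have "0 < l" "l \<le> 1" using st(1,2) by (auto simp: l_def)
      have "l \<noteq> 1" using b st(6) by (metis add.right_neutral cancel_comm_monoid_add_class.diff_cancel scaleR_one scaleR_zero_left)
      then have "l < 1" using \<open>l \<le> 1\<close> by simp
      have "norm b \<le> norm (l *\<^sub>R a) + norm ((1 - l) *\<^sub>R z)"
        using norm_triangle_ineq[of "l *\<^sub>R a" "(1 - l) *\<^sub>R z"] unfolding b[symmetric] .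
      also have "\<dots> = l * norm a + (1 - l) * norm z"
        using \<open>0 < l\<close> \<open>l < 1\<close> by simp
      also have "\<dots> < l * r + (1 - l) * r"
        using \<open>l < 1\<close> assms(1) st(4) by simp
      finally show False using st(5) by (simp add: algebra_simps)
    qed
    have eq: "s *\<^sub>R (a - z) = t *\<^sub>R (b - z)" by (rule trans[OF s(3)[symmetric] t(3)])
    show False
    proof (cases "s \<le> t")
      case True
      then show False using *[OF pos(1) True eq] assms by simp
    next
      case False
      then show False using *[OF pos(2) _ eq[symmetric]] assms by simp
    qed
  qed
  then show ?thesis by auto
qed

text \<open>Each stretch of the curve contains an accessible point. The arcs that reach these points
  may cross each other on the way, so only their last parts, which stay in disjoint balls about the
  end points, are kept. The Riemann map turns the inside into a disc, and in a large concentric disc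
  of this model the rest is replaced by straight segments to the image of \<open>x0\<close>.\<close>

lemma disjoint_arcs_to_interior_point:
  fixes c :: "real \<Rightarrow> complex" and s :: "nat \<Rightarrow> real"
  assumes c: "simple_path c" "pathfinish c = pathstart c"
    and x0: "x0 \<in> inside (path_image c)"
    and s: "\<And>i. i < k \<Longrightarrow> s i < s (Suc i)" "s 0 \<ge> 0" "s k \<le> 1"
  obtains t P where
    "\<And>i. i < k \<Longrightarrow> s i < t i \<and> t i < s (Suc i)"
    "\<And>i. i < k \<Longrightarrow> arc (P i) \<and> pathstart (P i) = c (t i) \<and> pathfinish (P i) = x0 \<and>
       path_image (P i) - {c (t i)} \<subseteq> inside (path_image c)"
    "\<And>i j. i < k \<Longrightarrow> j < k \<Longrightarrow> i \<noteq> j \<Longrightarrow> path_image (P i) \<inter> path_image (P j) = {x0}"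
proof -
  define S where "S = inside (path_image c)"
  note J = Jordan_inside_outside[OF c]
  have S: "open S" "connected S" "bounded S" "frontier S = path_image c" "S \<inter> path_image c = {}"
    using J inside_no_overlap[of "path_image c"] unfolding S_def by blast+
  have "simply_connected S" unfolding S_def by (rule inside_Jordan_simply_connected[OF c])
  moreover have "S \<noteq> {}" "S \<noteq> UNIV" using x0 S(3) unfolding S_def by auto
  ultimately obtain f g where fg: "f holomorphic_on S" "g holomorphic_on ball 0 1"
     "\<And>z. z \<in> S \<Longrightarrow> f z \<in> ball 0 1 \<and> g (f z) = z"
     "\<And>z. z \<in> ball 0 1 \<Longrightarrow> g z \<in> S \<and> f (g z) = z"
    using simply_connected_eq_biholomorphic_to_disc[OF S(1)] by metis
  have cf: "continuous_on S f" and cg: "continuous_on (ball 0 1) g"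
    using fg(1,2) holomorphic_on_imp_continuous_on by auto
  have mono: "s i \<le> s j" if "i \<le> j" "j \<le> k" for i j
    using that by (induction j rule: dec_induct) (use s(1) in \<open>auto simp: less_imp_le intro: order_trans\<close>)
  have s01: "0 \<le> s i" "s i \<le> 1" if "i \<le> k" for i
    using mono[of 0 i] mono[of i k] that s by auto
  define V where "V i = c ` {s i <..< s (Suc i)}" for i
  have inj: "inj_on c {0..<1}"
    using c(1) by (auto simp: simple_path_def loop_free_def inj_on_def) (metis atLeastAtMost_iff less_eq_real_def less_irrefl)+
  have opV: "openin (top_of_set (path_image c)) (V i)" if i: "i < k" for i
  proof -
    have si: "0 \<le> s i" "s i < s (Suc i)" "s (Suc i) \<le> 1"
      using s01[of i] s01[of "Suc i"] s(1)[OF i] i by auto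
    have lf: "x = y \<or> x = 0 \<and> y = 1 \<or> x = 1 \<and> y = 0" if "x \<in> {0..1}" "y \<in> {0..1}" "c x = c y" for x y
      using c(1) that unfolding simple_path_def loop_free_def by blast
    have "V i = path_image c - c ` ({0..s i} \<union> {s (Suc i)..1})"
    proof (intro equalityI subsetI)
      fix z assume "z \<in> V i"
      then obtain x where x: "z = c x" "s i < x" "x < s (Suc i)" by (auto simp: V_def)
      have "z \<noteq> c y" if "y \<in> {0..s i} \<union> {s (Suc i)..1}" for y
        using lf[of x y] x si that by auto
      then have "z \<notin> c ` ({0..s i} \<union> {s (Suc i)..1})" by blast
      then show "z \<in> path_image c - c ` ({0..s i} \<union> {s (Suc i)..1})"
        using x si by (auto simp: path_image_def)
    next
      fix z assume "z \<in> path_image c - c ` ({0..s i} \<union> {s (Suc i)..1})"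
      then obtain x where "z = c x" "x \<in> {0..1}" "x \<notin> {0..s i} \<union> {s (Suc i)..1}"
        unfolding path_image_def by blast
      then show "z \<in> V i" by (auto simp: V_def)
    qed
    moreover have "compact (c ` ({0..s i} \<union> {s (Suc i)..1}))"
    proof (rule compact_continuous_image)
      show "continuous_on ({0..s i} \<union> {s (Suc i)..1}) c"
        by (rule continuous_on_subset[of "{0..1}"])
          (use c(1) si in \<open>auto simp: simple_path_def path_def\<close>)
    qed auto
    ultimately show ?thesis
      by (metis compact_imp_closed open_Compl openin_open Diff_eq)
  qed
  have "\<exists>a. arc a \<and> a ` {0..<1} \<subseteq> S \<and> pathstart a = x0 \<and> pathfinish a \<in> V i" if i: "i < k" for i
  proof -
    have "V i \<noteq> {}" using s(1)[OF i] by (simp add: V_def)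
    then show ?thesis
      using dense_accessible_frontier_points_connected[OF S(1,2), of x0 "V i"] opV[OF i] x0 S(4)
      unfolding S_def by metis
  qed
  then obtain \<alpha> where \<alpha>: "\<And>i. i < k \<Longrightarrow> arc (\<alpha> i)" "\<And>i. i < k \<Longrightarrow> \<alpha> i ` {0..<1} \<subseteq> S"
     "\<And>i. i < k \<Longrightarrow> pathstart (\<alpha> i) = x0" "\<And>i. i < k \<Longrightarrow> pathfinish (\<alpha> i) \<in> V i"
    by metis
  have "\<exists>t. s i < t \<and> t < s (Suc i) \<and> \<alpha> i 1 = c t" if "i < k" for i
    using \<alpha>(4)[OF that] by (auto simp: V_def pathfinish_def)
  then obtain t where t: "\<And>i. i < k \<Longrightarrow> s i < t i \<and> t i < s (Suc i)" "\<And>i. i < k \<Longrightarrow> \<alpha> i 1 = c (t i)"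
    by metis
  define q where "q i = c (t i)" for i
  have t01: "0 < t i" "t i < 1" if "i < k" for i
    using t(1)[OF that] s01[of i] s01[of "Suc i"] that by auto
  have qS: "q i \<notin> S" if "i < k" for i
    using S(5) t01[OF that] by (auto simp: q_def path_image_def)
  have tlt: "t i < t j" if "i < j" "j < k" for i j
    using t(1)[of i] t(1)[of j] mono[of "Suc i" j] that by auto
  have qne: "q i \<noteq> q j" if ij: "i < k" "j < k" "i \<noteq> j" for i j
  proof -
    have "t i \<noteq> t j" using tlt[of i j] tlt[of j i] ij by (cases i j rule: linorder_cases) auto
    then show ?thesis
      using inj_onD[OF inj, of "t i" "t j"] t01[OF ij(1)] t01[OF ij(2)] by (auto simp: q_def)
  qed
  obtain \<epsilon> where eps: "\<epsilon> > 0" "\<And>i j. i < k \<Longrightarrow> j < k \<Longrightarrow> i \<noteq> j \<Longrightarrow> ball (q i) \<epsilon> \<inter> ball (q j) \<epsilon> = {}"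
    using finite_separated[of k q] qne by metis
  have ca: "continuous_on {0..1} (\<alpha> i)" if "i < k" for i
    using \<alpha>(1)[OF that] by (auto simp: arc_def path_def)
  \<comment> \<open>From time \<open>d i\<close> on the arc stays in the ball about its own end
    point, so the tails after these times are pairwise disjoint.\<close>
  have "\<exists>d. 0 \<le> d \<and> d < 1 \<and> (\<forall>x. d \<le> x \<longrightarrow> x \<le> 1 \<longrightarrow> \<alpha> i x \<in> ball (q i) \<epsilon>)" if i: "i < k" for i
  proof -
    obtain \<delta> where d: "\<delta> > 0" "\<And>x. x \<in> {0..1} \<Longrightarrow> dist x 1 < \<delta> \<Longrightarrow> dist (\<alpha> i x) (\<alpha> i 1) < \<epsilon>"
      using ca[OF i] eps(1) unfolding continuous_on_iff by (metis atLeastAtMost_iff order_refl zero_le_one)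
    show ?thesis
    proof (intro exI[of _ "max 0 (1 - \<delta> / 2)"] conjI allI impI)
      fix x assume x: "max 0 (1 - \<delta> / 2) \<le> x" "x \<le> 1"
      have "dist x 1 < \<delta>" using x d(1) by (auto simp: dist_real_def)
      then have "dist (\<alpha> i x) (\<alpha> i 1) < \<epsilon>" using d(2)[of x] x by auto
      then show "\<alpha> i x \<in> ball (q i) \<epsilon>" using t(2)[OF i] by (simp add: q_def dist_commute)
    qed (use d in auto)
  qed
  then obtain d where d: "\<And>i. i < k \<Longrightarrow> 0 \<le> d i \<and> d i < 1"
     "\<And>i x. i < k \<Longrightarrow> d i \<le> x \<Longrightarrow> x \<le> 1 \<Longrightarrow> \<alpha> i x \<in> ball (q i) \<epsilon>"
    by metis
  \<comment> \<open>\<open>K\<close> collects the model images of everything up to the times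
    \<open>d i\<close>. Being compact it lies in a disc of radius \<open>r < 1\<close>, so the last
    exit \<open>\<tau> i\<close> from that disc is not before \<open>d i\<close>.\<close>
  define K where "K = insert (f x0) (\<Union>i<k. f ` \<alpha> i ` {0..d i})"
  have aS: "\<alpha> i x \<in> S" if "i < k" "0 \<le> x" "x < 1" for i x
    using \<alpha>(2)[OF that(1)] that by auto
  have "compact K"
    unfolding K_def
  proof (intro compact_insert compact_UN finite_lessThan)
    fix i assume "i \<in> {..<k}"
    then have i: "i < k" by simp
    have "continuous_on {0..d i} (\<alpha> i)"
      by (rule continuous_on_subset[OF ca[OF i]]) (use d(1)[OF i] in auto)
    moreover have "\<alpha> i ` {0..d i} \<subseteq> S" using aS[OF i] d(1)[OF i] by auto
    ultimately show "compact (f ` \<alpha> i ` {0..d i})"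
      by (intro compact_continuous_image continuous_on_subset[OF cf]) auto
  qed
  moreover have Kb: "K \<subseteq> ball 0 1"
    using fg(3) aS d(1) x0 unfolding K_def S_def by fastforce
  moreover have "K \<noteq> {}" by (simp add: K_def)
  ultimately obtain zm where zm: "zm \<in> K" "\<And>z. z \<in> K \<Longrightarrow> norm z \<le> norm zm"
    using continuous_attains_sup[of K norm] by (auto simp: continuous_on_norm)
  define r where "r = (norm zm + 1) / 2"
  have zm1: "norm zm < 1" using zm(1) Kb by auto
  have r: "r < 1" "\<And>z. z \<in> K \<Longrightarrow> norm z < r" "0 < r"
  proof -
    show "r < 1" using zm1 by (simp add: r_def)
    show "norm z < r" if "z \<in> K" for z using zm1 zm(2)[OF that] by (simp add: r_def)
    show "0 < r" by (simp add: r_def add_nonneg_pos)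
  qed
  have Kr: "cball 0 r \<subseteq> ball (0::complex) 1" using r by auto
  define A where "A i = {x \<in> {0..1}. \<alpha> i x \<in> g ` cball 0 r}" for i
  have cK: "compact (g ` cball 0 r)"
    by (intro compact_continuous_image continuous_on_subset[OF cg Kr]) auto
  have gS: "g ` cball 0 r \<subseteq> S" using fg(4) Kr by auto
  have "\<exists>\<tau>. \<tau> \<in> A i \<and> (\<forall>x\<in>A i. x \<le> \<tau>) \<and> d i \<le> \<tau>" if i: "i < k" for i
  proof -
    have "compact (A i)"
    proof -
      have "closed ({0..1} \<inter> \<alpha> i -` (g ` cball 0 r))"
        by (intro continuous_closed_preimage[OF ca[OF i]] compact_imp_closed[OF cK]) simp
      moreover have "A i = {0..1} \<inter> \<alpha> i -` (g ` cball 0 r)" by (auto simp: A_def)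
      moreover have "bounded (A i)" by (rule bounded_subset[of "{0..1}"]) (auto simp: A_def)
      ultimately show ?thesis by (simp add: compact_eq_bounded_closed)
    qed
    moreover have dA: "d i \<in> A i"
    proof -
      have "d i \<in> {0..d i}" using d(1)[OF i] by simp
      then have "f (\<alpha> i (d i)) \<in> K" unfolding K_def using i by blast
      then have "norm (f (\<alpha> i (d i))) < r" by (rule r(2))
      moreover have "g (f (\<alpha> i (d i))) = \<alpha> i (d i)" using fg(3) aS[OF i] d(1)[OF i] by auto
      ultimately show ?thesis unfolding A_def using d(1)[OF i] by (auto intro!: image_eqI[of _ g "f (\<alpha> i (d i))"])
    qed
    ultimately obtain \<tau> where "\<tau> \<in> A i" "\<forall>x\<in>A i. x \<le> \<tau>"
      using compact_attains_sup[of "A i"] by auto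
    then show ?thesis using dA by auto
  qed
  then obtain \<tau> where tau: "\<And>i. i < k \<Longrightarrow> \<tau> i \<in> A i" "\<And>i x. i < k \<Longrightarrow> x \<in> A i \<Longrightarrow> x \<le> \<tau> i"
     "\<And>i. i < k \<Longrightarrow> d i \<le> \<tau> i"
    by metis
  have tau1: "0 \<le> \<tau> i \<and> \<tau> i < 1" if i: "i < k" for i
  proof -
    have "\<alpha> i 1 \<notin> S" using qS[OF i] t(2)[OF i] by (simp add: q_def)
    then have "\<tau> i \<noteq> 1" using tau(1)[OF i] gS by (auto simp: A_def)
    then show ?thesis using tau(1)[OF i] by (auto simp: A_def)
  qed
  define y where "y i = f (\<alpha> i (\<tau> i))" for i
  have ya: "g (y i) = \<alpha> i (\<tau> i)" if i: "i < k" for i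
    using fg(3) aS[OF i] tau1[OF i] by (auto simp: y_def)
  \<comment> \<open>At the last exit the norm is at most \<open>r\<close>, afterwards it is above
    \<open>r\<close>; continuity forces equality.\<close>
  have yr: "norm (y i) = r" if i: "i < k" for i
  proof -
    obtain z where z: "norm z \<le> r" "\<alpha> i (\<tau> i) = g z" using tau(1)[OF i] by (auto simp: A_def)
    then have le: "norm (y i) \<le> r" using fg(4)[of z] Kr by (auto simp: y_def)
    define b where "b = (\<tau> i + 1) / 2"
    have b: "\<tau> i < b" "b < 1" using tau1[OF i] by (auto simp: b_def)
    have notA: "norm (f (\<alpha> i x)) > r" if "\<tau> i < x" "x < 1" for x
    proof (rule ccontr)
      assume "\<not> norm (f (\<alpha> i x)) > r"
      then have "x \<in> A i"
        unfolding A_def using that tau1[OF i] fg(3)[OF aS[OF i, of x]]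
        by (auto intro!: image_eqI[of _ g "f (\<alpha> i x)"])
      then show False using tau(2)[OF i] that by force
    qed
    have "continuous_on {\<tau> i..b} (\<lambda>x. norm (f (\<alpha> i x)))"
    proof (intro continuous_on_norm continuous_on_compose2[OF cf])
      show "continuous_on {\<tau> i..b} (\<alpha> i)"
        by (rule continuous_on_subset[OF ca[OF i]]) (use b tau1[OF i] in auto)
      show "\<alpha> i ` {\<tau> i..b} \<subseteq> S" using aS[OF i] b tau1[OF i] by auto
    qed
    then obtain x where x: "\<tau> i \<le> x" "x \<le> b" "norm (f (\<alpha> i x)) = r"
      using IVT'[of "\<lambda>x. norm (f (\<alpha> i x))" "\<tau> i" r b] le notA[OF b] b by (auto simp: y_def)
    then have "x = \<tau> i" using notA[of x] b by force
    then show ?thesis using x by (simp add: y_def)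
  qed
  have fx0: "norm (f x0) < r" using r(2) by (simp add: K_def)
  have gx0: "g (f x0) = x0" using fg(3) x0 by (simp add: S_def)
  have yx: "y i \<noteq> f x0" if "i < k" for i using yr[OF that] fx0 by auto
  have tail: "\<alpha> i x \<notin> g ` cball 0 r" if "i < k" "\<tau> i < x" "x \<le> 1" for i x
    using tau(2)[OF that(1), of x] tau1[OF that(1)] that unfolding A_def by force
  \<comment> \<open>The new arc is the reversed tail \<open>T i\<close> from the boundary to the
    exit point, followed by the image \<open>Q i\<close> of a straight segment of the model.\<close>
  define Q where "Q i = g \<circ> linepath (y i) (f x0)" for i
  define T where "T i = subpath 1 (\<tau> i) (\<alpha> i)" for i
  define P where "P i = T i +++ Q i" for i
  have inj_g: "inj_on g (ball 0 1)" by (rule inj_on_inverseI[of _ f]) (use fg(4) in auto)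
  have segr: "closed_segment (y i) (f x0) \<subseteq> cball 0 r" if "i < k" for i
    using yr[OF that] fx0 by (intro closed_segment_subset) auto
  have imQ: "path_image (Q i) = g ` closed_segment (y i) (f x0)" for i
    by (simp add: Q_def path_image_compose)
  have imT: "path_image (T i) = \<alpha> i ` {\<tau> i..1}" if "i < k" for i
    using tau1[OF that] by (simp add: T_def path_image_subpath closed_segment_eq_real_ivl)
  have QK: "path_image (Q i) \<subseteq> g ` cball 0 r" if "i < k" for i
    using segr[OF that] imQ by auto
  have arcQ: "arc (Q i)" if i: "i < k" for i
  proof -
    have "arc (linepath (y i) (f x0))" using yx[OF i] by simp
    moreover have "inj_on g (path_image (linepath (y i) (f x0)))"
      by (rule inj_on_subset[OF inj_g]) (use segr[OF i] Kr in auto)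
    moreover have "continuous_on (path_image (linepath (y i) (f x0))) g"
      by (rule continuous_on_subset[OF cg]) (use segr[OF i] Kr in auto)
    ultimately show ?thesis
      unfolding Q_def arc_def by (auto intro!: path_continuous_image comp_inj_on simp: path_image_def)
  qed
  have Q0: "pathstart (Q i) = \<alpha> i (\<tau> i)" "pathfinish (Q i) = x0" if "i < k" for i
    using ya[OF that] gx0 by (auto simp: Q_def pathstart_compose pathfinish_compose)
  have arcT: "arc (T i)" if i: "i < k" for i
    unfolding T_def using tau1[OF i] by (intro arc_subpath_arc[OF \<alpha>(1)[OF i]]) auto
  have T0: "pathstart (T i) = q i" "pathfinish (T i) = \<alpha> i (\<tau> i)" if "i < k" for i
    using t(2)[OF that] by (auto simp: T_def q_def)
  have TK: "path_image (T i) \<inter> g ` cball 0 r \<subseteq> {\<alpha> i (\<tau> i)}" if i: "i < k" for i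
    using tail[OF i] unfolding imT[OF i] by force
  have imP: "path_image (P i) = path_image (T i) \<union> path_image (Q i)" if "i < k" for i
    unfolding P_def using Q0[OF that] T0[OF that] by (simp add: path_image_join)
  show thesis
  proof (rule that[of t P])
    show "s i < t i \<and> t i < s (Suc i)" if "i < k" for i by (rule t(1)[OF that])
    fix i assume i: "i < k"
    have "arc (P i)"
      unfolding P_def using arcT[OF i] arcQ[OF i] T0[OF i] Q0[OF i] TK[OF i] QK[OF i]
      by (intro arc_join) auto
    moreover have "path_image (P i) - {c (t i)} \<subseteq> S"
    proof -
      have "\<alpha> i x \<in> insert (c (t i)) S" if "\<tau> i \<le> x" "x \<le> 1" for x
        using aS[OF i, of x] tau1[OF i] that t(2)[OF i] by (cases "x = 1") auto
      then have "path_image (T i) \<subseteq> insert (c (t i)) S"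
        unfolding imT[OF i] by (simp add: image_subset_iff)
      moreover have "path_image (Q i) \<subseteq> S" using QK[OF i] gS by blast
      ultimately show ?thesis unfolding imP[OF i] by blast
    qed
    ultimately show "arc (P i) \<and> pathstart (P i) = c (t i) \<and> pathfinish (P i) = x0 \<and>
       path_image (P i) - {c (t i)} \<subseteq> inside (path_image c)"
      using T0[OF i] Q0[OF i] by (simp add: P_def q_def S_def)
    fix j assume j: "j < k" and ij: "i \<noteq> j"
    have Tb: "path_image (T i) \<subseteq> ball (q i) \<epsilon>" if i: "i < k" for i
    proof -
      have "\<alpha> i x \<in> ball (q i) \<epsilon>" if "\<tau> i \<le> x" "x \<le> 1" for x
        by (rule d(2)[OF i]) (use that tau(3)[OF i] in auto)
      then show ?thesis unfolding imT[OF i] by auto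
    qed
    have yn: "y i \<noteq> y j"
    proof
      assume "y i = y j"
      then have "\<alpha> i (\<tau> i) = \<alpha> j (\<tau> j)" using ya[OF i] ya[OF j] by simp
      moreover have "\<alpha> i (\<tau> i) \<in> ball (q i) \<epsilon>" "\<alpha> j (\<tau> j) \<in> ball (q j) \<epsilon>"
        using d(2) tau(3) tau1 i j by (meson less_imp_le)+
      ultimately show False using eps(2)[OF i j ij] by (metis IntI emptyE)
    qed
    have TT: "path_image (T i) \<inter> path_image (T j) = {}"
      using Tb[OF i] Tb[OF j] eps(2)[OF i j ij] by blast
    have QQ: "path_image (Q i) \<inter> path_image (Q j) = {x0}"
    proof -
      have "g ` closed_segment (y i) (f x0) \<inter> g ` closed_segment (y j) (f x0) =
         g ` (closed_segment (y i) (f x0) \<inter> closed_segment (y j) (f x0))"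
        by (rule inj_on_image_Int[OF inj_g, symmetric]) (use segr[OF i] segr[OF j] Kr in blast)+
      then show ?thesis
        unfolding imQ using segments_from_interior_point_meet[OF fx0 yr[OF i] yr[OF j] yn] gx0 by simp
    qed
    have TQ: "path_image (T i) \<inter> path_image (Q j) = {}" if i: "i < k" and j: "j < k" and yn: "y i \<noteq> y j" for i j
    proof -
      have "path_image (T i) \<inter> path_image (Q j) \<subseteq> {g (y i)}"
        using TK[OF i] QK[OF j] ya[OF i] by auto
      moreover have "g (y i) \<notin> path_image (Q j)"
      proof
        assume "g (y i) \<in> path_image (Q j)"
        then obtain w where w: "w \<in> closed_segment (y j) (f x0)" "g (y i) = g w" unfolding imQ by auto
        have "y i = w" by (rule inj_onD[OF inj_g w(2)]) (use w(1) segr[OF j] Kr yr[OF i] r in auto)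
        then have "y i \<in> closed_segment (y i) (f x0) \<inter> closed_segment (y j) (f x0)" using w by simp
        then show False using segments_from_interior_point_meet[OF fx0 yr[OF i] yr[OF j] yn] yx[OF i] by auto
      qed
      ultimately show ?thesis by blast
    qed
    show "path_image (P i) \<inter> path_image (P j) = {x0}"
      unfolding imP[OF i] imP[OF j] using TT QQ TQ[OF i j yn] TQ[OF j i yn[symmetric]] by blast
  qed
qed

text \<open>The arcs to \<open>x0\<close> are cut off where they first meet the disc. They shared
  only \<open>x0\<close>, which is lost by the cut.\<close>

lemma disjoint_arcs_to_circle:
  fixes c :: "real \<Rightarrow> complex" and s :: "nat \<Rightarrow> real"
  assumes c: "simple_path c" "pathfinish c = pathstart c"
    and x0: "cball x0 r \<subseteq> inside (path_image c)" "r > 0"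
    and s: "\<And>i. i < k \<Longrightarrow> s i < s (Suc i)" "s 0 \<ge> 0" "s k \<le> 1"
  obtains t P where
    "\<And>i. i < k \<Longrightarrow> s i < t i \<and> t i < s (Suc i)"
    "\<And>i. i < k \<Longrightarrow> arc (P i) \<and> pathstart (P i) = c (t i) \<and>
       path_image (P i) - {c (t i)} \<subseteq> inside (path_image c) \<and>
       path_image (P i) \<inter> cball x0 r = {pathfinish (P i)} \<and> dist x0 (pathfinish (P i)) = r"
    "\<And>i j. i < k \<Longrightarrow> j < k \<Longrightarrow> i \<noteq> j \<Longrightarrow> path_image (P i) \<inter> path_image (P j) = {}"
proof -
  have "x0 \<in> inside (path_image c)" using x0 by auto
  from disjoint_arcs_to_interior_point[OF c this s] obtain t P where
    t: "\<And>i. i < k \<Longrightarrow> s i < t i \<and> t i < s (Suc i)" and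
    P: "\<And>i. i < k \<Longrightarrow> arc (P i) \<and> pathstart (P i) = c (t i) \<and> pathfinish (P i) = x0 \<and>
       path_image (P i) - {c (t i)} \<subseteq> inside (path_image c)" and
    PP: "\<And>i j. i < k \<Longrightarrow> j < k \<Longrightarrow> i \<noteq> j \<Longrightarrow> path_image (P i) \<inter> path_image (P j) = {x0}"
    by blast
  have mono: "s i \<le> s j" if "i \<le> j" "j \<le> k" for i j
    using that by (induction j rule: dec_induct) (use s(1) in \<open>auto simp: less_imp_le intro: order_trans\<close>)
  have t01: "0 \<le> t i" "t i \<le> 1" if i: "i < k" for i
  proof -
    have "0 \<le> s i" using mono[of 0 i] s(2) i by simp
    then show "0 \<le> t i" using t[OF i] by linarith
    have "s (Suc i) \<le> 1" using mono[of "Suc i" k] s(3) i by simp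
    then show "t i \<le> 1" using t[OF i] by linarith
  qed
  have far: "c (t i) \<notin> cball x0 r" if i: "i < k" for i
  proof -
    have "c (t i) \<in> path_image c" using t01[OF i] by (auto simp: path_image_def)
    then show ?thesis using x0(1) inside_no_overlap[of "path_image c"] by blast
  qed
  have "\<exists>u. 0 < u \<and> u \<le> 1 \<and> (\<forall>x. 0 \<le> x \<and> x < u \<longrightarrow> dist x0 (P i x) > r) \<and> dist x0 (P i u) = r" if i: "i < k" for i
  proof -
    have *: "pathfinish (P i) \<notin> - cball x0 r" using P[OF i] x0(2) by simp
    have path: "path (P i)" using P[OF i] arc_imp_path by blast
    obtain u where u: "0 \<le> u" "u \<le> 1" "\<And>x. 0 \<le> x \<and> x < u \<Longrightarrow> P i x \<in> interior (- cball x0 r)"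
        "P i u \<notin> interior (- cball x0 r)" "u = 0 \<or> P i u \<in> closure (- cball x0 r)"
      using subpath_to_frontier_explicit[OF path *] by metis
    have int: "interior (- cball x0 r) = - cball x0 r" by (rule interior_open) (simp add: open_Compl)
    have "P i 0 = c (t i)" using P[OF i] by (simp add: pathstart_def)
    then have u0: "u \<noteq> 0" using u(4) far[OF i] unfolding int by auto
    have "P i u \<in> closure (- cball x0 r)" using u(5) u0 by simp
    then have "dist x0 (P i u) \<ge> r"
      by (simp add: closure_complement mem_ball)
    moreover have "dist x0 (P i u) \<le> r" using u(4) unfolding int by simp
    ultimately show ?thesis using u(1-3) u0 unfolding int by (intro exI[of _ u]) (auto simp: not_le)
  qed
  then obtain u where u: "\<And>i. i < k \<Longrightarrow> 0 < u i \<and> u i \<le> 1"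
     "\<And>i x. i < k \<Longrightarrow> 0 \<le> x \<Longrightarrow> x < u i \<Longrightarrow> dist x0 (P i x) > r" "\<And>i. i < k \<Longrightarrow> dist x0 (P i (u i)) = r"
    by metis
  define Q where "Q i = subpath 0 (u i) (P i)" for i
  have imQ: "path_image (Q i) = P i ` {0..u i}" if "i < k" for i
    using u(1)[OF that] by (simp add: Q_def path_image_subpath closed_segment_eq_real_ivl)
  have QP: "path_image (Q i) \<subseteq> path_image (P i)" if "i < k" for i
    unfolding imQ[OF that] using u(1)[OF that] by (auto simp: path_image_def)
  have fin: "pathfinish (Q i) = P i (u i)" for i by (simp add: Q_def)
  have x0Q: "x0 \<notin> path_image (Q i)" if i: "i < k" for i
  proof
    assume "x0 \<in> path_image (Q i)"
    then obtain x where "x0 = P i x" "0 \<le> x" "x \<le> u i" unfolding imQ[OF i] by auto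
    then show False using u(2)[OF i, of x] u(3)[OF i] x0(2) by (cases "x = u i") auto
  qed
  show thesis
  proof (rule that[of t Q])
    show "s i < t i \<and> t i < s (Suc i)" if "i < k" for i by (rule t[OF that])
    show "path_image (Q i) \<inter> path_image (Q j) = {}" if "i < k" "j < k" "i \<noteq> j" for i j
      
    proof -
      have "path_image (Q i) \<inter> path_image (Q j) \<subseteq> {x0}"
        unfolding PP[OF that, symmetric] using QP[OF that(1)] QP[OF that(2)] by (rule Int_mono)
      then show ?thesis using x0Q[OF that(1)] by auto
    qed
    fix i assume i: "i < k"
    have "arc (P i)" using P[OF i] by blast
    then have "arc (Q i)" unfolding Q_def by (rule arc_subpath_arc) (use u(1)[OF i] in auto)
    moreover have "pathstart (Q i) = c (t i)" using P[OF i] by (simp add: Q_def pathstart_def subpath_def)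
    moreover have "path_image (Q i) \<inter> cball x0 r = {P i (u i)}"
    proof -
      have "x = u i" if "0 \<le> x" "x \<le> u i" "dist x0 (P i x) \<le> r" for x
        using u(2)[OF i that(1)] that(2,3) by (cases "x = u i") auto
      then have "path_image (Q i) \<inter> cball x0 r \<subseteq> {P i (u i)}" unfolding imQ[OF i] by fastforce
      moreover have "0 \<le> u i" "dist x0 (P i (u i)) \<le> r" using u(1,3)[OF i] by auto
      ultimately show ?thesis unfolding imQ[OF i] by auto
    qed
    ultimately show "arc (Q i) \<and> pathstart (Q i) = c (t i) \<and>
       path_image (Q i) - {c (t i)} \<subseteq> inside (path_image c) \<and>
       path_image (Q i) \<inter> cball x0 r = {pathfinish (Q i)} \<and> dist x0 (pathfinish (Q i)) = r"
      using P[OF i] QP[OF i] u(3)[OF i] unfolding fin by blast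
  qed
qed

text \<open>If the chords were disjoint, each pair of opposite arcs would extend along its chord to
  a crosscut of the inside, and the two crosscuts would be disjoint. The first one splits the inside
  into \<open>U1\<close> and \<open>U2\<close>, and the second one joins \<open>q 1\<close> to
  \<open>q 3\<close> within one of these regions. But \<open>q 1\<close> is not in the closure of
  \<open>U2\<close>, and \<open>q 3\<close> is not in the closure of \<open>U1\<close>.\<close>

lemma chords_cross:
  fixes c :: "real \<Rightarrow> complex"
  assumes c: "simple_path c" "pathfinish c = pathstart c"
    and x0: "cball x0 r \<subseteq> inside (path_image c)"
    and t: "0 < t (0::nat)" "t 0 < t 1" "t 1 < t 2" "t 2 < t 3" "t 3 < 1"
    and P: "\<And>i. i < 4 \<Longrightarrow> arc (P i) \<and> pathstart (P i) = c (t i) \<and>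
       path_image (P i) - {c (t i)} \<subseteq> inside (path_image c) \<and>
       path_image (P i) \<inter> cball x0 r = {pathfinish (P i)}"
    and PP: "\<And>i j. i < 4 \<Longrightarrow> j < 4 \<Longrightarrow> i \<noteq> j \<Longrightarrow> path_image (P i) \<inter> path_image (P j) = {}"
  shows "closed_segment (pathfinish (P 0)) (pathfinish (P 2)) \<inter> closed_segment (pathfinish (P 1)) (pathfinish (P 3)) \<noteq> {}"
proof (rule notI)
  define e where "e i = pathfinish (P i)" for i
  define q where "q i = c (t i)" for i
  define S where "S = inside (path_image c)"
  assume "closed_segment (pathfinish (P 0)) (pathfinish (P 2)) \<inter> closed_segment (pathfinish (P 1)) (pathfinish (P 3)) = {}"
  then have disj: "closed_segment (e 0) (e 2) \<inter> closed_segment (e 1) (e 3) = {}" by (simp add: e_def)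
  note J = Jordan_inside_outside[OF c]
  have no: "S \<inter> path_image c = {}" using inside_no_overlap[of "path_image c"] by (auto simp: S_def)
  have arcP: "arc (P i)" and sP: "pathstart (P i) = q i" and fP: "pathfinish (P i) = e i"
    and iP: "path_image (P i) - {q i} \<subseteq> S" and cP: "path_image (P i) \<inter> cball x0 r = {e i}" if "i < 4" for i
    using P[OF that] by (auto simp: e_def q_def S_def)
  have eb: "e i \<in> cball x0 r" if "i < 4" for i using cP[OF that] by blast
  have eS: "e i \<in> S" if "i < 4" for i using eb[OF that] x0 by (auto simp: S_def)
  have eP: "e i \<in> path_image (P i)" and qP: "q i \<in> path_image (P i)" if "i < 4" for i
    using pathfinish_in_path_image[of "P i"] pathstart_in_path_image[of "P i"] sP[OF that] fP[OF that] by auto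
  have segb: "closed_segment (e i) (e j) \<subseteq> cball x0 r" if "i < 4" "j < 4" for i j
    using eb that by (intro closed_segment_subset) auto
  have chord: "\<exists>g. arc g \<and> pathstart g = q i \<and> pathfinish g = q j \<and>
       path_image g = path_image (P i) \<union> closed_segment (e i) (e j) \<union> path_image (P j)"
    if ij: "i < 4" "j < 4" "i \<noteq> j" for i j
  proof -
    have ne: "e i \<noteq> e j" using PP[OF ij] eP[OF ij(1)] eP[OF ij(2)] by (metis disjoint_iff)
    define h where "h = linepath (e i) (e j) +++ reversepath (P j)"
    have "closed_segment (e i) (e j) \<inter> path_image (P j) \<subseteq> {e j}"
      using cP[OF ij(2)] segb[OF ij(1,2)] by (metis Int_commute Int_mono order_refl)
    then have h: "arc h" unfolding h_def
      using ne arcP[OF ij(2)] fP[OF ij(2)] by (intro arc_join) (simp_all add: arc_reversepath)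
    have ih: "path_image h = closed_segment (e i) (e j) \<union> path_image (P j)"
      unfolding h_def using fP[OF ij(2)] by (simp add: path_image_join)
    have "arc (P i +++ h)"
    proof (rule arc_join[OF arcP[OF ij(1)] h])
      show "pathfinish (P i) = pathstart h" using fP[OF ij(1)] by (simp add: h_def)
      show "path_image (P i) \<inter> path_image h \<subseteq> {pathstart h}"
      proof -
        have "path_image (P i) \<inter> closed_segment (e i) (e j) \<subseteq> {e i}"
          using cP[OF ij(1)] segb[OF ij(1,2)] by (metis Int_mono order_refl)
        then show ?thesis unfolding ih Int_Un_distrib PP[OF ij] by (simp add: h_def)
      qed
    qed
    then show ?thesis using ih fP[OF ij(1)] sP[OF ij(1)] sP[OF ij(2)]
      by (intro exI[of _ "P i +++ h"]) (auto simp: path_image_join h_def)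
  qed
  obtain G where G: "arc G" "pathstart G = q 0" "pathfinish G = q 2"
       "path_image G = path_image (P 0) \<union> closed_segment (e 0) (e 2) \<union> path_image (P 2)"
    using chord[of 0 2] by auto
  have lf: "x = y \<or> x = 0 \<and> y = 1 \<or> x = 1 \<and> y = 0" if "x \<in> {0..1}" "y \<in> {0..1}" "c x = c y" for x y
    using c(1) that unfolding simple_path_def loop_free_def by blast
  have t2: "t 0 < t 2" "t 2 < 1" "0 < t 1" "t 1 < 1" "0 < t 3" "0 < t 2" "t 0 < 1" using t by auto
  have c01: "c 0 = c 1" using c(2) by (simp add: pathstart_def pathfinish_def)
  define c1 where "c1 = subpath (t 0) (t 2) c"
  \<comment> \<open>The second boundary arc passes the base point of the curve: it runs back from
    \<open>t 0\<close> to 0, continues from 1 and runs back to \<open>t 2\<close>.\<close>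
  define c2 where "c2 = subpath (t 0) 0 c +++ subpath 1 (t 2) c"
  have ic1: "path_image c1 = c ` {t 0..t 2}"
    using t2 by (simp add: c1_def path_image_subpath closed_segment_eq_real_ivl)
  have "path_image (subpath (t 0) 0 c) = c ` {0..t 0}" "path_image (subpath 1 (t 2) c) = c ` {t 2..1}"
    using t t2 by (simp_all add: path_image_subpath closed_segment_eq_real_ivl)
  note ic2' = this
  have ic2: "path_image c2 = c ` {0..t 0} \<union> c ` {t 2..1}"
    unfolding c2_def using c01 ic2' by (subst path_image_join) auto
  have a1: "arc c1" unfolding c1_def using t2 t by (intro arc_simple_path_subpath_interior[OF c(1)]) auto
  have a2: "arc c2" unfolding c2_def
  proof (rule arc_join)
    show "arc (subpath (t 0) 0 c)" "arc (subpath 1 (t 2) c)"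
      using t2 t lf[of "t 0" 0] lf[of "t 2" 1]
      by (intro arc_simple_path_subpath[OF c(1)]; auto)+
    show "path_image (subpath (t 0) 0 c) \<inter> path_image (subpath 1 (t 2) c) \<subseteq> {pathstart (subpath 1 (t 2) c)}"
      unfolding ic2'
    proof
      fix z assume "z \<in> c ` {0..t 0} \<inter> c ` {t 2..1}"
      then obtain x y where "z = c x" "x \<in> {0..t 0}" "z = c y" "y \<in> {t 2..1}" by blast
      then show "z \<in> {pathstart (subpath 1 (t 2) c)}" using lf[of x y] t2 t c01 by auto
    qed
  qed (use c01 in auto)
  have un: "path_image c1 \<union> path_image c2 = path_image c"
  proof -
    have "{0..1} = {t 0..t 2} \<union> ({0..t 0} \<union> {t 2..1})" using t t2 by auto
    then have "path_image c = c ` ({t 0..t 2} \<union> ({0..t 0} \<union> {t 2..1}))" by (simp add: path_image_def)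
    then show ?thesis unfolding ic1 ic2 by (simp add: image_Un)
  qed
  have G2: "path_image G - {q 0, q 2} \<subseteq> S"
  proof -
    have "path_image (P 0) \<subseteq> {q 0} \<union> S" "path_image (P 2) \<subseteq> {q 2} \<union> S"
      using iP[of 0] iP[of 2] unfolding Diff_subset_conv by simp_all
    moreover have "closed_segment (e 0) (e 2) \<subseteq> S"
      using segb[of 0 2] x0 by (simp add: S_def)
    ultimately show ?thesis unfolding G(4) by blast
  qed
  have q02: "q 0 \<noteq> q 2" using lf[of "t 0" "t 2"] t t2 by (auto simp: q_def)
  have q0c: "q 0 \<in> path_image c1" "q 2 \<in> path_image c1" "q 0 \<in> path_image c2" "q 2 \<in> path_image c2"
    using t t2 by (auto simp: ic1 ic2 q_def)
  have q0G: "q 0 \<in> path_image G" "q 2 \<in> path_image G"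
    using G(2,3) pathstart_in_path_image pathfinish_in_path_image by metis+
  have sub: "path_image c1 \<subseteq> path_image c" "path_image c2 \<subseteq> path_image c" using un by auto
  define U1 where "U1 = inside (path_image c1 \<union> path_image G)"
  define U2 where "U2 = inside (path_image c2 \<union> path_image G)"
  \<comment> \<open>The two boundary arcs and the crosscut \<open>G\<close> form a theta
    curve.\<close>
  have split: "U1 \<inter> U2 = {} \<and> U1 \<union> U2 \<union> (path_image G - {q 0, q 2}) = S"
  proof (rule split_inside_simple_closed_curve[of c1 "q 0" "q 2" c2 G, unfolded un])
    show "path_image G \<inter> inside (path_image c) \<noteq> {}"
      using eP[of 0] G(4) eS[of 0] by (auto simp: S_def)
    show "path_image c1 \<inter> path_image c2 = {q 0, q 2}"
    proof
      show "path_image c1 \<inter> path_image c2 \<subseteq> {q 0, q 2}"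
      proof
        fix z assume "z \<in> path_image c1 \<inter> path_image c2"
        then obtain x y where "z = c x" "x \<in> {t 0..t 2}" "z = c y" "y \<in> {0..t 0} \<union> {t 2..1}"
          unfolding ic1 ic2 by blast
        then show "z \<in> {q 0, q 2}" using lf[of x y] t2 t by (auto simp: q_def)
      qed
    qed (use q0c in auto)
    show "path_image c1 \<inter> path_image G = {q 0, q 2}"
      using G2 no sub(1) q0c q0G by blast
    show "path_image c2 \<inter> path_image G = {q 0, q 2}"
      using G2 no sub(2) q0c q0G by blast
    show "pathstart c1 = q 0" "pathfinish c1 = q 2" "pathstart c2 = q 0" "pathfinish c2 = q 2"
      by (simp_all add: c1_def c2_def q_def)
  qed (use a1 a2 G(1-3) q02 in \<open>simp_all add: arc_imp_simple_path U1_def U2_def S_def\<close>)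
  have clU: "closed (path_image c1 \<union> path_image G)" "closed (path_image c2 \<union> path_image G)"
    using a1 a2 G(1) by (auto intro!: closed_Un closed_path_image arc_imp_path)
  have opU: "open U1" "open U2" using open_inside[OF clU(1)] open_inside[OF clU(2)] by (auto simp: U1_def U2_def)
  have closU: "closure U1 \<subseteq> U1 \<union> (path_image c1 \<union> path_image G)" "closure U2 \<subseteq> U2 \<union> (path_image c2 \<union> path_image G)"
    using closure_inside_subset[OF clU(1)] closure_inside_subset[OF clU(2)] by (auto simp: U1_def U2_def)
  obtain D where D: "arc D" "pathstart D = q 1" "pathfinish D = q 3"
       "path_image D = path_image (P 1) \<union> closed_segment (e 1) (e 3) \<union> path_image (P 3)"
    using chord[of 1 3] by auto
  define D' where "D' = path_image D - {q 1, q 3}"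
  have "connected D'" unfolding D'_def using connected_simple_path_endless[of D] D arc_imp_simple_path by metis
  have D'S: "D' \<subseteq> S"
  proof -
    have "path_image (P 1) \<subseteq> {q 1} \<union> S" "path_image (P 3) \<subseteq> {q 3} \<union> S"
      using iP[of 1] iP[of 3] unfolding Diff_subset_conv by simp_all
    moreover have "closed_segment (e 1) (e 3) \<subseteq> S"
      using segb[of 1 3] x0 by (simp add: S_def)
    ultimately show ?thesis unfolding D'_def D(4) by blast
  qed
  have PS: "path_image (P i) \<inter> closed_segment (e j) (e k) = {}" if "i < 4" "j < 4" "k < 4" "i \<noteq> j" "i \<noteq> k" "closed_segment (e j) (e k) \<inter> closed_segment (e i) (e l) = {}" for i j k l
  proof -
    have "path_image (P i) \<inter> closed_segment (e j) (e k) \<subseteq> {e i}" using cP[OF that(1)] segb[OF that(2,3)] by blast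
    moreover have "e i \<in> closed_segment (e i) (e l)" by simp
    ultimately show ?thesis using that by blast
  qed
  have D'G: "path_image D \<inter> path_image G = {}"
  proof -
    have "closed_segment (e 1) (e 3) \<inter> closed_segment (e 0) (e 2) = {}"
      "closed_segment (e 1) (e 3) \<inter> closed_segment (e 2) (e 0) = {}"
      "closed_segment (e 0) (e 2) \<inter> closed_segment (e 1) (e 3) = {}"
      "closed_segment (e 0) (e 2) \<inter> closed_segment (e 3) (e 1) = {}"
      using disj by (metis Int_commute closed_segment_commute)+
    note PS[of 0 1 3 2, OF _ _ _ _ _ this(1)] PS[of 2 1 3 0, OF _ _ _ _ _ this(2)]
      PS[of 1 0 2 3, OF _ _ _ _ _ this(3)] PS[of 3 0 2 1, OF _ _ _ _ _ this(4)]
    then have "path_image (P 0) \<inter> closed_segment (e 1) (e 3) = {}" "path_image (P 2) \<inter> closed_segment (e 1) (e 3) = {}"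
      "path_image (P 1) \<inter> closed_segment (e 0) (e 2) = {}" "path_image (P 3) \<inter> closed_segment (e 0) (e 2) = {}"
      by simp_all
    moreover have "path_image (P 0) \<inter> path_image (P 1) = {}" "path_image (P 0) \<inter> path_image (P 3) = {}"
      "path_image (P 2) \<inter> path_image (P 1) = {}" "path_image (P 2) \<inter> path_image (P 3) = {}"
      by (intro PP; simp)+
    ultimately show ?thesis unfolding D(4) G(4) using disj by (simp only: Int_Un_distrib Int_Un_distrib2 Int_commute Un_empty)
  qed
  have "D' \<subseteq> U1 \<union> U2" using split D'S D'G by (auto simp: D'_def)
  then have "D' \<subseteq> U1 \<or> D' \<subseteq> U2"
  proof -
    have "U1 \<inter> D' = {} \<or> U2 \<inter> D' = {}"
      by (rule connectedD[OF \<open>connected D'\<close> opU]) (use split \<open>D' \<subseteq> U1 \<union> U2\<close> in auto)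
    then show ?thesis using \<open>D' \<subseteq> U1 \<union> U2\<close> by blast
  qed
  moreover have clD: "q 1 \<in> closure D'" "q 3 \<in> closure D'"
  proof -
    have D'im: "D' = D ` {0<..<1}"
      unfolding D'_def using simple_path_endless[of D] D arc_imp_simple_path by metis
    have cD: "continuous_on {0..1} D" using D(1) by (auto simp: arc_def path_def)
    have "D ` closure {0<..<1} \<subseteq> closure D'"
      unfolding D'im by (rule image_closure_subset) (use cD in \<open>auto simp: closure_subset\<close>)
    then have "D 0 \<in> closure D'" "D 1 \<in> closure D'" by auto
    then show "q 1 \<in> closure D'" "q 3 \<in> closure D'"
      using D(2,3) by (auto simp: pathstart_def pathfinish_def)
  qed
  moreover have "q 3 \<notin> U1 \<union> (path_image c1 \<union> path_image G)"
  proof -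
    have "q 3 \<in> path_image c" using t t2 by (auto simp: q_def path_image_def)
    then have "q 3 \<notin> U1" using split no by blast
    moreover have "q 3 \<notin> path_image c1"
    proof
      assume "q 3 \<in> path_image c1"
      then obtain x where "c (t 3) = c x" "t 0 \<le> x" "x \<le> t 2" by (auto simp: ic1 q_def)
      then show False using lf[of "t 3" x] t t2 by auto
    qed
    moreover have "q 3 \<notin> path_image G" using D'G D(4) qP[of 3] by auto
    ultimately show ?thesis by blast
  qed
  moreover have "q 1 \<notin> U2 \<union> (path_image c2 \<union> path_image G)"
  proof -
    have "q 1 \<in> path_image c" using t t2 by (auto simp: q_def path_image_def)
    then have "q 1 \<notin> U2" using split no by blast
    moreover have "q 1 \<notin> path_image c2"
    proof
      assume "q 1 \<in> path_image c2"
      then obtain x where "c (t 1) = c x" "0 \<le> x \<and> x \<le> t 0 \<or> t 2 \<le> x \<and> x \<le> 1" by (auto simp: ic2 q_def)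
      then show False using lf[of "t 1" x] t t2 by auto
    qed
    moreover have "q 1 \<notin> path_image G" using D'G D(4) qP[of 1] by auto
    ultimately show ?thesis by blast
  qed
  ultimately show False using closU closure_mono[of D' U1] closure_mono[of D' U2] by blast
qed

text \<open>Inversion at an inside point \<open>w0\<close> sends the punctured inside to a connected
  unbounded set that avoids the new curve, hence into its outside. The old outside becomes a
  connected set that approaches 0 and contains every nonzero point inside the new curve; if 0 were
  outside, this set would join an inside point to the outside.\<close>

lemma Jordan_inversion:
  fixes c :: "real \<Rightarrow> complex"
  assumes c: "simple_path c" "pathfinish c = pathstart c"
    and w0: "w0 \<in> inside (path_image c)"
  defines "\<iota> \<equiv> (\<lambda>z. inverse (z - w0))"
  shows "simple_path (\<iota> \<circ> c)" "pathfinish (\<iota> \<circ> c) = pathstart (\<iota> \<circ> c)"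
    and "0 \<in> inside (path_image (\<iota> \<circ> c))"
    and "\<And>z. z \<in> inside (path_image (\<iota> \<circ> c)) \<Longrightarrow> z \<noteq> 0 \<Longrightarrow> w0 + inverse z \<in> outside (path_image c)"
    and "\<And>w. w \<in> inside (path_image c) \<Longrightarrow> w \<noteq> w0 \<Longrightarrow> \<iota> w \<in> outside (path_image (\<iota> \<circ> c))"
proof -
  define I where "I = inside (path_image c)"
  define Ou where "Ou = outside (path_image c)"
  define D where "D = path_image (\<iota> \<circ> c)"
  note J = Jordan_inside_outside[OF c]
  have w0c: "w0 \<notin> path_image c" using w0 inside_no_overlap[of "path_image c"] by blast
  have inj: "\<iota> x = \<iota> y \<longleftrightarrow> x = y" for x y by (simp add: \<iota>_def)
  have inv: "w0 + inverse (\<iota> w) = w" for w by (simp add: \<iota>_def)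
  have inv': "\<iota> (w0 + inverse z) = z" for z by (simp add: \<iota>_def)
  have cont: "continuous_on S \<iota>" if "w0 \<notin> S" for S
    unfolding \<iota>_def using that by (intro continuous_intros) auto
  have D: "D = \<iota> ` path_image c" by (simp add: D_def path_image_compose)
  show sp: "simple_path (\<iota> \<circ> c)"
    using c(1) cont[OF w0c] inj unfolding simple_path_def loop_free_def
    by (auto intro: path_continuous_image)
  show cl: "pathfinish (\<iota> \<circ> c) = pathstart (\<iota> \<circ> c)"
    using c(2) by (simp add: pathstart_compose pathfinish_compose)
  note J' = Jordan_inside_outside[OF sp cl]
  have Iop: "open I" "connected I" and Oc: "connected Ou" "I \<inter> Ou = {}" "I \<union> Ou = - path_image c"
    using J unfolding I_def Ou_def by blast+
  define A where "A = \<iota> ` (I - {w0})"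
  have "connected (I - {w0})" by (rule connected_open_delete[OF Iop]) simp
  then have conA: "connected A" unfolding A_def by (intro connected_continuous_image cont) auto
  have Ic: "w \<notin> path_image c" if "w \<in> I \<union> Ou" for w using Oc(3) that by simp
  have AD: "A \<subseteq> - D" using Ic unfolding A_def D by (auto simp: inj)
  obtain \<epsilon> where eps: "\<epsilon> > 0" "ball w0 \<epsilon> \<subseteq> I" using Iop(1) w0 unfolding I_def by (meson openE)
  have bigA: "z \<in> A" if "norm z > 1 / \<epsilon>" for z
  proof -
    have "inverse (norm z) < inverse (1 / \<epsilon>)" using that eps(1) by (intro less_imp_inverse_less) auto
    then have "norm (inverse z) < \<epsilon>" by (simp add: norm_inverse)
    then have "w0 + inverse z \<in> I" using eps(2) by (auto simp: dist_norm)
    moreover have "z \<noteq> 0" using that eps(1) by auto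
    ultimately show ?thesis unfolding A_def using inv'[of z] by (intro image_eqI[of _ _ "w0 + inverse z"]) auto
  qed
  have "\<not> bounded A"
  proof
    assume "bounded A"
    then obtain b where b: "\<And>z. z \<in> A \<Longrightarrow> norm z \<le> b" by (auto simp: bounded_iff)
    define x where "x = complex_of_real (max b (1 / \<epsilon>) + 1)"
    have "norm x = \<bar>max b (1 / \<epsilon>) + 1\<bar>" unfolding x_def by (rule norm_of_real)
    then have "norm x > b" "norm x > 1 / \<epsilon>" by linarith+
    then show False using bigA[of x] b[of x] by linarith
  qed
  have Aout: "A \<subseteq> outside D"
  proof
    fix x assume "x \<in> A"
    then have "A \<subseteq> connected_component_set (- D) x" using conA AD by (intro connected_component_maximal)
    then show "x \<in> outside D" using \<open>\<not> bounded A\<close> \<open>x \<in> A\<close> AD bounded_subset unfolding outside_def by blast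
  qed
  then show "\<iota> w \<in> outside (path_image (\<iota> \<circ> c))" if "w \<in> inside (path_image c)" "w \<noteq> w0" for w
    using that unfolding A_def I_def D_def by auto
  have main: "w0 + inverse z \<in> Ou" if z: "z \<in> inside D" "z \<noteq> 0" for z
  proof -
    have "w0 + inverse z \<notin> I"
    proof
      assume "w0 + inverse z \<in> I"
      then have "z \<in> A" unfolding A_def using inv'[of z] z(2) by (intro image_eqI[of _ _ "w0 + inverse z"]) auto
      then show False using Aout z(1) inside_Int_outside[of D] by blast
    qed
    moreover have "w0 + inverse z \<notin> path_image c"
    proof
      assume "w0 + inverse z \<in> path_image c"
      then have "z \<in> D" unfolding D using inv'[of z] by (intro image_eqI[of _ _ "w0 + inverse z"]) auto
      then show False using z(1) inside_no_overlap[of D] by blast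
    qed
    ultimately show ?thesis using Oc(3) by blast
  qed
  then show "w0 + inverse z \<in> outside (path_image c)" if "z \<in> inside (path_image (\<iota> \<circ> c))" "z \<noteq> 0" for z
    using that unfolding D_def Ou_def by blast
  have "w0 \<notin> Ou" using w0 Oc(2) unfolding I_def by blast
  then have conO: "connected (\<iota> ` Ou)" using Oc(1) by (intro connected_continuous_image cont)
  have "0 \<notin> D" using w0c unfolding D \<iota>_def by auto
  show "0 \<in> inside (path_image (\<iota> \<circ> c))"
  proof (rule ccontr)
    assume "0 \<notin> inside (path_image (\<iota> \<circ> c))"
    then have "0 \<in> outside D" using J' \<open>0 \<notin> D\<close> unfolding D_def by blast
    moreover have "open (outside D)" using J' unfolding D_def by blast
    ultimately obtain d where d: "d > 0" "ball 0 d \<subseteq> outside D" by (meson openE)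
    have "bounded (path_image c \<union> I)"
      using J bounded_simple_path_image[OF c(1)] unfolding I_def by simp
    then obtain b where b: "\<And>z. z \<in> path_image c \<union> I \<Longrightarrow> norm z \<le> b" "b > 0" by (meson bounded_pos)
    \<comment> \<open>\<open>y\<close> is so far away that it lies outside the old curve and that
      its image has norm below \<open>d\<close>.\<close>
    define y where "y = complex_of_real (b + norm w0 + 1 / d + 1)"
    have pos: "b + norm w0 + 1 / d + 1 > 0" using b(2) d(1) by (simp add: add_pos_pos add_nonneg_pos)
    have ny: "norm y = b + norm w0 + 1 / d + 1" unfolding y_def using pos by (simp only: norm_of_real abs_of_pos)
    have d0: "1 / d > 0" using d by simp
    have "norm y > b" using ny d0 norm_ge_zero[of w0] by linarith
    then have "y \<notin> path_image c \<union> I" using b(1) by fastforce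
    then have yO: "y \<in> Ou" using Oc(3) by blast
    have "norm (y - w0) > 1 / d" using norm_triangle_ineq2[of y w0] ny b(2) by linarith
    then have "norm (\<iota> y) < d"
      using d0 less_imp_inverse_less[of "1 / d" "norm (y - w0)"] by (simp add: \<iota>_def norm_inverse)
    then have yo: "\<iota> y \<in> outside D" using d(2) by auto
    have "inside D \<noteq> {}" "open (inside D)" using J' unfolding D_def by blast+
    then obtain z where z: "z \<in> inside D" "z \<noteq> 0" using \<open>0 \<in> outside D\<close> inside_Int_outside[of D] by blast
    have "z \<in> \<iota> ` Ou" using main[OF z] inv'[of z] by (intro image_eqI[of _ _ "w0 + inverse z"]) auto
    moreover have "\<iota> ` Ou \<subseteq> - D" using Ic unfolding D by (auto simp: inj)
    ultimately have "connected_component (- D) z (\<iota> y)"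
      using conO yO unfolding connected_component_def by blast
    then have "z \<in> outside D" using yo outside_same_component connected_component_sym by metis
    then show False using z(1) inside_Int_outside[of D] by blast
  qed
qed

text \<open>Inversion turns the outside into the inside of a Jordan curve, where arcs to a small
  circle are available; inverting back gives a large circle. An arc starts at \<open>c (s i)\<close>
  by following the curve to the parameter \<open>t i\<close> at which the inverted arc begins. The
  half-open stretches keep these parts of the curve disjoint, and each of them contains one of the
  four starting points only.\<close>

lemma disjoint_arcs_outside_Jordan:
  fixes c :: "real \<Rightarrow> complex" and s :: "nat \<Rightarrow> real"
  assumes c: "simple_path c" "pathfinish c = pathstart c"
    and s: "\<And>i. i < 4 \<Longrightarrow> s i < s (Suc i)" "s 0 \<ge> 0" "s 4 \<le> 1"
  obtains w0 R A where "R > 0" "path_image c \<union> inside (path_image c) \<subseteq> ball w0 R"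
    "\<And>i. i < 4 \<Longrightarrow> arc (A i) \<and> pathstart (A i) = c (s i) \<and> dist w0 (pathfinish (A i)) = R \<and>
        path_image (A i) \<subseteq> insert (pathfinish (A i)) (ball w0 R) \<and>
        path_image (A i) \<subseteq> c ` {s i..<s (Suc i)} \<union> outside (path_image c)"
    "\<And>i j. i < 4 \<Longrightarrow> j < 4 \<Longrightarrow> i \<noteq> j \<Longrightarrow> path_image (A i) \<inter> path_image (A j) = {}"
    "closed_segment (pathfinish (A 0)) (pathfinish (A 2)) \<inter> closed_segment (pathfinish (A 1)) (pathfinish (A 3)) \<noteq> {}"
proof -
  note J = Jordan_inside_outside[OF c]
  obtain w0 where w0: "w0 \<in> inside (path_image c)" using J by blast
  define \<iota> where "\<iota> = (\<lambda>z. inverse (z - w0))"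
  define c' where "c' = \<iota> \<circ> c"
  note inv = Jordan_inversion[OF c w0, folded \<iota>_def, folded c'_def]
  have ii: "w0 + inverse (\<iota> w) = w" for w by (simp add: \<iota>_def)
  have "open (inside (path_image c'))" using Jordan_inside_outside[OF inv(1,2)] by blast
  then obtain r where r: "r > 0" "cball 0 r \<subseteq> inside (path_image c')" using inv(3) open_contains_cball by metis
  obtain t P where t: "\<And>i. i < 4 \<Longrightarrow> s i < t i \<and> t i < s (Suc i)"
    and P: "\<And>i. i < 4 \<Longrightarrow> arc (P i) \<and> pathstart (P i) = c' (t i) \<and>
       path_image (P i) - {c' (t i)} \<subseteq> inside (path_image c') \<and>
       path_image (P i) \<inter> cball 0 r = {pathfinish (P i)} \<and> dist 0 (pathfinish (P i)) = r"
    and PP: "\<And>i j. i < 4 \<Longrightarrow> j < 4 \<Longrightarrow> i \<noteq> j \<Longrightarrow> path_image (P i) \<inter> path_image (P j) = {}"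
    using disjoint_arcs_to_circle[OF inv(1,2) r(2,1) s] by blast
  have n4: "Suc 3 = (4::nat)" "Suc 2 = (3::nat)" "Suc (Suc 0) = 2" by simp_all
  have ts: "0 < t 0" "t 0 < t 1" "t 1 < t 2" "t 2 < t 3" "t 3 < 1"
    using t[of 0] t[of 1] t[of 2] t[of 3] s(2,3) by (simp_all add: n4)
  have cross: "closed_segment (pathfinish (P 0)) (pathfinish (P 2)) \<inter> closed_segment (pathfinish (P 1)) (pathfinish (P 3)) \<noteq> {}"
    by (rule chords_cross[OF inv(1,2) r(2) ts]) (use P PP in auto)
  define R where "R = 1 / r"
  define T where "T z = w0 + inverse z" for z :: complex
  have Tinj: "T x = T y \<longleftrightarrow> x = y" for x y by (simp add: T_def)
  have R0: "R > 0" using r by (simp add: R_def)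
  have sm: "s i \<le> s j" if "i \<le> j" "j \<le> 4" for i j
    using that by (induction j rule: dec_induct) (use s(1) in \<open>auto simp: less_imp_le intro: order_trans\<close>)
  have s01: "0 \<le> s i" "s i < t i" "t i < s (Suc i)" "s (Suc i) \<le> 1" if "i < 4" for i
    using sm[of 0 i] sm[of "Suc i" 4] t[of i] s(2,3) that by auto
  have lf: "x = y \<or> x = 0 \<and> y = 1 \<or> x = 1 \<and> y = 0" if "x \<in> {0..1}" "y \<in> {0..1}" "c x = c y" for x y
    using c(1) that unfolding simple_path_def loop_free_def by blast
  have tin: "c (t i) \<in> path_image c" if "i < 4" for i using s01[OF that] by (auto simp: path_image_def)
  have Pa: "arc (P i)" and Ps: "pathstart (P i) = c' (t i)"
    and Pi: "path_image (P i) - {c' (t i)} \<subseteq> inside (path_image c')"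
    and PB: "path_image (P i) \<inter> cball 0 r = {pathfinish (P i)}"
    and Pd: "norm (pathfinish (P i)) = r" if "i < 4" for i
    using P[OF that] by simp_all
  have 0: "0 \<notin> path_image (P i)" if "i < 4" for i
  proof
    assume "0 \<in> path_image (P i)"
    then have "0 \<in> path_image (P i) \<inter> cball 0 r" using r by simp
    then have "pathfinish (P i) = 0" unfolding PB[OF that] by simp
    then show False using Pd[OF that] r by simp
  qed
  have Tn: "dist w0 (T z) = 1 / norm z" for z by (simp add: T_def dist_norm norm_inverse divide_inverse)
  define Q where "Q i = T \<circ> P i" for i
  have Q0: "pathstart (Q i) = c (t i)" if "i < 4" for i
    using Ps[OF that] ii by (simp add: Q_def pathstart_compose T_def c'_def)
  have Q1: "pathfinish (Q i) = T (pathfinish (P i))" for i by (simp add: Q_def pathfinish_compose)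
  have imQ: "path_image (Q i) = T ` path_image (P i)" for i by (simp add: Q_def path_image_compose)
  have Qout: "path_image (Q i) \<subseteq> insert (c (t i)) (outside (path_image c))" if i: "i < 4" for i
  proof -
    have "T z \<in> insert (c (t i)) (outside (path_image c))" if "z \<in> path_image (P i)" for z
    proof (cases "z = c' (t i)")
      case True then show ?thesis using ii by (simp add: T_def c'_def)
    next
      case False
      then have "z \<in> inside (path_image c')" using Pi[OF i] that by blast
      then show ?thesis using inv(4)[of z] 0[OF i] that unfolding T_def by fastforce
    qed
    then show ?thesis unfolding imQ by blast
  qed
  have Qarc: "arc (Q i)" if i: "i < 4" for i
  proof -
    have "continuous_on (path_image (P i)) T"
      unfolding T_def using 0[OF i] by (intro continuous_intros) auto
    moreover have "arc (P i)" by (rule Pa[OF i])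
    ultimately show ?thesis
      unfolding Q_def arc_def by (auto intro!: path_continuous_image simp: inj_on_def Tinj)
  qed
  have Qball: "path_image (Q i) \<subseteq> insert (pathfinish (Q i)) (ball w0 R)" if i: "i < 4" for i
  proof -
    have "T z \<in> insert (T (pathfinish (P i))) (ball w0 R)" if "z \<in> path_image (P i)" for z
    proof (cases "z \<in> cball 0 r")
      case True
      then have "z \<in> path_image (P i) \<inter> cball 0 r" using that by simp
      then have "z = pathfinish (P i)" unfolding PB[OF i] by simp
      then show ?thesis by simp
    next
      case False
      then have "r < norm z" by simp
      then have "1 / norm z < R" unfolding R_def using r(1) by (simp add: divide_strict_left_mono frac_less2)
      then show ?thesis using Tn[of z] by simp
    qed
    then show ?thesis unfolding imQ Q1 by blast
  qed
  define C where "C i = subpath (s i) (t i) c" for i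
  have imC: "path_image (C i) = c ` {s i..t i}" if "i < 4" for i
    using s01[OF that] by (simp add: C_def path_image_subpath closed_segment_eq_real_ivl)
  have Cc: "path_image (C i) \<subseteq> path_image c" if "i < 4" for i
    unfolding imC[OF that] using s01[OF that] by (auto simp: path_image_def)
  have Carc: "arc (C i)" if "i < 4" for i
  proof -
    have "s i \<noteq> 0 \<or> t i \<noteq> 1" using s01[OF that] by auto
    moreover have "\<bar>s i - t i\<bar> < 1" using s01[OF that] by auto
    ultimately show ?thesis unfolding C_def using s01[OF that] by (intro arc_simple_path_subpath_interior[OF c(1)]) auto
  qed
  have C0: "pathstart (C i) = c (s i)" "pathfinish (C i) = c (t i)" for i by (simp_all add: C_def)
  have no: "outside (path_image c) \<subseteq> - path_image c" by (auto simp: outside_def)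
  define A where "A i = C i +++ Q i" for i
  have imA: "path_image (A i) = path_image (C i) \<union> path_image (Q i)" if "i < 4" for i
    unfolding A_def using C0 Q0[OF that] by (simp add: path_image_join)
  have inb: "path_image c \<union> inside (path_image c) \<subseteq> ball w0 R"
  proof
    fix w assume w: "w \<in> path_image c \<union> inside (path_image c)"
    show "w \<in> ball w0 R"
    proof (cases "w = w0")
      case False
      have "\<iota> w \<notin> inside (path_image c')"
      proof (cases "w \<in> path_image c")
        case True
        then have "\<iota> w \<in> path_image c'" by (simp add: c'_def path_image_compose)
        then show ?thesis using inside_no_overlap by blast
      next
        case False
        then have "\<iota> w \<in> outside (path_image c')" using inv(5)[of w] w \<open>w \<noteq> w0\<close> by (simp add: \<iota>_def)
        then show ?thesis using inside_Int_outside by blast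
      qed
      then have "\<iota> w \<notin> cball 0 r" using r(2) by blast
      then have "norm (\<iota> w) > r" by simp
      moreover have "T (\<iota> w) = w" using ii by (simp add: T_def)
      ultimately have "dist w0 w < 1 / r"
        using Tn[of "\<iota> w"] r(1) by (simp add: frac_less2)
      then show ?thesis by (simp add: R_def)
    qed (use R0 in simp)
  qed
  show thesis
  proof (rule that[OF R0 inb, of A])
    fix i :: nat assume i: "i < 4"
    have fin: "pathfinish (A i) = pathfinish (Q i)" by (simp add: A_def)
    have "arc (A i)"
      unfolding A_def
    proof (rule arc_join[OF Carc[OF i] Qarc[OF i]])
      show "pathfinish (C i) = pathstart (Q i)" using C0 Q0[OF i] by simp
      show "path_image (C i) \<inter> path_image (Q i) \<subseteq> {pathstart (Q i)}"
      proof -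
        have "path_image (C i) \<inter> path_image (Q i) \<subseteq> path_image c \<inter> insert (c (t i)) (- path_image c)"
          using Cc[OF i] Qout[OF i] no by (intro Int_mono) (auto intro: subset_trans)
        then show ?thesis unfolding Q0[OF i] by auto
      qed
    qed
    moreover have "pathstart (A i) = c (s i)" using C0 by (simp add: A_def)
    moreover have "dist w0 (pathfinish (A i)) = R"
      unfolding fin Q1 Tn R_def using Pd[OF i] by simp
    moreover have "path_image (A i) \<subseteq> insert (pathfinish (A i)) (ball w0 R)"
      unfolding imA[OF i] fin using Qball[OF i] Cc[OF i] inb by blast
    moreover have "path_image (A i) \<subseteq> c ` {s i..<s (Suc i)} \<union> outside (path_image c)"
    proof -
      have "c ` {s i..t i} \<subseteq> c ` {s i..<s (Suc i)}" "c (t i) \<in> c ` {s i..<s (Suc i)}" using s01[OF i] by auto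
      then show ?thesis unfolding imA[OF i] imC[OF i] using Qout[OF i] by blast
    qed
    ultimately show "arc (A i) \<and> pathstart (A i) = c (s i) \<and> dist w0 (pathfinish (A i)) = R \<and>
        path_image (A i) \<subseteq> insert (pathfinish (A i)) (ball w0 R) \<and>
        path_image (A i) \<subseteq> c ` {s i..<s (Suc i)} \<union> outside (path_image c)" by blast
  next
    have CC: "path_image (C i) \<inter> path_image (C j) = {}" if "i < j" "j < 4" for i j
    proof -
      have i: "i < 4" using that by simp
      have "c x \<noteq> c y" if "x \<in> {s i..t i}" "y \<in> {s j..t j}" for x y
      proof
        assume eq: "c x = c y"
        have "t i < s j" using s01[OF i] sm[of "Suc i" j] \<open>i < j\<close> \<open>j < 4\<close> by simp
        then have "x < y" "x < 1" "0 < y" "0 \<le> x" "y < 1"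
          using that s01[OF i] s01[OF \<open>j < 4\<close>] by auto
        then show False using lf[of x y] eq by auto
      qed
      then show ?thesis unfolding imC[OF i] imC[OF \<open>j < 4\<close>] by fast
    qed
    have CC': "path_image (C i) \<inter> path_image (C j) = {}" if "i < 4" "j < 4" "i \<noteq> j" for i j
      using CC[of i j] CC[of j i] that by (metis Int_commute linorder_neqE_nat)
    fix i j :: nat assume ij: "i < 4" "j < 4" "i \<noteq> j"
    have CQ: "path_image (C i) \<inter> path_image (Q j) = {}" if ij: "i < 4" "j < 4" "i \<noteq> j" for i j
    proof -
      have "path_image (C i) \<inter> path_image (Q j) \<subseteq> path_image c \<inter> insert (c (t j)) (- path_image c)"
        using Cc[OF ij(1)] Qout[OF ij(2)] no by (intro Int_mono) (auto intro: subset_trans)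
      then have "path_image (C i) \<inter> path_image (Q j) \<subseteq> {c (t j)}" by auto
      moreover have "c (t j) \<in> path_image (C j)" using C0 pathfinish_in_path_image by metis
      ultimately show ?thesis using CC'[OF ij] by (metis IntI Int_iff empty_iff singletonD subsetD equals0I)
    qed
    have "path_image (Q i) \<inter> path_image (Q j) = T ` (path_image (P i) \<inter> path_image (P j))"
      unfolding imQ by (rule image_Int[symmetric]) (simp add: inj_def Tinj)
    then have "path_image (Q i) \<inter> path_image (Q j) = {}" using PP[OF ij] by simp
    moreover have "path_image (C i) \<inter> path_image (C j) = {}" by (rule CC'[OF ij])
    moreover have "path_image (C i) \<inter> path_image (Q j) = {}" by (rule CQ[OF ij])
    moreover have "path_image (Q i) \<inter> path_image (C j) = {}" using CQ[of j i] ij by (metis Int_commute)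
    ultimately show "path_image (A i) \<inter> path_image (A j) = {}"
      unfolding imA[OF ij(1)] imA[OF ij(2)] by (simp only: Int_Un_distrib Int_Un_distrib2 Un_empty)
  next
    \<comment> \<open>On the circle of radius \<open>r\<close> the inversion agrees with the real
      affine map \<open>L\<close>, and affine maps preserve common points of segments.\<close>
    define L where "L z = w0 + cnj z / (r\<^sup>2)" for z
    have LT: "pathfinish (A i) = L (pathfinish (P i))" if i: "i < 4" for i
    proof -
      have n: "norm (pathfinish (P i)) = r" by (rule Pd[OF i])
      then have "pathfinish (P i) \<noteq> 0" using r by auto
      have "inverse (pathfinish (P i)) = cnj (pathfinish (P i)) / (norm (pathfinish (P i)))\<^sup>2"
        using complex_div_cnj[of 1 "pathfinish (P i)"] by (simp add: inverse_eq_divide)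
      then show ?thesis unfolding L_def A_def using Q1 n by (simp add: T_def)
    qed
    have Lseg: "L z \<in> closed_segment (L a) (L b)" if z: "z \<in> closed_segment a b" for z a b
    proof -
      obtain k where k: "0 \<le> k" "k \<le> 1" "z = (1 - k) *\<^sub>R a + k *\<^sub>R b" using z by (auto simp: in_segment)
      have "L z = (1 - k) *\<^sub>R L a + k *\<^sub>R L b"
        unfolding L_def k(3) by (simp add: scaleR_conv_of_real algebra_simps add_divide_distrib diff_divide_distrib)
      then show ?thesis using k(1,2) by (auto simp: in_segment)
    qed
    obtain z where z: "z \<in> closed_segment (pathfinish (P 0)) (pathfinish (P 2))" "z \<in> closed_segment (pathfinish (P 1)) (pathfinish (P 3))"
      using cross by blast
    have "L z \<in> closed_segment (pathfinish (A 0)) (pathfinish (A 2))" "L z \<in> closed_segment (pathfinish (A 1)) (pathfinish (A 3))"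
      using Lseg[OF z(1)] Lseg[OF z(2)] LT[of 0] LT[of 1] LT[of 2] LT[of 3] by simp_all
    then show "closed_segment (pathfinish (A 0)) (pathfinish (A 2)) \<inter> closed_segment (pathfinish (A 1)) (pathfinish (A 3)) \<noteq> {}"
      by blast
  qed
qed

section \<open>Drawing a crossover gadget in a disc\<close>

text \<open>The sign of the left side tells on which side of the line through 1 and
  \<open>cis b\<close> the point \<open>cis x\<close> lies; in the product it can be read off from
  the angles.\<close>

lemma cis_chord_side:
  "Im (cnj (cis b - 1) * (cis x - 1)) = 4 * sin (b / 2) * sin (x / 2) * sin ((x - b) / 2)"
proof -
  have c: "cos t - 1 = - 2 * (sin (t / 2))\<^sup>2" and s: "sin t = 2 * sin (t / 2) * cos (t / 2)" for t :: real
    using cos_double_sin[of "t / 2"] sin_double[of "t / 2"] by simp_all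
  have "Im (cnj (cis b - 1) * (cis x - 1)) = (cos b - 1) * sin x - sin b * (cos x - 1)"
    by (simp add: cis.sel)
  also have "\<dots> = 4 * sin (b / 2) * sin (x / 2) * (sin (x / 2) * cos (b / 2) - cos (x / 2) * sin (b / 2))"
    by (subst c, subst c, subst (1) s, subst (2) s) (simp add: power2_eq_square algebra_simps)
  also have "\<dots> = 4 * sin (b / 2) * sin (x / 2) * sin ((x - b) / 2)"
    by (simp add: sin_diff diff_divide_distrib)
  finally show ?thesis .
qed

text \<open>The affine function \<open>l\<close> vanishes on the line through \<open>z 0\<close> and
  \<open>z 2\<close>. The chords cross, so \<open>z 1\<close> and \<open>z 3\<close> cannot lie
  strictly on the same side; this leaves the two orientations of the cyclic order, and conjugation
  turns the clockwise one into the other.\<close>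

lemma crossing_chords_cyclic_order:
  fixes z :: "nat \<Rightarrow> complex"
  assumes z: "\<And>i. i < 4 \<Longrightarrow> norm (z i) = \<rho>" "\<rho> > 0"
    and ne: "\<And>i j. i < 4 \<Longrightarrow> j < 4 \<Longrightarrow> i \<noteq> j \<Longrightarrow> z i \<noteq> z j"
    and cross: "closed_segment (z 0) (z 2) \<inter> closed_segment (z 1) (z 3) \<noteq> {}"
  obtains h \<theta> where "h = id \<or> h = cnj" "\<And>i. i < 4 \<Longrightarrow> h (z i) = \<rho> * cis (\<theta> i)"
    "\<theta> 0 < \<theta> 1" "\<theta> 1 < \<theta> 2" "\<theta> 2 < \<theta> 3" "\<theta> 3 < \<theta> (0::nat) + 2 * pi"
proof -
  define \<phi> where "\<phi> i = Arg2pi (z i / z 0)" for i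
  have polar: "w = of_real (norm w) * cis (Arg2pi w)" for w
    using Arg2pi_eq[of w] by (simp add: cis_conv_exp)
  have z0: "z 0 \<noteq> 0" using z(1)[of 0] z(2) by auto
  have zi: "z i = z 0 * cis (\<phi> i)" if "i < 4" for i
  proof -
    have "norm (z i / z 0) = 1" using z(1)[OF that] z(1)[of 0] z(2) by (simp add: norm_divide)
    then have "z i / z 0 = cis (\<phi> i)" using polar[of "z i / z 0"] by (simp add: \<phi>_def)
    then show ?thesis using z0 by (simp add: field_simps)
  qed
  have \<phi>: "0 \<le> \<phi> i" "\<phi> i < 2 * pi" for i
    using Arg2pi_ge_0 Arg2pi_lt_2pi by (auto simp: \<phi>_def)
  have \<phi>pos: "0 < \<phi> i" if "0 < i" "i < 4" for i
  proof -
    have "\<phi> i \<noteq> 0" using zi[OF that(2)] ne[of i 0] that by auto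
    then show ?thesis using \<phi>(1)[of i] by simp
  qed
  have \<phi>ne: "\<phi> i \<noteq> \<phi> j" if "i < 4" "j < 4" "i \<noteq> j" for i j
    using zi[OF that(1)] zi[OF that(2)] ne[OF that] by metis
  define l where "l w = Im (cnj (z 2 / z 0 - 1) * (w / z 0 - 1))" for w
  have laff: "l ((1 - k) *\<^sub>R a + k *\<^sub>R b) = (1 - k) * l a + k * l b" for k a b
  proof -
    define c where "c = z 2 / z 0 - 1"
    have lw: "l w = Re c * Im (w / z 0) - Im c * (Re (w / z 0) - 1)" for w
      unfolding l_def c_def[symmetric] by simp
    have "((1 - k) *\<^sub>R a + k *\<^sub>R b) / z 0 = (1 - k) *\<^sub>R (a / z 0) + k *\<^sub>R (b / z 0)"
      by (simp add: scaleR_conv_of_real add_divide_distrib)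
    then show ?thesis unfolding lw by (simp only: scaleR_complex.sel plus_complex.sel) (simp add: algebra_simps)
  qed
  have li: "l (z i) = 4 * sin (\<phi> 2 / 2) * sin (\<phi> i / 2) * sin ((\<phi> i - \<phi> 2) / 2)" if "i < 4" for i
    unfolding l_def cis_chord_side[symmetric] using zi[OF that] zi[of 2] z0 by simp
  have spos: "sin (\<phi> i / 2) > 0" if "0 < i" "i < 4" for i
    using \<phi>pos[OF that] \<phi>(2)[of i] by (intro sin_gt_zero) auto
  have lneg: "l (z i) < 0" if "0 < i" "i < 4" "\<phi> i < \<phi> 2" for i
  proof -
    have "sin ((\<phi> 2 - \<phi> i) / 2) > 0"
      using that \<phi>(1)[of i] \<phi>(2)[of 2] by (intro sin_gt_zero) auto
    then have "sin ((\<phi> i - \<phi> 2) / 2) < 0"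
      using sin_minus[of "(\<phi> 2 - \<phi> i) / 2"] by (simp add: minus_divide_left)
    then show ?thesis using li[OF that(2)] spos[OF that(1,2)] spos[of 2] by (simp add: mult_pos_neg)
  qed
  have lpos: "l (z i) > 0" if "0 < i" "i < 4" "\<phi> i > \<phi> 2" for i
  proof -
    have "sin ((\<phi> i - \<phi> 2) / 2) > 0"
      using that \<phi>(1)[of 2] \<phi>(2)[of i] by (intro sin_gt_zero) auto
    then show ?thesis using li[OF that(2)] spos[OF that(1,2)] spos[of 2] by simp
  qed
  obtain w where w: "w \<in> closed_segment (z 0) (z 2)" "w \<in> closed_segment (z 1) (z 3)" using cross by blast
  obtain k where k: "w = (1 - k) *\<^sub>R z 0 + k *\<^sub>R z 2" using w(1) by (auto simp: in_segment)
  have "\<phi> 0 = 0" using z0 by (simp add: \<phi>_def Arg2pi_eq_0)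
  then have "l w = 0" unfolding k laff using li[of 0] li[of 2] by simp
  obtain k' where k': "0 \<le> k'" "k' \<le> 1" "w = (1 - k') *\<^sub>R z 1 + k' *\<^sub>R z 3" using w(2) by (auto simp: in_segment)
  have l0: "(1 - k') * l (z 1) + k' * l (z 3) = 0" using \<open>l w = 0\<close> unfolding k' laff .
  have notneg: "\<not> (l (z 1) < 0 \<and> l (z 3) < 0)"
    using l0 k'(1,2) convex_bound_lt[of "l (z 1)" 0 "l (z 3)" "1 - k'" k'] by auto
  have notpos: "\<not> (l (z 1) > 0 \<and> l (z 3) > 0)"
    using l0 k'(1,2) convex_bound_lt[of "- l (z 1)" 0 "- l (z 3)" "1 - k'" k'] by auto
  have cases: "\<phi> 1 < \<phi> 2 \<and> \<phi> 2 < \<phi> 3 \<or> \<phi> 3 < \<phi> 2 \<and> \<phi> 2 < \<phi> 1"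
    using \<phi>ne[of 1 2] \<phi>ne[of 3 2] lneg[of 1] lneg[of 3] lpos[of 1] lpos[of 3] notneg notpos
    by (cases "\<phi> 1 < \<phi> 2"; cases "\<phi> 3 < \<phi> 2") auto
  define \<alpha> where "\<alpha> = Arg2pi (z 0)"
  have za: "z 0 = of_real \<rho> * cis \<alpha>" using polar[of "z 0"] z(1)[of 0] by (simp add: \<alpha>_def)
  have zc: "z i = of_real \<rho> * cis (\<alpha> + \<phi> i)" if "i < 4" for i
    using zi[OF that] za by (simp add: cis_mult mult.assoc)
  from cases show thesis
  proof
    assume A: "\<phi> 1 < \<phi> 2 \<and> \<phi> 2 < \<phi> 3"
    show thesis
      by (rule that[of id "\<lambda>i. \<alpha> + \<phi> i"]) (use zc A \<phi>pos[of 1] \<phi>(2)[of 3] \<open>\<phi> 0 = 0\<close> in auto)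
  next
    assume A: "\<phi> 3 < \<phi> 2 \<and> \<phi> 2 < \<phi> 1"
    define \<theta> where "\<theta> i = (if i = 0 then - \<alpha> else 2 * pi - \<alpha> - \<phi> i)" for i :: nat
    have "cnj (z i) = of_real \<rho> * cis (\<theta> i)" if "i < 4" for i
    proof (cases "i = 0")
      case True then show ?thesis using za by (simp add: \<theta>_def cis_cnj)
    next
      case False
      have "cis (\<theta> i) = cis (- (\<alpha> + \<phi> i))"
        using False by (simp add: \<theta>_def complex_eq_iff cos_diff sin_diff algebra_simps cos_add sin_add)
      then show ?thesis using zc[OF that] by (simp add: cis_cnj)
    qed
    then show thesis
      by (intro that[of cnj \<theta>]) (use A \<phi>pos[of 3] \<phi>(2)[of 1] in \<open>auto simp: \<theta>_def\<close>)
  qed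
qed

text \<open>Radius and angle are interpolated linearly at the same time. Two such spirals can meet
  only at equal radius, hence at equal time, and there the difference of their angles is a convex
  combination of two numbers strictly between 0 and \<open>2 * pi\<close>.\<close>

lemma arcs_to_compass_points:
  fixes z :: "nat \<Rightarrow> complex" and \<theta> :: "nat \<Rightarrow> real"
  assumes z: "\<And>i. i < 4 \<Longrightarrow> z i = of_real \<rho> * cis (\<theta> i)" and \<rho>: "0 < \<rho>" "\<rho> < 1"
    and \<theta>: "\<theta> 0 < \<theta> 1" "\<theta> 1 < \<theta> 2" "\<theta> 2 < \<theta> 3" "\<theta> 3 < \<theta> 0 + 2 * pi"
  obtains B where
    "\<And>i. i < 4 \<Longrightarrow> arc (B i) \<and> pathstart (B i) = z i \<and> pathfinish (B i) = \<i> ^ Suc i \<and>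
       path_image (B i) \<subseteq> insert (\<i> ^ Suc i) (ball 0 1) \<and> path_image (B i) \<inter> cball 0 \<rho> = {z i}"
    "\<And>i j. i < 4 \<Longrightarrow> j < 4 \<Longrightarrow> i \<noteq> j \<Longrightarrow> path_image (B i) \<inter> path_image (B j) = {}"
proof -
  define r where "r t = \<rho> + t * (1 - \<rho>)" for t :: real
  define a where "a i t = (1 - t) * \<theta> i + t * (pi / 2 * real (Suc i))" for i t
  define B where "B i = (\<lambda>t. of_real (r t) * cis (a i t))" for i
  have r: "r t > 0" "r 0 = \<rho>" "r 1 = 1" if "0 \<le> t" for t using that \<rho> by (auto simp: r_def add_pos_nonneg)
  have rinj: "r s = r t \<longleftrightarrow> s = t" for s t using \<rho> by (auto simp: r_def)
  have nB: "norm (B i t) = r t" if "0 \<le> t" for i t using r[OF that] by (simp add: B_def norm_mult)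
  have rlt: "r t < 1" if "t < 1" for t
  proof -
    have "t * (1 - \<rho>) < 1 * (1 - \<rho>)" using that \<rho> by (intro mult_strict_right_mono) auto
    then show ?thesis by (simp add: r_def)
  qed
  have disj: "B i s \<noteq> B j t" if ij: "i < j" "j < 4" and st: "0 \<le> s" "s \<le> 1" "0 \<le> t" "t \<le> 1" for i j s t
  proof
    assume eq: "B i s = B j t"
    then have "r s = r t" using nB[of s i] nB[of t j] st by metis
    then have "s = t" by (simp add: rinj)
    then have "cis (a i t) = cis (a j t)" using eq r(1)[OF st(3)] by (simp add: B_def)
    then have "cis (a j t - a i t) = 1" by (simp add: cis_divide[symmetric])
    then have "cos (a j t - a i t) = 1" by (metis cis.sel(1) one_complex.sel(1))
    then obtain n :: int where n: "a j t - a i t = of_int n * 2 * pi" by (auto simp: cos_one_2pi_int)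
    have d: "0 < \<theta> j - \<theta> i" "\<theta> j - \<theta> i < 2 * pi"
    proof -
      have c: "i = 0 \<and> j = 1 \<or> i = 0 \<and> j = 2 \<or> i = 0 \<and> j = 3 \<or> i = 1 \<and> j = 2 \<or> i = 1 \<and> j = 3 \<or> i = 2 \<and> j = 3"
        using ij by linarith
      show "0 < \<theta> j - \<theta> i" using c \<theta> by (elim disjE conjE; hypsubst; linarith)
      show "\<theta> j - \<theta> i < 2 * pi" using c \<theta> by (elim disjE conjE; hypsubst; linarith)
    qed
    define e where "e = pi / 2 * real (Suc j) - pi / 2 * real (Suc i)"
    have e: "0 < e" "e < 2 * pi"
    proof -
      have "e = pi / 2 * (real j - real i)" by (simp add: e_def field_simps)
      moreover have "0 < pi / 2 * (real j - real i)" using ij by (intro mult_pos_pos) auto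
      moreover have "pi / 2 * (real j - real i) < pi / 2 * 4" using ij by (intro mult_strict_left_mono) auto
      ultimately show "0 < e" "e < 2 * pi" by linarith+
    qed
    have eq: "a j t - a i t = (1 - t) * (\<theta> j - \<theta> i) + t * e" by (simp add: a_def e_def algebra_simps)
    have "(1 - t) * (\<theta> j - \<theta> i) + t * e < 2 * pi" using convex_bound_lt[of "\<theta> j - \<theta> i" "2 * pi" e "1 - t" t] d e st by simp
    moreover have "(1 - t) * (\<theta> j - \<theta> i) + t * e > 0" 
    proof (cases "t = 1")
      case False
      then have "(1 - t) * (\<theta> j - \<theta> i) > 0" using d st by (intro mult_pos_pos) auto
      moreover have "t * e \<ge> 0" using e st by simp
      ultimately show ?thesis by linarith
    qed (use e in simp)
    ultimately have "of_int n * (2 * pi) < 1 * (2 * pi)" "0 * (2 * pi) < of_int n * (2 * pi)" using n eq by (simp_all add: algebra_simps)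
    then have "of_int n < (1::real)" "0 < real_of_int n" by (simp_all only: mult_less_cancel_right_pos pi_gt_zero mult_pos_pos zero_less_numeral)
    then show False by simp
  qed
  \<comment> \<open>The final angles are multiples of \<open>pi / 2\<close>: indices 0 to 3 end at
    the top, left, bottom and right point, which is the order \<open>u, v, u', v'\<close>.\<close>
  have B1: "B i 1 = \<i> ^ Suc i" for i
    using Complex.DeMoivre[of "pi / 2" "Suc i"] r(3)[of 0] by (simp add: B_def a_def mult.commute)
  show thesis
  proof (rule that[of B])
    fix i :: nat assume i: "i < 4"
    have "path (B i)" unfolding path_def B_def a_def r_def by (intro continuous_intros)
    moreover have "inj_on (B i) {0..1}"
    proof (rule inj_onI)
      fix s t assume st: "s \<in> {0..1::real}" "t \<in> {0..1}" "B i s = B i t"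
      have "r s = norm (B i s)" "r t = norm (B i t)" using nB[of s i] nB[of t i] st(1,2) by simp_all
      then have "r s = r t" using st(3) by metis
      then show "s = t" by (simp only: rinj)
    qed
    ultimately have "arc (B i)" by (simp add: arc_def)
    moreover have B0: "B i 0 = z i" using z[OF i] r(2)[of 0] by (simp add: B_def a_def)
    moreover have "path_image (B i) \<subseteq> insert (\<i> ^ Suc i) (ball 0 1)"
    proof -
      have "B i t \<in> insert (\<i> ^ Suc i) (ball 0 1)" if "0 \<le> t" "t \<le> 1" for t
        using nB[OF that(1), of i] rlt[of t] B1[of i] that by (cases "t = 1") auto
      then show ?thesis unfolding path_image_def by (intro image_subsetI) simp
    qed
    moreover have "path_image (B i) \<inter> cball 0 \<rho> = {z i}"
    proof -
      have "t = 0" if "0 \<le> t" "norm (B i t) \<le> \<rho>" for t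
      proof -
        have "t * (1 - \<rho>) \<le> 0" using nB[OF that(1), of i] that(2) by (simp add: r_def)
        then show ?thesis using that(1) \<rho> by (simp add: mult_le_0_iff)
      qed
      then have "B i t \<in> cball 0 \<rho> \<Longrightarrow> B i t = B i 0" if "t \<in> {0..1}" for t
        using that by (metis atLeastAtMost_iff mem_cball_0)
      then have "path_image (B i) \<inter> cball 0 \<rho> \<subseteq> {B i 0}" unfolding path_image_def by blast
      moreover have "B i 0 \<in> cball 0 \<rho>" using nB[of 0 i] r(2)[of 0] by simp
      moreover have "B i 0 \<in> path_image (B i)" by (simp add: path_image_def)
      ultimately show ?thesis unfolding B0[symmetric] by blast
    qed
    ultimately show "arc (B i) \<and> pathstart (B i) = z i \<and> pathfinish (B i) = \<i> ^ Suc i \<and>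
       path_image (B i) \<subseteq> insert (\<i> ^ Suc i) (ball 0 1) \<and> path_image (B i) \<inter> cball 0 \<rho> = {z i}"
      using B1[of i] by (simp add: pathstart_def pathfinish_def)
  next
    fix i j :: nat assume ij: "i < 4" "j < 4" "i \<noteq> j"
    have "B i s \<noteq> B j t" if "s \<in> {0..1}" "t \<in> {0..1}" for s t
      using disj[of i j s t] disj[of j i t s] that ij by (cases "i < j") auto
    then show "path_image (B i) \<inter> path_image (B j) = {}" unfolding path_image_def by fast
  qed
qed

text \<open>A planar drawing in which only the point set \<open>S e\<close> of each edge is recorded.\<close>

definition set_drawing :: "'a graph \<Rightarrow> ('a \<Rightarrow> complex) \<Rightarrow> ('a set \<Rightarrow> complex set) \<Rightarrow> bool" where
  "set_drawing G p S \<longleftrightarrow> inj_on p (verts G) \<and>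
     (\<forall>e\<in>edges G. \<exists>g. arc g \<and> {pathstart g, pathfinish g} = p ` e \<and> path_image g = S e) \<and>
     (\<forall>e\<in>edges G. \<forall>x\<in>verts G. p x \<in> S e \<longrightarrow> x \<in> e) \<and>
     (\<forall>e\<in>edges G. \<forall>f\<in>edges G. e \<noteq> f \<longrightarrow> S e \<inter> S f \<subseteq> p ` (e \<inter> f))"

lemma arc_interior: "arc g \<Longrightarrow> curve_interior g = path_image g - {pathstart g, pathfinish g}"
  unfolding curve_interior_def using simple_path_endless[of g] arc_imp_simple_path by metis

lemma planar_drawing_imp_set_drawing:
  assumes "planar_drawing G p \<gamma>" "simple_graph G"
  shows "set_drawing G p (\<lambda>e. path_image (\<gamma> e))"
proof -
  have inj: "inj_on p (verts G)"
    and arcs: "\<And>e. e \<in> edges G \<Longrightarrow> arc (\<gamma> e)"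
    and ends: "\<And>e. e \<in> edges G \<Longrightarrow> {pathstart (\<gamma> e), pathfinish (\<gamma> e)} = p ` e"
    and vert: "\<And>e x. e \<in> edges G \<Longrightarrow> x \<in> verts G \<Longrightarrow> p x \<notin> curve_interior (\<gamma> e)"
    and disj: "\<And>e f. e \<in> edges G \<Longrightarrow> f \<in> edges G \<Longrightarrow> e \<noteq> f \<Longrightarrow> curve_interior (\<gamma> e) \<inter> curve_interior (\<gamma> f) = {}"
    using assms(1) unfolding planar_drawing_def drawing_def by simp_all
  have sub: "e \<subseteq> verts G" if "e \<in> edges G" for e using assms(2) that by (auto simp: simple_graph_def)
  have im: "path_image (\<gamma> e) \<subseteq> curve_interior (\<gamma> e) \<union> p ` e" if "e \<in> edges G" for e
    using arc_interior[OF arcs[OF that]] ends[OF that] by auto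
  have V: "x \<in> e" if "e \<in> edges G" "x \<in> verts G" "p x \<in> path_image (\<gamma> e)" for e x
  proof -
    have "p x \<in> p ` e" using im[OF that(1)] vert[OF that(1,2)] that(3) by auto
    then show ?thesis using inj sub[OF that(1)] that(2) by (meson inj_on_image_mem_iff)
  qed
  show ?thesis
    unfolding set_drawing_def
  proof (intro conjI ballI impI)
    fix e f assume e: "e \<in> edges G" and f: "f \<in> edges G" and ef: "e \<noteq> f"
    show "path_image (\<gamma> e) \<inter> path_image (\<gamma> f) \<subseteq> p ` (e \<inter> f)"
    proof
      fix z assume z: "z \<in> path_image (\<gamma> e) \<inter> path_image (\<gamma> f)"
      have "z \<in> p ` e \<or> z \<in> p ` f"
      proof (rule ccontr)
        assume "\<not> (z \<in> p ` e \<or> z \<in> p ` f)"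
        then have "z \<in> curve_interior (\<gamma> e) \<inter> curve_interior (\<gamma> f)" using z im[OF e] im[OF f] by auto
        then show False unfolding disj[OF e f ef] by simp
      qed
      then obtain x where x: "z = p x" "x \<in> verts G" using sub[OF e] sub[OF f] by auto
      then have "x \<in> e" "x \<in> f" using V[OF e x(2)] V[OF f x(2)] z by auto
      then show "z \<in> p ` (e \<inter> f)" using x by simp
    qed
  next
    fix e assume e: "e \<in> edges G"
    show "\<exists>g. arc g \<and> {pathstart g, pathfinish g} = p ` e \<and> path_image g = path_image (\<gamma> e)"
      using arcs[OF e] ends[OF e] by blast
  qed (use inj V in auto)
qed

lemma set_drawing_imp_planar:
  assumes "set_drawing G p S" "simple_graph G"
  shows "planar G"
proof -
  have inj: "inj_on p (verts G)" using assms(1) by (simp add: set_drawing_def)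
  have "\<forall>e\<in>edges G. \<exists>g. arc g \<and> {pathstart g, pathfinish g} = p ` e \<and> path_image g = S e"
    using assms(1) by (simp add: set_drawing_def)
  then obtain \<gamma> where \<gamma>: "\<And>e. e \<in> edges G \<Longrightarrow> arc (\<gamma> e) \<and> {pathstart (\<gamma> e), pathfinish (\<gamma> e)} = p ` e \<and> path_image (\<gamma> e) = S e"
    by metis
  have ci: "curve_interior (\<gamma> e) = S e - p ` e" if "e \<in> edges G" for e
    using \<gamma>[OF that] arc_interior by metis
  have V: "p x \<notin> curve_interior (\<gamma> e)" if "e \<in> edges G" "x \<in> verts G" for e x
    unfolding ci[OF that(1)] using assms(1) that by (auto simp: set_drawing_def)
  have disj: "curve_interior (\<gamma> e) \<inter> curve_interior (\<gamma> f) = {}" if "e \<in> edges G" "f \<in> edges G" "e \<noteq> f" for e f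
  proof -
    have "S e \<inter> S f \<subseteq> p ` (e \<inter> f)" using assms(1) that by (simp add: set_drawing_def)
    then show ?thesis unfolding ci[OF that(1)] ci[OF that(2)] by auto
  qed
  have "planar_drawing G p \<gamma>"
    unfolding planar_drawing_def drawing_def
  proof (intro conjI ballI impI allI)
    fix e f x y assume "e \<in> edges G" "f \<in> edges G" "e \<noteq> f" and x: "x \<in> curve_interior (\<gamma> e) \<inter> curve_interior (\<gamma> f)"
    then show "x = y" using disj[of e f] by auto
  qed (use inj \<gamma> V disj in simp_all)
  then show ?thesis using assms(2) by (auto simp: planar_def)
qed

lemma set_drawing_inj_image:
  assumes D: "set_drawing G p S" and T: "inj T" "continuous_on UNIV T"
  shows "set_drawing G (T \<circ> p) (\<lambda>e. T ` S e)"
proof -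
  have arcT: "arc (T \<circ> g)" if "arc g" for g
    using that T unfolding arc_def
    by (auto intro!: path_continuous_image comp_inj_on intro: continuous_on_subset inj_on_subset)
  show ?thesis
    unfolding set_drawing_def
  proof (intro conjI ballI impI)
    show "inj_on (T \<circ> p) (verts G)"
      using D T(1) by (auto simp: set_drawing_def intro!: comp_inj_on intro: inj_on_subset)
    fix e assume e: "e \<in> edges G"
    then obtain g where g: "arc g" "{pathstart g, pathfinish g} = p ` e" "path_image g = S e"
      using D by (auto simp: set_drawing_def)
    have "{pathstart (T \<circ> g), pathfinish (T \<circ> g)} = T ` {pathstart g, pathfinish g}"
      by (simp add: pathstart_compose pathfinish_compose)
    then have "{pathstart (T \<circ> g), pathfinish (T \<circ> g)} = (T \<circ> p) ` e" unfolding g(2) by (simp add: image_comp)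
    then show "\<exists>g. arc g \<and> {pathstart g, pathfinish g} = (T \<circ> p) ` e \<and> path_image g = T ` S e"
      using arcT[OF g(1)] g(3) path_image_compose by metis
    show "x \<in> e" if "x \<in> verts G" "(T \<circ> p) x \<in> T ` S e" for x
      using that D e T(1) by (auto simp: set_drawing_def inj_image_mem_iff)
    fix f assume "f \<in> edges G" "e \<noteq> f"
    then have "S e \<inter> S f \<subseteq> p ` (e \<inter> f)" using D e by (simp add: set_drawing_def)
    then have "T ` (S e \<inter> S f) \<subseteq> T ` p ` (e \<inter> f)" by (rule image_mono)
    then show "T ` S e \<inter> T ` S f \<subseteq> (T \<circ> p) ` (e \<inter> f)" by (simp add: image_Int[OF T(1)] image_comp)
  qed
qed

text \<open>The drawing and the circle around it are shrunk into the closed disc of radius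
  \<open>1 / 2\<close> and reflected if the arcs end in clockwise order. The annulus that remains is
  used to turn the arcs to the four prescribed points of the unit circle.\<close>

lemma gadget_disc_drawing:
  assumes "crossover_gadget H u u' v v'"
  obtains p S A where "set_drawing H p S"
    "p ` verts H \<union> (\<Union>e\<in>edges H. S e) \<subseteq> ball 0 1"
    "\<And>i. i < 4 \<Longrightarrow> arc (A i) \<and> pathstart (A i) = p ([u, v, u', v'] ! i) \<and> pathfinish (A i) = \<i> ^ Suc i \<and>
       path_image (A i) \<subseteq> insert (\<i> ^ Suc i) (ball 0 1) \<and>
       path_image (A i) \<inter> (p ` verts H \<union> (\<Union>e\<in>edges H. S e)) \<subseteq> {p ([u, v, u', v'] ! i)}"
    "\<And>i j. i < 4 \<Longrightarrow> j < 4 \<Longrightarrow> i \<noteq> j \<Longrightarrow> path_image (A i) \<inter> path_image (A j) = {}"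
proof -
  from assms obtain p \<gamma> c s1 s2 s3 s4 where G: "simple_graph H" "planar_drawing H p \<gamma>"
    and c: "simple_path c" "pathfinish c = pathstart c"
    and cD: "path_image c \<inter> drawing_points H p \<gamma> = p ` {u, u', v, v'}"
    and Din: "drawing_points H p \<gamma> \<subseteq> path_image c \<union> inside (path_image c)"
    and ss: "0 \<le> s1" "s1 < s2" "s2 < s3" "s3 < s4" "s4 < 1"
    and cs: "c s1 = p u" "c s2 = p v" "c s3 = p u'" "c s4 = p v'"
    unfolding crossover_gadget_def by metis
  define D where "D = drawing_points H p \<gamma>"
  define tm where "tm i = [u, v, u', v'] ! i" for i
  \<comment> \<open>The last entry closes the fourth stretch of the curve at the end of the
    parameter interval.\<close>
  define s where "s i = [s1, s2, s3, s4, 1] ! i" for i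
  have four: "i = 0 \<or> i = 1 \<or> i = 2 \<or> i = 3" if "i < 4" for i :: nat using that by linarith
  have sl: "s i < s (Suc i)" if "i < 4" for i
    using four[OF that] ss by (auto simp: s_def)
  have s04: "s 0 \<ge> 0" "s 4 \<le> 1" using ss by (simp_all add: s_def)
  have csi: "c (s i) = p (tm i)" if "i < 4" for i
    using four[OF that] by (elim disjE) (simp_all add: s_def tm_def cs)
  obtain w0 R A where R: "R > 0" and inb: "path_image c \<union> inside (path_image c) \<subseteq> ball w0 R"
    and A: "\<And>i. i < 4 \<Longrightarrow> arc (A i) \<and> pathstart (A i) = c (s i) \<and> dist w0 (pathfinish (A i)) = R \<and>
        path_image (A i) \<subseteq> insert (pathfinish (A i)) (ball w0 R) \<and>
        path_image (A i) \<subseteq> c ` {s i..<s (Suc i)} \<union> outside (path_image c)"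
    and AA: "\<And>i j. i < 4 \<Longrightarrow> j < 4 \<Longrightarrow> i \<noteq> j \<Longrightarrow> path_image (A i) \<inter> path_image (A j) = {}"
    and cross: "closed_segment (pathfinish (A 0)) (pathfinish (A 2)) \<inter> closed_segment (pathfinish (A 1)) (pathfinish (A 3)) \<noteq> {}"
  proof (rule disjoint_arcs_outside_Jordan[OF c sl s04])
    fix R w0 A
    assume *: "R > 0" "path_image c \<union> inside (path_image c) \<subseteq> ball w0 R"
      "\<And>i. i < 4 \<Longrightarrow> arc (A i) \<and> pathstart (A i) = c (s i) \<and> dist w0 (pathfinish (A i)) = R \<and>
        path_image (A i) \<subseteq> insert (pathfinish (A i)) (ball w0 R) \<and>
        path_image (A i) \<subseteq> c ` {s i..<s (Suc i)} \<union> outside (path_image c)"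
      "\<And>i j. i < 4 \<Longrightarrow> j < 4 \<Longrightarrow> i \<noteq> j \<Longrightarrow> path_image (A i) \<inter> path_image (A j) = {}"
      "closed_segment (pathfinish (A 0)) (pathfinish (A 2)) \<inter> closed_segment (pathfinish (A 1)) (pathfinish (A 3)) \<noteq> {}"
    show thesis by (rule that[OF *])
  qed
  have mono: "s i \<le> s j" if "i \<le> j" "j \<le> 4" for i j
    using that by (induction j rule: dec_induct) (use sl in \<open>auto simp: less_imp_le intro: order_trans\<close>)
  \<comment> \<open>A point of the drawing is not outside the curve, so on the arc it must lie on
    the stretch that begins at \<open>s i\<close>. There the drawing has only terminals, and the
    stretch contains just one of them.\<close>
  have Ac: "path_image (A i) \<inter> D \<subseteq> {p (tm i)}" if i: "i < 4" for i
  proof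
    fix x assume x: "x \<in> path_image (A i) \<inter> D"
    have "x \<notin> outside (path_image c)"
    proof (cases "x \<in> path_image c")
      case True then show ?thesis by (simp add: outside_def)
    next
      case False
      then have "x \<in> inside (path_image c)" using Din x unfolding D_def by auto
      then show ?thesis using inside_Int_outside by blast
    qed
    moreover have "path_image (A i) \<subseteq> c ` {s i..<s (Suc i)} \<union> outside (path_image c)" using A[OF i] by simp
    ultimately obtain y where y: "x = c y" "s i \<le> y" "y < s (Suc i)" using x by auto
    have y1: "0 \<le> y" "y < 1" using y mono[of 0 i] mono[of "Suc i" 4] s04 i by auto
    then have "x \<in> path_image c" using y(1) by (auto simp: path_image_def)
    then have "x \<in> p ` {u, u', v, v'}" using x cD unfolding D_def by auto
    then have "\<exists>j<4. x = p (tm j)"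
    proof -
      have t: "tm 0 = u" "tm 1 = v" "tm 2 = u'" "tm 3 = v'" by (simp_all add: tm_def)
      from \<open>x \<in> p ` {u, u', v, v'}\<close> consider "x = p u" | "x = p u'" | "x = p v" | "x = p v'" by blast
      then show ?thesis
      proof cases
        case 1 then show ?thesis using t(1) by (intro exI[of _ 0]) simp
      next
        case 2 then show ?thesis using t(3) by (intro exI[of _ 2]) simp
      next
        case 3 then show ?thesis using t(2) by (intro exI[of _ 1]) simp
      next
        case 4 then show ?thesis using t(4) by (intro exI[of _ 3]) simp
      qed
    qed
    then obtain j where j: "j < 4" "x = p (tm j)" by blast
    have sj: "0 \<le> s j" "s j < 1" using sl[OF j(1)] mono[of 0 j] mono[of "Suc j" 4] s04 j(1) by auto
    have "c y = c (s j)" using y(1) j csi by simp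
    then have "y = s j"
      using c(1) y1 sj unfolding simple_path_def loop_free_def
      by (metis atLeastAtMost_iff less_eq_real_def order_less_irrefl)
    then have "i = j"
    proof -
      have "\<not> i < j" using mono[of "Suc i" j] j(1) y(3) \<open>y = s j\<close> by auto
      moreover have "\<not> j < i" using mono[of "Suc j" i] sl[OF j(1)] i y(2) \<open>y = s j\<close> by auto
      ultimately show ?thesis by simp
    qed
    then show "x \<in> {p (tm i)}" using j by simp
  qed
  define E where "E i = pathfinish (A i)" for i
  define z where "z i = (E i - w0) / (2 * R)" for i
  have nz: "norm (z i) = 1 / 2" if "i < 4" for i
  proof -
    have "norm (E i - w0) = R" using A[OF that] by (simp add: E_def dist_norm norm_minus_commute)
    then show ?thesis using R by (simp add: z_def norm_divide norm_mult)
  qed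
  have Ene: "E i \<noteq> E j" if "i < 4" "j < 4" "i \<noteq> j" for i j
    using AA[OF that] pathfinish_in_path_image[of "A i"] pathfinish_in_path_image[of "A j"]
    by (metis E_def disjoint_iff)
  have zne: "z i \<noteq> z j" if "i < 4" "j < 4" "i \<noteq> j" for i j
    using Ene[OF that] R by (simp add: z_def)
  have zseg: "(x - w0) / (2 * R) \<in> closed_segment (z i) (z j)" if x: "x \<in> closed_segment (E i) (E j)" for x i j
  proof -
    obtain k where k: "0 \<le> k" "k \<le> 1" "x = (1 - k) *\<^sub>R E i + k *\<^sub>R E j" using x by (auto simp: in_segment)
    have "(x - w0) / (2 * R) = (1 - k) *\<^sub>R z i + k *\<^sub>R z j"
      using R by (simp add: z_def k(3) scaleR_conv_of_real field_simps)
    then show ?thesis using k(1,2) by (auto simp: in_segment)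
  qed
  obtain x where "x \<in> closed_segment (E 0) (E 2)" "x \<in> closed_segment (E 1) (E 3)" using cross unfolding E_def by blast
  then have zcross: "closed_segment (z 0) (z 2) \<inter> closed_segment (z 1) (z 3) \<noteq> {}" using zseg by blast
  obtain h \<theta> where h: "h = id \<or> h = cnj" "\<And>i. i < 4 \<Longrightarrow> h (z i) = of_real (1/2) * cis (\<theta> i)"
    and \<theta>: "\<theta> 0 < \<theta> 1" "\<theta> 1 < \<theta> 2" "\<theta> 2 < \<theta> 3" "\<theta> 3 < \<theta> (0::nat) + 2 * pi"
  proof (rule crossing_chords_cyclic_order[of z "1 / 2"])
    fix h and \<theta> :: "nat \<Rightarrow> real"
    assume *: "h = id \<or> h = cnj" "\<And>i. i < 4 \<Longrightarrow> h (z i) = of_real (1/2) * cis (\<theta> i)"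
      "\<theta> 0 < \<theta> 1" "\<theta> 1 < \<theta> 2" "\<theta> 2 < \<theta> 3" "\<theta> 3 < \<theta> 0 + 2 * pi"
    show thesis by (rule that[OF *])
  qed (use nz zne zcross in simp_all)
  obtain B where B: "\<And>i. i < 4 \<Longrightarrow> arc (B i) \<and> pathstart (B i) = h (z i) \<and> pathfinish (B i) = \<i> ^ Suc i \<and>
       path_image (B i) \<subseteq> insert (\<i> ^ Suc i) (ball 0 1) \<and> path_image (B i) \<inter> cball 0 (1/2) = {h (z i)}"
    and BB: "\<And>i j. i < 4 \<Longrightarrow> j < 4 \<Longrightarrow> i \<noteq> j \<Longrightarrow> path_image (B i) \<inter> path_image (B j) = {}"
  proof (rule arcs_to_compass_points[of "\<lambda>i. h (z i)" "1 / 2" \<theta>])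
    fix B
    assume *: "\<And>i. i < 4 \<Longrightarrow> arc (B i) \<and> pathstart (B i) = h (z i) \<and> pathfinish (B i) = \<i> ^ Suc i \<and>
       path_image (B i) \<subseteq> insert (\<i> ^ Suc i) (ball 0 1) \<and> path_image (B i) \<inter> cball 0 (1/2) = {h (z i)}"
      "\<And>i j. i < 4 \<Longrightarrow> j < 4 \<Longrightarrow> i \<noteq> j \<Longrightarrow> path_image (B i) \<inter> path_image (B j) = {}"
    show thesis by (rule that[OF *])
  qed (use h(2) \<theta> in simp_all)
  define T where "T x = h ((x - w0) / (2 * R))" for x
  have hinj: "h x = h y \<longleftrightarrow> x = y" for x y using h(1) by auto
  have Tinj: "inj T" using R by (auto simp: T_def inj_def hinj)
  have "continuous_on UNIV h" using h(1) by (auto intro: continuous_intros)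
  then have Tcont: "continuous_on UNIV T"
    unfolding T_def by (rule continuous_on_compose2) (use R in \<open>auto intro!: continuous_intros\<close>)
  have nh: "norm (h x) = norm x" for x using h(1) by auto
  have nT: "norm (T x) = dist w0 x / (2 * R)" for x
    using R by (simp add: T_def nh norm_divide norm_mult dist_norm norm_minus_commute)
  have Tball: "T ` ball w0 R \<subseteq> ball 0 (1/2)" using R by (auto simp: nT field_simps)
  have TE: "T (E i) = h (z i)" for i by (simp add: T_def z_def)
  define S where "S e = T ` path_image (\<gamma> e)" for e
  have SD: "set_drawing H (T \<circ> p) S"
    unfolding S_def by (rule set_drawing_inj_image[OF planar_drawing_imp_set_drawing[OF G(2,1)] Tinj Tcont])
  have TD: "(T \<circ> p) ` verts H \<union> (\<Union>e\<in>edges H. S e) = T ` D"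
    by (auto simp: D_def drawing_points_def S_def)
  have DB: "T ` D \<subseteq> ball 0 (1/2)" using Din inb Tball unfolding D_def by blast
  define A' where "A' i = (T \<circ> A i) +++ B i" for i
  have bi: "pathstart (B i) = h (z i)" "arc (B i)" "pathfinish (B i) = \<i> ^ Suc i"
     "path_image (B i) \<subseteq> insert (\<i> ^ Suc i) (ball 0 1)" "path_image (B i) \<inter> cball 0 (1/2) = {h (z i)}" if "i < 4" for i
    using B[OF that] by simp_all
  have ai: "arc (A i)" "pathstart (A i) = p (tm i)" "path_image (A i) \<subseteq> insert (E i) (ball w0 R)" if "i < 4" for i
    using A[OF that] csi[OF that] by (simp_all add: E_def)
  have TA: "path_image (T \<circ> A i) \<subseteq> insert (h (z i)) (ball 0 (1/2))" if "i < 4" for i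
    using image_mono[OF ai(3)[OF that], of T] Tball unfolding path_image_compose by (auto simp: TE)
  have hz: "norm (h (z i)) = 1 / 2" if "i < 4" for i using nh nz[OF that] by simp
  have imA: "path_image (A' i) = T ` path_image (A i) \<union> path_image (B i)" if "i < 4" for i
    unfolding A'_def using bi(1)[OF that] TE[of i] by (simp add: path_image_join pathfinish_compose path_image_compose E_def)
  have TAB: "path_image (T \<circ> A i) \<inter> path_image (B j) \<subseteq> {h (z j)}" if "i < 4" "j < 4" for i j
  proof -
    have "path_image (T \<circ> A i) \<subseteq> cball 0 (1/2)" using TA[OF that(1)] hz[OF that(1)] by auto
    then have "path_image (T \<circ> A i) \<inter> path_image (B j) \<subseteq> path_image (B j) \<inter> cball 0 (1/2)" by auto
    then show ?thesis unfolding bi(5)[OF that(2)] .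
  qed
  have AfB: "pathfinish (T \<circ> A i) = h (z i)" for i using TE[of i] by (simp add: pathfinish_compose E_def)
  show thesis
  proof (rule that[OF SD, of A'])
    show "(T \<circ> p) ` verts H \<union> (\<Union>e\<in>edges H. S e) \<subseteq> ball 0 1" unfolding TD using DB by auto
    fix i :: nat assume i: "i < 4"
    have "arc (T \<circ> A i)"
      using ai(1)[OF i] Tinj Tcont unfolding arc_def
      by (auto intro!: path_continuous_image comp_inj_on intro: continuous_on_subset inj_on_subset)
    then have "arc (A' i)"
      unfolding A'_def using bi[OF i] AfB TAB[OF i i] by (intro arc_join) simp_all
    moreover have "pathstart (A' i) = (T \<circ> p) (tm i)" using ai(2)[OF i] by (simp add: A'_def pathstart_compose)
    moreover have "pathfinish (A' i) = \<i> ^ Suc i" using bi(3)[OF i] by (simp add: A'_def)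
    moreover have "path_image (A' i) \<subseteq> insert (\<i> ^ Suc i) (ball 0 1)"
    proof -
      have "T ` path_image (A i) \<subseteq> ball 0 1"
        using TA[OF i] hz[OF i] unfolding path_image_compose by auto
      then show ?thesis unfolding imA[OF i] using bi(4)[OF i] by auto
    qed
    moreover have "path_image (A' i) \<inter> T ` D \<subseteq> {(T \<circ> p) (tm i)}"
    proof -
      have "path_image (B i) \<inter> T ` D \<subseteq> path_image (B i) \<inter> cball 0 (1/2) \<inter> ball 0 (1/2)"
        using DB ball_subset_cball[of "0::complex" "1/2"] by blast
      also have "\<dots> = {}" unfolding bi(5)[OF i] using hz[OF i] by simp
      finally have "path_image (B i) \<inter> T ` D = {}" by simp
      moreover have "T ` path_image (A i) \<inter> T ` D = T ` (path_image (A i) \<inter> D)" by (rule image_Int[OF Tinj, symmetric])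
      moreover have "T ` (path_image (A i) \<inter> D) \<subseteq> {(T \<circ> p) (tm i)}" using Ac[OF i] by auto
      ultimately show ?thesis unfolding imA[OF i] Int_Un_distrib2 by simp
    qed
    ultimately show "arc (A' i) \<and> pathstart (A' i) = (T \<circ> p) ([u, v, u', v'] ! i) \<and> pathfinish (A' i) = \<i> ^ Suc i \<and>
       path_image (A' i) \<subseteq> insert (\<i> ^ Suc i) (ball 0 1) \<and>
       path_image (A' i) \<inter> ((T \<circ> p) ` verts H \<union> (\<Union>e\<in>edges H. S e)) \<subseteq> {(T \<circ> p) ([u, v, u', v'] ! i)}"
      unfolding TD tm_def by simp
  next
    fix i j :: nat assume ij: "i < 4" "j < 4" "i \<noteq> j"
    have X: "T ` path_image (A i) \<inter> path_image (B j) = {}" if ij: "i < 4" "j < 4" "i \<noteq> j" for i j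
    proof -
      have "h (z j) \<notin> T ` path_image (A i)"
      proof
        assume "h (z j) \<in> T ` path_image (A i)"
        then have "T (E j) \<in> T ` path_image (A i)" by (simp add: TE)
        then have "E j \<in> path_image (A i)" using Tinj by (simp add: inj_image_mem_iff)
        moreover have "E j \<in> path_image (A j)" unfolding E_def by (rule pathfinish_in_path_image)
        ultimately show False using AA[OF ij] by auto
      qed
      then show ?thesis using TAB[OF ij(1,2)] unfolding path_image_compose by (metis Int_iff equals0I singletonD subsetD)
    qed
    have "T ` path_image (A i) \<inter> T ` path_image (A j) = {}"
      unfolding image_Int[OF Tinj, symmetric] AA[OF ij] by simp
    moreover note X[OF ij] BB[OF ij] X[of j i]
    ultimately show "path_image (A' i) \<inter> path_image (A' j) = {}"
      unfolding imA[OF ij(1)] imA[OF ij(2)] Int_Un_distrib Int_Un_distrib2 Un_empty using ij by (simp add: Int_commute)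
  qed
qed

section \<open>Replacing all crossings\<close>

text \<open>The edge count serves to show later, by counting alone, that the written edge list has
  no repetitions. The summand 2 is four attaching edges minus two removed edges.\<close>

lemma replacement_simple_card:
  assumes R: "replacement H u u' v v' G a b c d G'" and G: "simple_graph G" and H: "simple_graph H"
    and t: "{u, u', v, v'} \<subseteq> verts H" "distinct [u, u', v, v']"
  shows "simple_graph G'" "card (edges G') = card (edges G) + card (edges H) + 2"
proof -
  from R obtain \<phi> where e: "{a, b} \<in> edges G" "{c, d} \<in> edges G" "{a, b} \<inter> {c, d} = {}"
    and \<phi>: "inj_on \<phi> (verts H)" "\<phi> ` verts H \<inter> verts G = {}"
    and G': "G' = Graph (verts G \<union> \<phi> ` verts H)
               ((edges G - {{a, b}, {c, d}}) \<union> (\<lambda>e. \<phi> ` e) ` edges H \<union>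
                {{a, \<phi> u}, {\<phi> u', b}, {c, \<phi> v}, {\<phi> v', d}})"
    unfolding replacement_def by auto
  have abcd: "a \<in> verts G" "b \<in> verts G" "c \<in> verts G" "d \<in> verts G"
    using G e unfolding simple_graph_def by auto
  have new: "\<phi> x \<noteq> y" if "x \<in> verts H" "y \<in> verts G" for x y using \<phi>(2) that by auto
  have fin: "finite (verts G)" "finite (verts H)" using G H by (auto simp: simple_graph_def)
  have sub: "edges G \<subseteq> Pow (verts G)" "edges H \<subseteq> Pow (verts H)" using G H by (auto simp: simple_graph_def)
  have finE: "finite (edges G)" "finite (edges H)" using fin sub by (meson finite_Pow_iff finite_subset)+
  have cardH: "card (\<phi> ` e) = 2" if "e \<in> edges H" for e
    using H that \<phi>(1) by (metis card_image inj_on_subset simple_graph_def)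
  have four: "card {a, \<phi> u} = 2" "card {\<phi> u', b} = 2" "card {c, \<phi> v} = 2" "card {\<phi> v', d} = 2"
    using new abcd t by (auto simp: card_insert_if)
  show "simple_graph G'"
    unfolding simple_graph_def G' graph.sel
  proof (intro conjI ballI)
    fix x assume "x \<in> (edges G - {{a, b}, {c, d}}) \<union> (\<lambda>e. \<phi> ` e) ` edges H \<union>
                {{a, \<phi> u}, {\<phi> u', b}, {c, \<phi> v}, {\<phi> v', d}}"
    then consider "x \<in> edges G" | e where "e \<in> edges H" "x = \<phi> ` e" | "x \<in> {{a, \<phi> u}, {\<phi> u', b}, {c, \<phi> v}, {\<phi> v', d}}"
      by blast
    then have "x \<subseteq> verts G \<union> \<phi> ` verts H \<and> card x = 2"
    proof cases
      case 1
      then show ?thesis using G by (auto simp: simple_graph_def)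
    next
      case 2
      then show ?thesis using sub(2) cardH by auto
    next
      case 3
      then show ?thesis using abcd t four by auto
    qed
    then show "x \<subseteq> verts G \<union> \<phi> ` verts H" "card x = 2" by simp_all
  qed (use fin in auto)
  let ?A = "edges G - {{a, b}, {c, d}}" and ?B = "(\<lambda>e. \<phi> ` e) ` edges H"
    and ?C = "{{a, \<phi> u}, {\<phi> u', b}, {c, \<phi> v}, {\<phi> v', d}}"
  have ne: "{a, b} \<noteq> {c, d}" using e(3) by auto
  then have cA: "card ?A = card (edges G) - 2" "card (edges G) \<ge> 2"
  proof -
    show "card ?A = card (edges G) - 2"
      using e(1,2) ne finE(1) by (subst card_Diff_subset) (auto simp: card_insert_if)
    have "card {{a, b}, {c, d}} \<le> card (edges G)" using e(1,2) finE(1) by (intro card_mono) auto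
    then show "card (edges G) \<ge> 2" using ne by (simp add: card_insert_if)
  qed
  have "inj_on (\<lambda>e. \<phi> ` e) (edges H)"
    by (rule inj_on_subset[OF inj_on_image_Pow[OF \<phi>(1)] sub(2)])
  then have cB: "card ?B = card (edges H)" by (rule card_image)
  have ps: "{x, \<phi> y} \<noteq> {x', \<phi> y'}" if "x \<in> verts G" "x' \<in> verts G" "y \<in> verts H" "y' \<in> verts H" "y \<noteq> y'" for x x' y y'
    using that new \<phi>(1) by (metis doubleton_eq_iff inj_onD)
  have C: "?C = {{a, \<phi> u}, {b, \<phi> u'}, {c, \<phi> v}, {d, \<phi> v'}}" by (simp add: insert_commute)
  have cC: "card ?C = 4"
    unfolding C using ps abcd t by (simp add: card_insert_if)
  have BG: "x \<notin> Pow (verts G)" if x: "x \<in> ?B" for x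
  proof -
    obtain e where e: "e \<in> edges H" "x = \<phi> ` e" using x by blast
    then have "e \<noteq> {}" using H by (auto simp: simple_graph_def)
    then obtain y where "y \<in> e" by blast
    then have "\<phi> y \<in> x" "\<phi> y \<notin> verts G" using e sub(2) new by auto
    then show ?thesis by auto
  qed
  have AB: "?A \<inter> ?B = {}" using BG sub(1) by auto
  have AC: "?A \<inter> ?C = {}"
  proof -
    have "x \<notin> Pow (verts G)" if "x \<in> ?C" for x using that t new by auto
    then show ?thesis using sub(1) by (meson DiffD1 disjoint_iff subsetD)
  qed
  have BC: "?B \<inter> ?C = {}"
  proof -
    have "x \<inter> verts G \<noteq> {}" if "x \<in> ?C" for x using that abcd by auto
    moreover have "x \<inter> verts G = {}" if "x \<in> ?B" for x
    proof -
      from that obtain e where e: "e \<in> edges H" "x = \<phi> ` e" by blast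
      then have "x \<subseteq> \<phi> ` verts H" using sub(2) by auto
      then show ?thesis using \<phi>(2) by auto
    qed
    ultimately show ?thesis by (meson disjoint_iff)
  qed
  have "card (?A \<union> ?B \<union> ?C) = card ?A + card ?B + card ?C"
    using finE AB AC BC by (subst card_Un_disjoint; (subst card_Un_disjoint)?; auto)
  then show "card (edges G') = card (edges G) + card (edges H) + 2"
    unfolding G' graph.sel cA(1) cB cC using cA(2) by simp
qed

text \<open>
  In what follows vertices are identified with their positions \<open>1..n\<close>, and \<open>V\<close> names the vertex at a position.
  A pair \<open>((a, b), (c, d))\<close> stands for a crossing, so \<open>a < c < b < d\<close>.  The order \<open>xless\<close> visits the
  crossings along each edge from left to right: those in which it is the edge that ends later
  come first.
\<close>

fun xless :: "(nat \<times> nat) \<times> (nat \<times> nat) \<Rightarrow> (nat \<times> nat) \<times> (nat \<times> nat) \<Rightarrow> bool" where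
  "xless ((a, b), (c, d)) ((a', b'), (c', d')) \<longleftrightarrow>
     b < b' \<or> b = b' \<and> (a' < a \<or> a = a' \<and> (c < c' \<or> c = c' \<and> d' < d))"

text \<open>All old names are below \<open>B\<close>, so the names from \<open>B\<close> on are free
  for the copies. Taking \<open>{..<h}\<close> as vertex set of the gadget makes the name of a
  copied vertex a sum, and its place within a block is the vertex itself.\<close>

locale crossings =
  fixes n :: nat and V :: "nat \<Rightarrow> nat" and E :: "(nat \<times> nat) set" and B :: nat
    and xs :: "((nat \<times> nat) \<times> (nat \<times> nat)) list"
    and H :: "nat graph" and h iu iu' iv iv' :: nat
  assumes E: "\<And>a b. (a, b) \<in> E \<Longrightarrow> 1 \<le> a \<and> a < b \<and> b \<le> n"
    and V: "inj_on V {1..n}" "\<And>b. b \<in> {1..n} \<Longrightarrow> V b < B"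
    and xs: "set xs = {((a, b), (c, d)). (a, b) \<in> E \<and> (c, d) \<in> E \<and> a < c \<and> c < b \<and> b < d}"
    and sorted: "sorted_wrt xless xs"
    and H: "simple_graph H" "verts H = {..<h}"
    and ter: "iu < h" "iu' < h" "iv < h" "iv' < h" "distinct [iu, iu', iv, iv']"
begin

text \<open>
  Vertex \<open>x\<close> of the copy of \<open>H\<close> for crossing \<open>j\<close> is named \<open>nm j x\<close>; the crossing edges are \<open>fe j\<close>
  and \<open>fs j\<close>.  When crossing \<open>j\<close> is replaced, the remaining part of edge \<open>e\<close> starts at \<open>cur j e\<close>.
\<close>

definition "N = length xs"
definition "fe j = fst (xs ! j)"
definition "fs j = snd (xs ! j)"
definition "bet j = snd (fe j)"
definition "on e j \<longleftrightarrow> e = fe j \<or> e = fs j"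
definition "nm j x = B + j * h + x"

fun cur :: "nat \<Rightarrow> nat \<times> nat \<Rightarrow> nat" where
  "cur 0 e = V (fst e)"
| "cur (Suc j) e = (if e = fe j then nm j iu' else if e = fs j then nm j iv' else cur j e)"

definition "G0 = Graph (V ` {1..n}) ((\<lambda>(a, b). {V a, V b}) ` E)"
text \<open>A piece that ends at copy \<open>j\<close> is never changed again and is recorded here.
  The pieces that leave the copy are still to be cut, so they are recorded only in
  \<open>inc\<close> of a later crossing or in \<open>fin\<close>.\<close>

definition "inc j = {{cur j (fe j), nm j iu}, {cur j (fs j), nm j iv}}"
definition "hed j = (\<lambda>e. nm j ` e) ` edges H"
definition "fin j = (\<lambda>e. {cur j e, V (snd e)}) ` E"
definition "graph j = Graph (V ` {1..n} \<union> {B..<B + j * h}) (fin j \<union> (\<Union>i<j. inc i \<union> hed i))"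

lemma E': "e \<in> E \<Longrightarrow> 1 \<le> fst e \<and> fst e < snd e \<and> snd e \<le> n"
  using E by (cases e) auto

lemma crossing:
  assumes "j < N"
  shows "fe j \<in> E" "fs j \<in> E" "fst (fe j) < fst (fs j)" "fst (fs j) < bet j" "bet j < snd (fs j)" "fe j \<noteq> fs j"
proof -
  have "xs ! j \<in> set xs" using assms by (simp add: N_def)
  then show "fe j \<in> E" "fs j \<in> E" "fst (fe j) < fst (fs j)" "fst (fs j) < bet j" "bet j < snd (fs j)" "fe j \<noteq> fs j"
    unfolding xs fe_def fs_def bet_def by auto
qed

lemma V_ge: "b \<in> {1..n} \<Longrightarrow> B \<le> V b \<Longrightarrow> False"
  using V(2)[of b] by simp

lemma h_pos: "h > 0"
  using ter by simp

lemma nm_inject: "x < h \<Longrightarrow> y < h \<Longrightarrow> nm i x = nm j y \<longleftrightarrow> i = j \<and> x = y"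
proof -
  assume "x < h" "y < h"
  then have "(i * h + x) div h = i" "(j * h + y) div h = j" "(i * h + x) mod h = x" "(j * h + y) mod h = y"
    using h_pos by simp_all
  then show ?thesis unfolding nm_def by (metis add.assoc add_left_cancel)
qed

lemma nm_ge: "nm i x \<ge> B + i * h" "nm i x \<ge> B"
  by (simp_all add: nm_def)

lemma cur_cases:
  obtains "cur j e = V (fst e)" "\<And>i. i < j \<Longrightarrow> \<not> on e i"
  | k x where "k < j" "on e k" "\<And>i. k < i \<Longrightarrow> i < j \<Longrightarrow> \<not> on e i" "cur j e = nm k x"
      "x = (if e = fe k then iu' else iv')"
proof (induction j arbitrary: thesis)
  case 0
  then show ?case by simp
next
  case (Suc j)
  show ?case
  proof (cases "on e j")
    case True
    show ?thesis
      by (rule Suc.prems(2)[of j "if e = fe j then iu' else iv'"]) (use True in \<open>auto simp: on_def\<close>)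
  next
    case False
    then have c: "cur (Suc j) e = cur j e" by (auto simp: on_def)
    show ?thesis
    proof (rule Suc.IH)
      assume "cur j e = V (fst e)" "\<And>i. i < j \<Longrightarrow> \<not> on e i"
      then show thesis using False c by (intro Suc.prems(1)) (auto simp: less_Suc_eq)
    next
      fix k x assume "k < j" "on e k" "\<And>i. k < i \<Longrightarrow> i < j \<Longrightarrow> \<not> on e i" "cur j e = nm k x"
        "x = (if e = fe k then iu' else iv')"
      then show thesis using False c by (intro Suc.prems(2)[of k x]) (auto simp: less_Suc_eq)
    qed
  qed
qed

lemma ter_if: "(if P then iu' else iv') < h"
  using ter by simp

text \<open>Several edges may still start at one old vertex, hence the restriction to names from
  \<open>B\<close> on. A terminal of a copy is left by one edge only: \<open>iu'\<close> by
  \<open>fe\<close> and \<open>iv'\<close> by \<open>fs\<close>.\<close>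

lemma cur_inject:
  assumes "e \<in> E" "f \<in> E" "cur j e = cur j f" "j \<le> N" "B \<le> cur j e"
  shows "e = f"
proof (rule cur_cases[of j e])
  assume "cur j e = V (fst e)"
  then show ?thesis using V_ge[of "fst e"] E'[OF assms(1)] assms(5) by auto
next
  fix k x assume k: "k < j" "on e k" "cur j e = nm k x" "x = (if e = fe k then iu' else iv')"
  show ?thesis
  proof (rule cur_cases[of j f])
    assume "cur j f = V (fst f)"
    then show ?thesis using V_ge[of "fst f"] E'[OF assms(2)] assms(3,5) by auto
  next
    fix l y assume l: "l < j" "on f l" "cur j f = nm l y" "y = (if f = fe l then iu' else iv')"
    have "k = l" "x = y" using nm_inject[of x y k l] k l assms(3) ter_if by auto
    then show ?thesis using k(2,4) l(2,4) ter(5) by (auto simp: on_def split: if_splits)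
  qed
qed

lemma cur_ne_V:
  assumes "e \<in> E" "b \<in> {1..n}" "fst e \<noteq> b"
  shows "cur j e \<noteq> V b"
proof (rule cur_cases[of j e])
  assume "cur j e = V (fst e)"
  then show ?thesis using assms V(1) E'[OF assms(1)] by (auto dest: inj_onD)
next
  fix k x assume "cur j e = nm k x"
  then show ?thesis using V(2)[OF assms(2)] nm_ge(2)[of k x] by simp
qed

text \<open>Removing two last pieces must not delete an older edge. An older piece ends at a
  terminal \<open>iu\<close> or \<open>iv\<close>, whereas a last piece joins an old vertex to an
  old vertex or to a terminal \<open>iu'\<close> or \<open>iv'\<close>; edges of copies contain no
  old vertex.\<close>

lemma fin_not_inc_hed:
  assumes "e \<in> E" "j \<le> N"
  shows "{cur j e, V (snd e)} \<notin> (\<Union>i<j. inc i \<union> hed i)"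
proof
  have V: "V (snd e) < B" using E'[OF assms(1)] V(2) by auto
  assume "{cur j e, V (snd e)} \<in> (\<Union>i<j. inc i \<union> hed i)"
  then obtain i where i: "i < j" "{cur j e, V (snd e)} \<in> inc i \<or> {cur j e, V (snd e)} \<in> hed i" by auto
  from i(2) show False
  proof
    assume "{cur j e, V (snd e)} \<in> hed i"
    then obtain x where "V (snd e) = nm i x" by (auto simp: hed_def)
    then show False using V nm_ge(2)[of i x] by simp
  next
    assume "{cur j e, V (snd e)} \<in> inc i"
    then obtain x w where x: "x = iu \<or> x = iv" "{cur j e, V (snd e)} = {w, nm i x}" by (auto simp: inc_def)
    then have eq: "cur j e = nm i x" using V nm_ge(2)[of i x] by (metis doubleton_eq_iff leD)
    show False
    proof (rule cur_cases[of j e])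
      assume "cur j e = V (fst e)"
      then show False using eq nm_ge(2)[of i x] V_ge[of "fst e"] E'[OF assms(1)] by auto
    next
      fix k y assume "cur j e = nm k y" "y = (if e = fe k then iu' else iv')"
      then show False using eq nm_inject[of y x k i] x(1) ter by (auto split: if_splits)
    qed
  qed
qed

lemma fin_inject:
  assumes "e \<in> E" "f \<in> E" "j \<le> N" "{cur j e, V (snd e)} = {cur j f, V (snd f)}"
  shows "e = f"
proof (cases "B \<le> cur j e")
  case True
  have "V (snd f) < B" using E'[OF assms(2)] V(2) by auto
  then have "cur j e = cur j f" using assms(4) True by (metis doubleton_eq_iff leD)
  then show ?thesis using cur_inject[OF assms(1,2)] assms(3) True by simp
next
  case False
  have Vb: "V (snd e) < B" using E'[OF assms(1)] V(2) by auto
  have *: "cur j e = V (fst e)" if "\<not> B \<le> cur j e" for e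
    using cur_cases[of j e] that nm_ge(2) by metis
  have "cur j f \<in> {cur j e, V (snd e)}" using assms(4) by simp
  then have "\<not> B \<le> cur j f" using False Vb by auto
  then have "{V (fst e), V (snd e)} = {V (fst f), V (snd f)}" using *[OF False] *[of f] assms(4) by simp
  moreover have "V x = V y \<longleftrightarrow> x = y" if "x \<in> {1..n}" "y \<in> {1..n}" for x y
    using V(1) that by (auto dest: inj_onD)
  ultimately have "{fst e, snd e} = {fst f, snd f}"
    using E'[OF assms(1)] E'[OF assms(2)] by (auto simp: doubleton_eq_iff)
  then show ?thesis using E'[OF assms(1)] E'[OF assms(2)] by (auto simp: doubleton_eq_iff prod_eq_iff)
qed

lemma graph_0: "graph 0 = G0"
  by (simp add: graph_def G0_def fin_def case_prod_beta)

text \<open>Usefulness speaks about disjoint edges of the current graph; here they are the last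
  pieces of the two crossing edges. Their four ends differ because the positions interleave strictly
  and because a terminal of a copy starts one piece only.\<close>

lemma graph_Suc:
  assumes "j < N"
  shows "replacement H iu iu' iv iv' (graph j) (cur j (fe j)) (V (snd (fe j))) (cur j (fs j)) (V (snd (fs j))) (graph (Suc j))"
proof -
  note X = crossing[OF assms]
  have jN: "j \<le> N" using assms by simp
  define a b c d where "a = cur j (fe j)" "b = V (snd (fe j))" "c = cur j (fs j)" "d = V (snd (fs j))"
  note abcd = this
  have bd: "snd (fe j) \<in> {1..n}" "snd (fs j) \<in> {1..n}" using E'[OF X(1)] E'[OF X(2)] by auto
  have "{a, b} \<inter> {c, d} = {}"
  proof -
    have "a \<noteq> c"
    proof
      assume ac: "a = c"
      show False
      proof (cases "B \<le> a")
        case True then show False using cur_inject[OF X(1,2)] ac X(6) jN by (simp add: abcd)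
      next
        case False
        have "a = V (fst (fe j))" using cur_cases[of j "fe j"] False nm_ge(2) unfolding abcd by metis
        moreover have "fst (fe j) \<in> {1..n}" using E'[OF X(1)] by auto
        ultimately show False using cur_ne_V[OF X(2), of "fst (fe j)" j] ac X(3) by (simp add: abcd)
      qed
    qed
    moreover have "a \<noteq> d" unfolding abcd using E'[OF X(2)] X(3) by (intro cur_ne_V[OF X(1) bd(2)]) auto
    moreover have "c \<noteq> b" unfolding abcd using X(4) by (intro cur_ne_V[OF X(2) bd(1)]) (auto simp: bet_def)
    moreover have "b \<noteq> d" using inj_onD[OF V(1) _ bd] X(5) unfolding abcd bet_def by auto
    ultimately show ?thesis by auto
  qed
  moreover have in1: "{a, b} \<in> fin j" "{c, d} \<in> fin j" unfolding fin_def abcd using X(1,2) by blast+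
  moreover have "inj_on (nm j) (verts H)" by (rule inj_onI) (simp add: nm_def)
  moreover have im: "nm j ` verts H = {B + j * h..<B + Suc j * h}"
  proof -
    have "nm j ` {0..<h} = (+) (B + j * h) ` {0..<h}" by (auto simp: nm_def)
    then show ?thesis unfolding H(2) by (simp add: lessThan_atLeast0 add.commute add.left_commute)
  qed
  moreover have "nm j ` verts H \<inter> verts (graph j) = {}"
  proof -
    have "x \<notin> {B + j * h..<B + Suc j * h}" if "x \<in> V ` {1..n}" for x using V(2) that by fastforce
    then show ?thesis unfolding im graph_def graph.sel by auto
  qed
  moreover have "graph (Suc j) = Graph (verts (graph j) \<union> nm j ` verts H)
               ((edges (graph j) - {{a, b}, {c, d}}) \<union> (\<lambda>e. nm j ` e) ` edges H \<union>
                {{a, nm j iu}, {nm j iu', b}, {c, nm j iv}, {nm j iv', d}})"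
  proof (rule graph.expand, unfold graph.sel, intro conjI)
    show "verts (graph (Suc j)) = verts (graph j) \<union> nm j ` verts H"
      unfolding im unfolding graph_def graph.sel by (auto simp: Un_assoc ivl_disj_un)
    define rest where "rest = (\<lambda>e. {cur j e, V (snd e)}) ` (E - {fe j, fs j})"
    have f1: "fin (Suc j) = rest \<union> {{nm j iu', b}, {nm j iv', d}}"
    proof -
      have "E = (E - {fe j, fs j}) \<union> {fe j, fs j}" using X(1,2) by blast
      then have "fin (Suc j) = (\<lambda>e. {cur (Suc j) e, V (snd e)}) ` (E - {fe j, fs j}) \<union>
          (\<lambda>e. {cur (Suc j) e, V (snd e)}) ` {fe j, fs j}"
        unfolding fin_def by (metis image_Un)
      moreover have "(\<lambda>e. {cur (Suc j) e, V (snd e)}) ` (E - {fe j, fs j}) = rest"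
        unfolding rest_def by (rule image_cong) auto
      moreover have "(\<lambda>e. {cur (Suc j) e, V (snd e)}) ` {fe j, fs j} = {{nm j iu', b}, {nm j iv', d}}"
        using X(6) by (simp add: abcd)
      ultimately show ?thesis by (simp only:)
    qed
    have f0: "fin j - {{a, b}, {c, d}} = rest"
    proof -
      have "{cur j e, V (snd e)} \<in> {{a, b}, {c, d}} \<longleftrightarrow> e \<in> {fe j, fs j}" if "e \<in> E" for e
        using fin_inject[OF that X(1) jN] fin_inject[OF that X(2) jN] unfolding abcd by blast
      then have "{e \<in> E. {cur j e, V (snd e)} \<notin> {{a, b}, {c, d}}} = E - {fe j, fs j}" by blast
      moreover have "g ` E - S = g ` {e \<in> E. g e \<notin> S}" for g :: "nat \<times> nat \<Rightarrow> nat set" and S by blast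
      ultimately show ?thesis unfolding fin_def rest_def by simp
    qed
    define old where "old = (\<Union>i<j. inc i \<union> hed i)"
    have o: "old - {{a, b}, {c, d}} = old"
      using fin_not_inc_hed[OF X(1) jN] fin_not_inc_hed[OF X(2) jN] unfolding old_def abcd by blast
    have "edges (graph (Suc j)) = fin (Suc j) \<union> (old \<union> (inc j \<union> hed j))"
      unfolding graph_def graph.sel old_def by (auto simp: lessThan_Suc)
    also have "\<dots> = (rest \<union> old) \<union> hed j \<union> {{a, nm j iu}, {nm j iu', b}, {c, nm j iv}, {nm j iv', d}}"
      unfolding f1 inc_def by (auto simp: abcd)
    also have "rest \<union> old = edges (graph j) - {{a, b}, {c, d}}"
      unfolding graph_def graph.sel using f0 o unfolding old_def by blast
    finally show "edges (graph (Suc j)) = (edges (graph j) - {{a, b}, {c, d}}) \<union> (\<lambda>e. nm j ` e) ` edges H \<union>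
                {{a, nm j iu}, {nm j iu', b}, {c, nm j iv}, {nm j iv', d}}"
      unfolding hed_def .
  qed
  ultimately show ?thesis
    unfolding replacement_def abcd[symmetric] graph_def[of j] by (intro conjI exI[of _ "nm j"]) (auto simp: graph_def)
qed

lemma simple_G0: "simple_graph G0"
  unfolding simple_graph_def G0_def graph.sel
proof (intro conjI ballI)
  fix e assume "e \<in> (\<lambda>(a, b). {V a, V b}) ` E"
  then obtain a b where e: "(a, b) \<in> E" "e = {V a, V b}" by auto
  then have ab: "a \<in> {1..n}" "b \<in> {1..n}" "a \<noteq> b" using E[of a b] by auto
  then have "V a \<noteq> V b" using V(1) by (auto dest: inj_onD)
  then show "e \<subseteq> V ` {1..n}" "card e = 2" using e ab by auto
qed simp

lemma graph_simple_card:
  "j \<le> N \<Longrightarrow> simple_graph (graph j) \<and> card (edges (graph j)) = card E + j * (card (edges H) + 2)"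
proof (induction j)
  case 0
  have "inj_on (\<lambda>(a, b). {V a, V b}) E"
    using fin_inject[of _ _ 0] by (intro inj_onI) (auto simp: case_prod_beta)
  then show ?case using simple_G0 by (simp add: graph_0) (simp add: G0_def card_image)
next
  case (Suc j)
  have "j < N" using Suc.prems by simp
  from replacement_simple_card[OF graph_Suc[OF this] _ H(1)] Suc ter H(2) show ?case by auto
qed

lemma useful_iterate:
  assumes U: "\<And>G t a b c d G'. simple_graph G \<Longrightarrow> replacement H iu iu' iv iv' G a b c d G' \<Longrightarrow> ((G, t) \<in> P \<longleftrightarrow> (G', t + k) \<in> P)"
    and "j \<le> N"
  shows "(G0, t) \<in> P \<longleftrightarrow> (graph j, t + int j * k) \<in> P"
  using assms(2)
proof (induction j)
  case 0
  then show ?case by (simp add: graph_0)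
next
  case (Suc j)
  have j: "j < N" using Suc.prems by simp
  have "(graph j, t + int j * k) \<in> P \<longleftrightarrow> (graph (Suc j), t + int j * k + k) \<in> P"
    by (rule U[OF _ graph_Suc[OF j]]) (use graph_simple_card[of j] j in simp)
  moreover have "t + int j * k + k = t + int (Suc j) * k" by (simp add: algebra_simps)
  ultimately show ?case using Suc by simp
qed

end

section \<open>The layout of the resulting graph\<close>

lemma card_cut_le_layout_cutwidth:
  "1 \<le> i \<Longrightarrow> i < card (verts G) \<Longrightarrow> card (cut_edges G \<pi> i) \<le> layout_cutwidth G \<pi>"
  unfolding layout_cutwidth_def by (intro Max_ge) auto

lemma layout_cutwidth_le:
  "(\<And>i. 1 \<le> i \<Longrightarrow> i < card (verts G) \<Longrightarrow> card (cut_edges G \<pi> i) \<le> k) \<Longrightarrow> layout_cutwidth G \<pi> \<le> k"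
  unfolding layout_cutwidth_def by (subst Max_le_iff) auto

context crossings
begin

section \<open>Positions of the blocks and of the old vertices\<close>

lemma xless_nth: "i < j \<Longrightarrow> j < N \<Longrightarrow> xless (fe i, fs i) (fe j, fs j)"
  using sorted_wrt_nth_less[OF sorted, of i j] by (simp add: N_def fe_def fs_def)

lemma bet_mono: "i \<le> j \<Longrightarrow> j < N \<Longrightarrow> bet i \<le> bet j"
  using xless_nth[of i j] unfolding bet_def
  by (cases "i = j"; cases "fe i"; cases "fs i"; cases "fe j"; cases "fs j") auto

text \<open>Before block \<open>j\<close> there are \<open>j\<close> blocks of size \<open>h\<close>
  and \<open>bet j - 1\<close> old vertices, so this is its first position.\<close>

definition "start j = h * j + bet j"
definition "posV b = b + h * card {j. j < N \<and> bet j \<le> b}"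

lemma start_gap: "i < j \<Longrightarrow> j < N \<Longrightarrow> start i + h \<le> start j"
proof -
  assume ij: "i < j" "j < N"
  have "h * Suc i \<le> h * j" using ij(1) by (intro mult_le_mono2) simp
  then show ?thesis using bet_mono[of i j] ij by (simp add: start_def)
qed

lemma posV_mono: "b < b' \<Longrightarrow> posV b < posV b'"
proof -
  assume b: "b < b'"
  have "card {j. j < N \<and> bet j \<le> b} \<le> card {j. j < N \<and> bet j \<le> b'}"
    using b by (intro card_mono) auto
  then have "h * card {j. j < N \<and> bet j \<le> b} \<le> h * card {j. j < N \<and> bet j \<le> b'}"
    by (rule mult_le_mono2)
  then show ?thesis using b unfolding posV_def by linarith
qed

lemma posV_start: "b < bet j \<Longrightarrow> j < N \<Longrightarrow> posV b < start j"
proof -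
  assume b: "b < bet j" "j < N"
  have "{i. i < N \<and> bet i \<le> b} \<subseteq> {..<j}"
  proof
    fix i assume i: "i \<in> {i. i < N \<and> bet i \<le> b}"
    have "\<not> j \<le> i" using bet_mono[of j i] i b by auto
    then show "i \<in> {..<j}" by simp
  qed
  then have "card {i. i < N \<and> bet i \<le> b} \<le> j" using card_mono[of "{..<j}"] by fastforce
  then have "h * card {i. i < N \<and> bet i \<le> b} \<le> h * j" by (rule mult_le_mono2)
  then show ?thesis using b unfolding posV_def start_def by linarith
qed

lemma start_posV: "bet j \<le> b \<Longrightarrow> j < N \<Longrightarrow> start j + h \<le> posV b"
proof -
  assume b: "bet j \<le> b" "j < N"
  have "{..j} \<subseteq> {i. i < N \<and> bet i \<le> b}"
    using bet_mono[of _ j] b by (auto intro: order_trans)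
  then have "card {..j} \<le> card {i. i < N \<and> bet i \<le> b}" by (intro card_mono) auto
  then have "h * Suc j \<le> h * card {i. i < N \<and> bet i \<le> b}" by (intro mult_le_mono2) simp
  then show ?thesis using b by (simp add: posV_def start_def)
qed

lemma on_bet:
  assumes "on e j" "j < N"
  shows "e \<in> E" "fst e < bet j" "bet j \<le> snd e"
  using crossing[OF assms(2)] assms(1) by (auto simp: on_def bet_def)

text \<open>A piece is indexed by the crossing at which it ends, with \<open>N\<close> for the last
  piece. Its left end is \<open>cur j e\<close> in either case, which treats all pieces of an edge
  alike.\<close>

definition "piece j e \<longleftrightarrow> j < N \<and> on e j \<or> j = N \<and> e \<in> E"
definition "tip j e = (if j < N then (if e = fe j then nm j iu else nm j iv) else V (snd e))"

lemma edges_graph_N: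
  "edges (graph N) = {{cur j e, tip j e} |j e. piece j e} \<union> (\<Union>j<N. hed j)" (is "_ = ?R \<union> _")
proof -
  define g where "g j e = {cur j e, tip j e}" for j e
  have "inc j = g j ` {e. on e j}" if "j < N" for j
  proof -
    have "{e. on e j} = {fe j, fs j}" by (auto simp: on_def)
    then show ?thesis using that crossing(6)[OF that] by (auto simp: inc_def g_def tip_def)
  qed
  then have "(\<Union>j<N. inc j) = (\<Union>j<N. g j ` {e. on e j})" by simp
  moreover have "fin N = g N ` E" by (simp add: fin_def g_def tip_def)
  moreover have "?R = {g j e |j e. piece j e}" by (simp add: g_def)
  moreover have "{g j e |j e. piece j e} = g N ` E \<union> (\<Union>j<N. g j ` {e. on e j})"
    unfolding piece_def by blast
  moreover have "edges (graph N) = fin N \<union> (\<Union>j<N. inc j) \<union> (\<Union>j<N. hed j)"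
    unfolding graph_def graph.sel by blast
  ultimately show ?thesis by simp
qed

lemma inj_edge: "inj_on (\<lambda>(a, b). {V a, V b}) E"
  using fin_inject[of _ _ 0] by (intro inj_onI) (auto simp: case_prod_beta)

text \<open>The pieces of one edge follow each other in the layout and can overlap only within a
  block. Hence, apart from pieces that end in the block split by the cut, each edge has at most one
  piece over the cut, and it then spans the cut in the old layout as well. At most two pieces end in
  the split block, and the edges of its copy contribute a cut of \<open>H\<close>. The pieces that
  leave the block are already charged to their edges, so the count stays below the allowed
  4.\<close>

lemma layout_cutwidth_graph:
  assumes LV: "\<And>b. b \<in> {1..n} \<Longrightarrow> L (V b) = posV b"
    and Lnm: "\<And>j x. j < N \<Longrightarrow> x < h \<Longrightarrow> L (nm j x) = start j + x"
    and \<pi>: "\<And>b. b \<in> {1..n} \<Longrightarrow> \<pi> (V b) = b"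
  shows "layout_cutwidth (graph N) L \<le> layout_cutwidth G0 \<pi> + layout_cutwidth H Suc + 4"
proof (rule layout_cutwidth_le)
  fix c assume "1 \<le> c" "c < card (verts (graph N))"
  have piece_E: "e \<in> E" "j \<le> N" if "piece j e" for j e
    using that on_bet(1)[of e j] by (auto simp: piece_def)
  have curL: "L (V (fst e)) \<le> L (cur j e)" "L (cur j e) < L (tip j e)" if p: "piece j e" for j e
  proof -
    note e = E'[OF piece_E(1)[OF p]]
    have tip: "L (tip j e) = (if j < N then start j + (if e = fe j then iu else iv) else posV (snd e))"
      using LV[of "snd e"] Lnm[of j] ter e by (auto simp: tip_def)
    have bj: "fst e < bet j" if "j < N" using that p on_bet[of e j] by (auto simp: piece_def)
    have "L (V (fst e)) \<le> L (cur j e) \<and> L (cur j e) < L (tip j e)"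
    proof (rule cur_cases[of j e])
      assume c: "cur j e = V (fst e)"
      have "posV (fst e) < L (tip j e)"
        unfolding tip using posV_start[of "fst e" j] bj posV_mono[of "fst e" "snd e"] e by auto
      then show ?thesis unfolding c using LV[of "fst e"] e by auto
    next
      fix k x assume k: "k < j" "on e k" "cur j e = nm k x" "x = (if e = fe k then iu' else iv')"
      have kN: "k < N" using k(1) piece_E(2)[OF p] by simp
      have xh: "x < h" using k(4) ter_if by simp
      have "start k + x < L (tip j e)"
        unfolding tip using start_gap[of k j] start_posV[of k "snd e"] on_bet[OF k(2) kN] kN k(1) xh by auto
      moreover have "posV (fst e) < start k" using posV_start[OF on_bet(2)[OF k(2) kN] kN] .
      ultimately show ?thesis unfolding k(3) using Lnm[OF kN xh] LV[of "fst e"] e by auto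
    qed
    then show "L (V (fst e)) \<le> L (cur j e)" "L (cur j e) < L (tip j e)" by auto
  qed
  have tipL: "L (tip j e) \<le> L (V (snd e))" if p: "piece j e" for j e
  proof (cases "j < N")
    case True
    then have o: "on e j" using p by (auto simp: piece_def)
    have "L (tip j e) < start j + h" using True Lnm[OF True] ter by (auto simp: tip_def)
    also have "\<dots> \<le> posV (snd e)" using start_posV[OF on_bet(3)[OF o True] True] .
    finally show ?thesis using LV[of "snd e"] E'[OF piece_E(1)[OF p]] by auto
  qed (simp add: tip_def)
  have later: "start j \<le> L (cur j' e)" if p: "piece j e" "piece j' e" "j < j'" for j j' e
  proof (rule cur_cases[of j' e])
    have jN: "j < N" using p(3) piece_E(2)[OF p(2)] by simp
    then have o: "on e j" using p(1) by (auto simp: piece_def)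
    {
      assume "\<And>i. i < j' \<Longrightarrow> \<not> on e i"
      then show ?thesis using o p(3) by blast
    next
      fix k x assume k: "k < j'" "on e k" "\<And>i. k < i \<Longrightarrow> i < j' \<Longrightarrow> \<not> on e i" "cur j' e = nm k x"
        "x = (if e = fe k then iu' else iv')"
      have "j \<le> k" using k(3)[of j] o p(3) by (cases "k < j") auto
      moreover have "k < N" using k(1) piece_E(2)[OF p(2)] by simp
      ultimately have "start j \<le> start k" using start_gap[of j k] by (cases "j = k") auto
      then show ?thesis unfolding k(4) using Lnm[OF \<open>k < N\<close>, of x] k(5) ter_if by simp
    }
  qed
  \<comment> \<open>The block occupies the positions from \<open>start j\<close> to
    \<open>start j + (h - 1)\<close>; for \<open>c\<close> in this range the cut after position
    \<open>c\<close> separates two of them.\<close>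
  define split where "split j \<longleftrightarrow> j < N \<and> start j \<le> c \<and> c < start j + (h - 1)" for j
  have split_unique: "i = j" if "split i" "split j" for i j
    using that start_gap[of i j] start_gap[of j i] by (cases i j rule: linorder_cases) (auto simp: split_def)
  define Q where "Q = {(j, e). piece j e \<and> L (cur j e) \<le> c \<and> c < L (tip j e)}"
  define Q1 where "Q1 = {(j, e) \<in> Q. split j}"
  define Q2 where "Q2 = {(j, e) \<in> Q. \<not> split j}"
  define R where "R = {x \<in> \<Union>j<N. hed j. \<exists>u v. x = {u, v} \<and> L u \<le> c \<and> c < L v}"
  define Sp where "Sp = {e \<in> E. L (V (fst e)) \<le> c \<and> c < L (V (snd e))}"
  have "E \<subseteq> {1..n} \<times> {1..n}" using E' by force
  then have finE: "finite E" by (rule finite_subset) auto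
  have finQ: "finite Q"
    by (rule finite_subset[of _ "{..N} \<times> E"]) (use piece_E finE in \<open>auto simp: Q_def\<close>)
  have fin: "finite Q1" "finite Q2" using finQ by (auto simp: Q1_def Q2_def intro: finite_subset[rotated])
  have finH: "finite (edges H)"
    using H finite_subset[of "edges H" "Pow (verts H)"] by (auto simp: simple_graph_def)
  have finR: "finite R"
  proof -
    from finH show ?thesis unfolding R_def hed_def by (auto intro: finite_subset[rotated])
  qed
  have "cut_edges (graph N) L c \<subseteq> (\<lambda>(j, e). {cur j e, tip j e}) ` (Q1 \<union> Q2) \<union> R"
  proof
    fix x assume "x \<in> cut_edges (graph N) L c"
    then obtain u v where x: "x \<in> edges (graph N)" "x = {u, v}" "L u \<le> c" "c < L v"
      by (auto simp: cut_edges_def)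
    from x(1) consider j e where "x = {cur j e, tip j e}" "piece j e" | "x \<in> (\<Union>j<N. hed j)"
      unfolding edges_graph_N by blast
    then show "x \<in> (\<lambda>(j, e). {cur j e, tip j e}) ` (Q1 \<union> Q2) \<union> R"
    proof cases
      case 1
      then have "L (cur j e) \<le> c \<and> c < L (tip j e)"
        using x(2-4) curL(2)[OF 1(2)] by (auto simp: doubleton_eq_iff)
      then have "(j, e) \<in> Q1 \<union> Q2" using 1(2) by (auto simp: Q_def Q1_def Q2_def)
      then show ?thesis using 1(1) by force
    next
      case 2
      then show ?thesis using x by (auto simp: R_def)
    qed
  qed
  then have "card (cut_edges (graph N) L c) \<le> card ((\<lambda>(j, e). {cur j e, tip j e}) ` (Q1 \<union> Q2) \<union> R)"
    using fin finR by (intro card_mono) auto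
  also have "\<dots> \<le> card (Q1 \<union> Q2) + card R"
    by (rule order_trans[OF card_Un_le]) (use fin in \<open>simp add: card_image_le\<close>)
  also have "\<dots> \<le> card Q1 + card Q2 + card R" using card_Un_le[of Q1 Q2] by simp
  finally have main: "card (cut_edges (graph N) L c) \<le> card Q1 + card Q2 + card R" .
  have Q1: "card Q1 \<le> 2"
  proof (cases "\<exists>j. split j")
    case True
    then obtain J where J: "split J" by blast
    have "Q1 \<subseteq> {(J, fe J), (J, fs J)}"
    proof
      fix z assume z: "z \<in> Q1"
      obtain j e where je: "z = (j, e)" by (cases z)
      then have "split j" "piece j e" using z by (auto simp: Q1_def Q_def)
      then have "j = J" "on e j" using split_unique[OF _ J] by (auto simp: piece_def split_def)
      then show "z \<in> {(J, fe J), (J, fs J)}" using je by (auto simp: on_def)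
    qed
    then have "card Q1 \<le> card {(J, fe J), (J, fs J)}" by (rule card_mono[rotated]) simp
    also have "\<dots> \<le> 2" by (simp add: card_insert_if)
    finally show ?thesis .
  next
    case False
    then have "Q1 = {}" by (auto simp: Q1_def)
    then show ?thesis by simp
  qed
  have Q2: "card Q2 \<le> card Sp"
  proof (rule card_inj_on_le[of snd])
    show "inj_on snd Q2"
    proof (rule inj_onI)
      fix y z assume yz: "y \<in> Q2" "z \<in> Q2" "snd y = snd z"
      obtain j i e where je: "y = (j, e)" "z = (i, e)" using yz(3) by (cases y; cases z) auto
      \<comment> \<open>The later piece starts at \<open>start j\<close> or further right and the
        earlier one has its tip in block \<open>j\<close>. If both are over the cut, the cut splits
        block \<open>j\<close>.\<close>
      have "False" if "(j, e) \<in> Q2" "(i, e) \<in> Q2" "j < i" for i j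
      proof -
        have p: "piece j e" "piece i e" "c < L (tip j e)" "L (cur i e) \<le> c" "\<not> split j"
          using that by (auto simp: Q2_def Q_def)
        have jN: "j < N" using that(3) piece_E(2)[OF p(2)] by simp
        have "L (tip j e) \<le> start j + (h - 1)" using jN Lnm[OF jN] ter by (auto simp: tip_def)
        then show False using later[OF p(1,2) that(3)] p jN by (auto simp: split_def)
      qed
      then have "j = i" using yz(1,2) je by (cases i j rule: linorder_cases) blast+
      then show "y = z" using je by simp
    qed
    show "snd ` Q2 \<subseteq> Sp"
    proof
      fix e assume "e \<in> snd ` Q2"
      then obtain j where "piece j e" "L (cur j e) \<le> c" "c < L (tip j e)" by (auto simp: Q2_def Q_def)
      then show "e \<in> Sp" using curL(1)[of j e] tipL[of j e] piece_E(1)[of j e] by (auto simp: Sp_def)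
    qed
    show "finite Sp" using finE by (simp add: Sp_def)
  qed
  have Sp: "card Sp \<le> layout_cutwidth G0 \<pi>"
  proof (cases "Sp = {}")
    case False
    define M where "M = {b \<in> {1..n}. posV b \<le> c}"
    \<comment> \<open>All these edges cross the cut of the old layout that follows the last old
      vertex placed at a position up to \<open>c\<close>.\<close>
    define b0 where "b0 = Max M"
    have SpM: "fst e \<in> M \<and> snd e \<notin> M \<and> snd e \<in> {1..n}" if "e \<in> Sp" for e
      using that E'[of e] LV[of "fst e"] LV[of "snd e"] by (auto simp: Sp_def M_def)
    have finM: "finite M" by (simp add: M_def)
    obtain e0 where e0: "e0 \<in> Sp" using False by blast
    then have b0: "b0 \<in> M" unfolding b0_def using SpM[OF e0] finM by (intro Max_in) auto
    have cut: "fst e \<le> b0 \<and> b0 < snd e" if "e \<in> Sp" for e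
    proof -
      have "fst e \<le> b0" unfolding b0_def using SpM[OF that] finM by simp
      moreover have "\<not> snd e \<le> b0"
        using SpM[OF that] b0 posV_mono[of "snd e" b0] by (cases "snd e = b0") (auto simp: M_def)
      ultimately show ?thesis by simp
    qed
    have V_card: "card (verts G0) = n" unfolding G0_def graph.sel using V(1) by (simp add: card_image)
    have "card Sp = card ((\<lambda>(a, b). {V a, V b}) ` Sp)"
      by (rule card_image[symmetric], rule inj_on_subset[OF inj_edge]) (auto simp: Sp_def)
    also have "\<dots> \<le> card (cut_edges G0 \<pi> b0)"
    proof (rule card_mono)
      show "finite (cut_edges G0 \<pi> b0)" using finE by (simp add: cut_edges_def G0_def)
      show "(\<lambda>(a, b). {V a, V b}) ` Sp \<subseteq> cut_edges G0 \<pi> b0"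
      proof
        fix x assume "x \<in> (\<lambda>(a, b). {V a, V b}) ` Sp"
        then obtain a b where ab: "(a, b) \<in> Sp" "x = {V a, V b}" by auto
        then have "(a, b) \<in> E" by (simp add: Sp_def)
        moreover have "\<pi> (V a) = a" "\<pi> (V b) = b" using E[OF \<open>(a, b) \<in> E\<close>] \<pi> by auto
        ultimately show "x \<in> cut_edges G0 \<pi> b0"
          using cut[OF ab(1)] ab(2) unfolding cut_edges_def G0_def graph.sel
          by (intro CollectI conjI exI[of _ "V a"] exI[of _ "V b"]) auto
      qed
    qed
    also have "\<dots> \<le> layout_cutwidth G0 \<pi>"
    proof (rule card_cut_le_layout_cutwidth)
      show "1 \<le> b0" using b0 by (simp add: M_def)
      show "b0 < card (verts G0)" unfolding V_card using cut[OF e0] SpM[OF e0] by auto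
    qed
    finally show ?thesis .
  qed simp
  have R: "card R \<le> layout_cutwidth H Suc"
  proof -
    have Rj: "\<exists>j x y. split j \<and> {x, y} \<in> edges H \<and> e = nm j ` {x, y} \<and> start j + x \<le> c \<and> c < start j + y \<and> y < h"
      if eR: "e \<in> R" for e
    proof -
      obtain j f u v where e: "j < N" "f \<in> edges H" "e = nm j ` f" "e = {u, v}" "L u \<le> c" "c < L v"
        using eR unfolding R_def hed_def by blast
      have f: "f \<subseteq> {..<h}" using H e(2) by (auto simp: simple_graph_def)
      have "u \<in> nm j ` f" "v \<in> nm j ` f" using e(3,4) by auto
      then obtain x y where xy: "x \<in> f" "y \<in> f" "u = nm j x" "v = nm j y" by auto
      have lt: "x < h" "y < h" using f xy by auto
      then have L: "start j + x \<le> c" "c < start j + y" using e(5,6) xy Lnm[OF e(1)] by auto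
      then have "x \<noteq> y" by auto
      moreover have "card f = 2" using H e(2) by (auto simp: simple_graph_def)
      then obtain p q where "f = {p, q}" by (meson card_2_iff)
      ultimately have "f = {x, y}" using xy(1,2) by auto
      moreover have "split j" unfolding split_def using L lt e(1) by linarith
      ultimately show ?thesis using L lt(2) e(2,3) by metis
    qed
    show ?thesis
    proof (cases "\<exists>j. split j")
      case True
      then obtain J where J: "split J" by blast
      \<comment> \<open>Vertex \<open>x\<close> of the copy is at \<open>start J + x\<close> here
        and at \<open>Suc x\<close> in the layout \<open>Suc\<close> of \<open>H\<close>, hence the
        shift by 1.\<close>
      define k where "k = c - start J + 1"
      have "R \<subseteq> (\<lambda>e. nm J ` e) ` cut_edges H Suc k"
      proof
        fix e assume "e \<in> R"
        from Rj[OF this] obtain j x y where e: "split j" "{x, y} \<in> edges H" "e = nm j ` {x, y}" "start j + x \<le> c" "c < start j + y"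
          by (elim exE conjE) (rule that; assumption)
        have "j = J" using split_unique[OF e(1) J] .
        then have "{x, y} \<in> cut_edges H Suc k"
        proof -
          have "Suc x \<le> k" "k < Suc y" using e(4,5) J \<open>j = J\<close> by (auto simp: k_def split_def)
          then show ?thesis using e(2) unfolding cut_edges_def by blast
        qed
        then show "e \<in> (\<lambda>e. nm J ` e) ` cut_edges H Suc k" using e(3) \<open>j = J\<close> by blast
      qed
      moreover have "finite (cut_edges H Suc k)"
        using finH by (simp add: cut_edges_def)
      ultimately have "card R \<le> card (cut_edges H Suc k)" by (meson card_image_le card_mono finite_imageI order_trans)
      also have "\<dots> \<le> layout_cutwidth H Suc"
      proof (rule card_cut_le_layout_cutwidth)
        show "1 \<le> k" by (simp add: k_def)
        show "k < card (verts H)" using J unfolding H(2) k_def split_def card_lessThan by linarith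
      qed
      finally show ?thesis .
    next
      case False
      then have "R = {}" using Rj by blast
      then show ?thesis by simp
    qed
  qed
  show "card (cut_edges (graph N) L c) \<le> layout_cutwidth G0 \<pi> + layout_cutwidth H Suc + 4"
  proof -
    have "card Q1 + card Q2 + card R \<le> 2 + layout_cutwidth G0 \<pi> + layout_cutwidth H Suc"
      by (intro add_mono Q1 R order_trans[OF Q2 Sp])
    then show ?thesis using main by linarith
  qed
qed

end

section \<open>Rectilinear drawing of a laid out graph\<close>

text \<open>
  With \<open>K = 2n + 2\<close> vertex \<open>i\<close> is drawn at \<open>(Ki, -Ki)\<close>.  Edge \<open>(a, b)\<close> fans out from \<open>(Ka, -Ka)\<close>
  to \<open>(Ka + n + 1, -Ka + b)\<close>, continues horizontally to \<open>(Kb - a, -Ka + b)\<close> and vertically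
  to \<open>(Kb - a, -Kb + n + 1)\<close>, and fans in to \<open>(Kb, -Kb)\<close>.  The offsets \<open>b\<close> and \<open>a\<close> keep
  parallel segments of different edges apart.
\<close>

abbreviation gap :: "nat \<Rightarrow> real" where
  "gap n \<equiv> 2 * real n + 2"

definition fan1 :: "nat \<Rightarrow> nat \<times> nat \<Rightarrow> real \<Rightarrow> real \<Rightarrow> bool" where
  "fan1 n e x y \<longleftrightarrow> (\<exists>t::real. 0 \<le> t \<and> t \<le> 1 \<and> x = gap n * real (fst e) + (real n + 1) * t \<and> y = - (gap n * real (fst e)) + real (snd e) * t)"
definition horiz :: "nat \<Rightarrow> nat \<times> nat \<Rightarrow> real \<Rightarrow> real \<Rightarrow> bool" where
  "horiz n e x y \<longleftrightarrow> y = - (gap n * real (fst e)) + real (snd e) \<and>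
     gap n * real (fst e) + n + 1 \<le> x \<and> x \<le> gap n * real (snd e) - real (fst e)"
definition verti :: "nat \<Rightarrow> nat \<times> nat \<Rightarrow> real \<Rightarrow> real \<Rightarrow> bool" where
  "verti n e x y \<longleftrightarrow> x = gap n * real (snd e) - real (fst e) \<and>
     - (gap n * real (snd e)) + n + 1 \<le> y \<and> y \<le> - (gap n * real (fst e)) + real (snd e)"
definition fan2 :: "nat \<Rightarrow> nat \<times> nat \<Rightarrow> real \<Rightarrow> real \<Rightarrow> bool" where
  "fan2 n e x y \<longleftrightarrow> (\<exists>t::real. 0 \<le> t \<and> t \<le> 1 \<and> x = gap n * real (snd e) - real (fst e) * t \<and> y = - (gap n * real (snd e)) + (real n + 1) * t)"
definition loc :: "nat \<Rightarrow> nat \<times> nat \<Rightarrow> real \<Rightarrow> real \<Rightarrow> bool" where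
  "loc n e x y \<longleftrightarrow> fan1 n e x y \<or> horiz n e x y \<or> verti n e x y \<or> fan2 n e x y"

definition ok :: "nat \<Rightarrow> nat \<times> nat \<Rightarrow> bool" where
  "ok n e \<longleftrightarrow> 1 \<le> fst e \<and> fst e < snd e \<and> snd e \<le> n"

lemma gridK: "(i::nat) < j \<Longrightarrow> gap n * i + gap n \<le> gap n * j"
proof -
  assume "i < j"
  then have "real i + 1 \<le> real j" by linarith
  then have "gap n * (real i + 1) \<le> gap n * real j" by (intro mult_left_mono) auto
  then show ?thesis by (simp add: distrib_left)
qed

lemma grid_eq:
  fixes i j :: nat and r s :: real
  assumes "gap n * i + r = gap n * j + s" "\<bar>r - s\<bar> < 2 * real n + 2"
  shows "i = j"
  using gridK[of i j n] gridK[of j i n] assms by (cases i j rule: linorder_cases) (auto simp: abs_if split: if_splits)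

text \<open>The offsets of the fans from the grid value of their vertex lie in ranges such as
  \<open>-n\<close> to \<open>n + 1\<close>. The width \<open>2 * n + 2\<close> of the grid is
  chosen larger than the length of such a range, so a coordinate determines the vertex.\<close>

lemma grid_near:
  fixes i j :: nat and x :: real
  assumes "gap n * i + r1 \<le> x" "x \<le> gap n * i + r2"
    "gap n * j + s1 \<le> x" "x \<le> gap n * j + s2"
    "r2 - s1 < 2 * real n + 2" "s2 - r1 < 2 * real n + 2"
  shows "i = j"
  using gridK[of i j n] gridK[of j i n] assms by (cases i j rule: linorder_cases) linarith+

lemma fan1_bounds:
  assumes "fan1 n e x y" "ok n e"
  shows "gap n * real (fst e) + 0 \<le> x" "x \<le> gap n * real (fst e) + (real n + 1)"
    "gap n * real (fst e) + (- real n) \<le> - y" "- y \<le> gap n * real (fst e) + 0"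
proof -
  obtain t :: real where t: "0 \<le> t" "t \<le> 1" "x = gap n * real (fst e) + (real n + 1) * t" "y = - (gap n * real (fst e)) + real (snd e) * t"
    using assms(1) by (auto simp: fan1_def)
  have "real (snd e) * t \<le> real n * 1" using assms(2) t by (intro mult_mono) (auto simp: ok_def)
  moreover have "(real n + 1) * t \<le> (real n + 1) * 1" using t by (intro mult_left_mono) auto
  moreover have "0 \<le> real (snd e) * t" "0 \<le> (real n + 1) * t" using t by simp_all
  ultimately show "gap n * real (fst e) + 0 \<le> x" "x \<le> gap n * real (fst e) + (real n + 1)"
    "gap n * real (fst e) + (- real n) \<le> - y" "- y \<le> gap n * real (fst e) + 0"
    unfolding t(3,4) by simp_all
qed

lemma fan2_bounds:
  assumes "fan2 n e x y" "ok n e"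
  shows "gap n * real (snd e) + (- real n) \<le> x" "x \<le> gap n * real (snd e) + 0"
    "gap n * real (snd e) + (- (real n + 1)) \<le> - y" "- y \<le> gap n * real (snd e) + 0"
proof -
  obtain t :: real where t: "0 \<le> t" "t \<le> 1" "x = gap n * real (snd e) - real (fst e) * t" "y = - (gap n * real (snd e)) + (real n + 1) * t"
    using assms(1) by (auto simp: fan2_def)
  have "real (fst e) * t \<le> real n * 1" using assms(2) t by (intro mult_mono) (auto simp: ok_def)
  moreover have "(real n + 1) * t \<le> (real n + 1) * 1" using t by (intro mult_left_mono) auto
  moreover have "0 \<le> real (fst e) * t" "0 \<le> (real n + 1) * t" using t by simp_all
  moreover have "real n + 1 - (real n + 1) * t \<ge> 0" using calculation(2) by simp
  ultimately show "gap n * real (snd e) + (- real n) \<le> x" "x \<le> gap n * real (snd e) + 0"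
    "gap n * real (snd e) + (- (real n + 1)) \<le> - y" "- y \<le> gap n * real (snd e) + 0"
    unfolding t(3,4) by linarith+
qed

lemma real_ok:
  assumes "ok n e"
  shows "1 \<le> real (fst e)" "real (fst e) + 1 \<le> real (snd e)" "real (snd e) \<le> real n"
  using assms by (auto simp: ok_def)

definition vertex_at :: "nat \<Rightarrow> nat \<Rightarrow> real \<Rightarrow> real \<Rightarrow> bool" where
  "vertex_at n a x y \<longleftrightarrow> x = gap n * a \<and> y = - (gap n * a)"

text \<open>At a crossing the edge that ends first is always on its vertical part and the other one
  on its horizontal part. So all crossings look alike, and one way to insert the gadget
  suffices.\<close>

definition meets :: "nat \<Rightarrow> nat \<times> nat \<Rightarrow> nat \<times> nat \<Rightarrow> real \<Rightarrow> real \<Rightarrow> bool" where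
  "meets n e f x y \<longleftrightarrow> (\<exists>a. a \<in> {fst e, snd e} \<and> a \<in> {fst f, snd f} \<and> vertex_at n a x y) \<or>
     fst e < fst f \<and> fst f < snd e \<and> snd e < snd f \<and> verti n e x y \<and> horiz n f x y \<or>
     fst f < fst e \<and> fst e < snd f \<and> snd f < snd e \<and> verti n f x y \<and> horiz n e x y"

lemma meets_sym: "meets n e f x y \<Longrightarrow> meets n f e x y"
  unfolding meets_def by blast

section \<open>Which parts of two drawn edges can meet\<close>

lemma fan1_fan1:
  assumes "fan1 n e x y" "fan1 n f x y" "ok n e" "ok n f" "e \<noteq> f"
  shows "meets n e f x y"
proof -
  have eq: "fst e = fst f"
    by (rule grid_near[OF fan1_bounds(1,2)[OF assms(1,3)] fan1_bounds(1,2)[OF assms(2,4)]]) auto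
  obtain t :: real where t: "x = gap n * real (fst e) + (real n + 1) * t" "y = - (gap n * real (fst e)) + real (snd e) * t"
    using assms(1) by (auto simp: fan1_def)
  obtain s :: real where s: "x = gap n * real (fst f) + (real n + 1) * s" "y = - (gap n * real (fst f)) + real (snd f) * s"
    using assms(2) by (auto simp: fan1_def)
  have "t = s" using t(1) s(1) eq by simp
  have "real (snd e) * t = real (snd f) * t" using t(2) s(2) unfolding eq \<open>t = s\<close> by linarith
  moreover have "snd e \<noteq> snd f" using eq assms(5) by (auto simp: prod_eq_iff)
  ultimately have "t = 0" by (metis mult_cancel_right of_nat_eq_iff)
  then show ?thesis using t eq by (auto simp: meets_def vertex_at_def)
qed

lemma fan2_fan2:
  assumes "fan2 n e x y" "fan2 n f x y" "ok n e" "ok n f" "e \<noteq> f"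
  shows "meets n e f x y"
proof -
  have eq: "snd e = snd f"
    by (rule grid_near[OF fan2_bounds(1,2)[OF assms(1,3)] fan2_bounds(1,2)[OF assms(2,4)]]) auto
  obtain t :: real where t: "x = gap n * real (snd e) - real (fst e) * t" "y = - (gap n * real (snd e)) + (real n + 1) * t"
    using assms(1) by (auto simp: fan2_def)
  obtain s :: real where s: "x = gap n * real (snd f) - real (fst f) * s" "y = - (gap n * real (snd f)) + (real n + 1) * s"
    using assms(2) by (auto simp: fan2_def)
  have "t = s" using t(2) s(2) eq by simp
  have "real (fst e) * t = real (fst f) * t" using t(1) s(1) unfolding eq \<open>t = s\<close> by linarith
  moreover have "fst e \<noteq> fst f" using eq assms(5) by (auto simp: prod_eq_iff)
  ultimately have "t = 0" by (metis mult_cancel_right of_nat_eq_iff)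
  then show ?thesis using t eq by (auto simp: meets_def vertex_at_def)
qed

lemma fan1_fan2:
  assumes "fan1 n e x y" "fan2 n f x y" "ok n e" "ok n f"
  shows "meets n e f x y"
proof -
  have eq: "fst e = snd f"
    by (rule grid_near[OF fan1_bounds(1,2)[OF assms(1,3)] fan2_bounds(1,2)[OF assms(2,4)]]) auto
  obtain t :: real where t: "0 \<le> t" "x = gap n * real (fst e) + (real n + 1) * t" "y = - (gap n * real (fst e)) + real (snd e) * t"
    using assms(1) by (auto simp: fan1_def)
  have "x \<le> gap n * real (snd f)" using fan2_bounds(2)[OF assms(2,4)] by simp
  then have "(real n + 1) * t \<le> 0" using t(2) eq by simp
  then have "t = 0" using t(1) by (simp add: mult_le_0_iff)
  then show ?thesis using t eq by (auto simp: meets_def vertex_at_def)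
qed

lemma fan1_horiz:
  assumes "fan1 n e x y" "horiz n f x y" "ok n e" "ok n f" "e \<noteq> f"
  shows False
proof -
  have hy: "gap n * real (fst f) + (- real (snd f)) = - y" "gap n * real (fst f) + n + 1 \<le> x"
    using assms(2) by (simp_all add: horiz_def)
  have eq: "fst e = fst f"
    by (rule grid_near[OF fan1_bounds(3,4)[OF assms(1,3)], of "fst f" "- real (snd f)" "- real (snd f)"])
      (use hy real_ok[OF assms(4)] in auto)
  obtain t :: real where t: "t \<le> 1" "x = gap n * real (fst e) + (real n + 1) * t" "y = - (gap n * real (fst e)) + real (snd e) * t"
    using assms(1) by (auto simp: fan1_def)
  have "(real n + 1) * t \<ge> real n + 1" using hy(2) t(2) eq by simp
  then have "(real n + 1) * 1 \<le> (real n + 1) * t" by simp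
  then have "1 \<le> t" by (rule mult_left_le_imp_le) simp
  then have "t = 1" using t(1) by simp
  then have "snd e = snd f" using hy(1) t(3) eq by simp
  then show False using eq assms(5) by (simp add: prod_eq_iff)
qed

lemma fan1_verti:
  assumes "fan1 n e x y" "verti n f x y" "ok n e" "ok n f"
  shows False
proof -
  have "x = gap n * real (snd f) + (- real (fst f))" using assms(2) by (simp add: verti_def)
  note hx = this
  note b = fan1_bounds(1,2)[OF assms(1,3)]
  show False
    using gridK[of "fst e" "snd f" n] gridK[of "snd f" "fst e" n] hx b real_ok[OF assms(4)] real_ok[OF assms(3)]
    by (cases "fst e" "snd f" rule: linorder_cases) auto
qed

lemma fan2_horiz:
  assumes "fan2 n e x y" "horiz n f x y" "ok n e" "ok n f"
  shows False
proof -
  have hy: "gap n * real (fst f) + (- real (snd f)) = - y" "gap n * real (fst f) + n + 1 \<le> x"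
    using assms(2) by (simp_all add: horiz_def)
  have eq: "snd e = fst f"
    by (rule grid_near[OF fan2_bounds(3,4)[OF assms(1,3)], of "fst f" "- real (snd f)" "- real (snd f)"])
      (use hy real_ok[OF assms(4)] in auto)
  then show False using fan2_bounds(2)[OF assms(1,3)] hy(2) by simp
qed

lemma fan2_verti:
  assumes "fan2 n e x y" "verti n f x y" "ok n e" "ok n f" "e \<noteq> f"
  shows False
proof -
  have hx: "gap n * real (snd f) + (- real (fst f)) = x" "- (gap n * real (snd f)) + n + 1 \<le> y"
    using assms(2) by (simp_all add: verti_def)
  have eq: "snd e = snd f"
    by (rule grid_near[OF fan2_bounds(1,2)[OF assms(1,3)], of "snd f" "- real (fst f)" "- real (fst f)"])
      (use hx real_ok[OF assms(4)] in auto)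
  obtain t :: real where t: "t \<le> 1" "x = gap n * real (snd e) - real (fst e) * t" "y = - (gap n * real (snd e)) + (real n + 1) * t"
    using assms(1) by (auto simp: fan2_def)
  have "(real n + 1) * t \<ge> real n + 1" using hx(2) t(3) eq by simp
  then have "(real n + 1) * 1 \<le> (real n + 1) * t" by simp
  then have "1 \<le> t" by (rule mult_left_le_imp_le) simp
  then have "t = 1" using t(1) by simp
  then have "fst e = fst f" using hx(1) t(2) eq by simp
  then show False using eq assms(5) by (simp add: prod_eq_iff)
qed

lemma horiz_horiz:
  assumes "horiz n e x y" "horiz n f x y" "ok n e" "ok n f"
  shows "e = f"
proof -
  have y: "gap n * real (fst e) + (- real (snd e)) = gap n * real (fst f) + (- real (snd f))"
    using assms(1,2) by (simp add: horiz_def)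
  have "fst e = fst f" by (rule grid_eq[OF y]) (use real_ok[OF assms(3)] real_ok[OF assms(4)] in auto)
  then show ?thesis using y by (simp add: prod_eq_iff)
qed

lemma verti_verti:
  assumes "verti n e x y" "verti n f x y" "ok n e" "ok n f"
  shows "e = f"
proof -
  have y: "gap n * real (snd e) + (- real (fst e)) = gap n * real (snd f) + (- real (fst f))"
    using assms(1,2) by (simp add: verti_def)
  have "snd e = snd f" by (rule grid_eq[OF y]) (use real_ok[OF assms(3)] real_ok[OF assms(4)] in auto)
  then show ?thesis using y by (simp add: prod_eq_iff)
qed

text \<open>Compared in multiples of the grid width, the coordinates give
  \<open>fst e \<le> fst f\<close>, \<open>fst f < snd e\<close> and
  \<open>snd e \<le> snd f\<close>. If the left ends agreed, the offsets would force the right ends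
  to agree too, and conversely; both would make the edges equal.\<close>

lemma verti_horiz:
  assumes "verti n e x y" "horiz n f x y" "ok n e" "ok n f" "e \<noteq> f"
  shows "meets n e f x y"
proof -
  have v: "x = gap n * real (snd e) - real (fst e)" "- (gap n * real (snd e)) + n + 1 \<le> y" "y \<le> - (gap n * real (fst e)) + real (snd e)"
    using assms(1) by (simp_all add: verti_def)
  have h: "y = - (gap n * real (fst f)) + real (snd f)" "gap n * real (fst f) + n + 1 \<le> x" "x \<le> gap n * real (snd f) - real (fst f)"
    using assms(2) by (simp_all add: horiz_def)
  note r = real_ok[OF assms(3)] real_ok[OF assms(4)]
  have 1: "fst f < snd e"
  proof (rule ccontr)
    assume "\<not> fst f < snd e"
    then have "gap n * real (snd e) \<le> gap n * real (fst f)" by (intro mult_left_mono) auto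
    then show False using v(1) h(2) r by linarith
  qed
  have 2: "snd e \<le> snd f"
  proof (rule ccontr)
    assume "\<not> snd e \<le> snd f"
    then show False using gridK[of "snd f" "snd e" n] v(1) h(3) r by linarith
  qed
  have 3: "fst e \<le> fst f"
  proof (rule ccontr)
    assume "\<not> fst e \<le> fst f"
    then show False using gridK[of "fst f" "fst e" n] v(3) h(1) r by linarith
  qed
  have "fst e \<noteq> fst f"
  proof
    assume eq: "fst e = fst f"
    then have "real (snd f) \<le> snd e" using v(3) h(1) by simp
    then show False using 2 eq assms(5) by (simp add: prod_eq_iff)
  qed
  moreover have "snd e \<noteq> snd f"
  proof
    assume eq: "snd e = snd f"
    then have "real (fst f) \<le> fst e" using v(1) h(3) by simp
    then show False using 3 eq assms(5) by (simp add: prod_eq_iff)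
  qed
  ultimately show ?thesis unfolding meets_def using 1 2 3 assms(1,2) by simp
qed

lemma loc_meets:
  assumes "loc n e x y" "loc n f x y" "ok n e" "ok n f" "e \<noteq> f"
  shows "meets n e f x y"
proof -
  note ok = assms(3,4) and ne = assms(5) assms(5)[symmetric]
  from assms(1)[unfolded loc_def] assms(2)[unfolded loc_def] show ?thesis
    using fan1_fan1[of n e x y f, OF _ _ ok ne(1)] fan1_horiz[of n e x y f, OF _ _ ok ne(1)]
      fan1_verti[of n e x y f, OF _ _ ok] fan1_fan2[of n e x y f, OF _ _ ok]
      fan1_horiz[of n f x y e, OF _ _ ok(2,1) ne(2)] fan1_verti[of n f x y e, OF _ _ ok(2,1)]
      meets_sym[OF fan1_fan2[of n f x y e, OF _ _ ok(2,1)]]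
      horiz_horiz[of n e x y f, OF _ _ ok] verti_verti[of n e x y f, OF _ _ ok]
      verti_horiz[of n e x y f, OF _ _ ok ne(1)] meets_sym[OF verti_horiz[of n f x y e, OF _ _ ok(2,1) ne(2)]]
      fan2_horiz[of n e x y f, OF _ _ ok] fan2_horiz[of n f x y e, OF _ _ ok(2,1)]
      fan2_verti[of n e x y f, OF _ _ ok ne(1)] fan2_verti[of n f x y e, OF _ _ ok(2,1) ne(2)]
      fan2_fan2[of n e x y f, OF _ _ ok ne(1)] ne(1)
    by argo
qed

text \<open>Parallel straight parts are at distance at least 1 because their offsets are integers. A
  first fan misses the x coordinate of the crossing point, and a last fan would need equal grid
  values for \<open>snd e\<close> and \<open>fst f\<close>. This isolation leaves room for a disc
  around every crossing.\<close>

lemma near_crossing: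
  assumes g: "loc n g x y" "ok n g" and e: "ok n e" and f: "ok n f" and c: "fst f < snd e"
    and d: "\<bar>x - (gap n * real (snd e) - real (fst e))\<bar> < 1" "\<bar>y - (- (gap n * real (fst f)) + real (snd f))\<bar> < 1"
  shows "g = e \<and> x = gap n * real (snd e) - real (fst e) \<or> g = f \<and> y = - (gap n * real (fst f)) + real (snd f)"
proof -
  note r = real_ok[OF e] real_ok[OF f] real_ok[OF g(2)]
  from g(1)[unfolded loc_def] show ?thesis
  proof (elim disjE)
    assume "fan1 n g x y"
    note b = fan1_bounds[OF this g(2)]
    have False
      using gridK[of "fst g" "snd e" n] gridK[of "snd e" "fst g" n] b(1,2) d(1) r
      by (cases "fst g" "snd e" rule: linorder_cases) (auto simp: abs_less_iff)
    then show ?thesis ..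
  next
    assume "fan2 n g x y"
    note b = fan2_bounds[OF this g(2)]
    have "snd g = fst f"
      by (rule grid_near[OF b(3,4), of "fst f" "- real n - 1" "0"]) (use d(2) r in \<open>auto simp: abs_less_iff\<close>)
    moreover have "snd g = snd e"
      by (rule grid_near[OF b(1,2), of "snd e" "- real n - 1" "0"]) (use d(1) r in \<open>auto simp: abs_less_iff\<close>)
    ultimately show ?thesis using c by simp
  next
    assume "horiz n g x y"
    then have y: "- y = gap n * real (fst g) + (- real (snd g))" by (simp add: horiz_def)
    have "fst g = fst f"
      by (rule grid_near[of n "fst g" "- real (snd g)" "- y" "- real (snd g)" _ "- real (snd f) - 1" "- real (snd f) + 1"])
        (use y d(2) r in \<open>auto simp: abs_less_iff\<close>)
    moreover from this have "snd g = snd f" using y d(2) by auto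
    ultimately show ?thesis using y by (simp add: prod_eq_iff)
  next
    assume "verti n g x y"
    then have x: "x = gap n * real (snd g) + (- real (fst g))" by (simp add: verti_def)
    have "snd g = snd e"
      by (rule grid_near[of n "snd g" "- real (fst g)" x "- real (fst g)" _ "- real (fst e) - 1" "- real (fst e) + 1"])
        (use x d(1) r in \<open>auto simp: abs_less_iff\<close>)
    moreover from this have "fst g = fst e" using x d(1) by auto
    ultimately show ?thesis using x by (simp add: prod_eq_iff)
  qed
qed

lemma loc_vertex:
  assumes "loc n e x y" "ok n e" "vertex_at n a x y"
  shows "a = fst e \<or> a = snd e"
proof -
  note r = real_ok[OF assms(2)]
  have v: "gap n * a + 0 \<le> x" "x \<le> gap n * a + 0"
     "gap n * a + 0 \<le> - y" "- y \<le> gap n * a + 0"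
    using assms(3) by (simp_all add: vertex_at_def)
  from assms(1)[unfolded loc_def] show ?thesis
  proof (elim disjE)
    assume "fan1 n e x y"
    from grid_near[OF v(1,2) fan1_bounds(1,2)[OF this assms(2)]] show ?thesis by simp
  next
    assume "fan2 n e x y"
    from grid_near[OF v(1,2) fan2_bounds(1,2)[OF this assms(2)]] show ?thesis by simp
  next
    assume "horiz n e x y"
    then have "- y = gap n * real (fst e) + (- real (snd e))" by (simp add: horiz_def)
    from grid_near[OF v(3,4), of "fst e" "- real (snd e)" "- real (snd e)"] this r show ?thesis by simp
  next
    assume "verti n e x y"
    then have "x = gap n * real (snd e) + (- real (fst e))" by (simp add: verti_def)
    from grid_near[OF v(1,2), of "snd e" "- real (fst e)" "- real (fst e)"] this r show ?thesis by simp
  qed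
qed

lemma vertex_not_near_crossing:
  assumes e: "ok n e" and v: "vertex_at n a x y"
  shows "\<not> \<bar>x - (gap n * real (snd e) - real (fst e))\<bar> < 1"
proof
  assume d: "\<bar>x - (gap n * real (snd e) - real (fst e))\<bar> < 1"
  have "x = gap n * a" using v by (simp add: vertex_at_def)
  then show False
    using gridK[of a "snd e" n] gridK[of "snd e" a n] d real_ok[OF e]
    by (cases a "snd e" rule: linorder_cases) (auto simp: abs_less_iff)
qed

text \<open>The difference of the coordinates increases along an edge and serves as its parameter.\<close>

definition xcoord :: "nat \<Rightarrow> nat \<times> nat \<Rightarrow> real \<Rightarrow> real" where
  "xcoord n e s = (let K = 2 * real n + 2; a = real (fst e); b = real (snd e) in
     min (min (K * a + (real n + 1) * ((s - 2 * (K * a)) / (real n + 1 - b))) (s - K * a + b)) (K * b - a)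
     + max 0 (a * ((s - (2 * (K * b) - a - real n - 1)) / (a + real n + 1))))"

definition edge_curve :: "nat \<Rightarrow> nat \<times> nat \<Rightarrow> real \<Rightarrow> complex" where
  "edge_curve n e s = Complex (xcoord n e s) (xcoord n e s - s)"

lemma continuous_edge_curve: "continuous_on S (edge_curve n e)"
  unfolding edge_curve_def Complex_eq xcoord_def Let_def divide_inverse
  by (intro continuous_intros)

text \<open>Up to the last bend the x coordinate is a concave function of the parameter: its slope
  is \<open>(n + 1) / (n + 1 - b)\<close>, which exceeds 1, on the first fan, then 1 on the
  horizontal and 0 on the vertical part. So it is the minimum of three affine functions. The last
  fan has positive slope again, which the summand with \<open>max\<close> adds.\<close>

lemma edge_curve_parts:
  fixes s :: real
  assumes e: "ok n e"
  defines "K \<equiv> 2 * real n + 2" and "a \<equiv> real (fst e)" and "b \<equiv> real (snd e)"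
  shows "s \<le> 2 * (K * a) + real n + 1 - b \<Longrightarrow> xcoord n e s = K * a + (real n + 1) * ((s - 2 * (K * a)) / (real n + 1 - b))"
    and "2 * (K * a) + real n + 1 - b \<le> s \<Longrightarrow> s \<le> K * a + K * b - a - b \<Longrightarrow> xcoord n e s = s - K * a + b"
    and "K * a + K * b - a - b \<le> s \<Longrightarrow> s \<le> 2 * (K * b) - a - real n - 1 \<Longrightarrow> xcoord n e s = K * b - a"
    and "2 * (K * b) - a - real n - 1 \<le> s \<Longrightarrow> xcoord n e s = K * b - a + a * ((s - (2 * (K * b) - a - real n - 1)) / (a + real n + 1))"
proof -
  have r: "1 \<le> a" "a + 1 \<le> b" "b \<le> n" using real_ok[OF e] by (simp_all add: a_def b_def)
  have g: "K * a + K \<le> K * b" using gridK[of "fst e" "snd e" n] e by (simp add: ok_def K_def a_def b_def)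
  define t where "t = (s - 2 * (K * a)) / (real n + 1 - b)"
  define w where "w = (s - (2 * (K * b) - a - real n - 1)) / (a + real n + 1)"
  have nb: "real n + 1 - b > 0" using r by linarith
  have s: "s = 2 * (K * a) + (real n + 1 - b) * t" using nb by (simp add: t_def)
  have s': "s = 2 * (K * b) - a - real n - 1 + (a + real n + 1) * w" using r by (simp add: w_def)
  have x: "xcoord n e s = min (min (K * a + (real n + 1) * t) (s - K * a + b)) (K * b - a) + max 0 (a * w)"
    unfolding xcoord_def Let_def t_def w_def K_def a_def b_def by simp
  have L12: "(s - K * a + b) - (K * a + (real n + 1) * t) = b * (1 - t)" unfolding s by (simp add: algebra_simps)
  have Kn: "K = 2 * real n + 2" by (simp add: K_def)
  have t1: "t \<le> 1 \<longleftrightarrow> s \<le> 2 * (K * a) + real n + 1 - b" "1 \<le> t \<longleftrightarrow> 2 * (K * a) + real n + 1 - b \<le> s"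
    using nb by (auto simp: t_def field_simps)
  have w0: "w \<le> 0 \<longleftrightarrow> s \<le> 2 * (K * b) - a - real n - 1" "0 \<le> w \<longleftrightarrow> 2 * (K * b) - a - real n - 1 \<le> s"
    using r by (auto simp: w_def divide_le_0_iff zero_le_divide_iff)
  have m0: "max 0 (a * w) = 0" if "s \<le> 2 * (K * b) - a - real n - 1"
  proof -
    have "w \<le> 0" using w0(1) that by simp
    then have "a * w \<le> 0" using r(1) by (intro mult_nonneg_nonpos) auto
    then show ?thesis by simp
  qed
  have m1: "max 0 (a * w) = a * w" if "2 * (K * b) - a - real n - 1 \<le> s"
  proof -
    have "0 \<le> w" using w0(2) that by simp
    then have "0 \<le> a * w" using r(1) by (intro mult_nonneg_nonneg) auto
    then show ?thesis by simp
  qed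
  have bt: "b * (1 - t) \<ge> 0" if "t \<le> 1" using that r by simp
  have bt': "b * (1 - t) \<le> 0" if "1 \<le> t" using that r by (simp add: mult_nonneg_nonpos)
  show "xcoord n e s = K * a + (real n + 1) * ((s - 2 * (K * a)) / (real n + 1 - b))" if "s \<le> 2 * (K * a) + real n + 1 - b"
  proof -
    have "t \<le> 1" using t1(1) that by simp
    then have "(real n + 1) * t \<le> real n + 1" using mult_left_mono[of t 1 "real n + 1"] by simp
    moreover have "real n + 1 \<le> K - a" using r Kn by linarith
    ultimately have "K * a + (real n + 1) * t \<le> K * b - a" using g by linarith
    moreover have "K * a + (real n + 1) * t \<le> s - K * a + b" using L12 bt[OF \<open>t \<le> 1\<close>] by linarith
    moreover have "s \<le> 2 * (K * b) - a - real n - 1" using that g r Kn by linarith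
    ultimately show ?thesis unfolding x t_def[symmetric] using m0 by (simp add: min_def)
  qed
  show "xcoord n e s = s - K * a + b" if "2 * (K * a) + real n + 1 - b \<le> s" "s \<le> K * a + K * b - a - b"
  proof -
    have "s - K * a + b \<le> K * a + (real n + 1) * t" using L12 bt' t1(2) that by simp
    moreover have "s \<le> 2 * (K * b) - a - real n - 1" using that g r Kn by linarith
    moreover have "s - K * a + b \<le> K * b - a" using that by linarith
    ultimately show ?thesis unfolding x using m0 by (simp add: min_def)
  qed
  have big: "K * b - a \<le> s - K * a + b \<and> K * b - a \<le> K * a + (real n + 1) * t" if "K * a + K * b - a - b \<le> s"
  proof -
    have "1 \<le> t" unfolding t1(2) using that g r Kn by linarith
    then show ?thesis using L12 bt' that by force
  qed
  show "xcoord n e s = K * b - a" if "K * a + K * b - a - b \<le> s" "s \<le> 2 * (K * b) - a - real n - 1"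
    unfolding x using big[OF that(1)] m0[OF that(2)] by (simp add: min_def)
  show "xcoord n e s = K * b - a + a * ((s - (2 * (K * b) - a - real n - 1)) / (a + real n + 1))" if "2 * (K * b) - a - real n - 1 \<le> s"
  proof -
    have "K * a + K * b - a - b \<le> s" using that g r Kn by linarith
    then show ?thesis unfolding x using big m1[OF that] by (simp add: min_def w_def)
  qed
qed

lemma edge_curve_loc:
  assumes e: "ok n e" and s: "2 * (gap n * fst e) \<le> s" "s \<le> 2 * (gap n * snd e)"
  shows "loc n e (Re (edge_curve n e s)) (Im (edge_curve n e s))"
proof -
  define K a b where "K = 2 * real n + 2" "a = real (fst e)" "b = real (snd e)"
  note d = this
  note p = edge_curve_parts[OF e, folded d]
  have r: "1 \<le> a" "a + 1 \<le> b" "b \<le> n" using real_ok[OF e] by (simp_all add: d)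
  have g: "K * a + K \<le> K * b" using gridK[of "fst e" "snd e" n] e by (simp add: ok_def d)
  have Kn: "K = 2 * real n + 2" by (simp add: d)
  consider "s \<le> 2 * (K * a) + real n + 1 - b" | "2 * (K * a) + real n + 1 - b \<le> s" "s \<le> K * a + K * b - a - b"
    | "K * a + K * b - a - b \<le> s" "s \<le> 2 * (K * b) - a - real n - 1" | "2 * (K * b) - a - real n - 1 \<le> s"
    by linarith
  then show ?thesis
  proof cases
    case 1
    define t where "t = (s - 2 * (K * a)) / (real n + 1 - b)"
    have nb: "real n + 1 - b > 0" using r by linarith
    have st: "s = 2 * (K * a) + (real n + 1 - b) * t" using nb by (simp add: t_def)
    have "0 \<le> t" "t \<le> 1" using s(1) 1 nb unfolding d[symmetric] by (auto simp: t_def field_simps)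
    moreover define X where "X = xcoord n e s"
    moreover have x: "X = K * a + (real n + 1) * t" using p(1)[OF 1] by (simp add: t_def X_def)
    moreover have "X - s = - (K * a) + b * t" using x st by (simp add: algebra_simps)
    ultimately have "fan1 n e X (X - s)"
      unfolding fan1_def d[symmetric] by (intro exI[of _ t]) auto
    then show ?thesis by (simp add: loc_def edge_curve_def X_def)
  next
    case 2
    have "horiz n e (xcoord n e s) (xcoord n e s - s)"
      unfolding p(2)[OF 2] horiz_def d[symmetric] using 2 r by auto
    then show ?thesis by (simp add: loc_def edge_curve_def)
  next
    case 3
    have "verti n e (xcoord n e s) (xcoord n e s - s)"
      unfolding p(3)[OF 3] verti_def d[symmetric] using 3 r by auto
    then show ?thesis by (simp add: loc_def edge_curve_def)
  next
    case 4
    define w where "w = (s - (2 * (K * b) - a - real n - 1)) / (a + real n + 1)"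
    have sw: "s = 2 * (K * b) - a - real n - 1 + (a + real n + 1) * w" using r by (simp add: w_def)
    have "0 \<le> w" "w \<le> 1" using s(2) 4 r unfolding d[symmetric] by (auto simp: w_def field_simps)
    moreover define X where "X = xcoord n e s"
    moreover have x: "X = K * b - a + a * w" using p(4)[OF 4] by (simp add: w_def X_def)
    moreover have "X - s = - (K * b) + (real n + 1) * (1 - w)" using x sw by (simp add: algebra_simps)
    moreover have "X = K * b - a * (1 - w)" using x by (simp add: algebra_simps)
    ultimately have "fan2 n e X (X - s)"
      unfolding fan2_def d[symmetric] by (intro exI[of _ "1 - w"]) auto
    then show ?thesis by (simp add: loc_def edge_curve_def X_def)
  qed
qed

lemma edge_curve_ends:
  assumes "ok n e"
  shows "edge_curve n e (2 * (gap n * fst e)) = Complex (gap n * fst e) (- (gap n * fst e))"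
    "edge_curve n e (2 * (gap n * snd e)) = Complex (gap n * snd e) (- (gap n * snd e))"
proof -
  have "real (fst e) + real n + 1 \<noteq> 0" by linarith
  then have D: "(x - (x - real (fst e) - real n - 1)) / (real (fst e) + real n + 1) = 1" for x
    by (simp add: divide_eq_1_iff)
  have "xcoord n e (2 * (gap n * snd e)) = gap n * snd e"
    using edge_curve_parts(4)[OF assms, of "2 * (gap n * snd e)", unfolded D] by simp
  then show "edge_curve n e (2 * (gap n * snd e)) = Complex (gap n * snd e) (- (gap n * snd e))"
    by (simp add: edge_curve_def)
  show "edge_curve n e (2 * (gap n * fst e)) = Complex (gap n * fst e) (- (gap n * fst e))"
    using edge_curve_parts(1)[OF assms, of "2 * (gap n * fst e)"] real_ok[OF assms]
    by (simp add: edge_curve_def)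
qed

lemma edge_curve_diff: "Re (edge_curve n e s) - Im (edge_curve n e s) = s"
  by (simp add: edge_curve_def)

definition cross_point :: "nat \<Rightarrow> nat \<times> nat \<Rightarrow> nat \<times> nat \<Rightarrow> complex" where
  "cross_point n e f = Complex (gap n * snd e - fst e) (- (gap n * fst f) + snd f)"

definition cross_par :: "nat \<Rightarrow> nat \<times> nat \<Rightarrow> nat \<times> nat \<Rightarrow> real" where
  "cross_par n e f = gap n * snd e + gap n * fst f - fst e - snd f"

text \<open>Near a crossing the parameter is arc length: the edge that ends first runs straight
  down, the other one straight to the right. Hence they enter a disc about the crossing at the top
  and the left and leave it at the bottom and the right.\<close>

lemma edge_curve_at_crossing:
  assumes e: "ok n e" and f: "ok n f" and c: "fst e < fst f" "fst f < snd e" "snd e < snd f"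
    and s: "\<bar>s - cross_par n e f\<bar> \<le> 1"
  shows "edge_curve n e s = cross_point n e f + \<i> * of_real (cross_par n e f - s)"
    "edge_curve n f s = cross_point n e f + of_real (s - cross_par n e f)"
    "2 * (gap n * fst e) < s" "s < 2 * (gap n * snd e)"
    "2 * (gap n * fst f) < s" "s < 2 * (gap n * snd f)"
proof -
  note g = gridK[OF c(1), of n] gridK[OF c(2), of n] gridK[OF c(3), of n]
  note r = real_ok[OF e] real_ok[OF f]
  have "real (fst e) + 1 \<le> real (fst f)" "real (fst f) + 1 \<le> real (snd e)" "real (snd e) + 1 \<le> real (snd f)" using c by auto
  note r = r this
  have s': "cross_par n e f - 1 \<le> s" "s \<le> cross_par n e f + 1" using s by auto
  have "xcoord n e s = gap n * snd e - fst e"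
    by (rule edge_curve_parts(3)[OF e]) (use s' r g in \<open>auto simp: cross_par_def\<close>)
  then show "edge_curve n e s = cross_point n e f + \<i> * of_real (cross_par n e f - s)"
    by (simp add: edge_curve_def cross_point_def cross_par_def complex_eq_iff)
  have "xcoord n f s = s - gap n * fst f + snd f"
    by (rule edge_curve_parts(2)[OF f]) (use s' r g in \<open>auto simp: cross_par_def\<close>)
  then show "edge_curve n f s = cross_point n e f + of_real (s - cross_par n e f)"
    by (simp add: edge_curve_def cross_point_def cross_par_def complex_eq_iff)
  show "2 * (gap n * fst e) < s" "s < 2 * (gap n * snd e)"
    "2 * (gap n * fst f) < s" "s < 2 * (gap n * snd f)"
    using s' r g unfolding cross_par_def by linarith+
qed

lemma edge_curve_near_crossing:
  assumes e: "ok n e" and f: "ok n f" and c: "fst f < snd e"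
    and g: "ok n g" "2 * (gap n * fst g) \<le> s" "s \<le> 2 * (gap n * snd g)"
    and d: "dist (cross_point n e f) (edge_curve n g s) < 1"
  shows "(g = e \<or> g = f) \<and> dist (cross_point n e f) (edge_curve n g s) = \<bar>s - cross_par n e f\<bar>"
proof -
  define z where "z = edge_curve n g s"
  have "\<bar>Re z - Re (cross_point n e f)\<bar> < 1" "\<bar>Im z - Im (cross_point n e f)\<bar> < 1"
    using d abs_Re_le_cmod[of "z - cross_point n e f"] abs_Im_le_cmod[of "z - cross_point n e f"]
    by (simp_all add: z_def dist_norm norm_minus_commute)
  from near_crossing[OF edge_curve_loc[OF g, folded z_def] g(1) e f c, of] this
  have *: "g = e \<and> Re z = Re (cross_point n e f) \<or> g = f \<and> Im z = Im (cross_point n e f)"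
    by (simp add: cross_point_def)
  have zs: "Re z - Im z = s" by (simp add: z_def edge_curve_diff)
  have cs: "Re (cross_point n e f) - Im (cross_point n e f) = cross_par n e f"
    by (simp add: cross_point_def cross_par_def)
  from * show ?thesis unfolding z_def[symmetric]
  proof
    assume A: "g = e \<and> Re z = Re (cross_point n e f)"
    then have "z - cross_point n e f = Complex 0 (cross_par n e f - s)"
      using zs cs by (simp add: complex_eq_iff)
    then show "(g = e \<or> g = f) \<and> dist (cross_point n e f) z = \<bar>s - cross_par n e f\<bar>"
      using A dist_commute[of z "cross_point n e f"] by (simp add: dist_norm cmod_def abs_minus_commute)
  next
    assume A: "g = f \<and> Im z = Im (cross_point n e f)"
    then have "z - cross_point n e f = Complex (s - cross_par n e f) 0"
      using zs cs by (simp add: complex_eq_iff)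
    then show "(g = e \<or> g = f) \<and> dist (cross_point n e f) z = \<bar>s - cross_par n e f\<bar>"
      using A dist_commute[of z "cross_point n e f"] by (simp add: dist_norm cmod_def abs_minus_commute)
  qed
qed

text \<open>The drawn curves belong to pieces and to pairs of a copy and an edge of
  \<open>H\<close>. Choosing one label for every edge avoids a separate proof that different labels
  name different edges.\<close>

lemma planar_labelled:
  fixes S :: "'l \<Rightarrow> complex set" and ed :: "'l \<Rightarrow> 'a set"
  assumes G: "simple_graph G" "edges G = ed ` L" and inj: "inj_on p (verts G)"
    and arc: "\<And>l. l \<in> L \<Longrightarrow> \<exists>g. arc g \<and> {pathstart g, pathfinish g} = p ` ed l \<and> path_image g = S l"
    and vert: "\<And>l x. l \<in> L \<Longrightarrow> x \<in> verts G \<Longrightarrow> p x \<in> S l \<Longrightarrow> x \<in> ed l"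
    and disj: "\<And>l m. l \<in> L \<Longrightarrow> m \<in> L \<Longrightarrow> l \<noteq> m \<Longrightarrow> S l \<inter> S m \<subseteq> p ` (ed l \<inter> ed m)"
  shows "planar G"
proof -
  define lab where "lab e = (SOME l. l \<in> L \<and> ed l = e)" for e
  have lab: "lab e \<in> L" "ed (lab e) = e" if "e \<in> edges G" for e
  proof -
    have "\<exists>l. l \<in> L \<and> ed l = e" using that G(2) by auto
    from someI_ex[OF this] show "lab e \<in> L" "ed (lab e) = e" by (simp_all add: lab_def)
  qed
  have "set_drawing G p (\<lambda>e. S (lab e))"
    unfolding set_drawing_def
  proof (intro conjI ballI impI)
    fix e assume e: "e \<in> edges G"
    show "\<exists>g. arc g \<and> {pathstart g, pathfinish g} = p ` e \<and> path_image g = S (lab e)"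
      using arc[OF lab(1)[OF e]] lab(2)[OF e] by simp
    show "x \<in> e" if "x \<in> verts G" "p x \<in> S (lab e)" for x
      using vert[OF lab(1)[OF e] that] lab(2)[OF e] by simp
    fix f assume f: "f \<in> edges G" "e \<noteq> f"
    then have "lab e \<noteq> lab f" using lab(2)[OF e] lab(2)[OF f(1)] by metis
    from disj[OF lab(1)[OF e] lab(1)[OF f(1)] this] show "S (lab e) \<inter> S (lab f) \<subseteq> p ` (e \<inter> f)"
      using lab(2)[OF e] lab(2)[OF f(1)] by simp
  qed (rule inj)
  then show ?thesis by (rule set_drawing_imp_planar) (rule G(1))
qed

section \<open>Planarity of the resulting graph\<close>

locale drawn_crossings = crossings +
  fixes q :: "nat \<Rightarrow> complex" and S :: "nat set \<Rightarrow> complex set" and A :: "nat \<Rightarrow> real \<Rightarrow> complex"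
  assumes S: "set_drawing H q S"
    and qS: "q ` verts H \<union> (\<Union>e\<in>edges H. S e) \<subseteq> ball 0 1"
    and A: "\<And>i. i < 4 \<Longrightarrow> arc (A i) \<and> pathstart (A i) = q ([iu, iv, iu', iv'] ! i) \<and> pathfinish (A i) = \<i> ^ Suc i \<and>
       path_image (A i) \<subseteq> insert (\<i> ^ Suc i) (ball 0 1) \<and>
       path_image (A i) \<inter> (q ` verts H \<union> (\<Union>e\<in>edges H. S e)) \<subseteq> {q ([iu, iv, iu', iv'] ! i)}"
    and AA: "\<And>i j. i < 4 \<Longrightarrow> j < 4 \<Longrightarrow> i \<noteq> j \<Longrightarrow> path_image (A i) \<inter> path_image (A j) = {}"
begin

text \<open>
  The copy for crossing \<open>j\<close> is drawn in the disc of radius \<open>1/3\<close> about the crossing point; \<open>iu, iv, iu', iv'\<close>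
  are attached at its top, left, bottom and right point.  The piece \<open>con j e\<close> of edge \<open>e\<close> ends in the disc of
  crossing \<open>j\<close> (at the right end of \<open>e\<close> if \<open>j = N\<close>) and starts in the disc of the previous
  crossing on \<open>e\<close>, if any.
\<close>

definition "curve = edge_curve n"
definition "gr b = gap n * real b"
definition "cen j = cross_point n (fe j) (fs j)"
definition "sg j = cross_par n (fe j) (fs j)"
definition "T j z = cen j + z / 3"
definition "tt i = [iu, iv, iu', iv'] ! i"
definition "pd j i = T j ` path_image (A i)"

fun lst :: "nat \<Rightarrow> nat \<times> nat \<Rightarrow> nat option" where
  "lst 0 e = None"
| "lst (Suc j) e = (if on e j then Some j else lst j e)"

text \<open>The shift by \<open>1 / 3\<close> is the radius of the discs: near a crossing the
  parameter is arc length, so these are the points where the edge leaves one disc and enters the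
  next.\<close>

definition "lo j e = (case lst j e of None \<Rightarrow> 2 * gr (fst e) | Some k \<Rightarrow> sg k + 1 / 3)"
definition "hi j e = (if j < N then sg j - 1 / 3 else 2 * gr (snd e))"
text \<open>Indices of the arcs of the gadget drawing: edges enter at 0 (top) or 1 (left) and leave
  at 2 (bottom) or 3 (right).\<close>

definition "inp j e = (if e = fe j then 0 else (1::nat))"
definition "outp j e = (if e = fe j then 2 else (3::nat))"
definition "pend j e = {(k, i). j < N \<and> k = j \<and> i = inp j e \<or> lst j e = Some k \<and> i = outp k e}"
definition "con j e = curve e ` {lo j e..hi j e} \<union> (\<Union>(k, i)\<in>pend j e. pd k i)"
definition "ptV b = Complex (gr b) (- gr b)"
definition "pos x = (if x < B then ptV (inv_into {1..n} V x) else T ((x - B) div h) (q ((x - B) mod h)))"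

section \<open>Crossings along an edge and the discs around them\<close>

lemma okE: "e \<in> E \<Longrightarrow> ok n e"
  using E'[of e] by (simp add: ok_def)

lemma on_E: "on e j \<Longrightarrow> j < N \<Longrightarrow> ok n e"
  using on_bet(1) okE by blast

lemma ok_crossing:
  assumes "j < N"
  shows "ok n (fe j)" "ok n (fs j)" "fst (fe j) < fst (fs j)" "fst (fs j) < snd (fe j)" "snd (fe j) < snd (fs j)"
  using crossing[OF assms] okE by (auto simp: bet_def)

lemma lst_None: "lst j e = None \<Longrightarrow> cur j e = V (fst e) \<and> (\<forall>i<j. \<not> on e i)"
  by (induction j) (auto simp: on_def less_Suc_eq split: if_splits)

lemma lst_Some:
  "lst j e = Some k \<Longrightarrow> k < j \<and> on e k \<and> (\<forall>i. k < i \<longrightarrow> i < j \<longrightarrow> \<not> on e i) \<and> cur j e = nm k (tt (outp k e))"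
  by (induction j) (auto simp: on_def less_Suc_eq tt_def outp_def split: if_splits)

text \<open>Here \<open>xless\<close> is matched with the drawing. An edge meets first, on its
  horizontal part, the edges that end before it, and then, on its vertical part, those that end
  after it. Within either part the grid values decide and integer offsets break ties, which gives
  the gap 1.\<close>

lemma sg_mono:
  assumes "k < j" "j < N" "on e k" "on e j"
  shows "sg k + 1 \<le> sg j"
proof -
  have kN: "k < N" using assms by simp
  note ck = ok_crossing[OF kN] and cj = ok_crossing[OF assms(2)]
  note r = real_ok[OF ck(1)] real_ok[OF ck(2)] real_ok[OF cj(1)] real_ok[OF cj(2)]
  have x: "xless (fe k, fs k) (fe j, fs j)" by (rule xless_nth[OF assms(1,2)])
  have sk: "sg k = gr (snd (fe k)) + gr (fst (fs k)) - fst (fe k) - snd (fs k)"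
    and sj: "sg j = gr (snd (fe j)) + gr (fst (fs j)) - fst (fe j) - snd (fs j)"
    by (simp_all add: sg_def cross_par_def gr_def)
  have g: "gr i + gap n \<le> gr l" if "i < l" for i l
    using gridK[OF that, of n] by (simp add: gr_def)
  from assms(3,4) consider "fe k = fe j" | "fs k = fs j" | "fe k = fs j" | "fs k = fe j"
    by (auto simp: on_def)
  then show ?thesis
  proof cases
    case 1
    have "fst (fs k) < fst (fs j) \<or> fst (fs k) = fst (fs j) \<and> snd (fs j) < snd (fs k)"
      using x 1 by (cases "fe k"; cases "fs k"; cases "fe j"; cases "fs j") auto
    then show ?thesis using g[of "fst (fs k)" "fst (fs j)"] r 1 unfolding sk sj by auto
  next
    case 2
    have "snd (fe k) < snd (fe j) \<or> snd (fe k) = snd (fe j) \<and> fst (fe j) < fst (fe k)"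
      using x 2 by (cases "fe k"; cases "fs k"; cases "fe j"; cases "fs j") auto
    then show ?thesis using g[of "snd (fe k)" "snd (fe j)"] r 2 unfolding sk sj by auto
  next
    case 3
    have "snd (fe k) \<le> snd (fe j)" using bet_mono[of k j] assms(1,2) by (simp add: bet_def)
    then show ?thesis using 3 cj(5) by simp
  next
    case 4
    have "snd (fe k) < snd (fe j)" "fst (fs k) < fst (fs j)" using 4 ck(5) cj(3) by simp_all
    from g[OF this(1)] g[OF this(2)] show ?thesis using r unfolding sk sj by linarith
  qed
qed

lemma curve_at:
  assumes "on e j" "j < N" "\<bar>s - sg j\<bar> \<le> 1"
  shows "curve e s = T j ((if e = fe j then - \<i> else 1) * of_real (3 * (s - sg j)))"
    "2 * gr (fst e) < s" "s < 2 * gr (snd e)"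
proof -
  note c = ok_crossing[OF assms(2)]
  note k = edge_curve_at_crossing[OF c assms(3)[unfolded sg_def]]
  have "T j (- \<i> * of_real (3 * (s - sg j))) = cen j + \<i> * of_real (sg j - s)"
    "T j (1 * of_real (3 * (s - sg j))) = cen j + of_real (s - sg j)"
    by (simp_all add: T_def complex_eq_iff diff_divide_distrib)
  moreover have "e = fe j \<or> e = fs j \<and> e \<noteq> fe j" using assms(1) by (auto simp: on_def)
  ultimately show "curve e s = T j ((if e = fe j then - \<i> else 1) * of_real (3 * (s - sg j)))"
    "2 * gr (fst e) < s" "s < 2 * gr (snd e)"
    using k unfolding curve_def gr_def sg_def[symmetric] cen_def[symmetric] by auto
qed

lemma curve_lo_hi:
  assumes "on e j" "j < N"
  shows "curve e (sg j - 1 / 3) = T j (\<i> ^ Suc (inp j e))" "curve e (sg j + 1 / 3) = T j (\<i> ^ Suc (outp j e))"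
  using curve_at(1)[OF assms, of "sg j - 1 / 3"] curve_at(1)[OF assms, of "sg j + 1 / 3"]
  by (auto simp: inp_def outp_def eval_nat_numeral)

lemma lo_hi:
  assumes p: "piece j e"
  shows "2 * gr (fst e) \<le> lo j e" "lo j e < hi j e" "hi j e \<le> 2 * gr (snd e)"
proof -
  have e: "e \<in> E" "j \<le> N" using p on_bet(1)[of e j] by (auto simp: piece_def)
  have ge: "2 * gr (fst e) < 2 * gr (snd e)" using gridK[of "fst e" "snd e" n] E'[OF e(1)] by (simp add: gr_def)
  have j: "on e j" if "j < N" using that p by (auto simp: piece_def)
  have l: "lo j e = 2 * gr (fst e) \<or> (\<exists>k. k < j \<and> on e k \<and> lo j e = sg k + 1 / 3)"
  proof (cases "lst j e")
    case None
    then show ?thesis by (simp add: lo_def)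
  next
    case (Some k)
    then show ?thesis using lst_Some[OF Some] by (auto simp: lo_def)
  qed
  show 1: "2 * gr (fst e) \<le> lo j e"
    using l curve_at(2)[of e _ "lo j e"] e(2) by (elim disjE exE conjE) (auto intro: less_imp_le)
  show 3: "hi j e \<le> 2 * gr (snd e)"
    using curve_at(3)[OF j, of "hi j e"] by (auto simp: hi_def intro: less_imp_le)
  show "lo j e < hi j e"
  proof (cases "j < N")
    case True
    from l show ?thesis
    proof (elim disjE exE conjE)
      assume "lo j e = 2 * gr (fst e)"
      then show ?thesis using curve_at(2)[OF j[OF True] True, of "hi j e"] True by (simp add: hi_def)
    next
      fix k assume k: "k < j" "on e k" "lo j e = sg k + 1 / 3"
      then show ?thesis using sg_mono[OF k(1) True k(2) j[OF True]] True by (simp add: hi_def)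
    qed
  next
    case False
    from l show ?thesis
    proof (elim disjE exE conjE)
      assume "lo j e = 2 * gr (fst e)"
      then show ?thesis using ge False by (simp add: hi_def)
    next
      fix k assume k: "k < j" "on e k" "lo j e = sg k + 1 / 3"
      then show ?thesis using curve_at(3)[OF k(2), of "lo j e"] e(2) False by (simp add: hi_def)
    qed
  qed
qed

lemma T_inject: "T j z = T j w \<longleftrightarrow> z = w"
  by (simp add: T_def)

lemma dist_T: "dist (cen j) (T j z) = norm z / 3"
  by (simp add: T_def dist_norm)

text \<open>If two centers had distance below 1, an edge of crossing \<open>k\<close> would also be
  on crossing \<open>j\<close>, at parameters less than 1 apart, which contradicts
  \<open>sg_mono\<close> unless the crossings are the same.\<close>

lemma centers_apart:
  assumes "j < N" "k < N" "dist (cen j) z \<le> 1 / 3" "dist (cen k) z \<le> 1 / 3"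
  shows "j = k"
proof -
  note cj = ok_crossing[OF assms(1)] and ck = ok_crossing[OF assms(2)]
  have d: "dist (cen k) (cen j) < 1"
    using dist_triangle2[of "cen k" "cen j" z] assms(3,4) by simp
  have on: "on (fe k) k" "on (fs k) k" by (simp_all add: on_def)
  have ce: "curve e (sg k) = cen k" "2 * gr (fst e) \<le> sg k" "sg k \<le> 2 * gr (snd e)" if "on e k" for e
    using curve_at[OF that assms(2), of "sg k"] by (simp_all add: T_def)
  have near: "e = fe j \<or> e = fs j" "\<bar>sg k - sg j\<bar> < 1" if "on e k" for e
  proof -
    have "(e = fe j \<or> e = fs j) \<and> dist (cross_point n (fe j) (fs j)) (edge_curve n e (sg k)) = \<bar>sg k - cross_par n (fe j) (fs j)\<bar>"
      using ce[OF that] d on_E[OF that assms(2)] cj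
      by (intro edge_curve_near_crossing) (simp_all add: curve_def cen_def gr_def dist_commute)
    then show "e = fe j \<or> e = fs j" "\<bar>sg k - sg j\<bar> < 1"
      using d ce(1)[OF that] by (simp_all add: curve_def cen_def sg_def dist_commute)
  qed
  have "on (fe k) j" using near(1)[OF on(1)] by (auto simp: on_def)
  then have "\<not> j < k" "\<not> k < j"
    using sg_mono[of j k "fe k"] sg_mono[of k j "fe k"] on(1) near(2)[OF on(1)] assms(1,2) by auto
  then show ?thesis by simp
qed

lemma curve_in_disc:
  assumes "e \<in> E" "2 * gr (fst e) \<le> s" "s \<le> 2 * gr (snd e)" "j < N" "dist (cen j) (curve e s) \<le> 1 / 3"
  shows "on e j" "\<bar>s - sg j\<bar> \<le> 1 / 3" "dist (cen j) (curve e s) = \<bar>s - sg j\<bar>"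
proof -
  note c = ok_crossing[OF assms(4)]
  have "(e = fe j \<or> e = fs j) \<and> dist (cross_point n (fe j) (fs j)) (edge_curve n e s) = \<bar>s - cross_par n (fe j) (fs j)\<bar>"
    using assms okE[OF assms(1)] c by (intro edge_curve_near_crossing) (simp_all add: curve_def cen_def gr_def)
  then show "on e j" "\<bar>s - sg j\<bar> \<le> 1 / 3" "dist (cen j) (curve e s) = \<bar>s - sg j\<bar>"
    using assms(5) by (auto simp: on_def curve_def cen_def sg_def)
qed

lemma piece_E: "piece j e \<Longrightarrow> e \<in> E \<and> j \<le> N"
  using on_bet(1)[of e j] by (auto simp: piece_def)

text \<open>In a disc an edge has only parameters within \<open>1 / 3\<close> of its crossing, and a
  piece runs between the discs of two consecutive crossings on its edge. So only the two ends of its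
  parameter range can touch a disc, and they do so on the circle.\<close>

lemma curve_piece_in_disc:
  assumes p: "piece j e" and s: "lo j e \<le> s" "s \<le> hi j e" and k: "k < N" and d: "dist (cen k) (curve e s) \<le> 1 / 3"
  shows "\<exists>i. (k, i) \<in> pend j e \<and> curve e s = T k (\<i> ^ Suc i) \<and> (lst j e = Some k \<and> i = outp k e \<or> k = j \<and> i = inp k e)"
proof -
  have e: "e \<in> E" "j \<le> N" using piece_E[OF p] by auto
  note r = curve_in_disc[OF e(1) _ _ k d]
  have on: "on e k" and near: "\<bar>s - sg k\<bar> \<le> 1 / 3"
    using r s lo_hi[OF p] by auto
  show ?thesis
  proof (cases "k < j")
    case True
    have "lst j e \<noteq> None" using lst_None[of j e] True on by blast
    then obtain l where l: "lst j e = Some l" by blast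
    note L = lst_Some[OF l]
    have "k \<le> l" using L True on by (meson linorder_not_less)
    have lN: "l < N" using L e(2) by simp
    have lo: "lo j e = sg l + 1 / 3" using l by (simp add: lo_def)
    have "k = l"
    proof (rule ccontr)
      assume "k \<noteq> l"
      then have "sg k + 1 \<le> sg l" using \<open>k \<le> l\<close> L lN on by (intro sg_mono) auto
      then show False using near s(1) lo by auto
    qed
    then have "s = sg k + 1 / 3" using near s(1) lo by auto
    then have "curve e s = T k (\<i> ^ Suc (outp k e))" using curve_lo_hi(2)[OF on k] by simp
    then show ?thesis using l \<open>k = l\<close> by (intro exI[of _ "outp k e"]) (simp add: pend_def)
  next
    case False
    then have jN: "j < N" using k by simp
    have oj: "on e j" using p jN by (auto simp: piece_def)
    have hi: "hi j e = sg j - 1 / 3" using jN by (simp add: hi_def)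
    have "k = j"
    proof (rule ccontr)
      assume "k \<noteq> j"
      then have "sg j + 1 \<le> sg k" using False oj on k by (intro sg_mono[of _ _ e]) auto
      then show False using near s(2) hi by auto
    qed
    then have "s = sg k - 1 / 3" using near s(2) hi by auto
    then have "curve e s = T k (\<i> ^ Suc (inp k e))" using curve_lo_hi(1)[OF on k] by simp
    then show ?thesis using \<open>k = j\<close> jN by (intro exI[of _ "inp k e"]) (simp add: pend_def)
  qed
qed

lemma pend_bound: "piece j e \<Longrightarrow> (k, i) \<in> pend j e \<Longrightarrow> k < N \<and> i < 4"
  using piece_E[of j e] lst_Some[of j e k] by (auto simp: pend_def inp_def outp_def)

text \<open>Each arc in a disc continues one piece only: arcs 0 and 1 the pieces that end at the
  crossing, arcs 2 and 3 the next pieces of the two edges.\<close>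

lemma pend_disjoint:
  assumes "piece j e" "piece j' e'" "(k, i) \<in> pend j e" "(k, i) \<in> pend j' e'"
  shows "j = j' \<and> e = e'"
proof -
  have inout: "inp a b \<noteq> outp c d" for a b c d by (simp add: inp_def outp_def)
  have on: "on e j" if "j < N" "piece j e" for j e using that by (auto simp: piece_def)
  have ns: "fe k \<noteq> fs k" if "k < N" using crossing(6)[OF that] .
  have ii: "e = e'" if "inp j e = inp j e'" "on e j" "on e' j" "j < N"
    using that by (auto simp: inp_def on_def split: if_splits)
  have oo: "e = e'" if "outp k e = outp k e'" "on e k" "on e' k"
    using that by (auto simp: outp_def on_def split: if_splits)
  consider "j < N" "k = j" "i = inp j e" "j' < N" "k = j'" "i = inp j' e'"
    | "lst j e = Some k" "i = outp k e" "lst j' e' = Some k" "i = outp k e'"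
  proof -
    have "j < N \<and> k = j \<and> i = inp j e \<or> lst j e = Some k \<and> i = outp k e"
      "j' < N \<and> k = j' \<and> i = inp j' e' \<or> lst j' e' = Some k \<and> i = outp k e'"
      using assms(3,4) by (simp_all add: pend_def)
    then show ?thesis using that inout by metis
  qed
  then show ?thesis
  proof cases
    case 1
    then show ?thesis using ii on[of j e] on[of j' e'] assms(1,2) by auto
  next
    case 2
    note L = lst_Some[OF 2(1)] and L' = lst_Some[OF 2(3)]
    have e: "e = e'" using oo 2 L L' by auto
    have False if j: "a < b" "piece a e" "piece b e" "lst a e = Some k" "lst b e = Some k" for a b
    proof -
      have "a < N" using piece_E[OF j(3)] j(1) by simp
      then have "on e a" using on j(2) by blast
      moreover have "k < a" using lst_Some[OF j(4)] by blast
      ultimately show False using lst_Some[OF j(5)] j(1) by blast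
    qed
    then have "\<not> j < j'" "\<not> j' < j" using 2 e assms(1,2) by blast+
    then show ?thesis using e by simp
  qed
qed

lemma pend_terminal:
  assumes "piece j e" "(k, i) \<in> pend j e"
  shows "nm k (tt i) \<in> {cur j e, tip j e}"
proof -
  from assms(2) have "j < N \<and> k = j \<and> i = inp j e \<or> lst j e = Some k \<and> i = outp k e" by (simp add: pend_def)
  then show ?thesis
  proof
    assume "j < N \<and> k = j \<and> i = inp j e"
    then show ?thesis by (auto simp: tip_def tt_def inp_def)
  next
    assume "lst j e = Some k \<and> i = outp k e"
    then show ?thesis using lst_Some[of j e k] by auto
  qed
qed

lemma tt_less: "i < 4 \<Longrightarrow> tt i < h"
  using ter by (auto simp: tt_def eval_nat_numeral less_Suc_eq nth_Cons')

lemma pos_V: "b \<in> {1..n} \<Longrightarrow> pos (V b) = ptV b"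
  using V by (simp add: pos_def)

lemma pos_nm: "x < h \<Longrightarrow> pos (nm j x) = T j (q x)"
  using h_pos by (simp add: pos_def nm_def)

lemma pendant_arc:
  assumes "i < 4"
  shows "arc (A i)" "pathstart (A i) = q (tt i)" "pathfinish (A i) = \<i> ^ Suc i"
    "path_image (A i) \<subseteq> insert (\<i> ^ Suc i) (ball 0 1)"
    "path_image (A i) \<inter> (q ` verts H \<union> (\<Union>e\<in>edges H. S e)) \<subseteq> {q (tt i)}"
  using A[OF assms] by (simp_all add: tt_def)

lemma norm_i_pow: "norm (\<i> ^ Suc i) = 1"
  by (simp add: norm_power norm_mult)

lemma pd_in_disc: "i < 4 \<Longrightarrow> z \<in> pd k i \<Longrightarrow> dist (cen k) z < 1 / 3 \<or> z = T k (\<i> ^ Suc i)"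
  using pendant_arc(4)[of i] by (auto simp: pd_def dist_T)

lemma pd_in_disc': "i < 4 \<Longrightarrow> z \<in> pd k i \<Longrightarrow> dist (cen k) z \<le> 1 / 3"
  using pd_in_disc[of i z k] by (auto simp: dist_T norm_mult norm_power)

lemma T_pow_sphere: "dist (cen k) (T k (\<i> ^ Suc i)) = 1 / 3"
  unfolding dist_T norm_i_pow by simp

lemma T_pow_in_pd: "i < 4 \<Longrightarrow> T k (\<i> ^ Suc i) \<in> pd k i"
  using pendant_arc(3)[of i] pathfinish_in_path_image[of "A i"] by (auto simp: pd_def)

lemma pd_disjoint:
  assumes "z \<in> pd k i" "z \<in> pd l i'" "i < 4" "i' < 4" "k < N" "l < N"
  shows "k = l \<and> i = i'"
proof -
  have "k = l" using centers_apart[OF assms(5,6)] pd_in_disc'[OF assms(3,1)] pd_in_disc'[OF assms(4,2)] by blast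
  moreover have "i = i'"
  proof (rule ccontr)
    assume ne: "i \<noteq> i'"
    obtain x y where "z = T k x" "x \<in> path_image (A i)" "z = T l y" "y \<in> path_image (A i')"
      using assms(1,2) unfolding pd_def by blast
    then show False using AA[OF assms(3,4) ne] \<open>k = l\<close> T_inject by auto
  qed
  ultimately show ?thesis by simp
qed

lemma con_cases:
  assumes "z \<in> con j e"
  obtains s where "lo j e \<le> s" "s \<le> hi j e" "z = curve e s" | k i where "(k, i) \<in> pend j e" "z \<in> pd k i"
  using assms unfolding con_def by auto

lemma curve_vertex:
  assumes p: "piece j e" and s: "lo j e \<le> s" "s \<le> hi j e" and z: "curve e s = ptV b"
  shows "b \<in> {1..n} \<and> V b \<in> {cur j e, tip j e}"
proof -
  have e: "e \<in> E" "j \<le> N" using piece_E[OF p] by auto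
  have sb: "s = 2 * gr b" using edge_curve_diff[of n e s] z by (simp add: curve_def ptV_def)
  have rng: "2 * gr (fst e) \<le> s" "s \<le> 2 * gr (snd e)" using s lo_hi[OF p] by auto
  have "loc n e (Re (curve e s)) (Im (curve e s))"
    unfolding curve_def using edge_curve_loc[OF okE[OF e(1)]] rng by (simp add: gr_def)
  then have "b = fst e \<or> b = snd e"
    unfolding z by (rule loc_vertex[OF _ okE[OF e(1)]]) (simp add: ptV_def vertex_at_def gr_def)
  then show ?thesis
  proof
    assume b: "b = fst e"
    have "lst j e = None"
    proof (cases "lst j e")
      case (Some k)
      then have "lo j e = sg k + 1 / 3" "on e k" "k < N" using lst_Some[OF Some] e(2) by (auto simp: lo_def)
      then have "2 * gr (fst e) < lo j e" using curve_at(2)[of e k "lo j e"] by simp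
      then show ?thesis using s(1) sb b by simp
    qed simp
    then show ?thesis using b lst_None[of j e] E'[OF e(1)] by simp
  next
    assume b: "b = snd e"
    have "\<not> j < N"
    proof
      assume j: "j < N"
      then have "on e j" using p by (auto simp: piece_def)
      then have "hi j e < 2 * gr (snd e)" using curve_at(3)[of e j "hi j e"] j by (simp add: hi_def)
      then show False using s(2) sb b by simp
    qed
    then show ?thesis using b E'[OF e(1)] by (simp add: tip_def)
  qed
qed

lemma vertex_not_in_disc: "j < N \<Longrightarrow> \<not> dist (cen j) (ptV b) \<le> 1 / 3"
proof
  assume j: "j < N" and d: "dist (cen j) (ptV b) \<le> 1 / 3"
  have "\<bar>Re (ptV b) - Re (cen j)\<bar> < 1"
    using d abs_Re_le_cmod[of "ptV b - cen j"] by (simp add: dist_norm norm_minus_commute)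
  moreover have "vertex_at n b (Re (ptV b)) (Im (ptV b))" by (simp add: ptV_def vertex_at_def gr_def)
  ultimately show False
    using vertex_not_near_crossing[OF ok_crossing(1)[OF j]] by (simp add: cen_def cross_point_def)
qed

text \<open>Pieces of one edge have disjoint parameter ranges. Pieces of different edges could apart
  from vertices meet only in a crossing point; this is the center of a disc, and the pieces reach
  only the circle around it.\<close>

lemma curves_meet:
  assumes p: "piece j e" "piece j' e'" "(j, e) \<noteq> (j', e')"
    and s: "lo j e \<le> s" "s \<le> hi j e" "lo j' e' \<le> s'" "s' \<le> hi j' e'" "curve e s = curve e' s'"
  shows "\<exists>b. b \<in> {1..n} \<and> curve e s = ptV b"
proof -
  have E1: "e \<in> E" "e' \<in> E" using piece_E p by auto
  \<comment> \<open>The parameter is the difference of the coordinates and so is determined by the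
    point.\<close>
  have ss: "s = s'" using edge_curve_diff[of n e s] edge_curve_diff[of n e' s'] s(5) by (simp add: curve_def)
  have rng: "2 * gr (fst e) \<le> s" "s \<le> 2 * gr (snd e)" "2 * gr (fst e') \<le> s'" "s' \<le> 2 * gr (snd e')"
    using s lo_hi[OF p(1)] lo_hi[OF p(2)] by auto
  have ne: "e \<noteq> e'"
  proof
    assume "e = e'"
    have *: False if q: "piece i e" "piece i' e" "i < i'" "s \<le> hi i e" "lo i' e \<le> s" for i i'
    proof -
      have iN: "i < N" using piece_E[OF q(2)] q(3) by simp
      then have on: "on e i" using q(1) by (auto simp: piece_def)
      then have "lst i' e \<noteq> None" using lst_None q(3) by blast
      then obtain k where k: "lst i' e = Some k" by blast
      note L = lst_Some[OF k]
      have "i \<le> k" using L on q(3) by (meson linorder_not_less)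
      moreover have "k < N" using L piece_E[OF q(2)] by simp
      ultimately have "sg i \<le> sg k" using sg_mono[of i k e] on L by (cases "i = k") auto
      then show False using q(4,5) k iN by (simp add: lo_def hi_def)
    qed
    have "j \<noteq> j'" using p(3) \<open>e = e'\<close> by simp
    then show False using *[of j j'] *[of j' j] p s ss \<open>e = e'\<close> by (cases "j < j'") auto
  qed
  define z where "z = curve e s"
  have l: "loc n e (Re z) (Im z)" "loc n e' (Re z) (Im z)"
    using edge_curve_loc[OF okE[OF E1(1)], of s] edge_curve_loc[OF okE[OF E1(2)], of s'] rng s(5)
    by (simp_all add: curve_def z_def gr_def)
  have no: False if m: "f \<in> E" "f' \<in> E" "fst f < fst f'" "fst f' < snd f" "snd f < snd f'"
    "verti n f (Re z) (Im z)" "horiz n f' (Re z) (Im z)" for f f'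
  proof -
    have "(f, f') \<in> set xs" unfolding xs using m(1-5) by auto
    then obtain k where k: "k < N" "xs ! k = (f, f')" by (auto simp: N_def in_set_conv_nth)
    have "z = cen k" using m(6,7) k(2)
      by (simp add: cen_def cross_point_def fe_def fs_def verti_def horiz_def complex_eq_iff)
    then have "dist (cen k) (curve e s) \<le> 1 / 3" by (simp add: z_def)
    from curve_piece_in_disc[OF p(1) s(1,2) k(1) this] obtain i where "curve e s = T k (\<i> ^ Suc i)" by blast
    then have "dist (cen k) z = 1 / 3" using T_pow_sphere by (simp add: z_def)
    then show False using \<open>z = cen k\<close> by simp
  qed
  have "meets n e e' (Re z) (Im z)" by (rule loc_meets[OF l okE[OF E1(1)] okE[OF E1(2)] ne])
  then obtain b where b: "b \<in> {fst e, snd e}" "vertex_at n b (Re z) (Im z)"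
    unfolding meets_def using no[OF E1(1,2)] no[OF E1(2,1)] by blast
  then show ?thesis
    using E'[OF E1(1)] by (intro exI[of _ b]) (auto simp: z_def vertex_at_def ptV_def gr_def complex_eq_iff)
qed

lemma arc_T: "arc g \<Longrightarrow> arc (T k \<circ> g)"
  unfolding arc_def T_def
  by (auto intro!: path_continuous_image continuous_intros simp: inj_on_def)

text \<open>The piece is joined from up to three arcs: out of the previous copy, along the edge,
  into the next copy. The joins are arcs because the middle one touches a pendant arc only in the
  point of the circle where they are joined.\<close>

lemma arc_con:
  assumes p: "piece j e"
  shows "\<exists>g. arc g \<and> pathstart g = pos (cur j e) \<and> pathfinish g = pos (tip j e) \<and> path_image g = con j e"
proof -
  have e: "e \<in> E" "j \<le> N" using piece_E[OF p] by auto
  note lh = lo_hi[OF p]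
  define m where "m = curve e \<circ> linepath (lo j e) (hi j e)"
  have im: "path_image m = curve e ` {lo j e..hi j e}"
    using lh(2) by (simp add: m_def path_image_compose closed_segment_eq_real_ivl)
  have "inj (curve e)"
    by (rule inj_on_inverseI[of _ "\<lambda>z. Re z - Im z"]) (simp add: curve_def edge_curve_diff)
  then have am: "arc m"
    unfolding m_def curve_def arc_def using lh(2) continuous_edge_curve[of _ n e]
    by (auto intro!: path_continuous_image comp_inj_on intro: inj_on_subset simp: inj_on_linepath)
  have sm: "pathstart m = curve e (lo j e)" "pathfinish m = curve e (hi j e)"
    by (simp_all add: m_def pathstart_compose pathfinish_compose)
  have touch: "z = T k (\<i> ^ Suc i)" if z: "z \<in> path_image m" "z \<in> pd k i" and ki: "(k, i) \<in> pend j e" for z k i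
  proof -
    obtain s where s: "lo j e \<le> s" "s \<le> hi j e" "z = curve e s" using z(1) unfolding im by auto
    note b = pend_bound[OF p ki]
    obtain i' where i': "(k, i') \<in> pend j e" "z = T k (\<i> ^ Suc i')"
      using curve_piece_in_disc[OF p s(1,2), of k] b pd_in_disc'[OF _ z(2)] s(3) by blast
    have "z \<in> pd k i'" using T_pow_in_pd[of i' k] pend_bound[OF p i'(1)] i'(2) by simp
    then have "i = i'" using pd_disjoint[OF z(2)] b pend_bound[OF p i'(1)] by blast
    then show ?thesis using i' by simp
  qed
  have "\<exists>g. arc g \<and> pathstart g = curve e (lo j e) \<and> pathfinish g = pos (tip j e) \<and>
     path_image g = path_image m \<union> (if j < N then pd j (inp j e) else {})"
  proof (cases "j < N")
    case True
    have on: "on e j" using p True by (auto simp: piece_def)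
    have P: "(j, inp j e) \<in> pend j e" using True by (simp add: pend_def)
    note A' = pendant_arc[of "inp j e"]
    have i4: "inp j e < 4" using pend_bound[OF p P] by simp
    define r where "r = reversepath (T j \<circ> A (inp j e))"
    have r: "arc r" "path_image r = pd j (inp j e)" "pathstart r = T j (\<i> ^ Suc (inp j e))"
      "pathfinish r = T j (q (tt (inp j e)))"
      using arc_T[OF A'(1)[OF i4]] A'(2,3)[OF i4]
      by (simp_all add: r_def arc_reversepath path_image_compose pd_def pathstart_compose pathfinish_compose)
    have tip: "tip j e = nm j (tt (inp j e))" using True by (simp add: tip_def tt_def inp_def)
    have fm: "pathfinish m = pathstart r"
      using curve_lo_hi(1)[OF on True] True unfolding sm r(3) by (simp add: hi_def)
    have "arc (m +++ r)"
      using am r(1) fm by (rule arc_join) (use touch[OF _ _ P] r(2,3) in auto)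
    moreover have "path_image (m +++ r) = path_image m \<union> pd j (inp j e)"
      using fm r(2) by (simp add: path_image_join)
    ultimately show ?thesis
      using True sm(1) r(4) tip pos_nm[OF tt_less[OF i4]] by (intro exI[of _ "m +++ r"]) simp
  next
    case False
    have "pathfinish m = ptV (snd e)"
      using edge_curve_ends(2)[OF okE[OF e(1)]] False unfolding sm by (simp add: hi_def curve_def gr_def ptV_def)
    moreover have "pos (tip j e) = ptV (snd e)" using False pos_V[of "snd e"] E'[OF e(1)] by (simp add: tip_def)
    ultimately show ?thesis using am sm(1) False by (intro exI[of _ m]) simp
  qed
  then obtain g where g: "arc g" "pathstart g = curve e (lo j e)" "pathfinish g = pos (tip j e)"
     "path_image g = path_image m \<union> (if j < N then pd j (inp j e) else {})" by blast
  show ?thesis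
  proof (cases "lst j e")
    case None
    have "pend j e = (if j < N then {(j, inp j e)} else {})" using None by (auto simp: pend_def)
    then have "con j e = path_image g" unfolding con_def g(4) im by simp
    moreover have "pathstart g = pos (cur j e)"
      using g(2) None lst_None[OF None] edge_curve_ends(1)[OF okE[OF e(1)]] pos_V[of "fst e"] E'[OF e(1)]
      by (simp add: lo_def curve_def gr_def ptV_def)
    ultimately show ?thesis using g by blast
  next
    case (Some k)
    note L = lst_Some[OF Some]
    have kN: "k < N" using L e(2) by simp
    have P: "(k, outp k e) \<in> pend j e" using Some by (simp add: pend_def)
    have i4: "outp k e < 4" using pend_bound[OF p P] by simp
    define l where "l = T k \<circ> A (outp k e)"
    have l: "arc l" "path_image l = pd k (outp k e)" "pathfinish l = T k (\<i> ^ Suc (outp k e))"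
      "pathstart l = T k (q (tt (outp k e)))"
      using arc_T[OF pendant_arc(1)[OF i4]] pendant_arc(2,3)[OF i4]
      by (simp_all add: l_def path_image_compose pd_def pathstart_compose pathfinish_compose)
    have fl: "pathfinish l = pathstart g"
      using curve_lo_hi(2)[of e k] L kN Some unfolding l(3) g(2) by (simp add: lo_def)
    have sl: "pathstart l = pos (cur j e)"
      using L pos_nm[OF tt_less[OF i4]] unfolding l(4) by simp
    have "path_image l \<inter> path_image g \<subseteq> {pathstart g}"
    proof
      fix z assume z: "z \<in> path_image l \<inter> path_image g"
      have "z \<notin> pd j (inp j e)" if "j < N"
      proof
        assume "z \<in> pd j (inp j e)"
        moreover have "z \<in> pd k (outp k e)" using z l(2) by simp
        ultimately have "j = k" using pd_disjoint[of z j "inp j e" k "outp k e"] that kN i4 by (simp add: inp_def)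
        then show False using L by simp
      qed
      then have "z \<in> path_image m" using z g(4) by (auto split: if_splits)
      then have "z = T k (\<i> ^ Suc (outp k e))" using touch[OF _ _ P] z l(2) by blast
      then show "z \<in> {pathstart g}" using l(3) fl by simp
    qed
    then have "arc (l +++ g)" by (rule arc_join[OF l(1) g(1) fl])
    moreover have "path_image (l +++ g) = con j e"
    proof -
      have "pend j e = insert (k, outp k e) (if j < N then {(j, inp j e)} else {})"
        using Some by (auto simp: pend_def)
      then have "con j e = path_image m \<union> (pd k (outp k e) \<union> (if j < N then pd j (inp j e) else {}))"
        unfolding con_def im by simp
      then show ?thesis using fl l(2) g(4) by (simp add: path_image_join Un_ac)
    qed
    ultimately show ?thesis using sl g(3) by (intro exI[of _ "l +++ g"]) simp
  qed
qed

lemma new_vertex: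
  assumes "y \<in> {B..<B + N * h}"
  obtains j x where "j < N" "x < h" "y = nm j x"
proof (rule that[of "(y - B) div h" "(y - B) mod h"])
  show "(y - B) div h < N" using assms by (intro less_mult_imp_div_less) auto
  show "(y - B) mod h < h" using h_pos by simp
  show "y = nm ((y - B) div h) ((y - B) mod h)" using assms by (simp add: nm_def)
qed

lemma q_in_disc: "x < h \<Longrightarrow> dist (cen j) (T j (q x)) < 1 / 3"
  using qS H(2) by (auto simp: dist_T)

lemma S_in_disc: "x \<in> edges H \<Longrightarrow> z \<in> T j ` S x \<Longrightarrow> dist (cen j) z < 1 / 3"
  using qS by (fastforce simp: dist_T)

lemma set_drawing_H:
  shows "inj_on q {..<h}"
    "\<And>x. x \<in> edges H \<Longrightarrow> \<exists>g. arc g \<and> {pathstart g, pathfinish g} = q ` x \<and> path_image g = S x"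
    "\<And>x y. x \<in> edges H \<Longrightarrow> y < h \<Longrightarrow> q y \<in> S x \<Longrightarrow> y \<in> x"
    "\<And>x y. x \<in> edges H \<Longrightarrow> y \<in> edges H \<Longrightarrow> x \<noteq> y \<Longrightarrow> S x \<inter> S y \<subseteq> q ` (x \<inter> y)"
  using S unfolding set_drawing_def H(2) by simp_all

lemma edge_H: "x \<in> edges H \<Longrightarrow> x \<subseteq> {..<h}"
  using H by (auto simp: simple_graph_def)

lemma pd_meets_block:
  assumes "piece j e" "(k, i) \<in> pend j e" "z \<in> pd k i" "l < N" "z = T l w" "w \<in> q ` verts H \<union> (\<Union>e\<in>edges H. S e)"
  shows "l = k" "w = q (tt i)"
proof -
  note b = pend_bound[OF assms(1,2)]
  have "norm w < 1" using qS assms(6) by auto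
  then have "dist (cen l) z \<le> 1 / 3" unfolding assms(5) dist_T by simp
  then show "l = k" using centers_apart[of l k z] pd_in_disc'[of i z k] assms(3,4) b by blast
  then have "w \<in> path_image (A i)" using assms(3,5) T_inject by (auto simp: pd_def)
  then show "w = q (tt i)" using pendant_arc(5)[of i] b assms(6) by blast
qed

lemma curve_not_in_open_disc:
  assumes "piece j e" "lo j e \<le> s" "s \<le> hi j e" "k < N"
  shows "\<not> dist (cen k) (curve e s) < 1 / 3"
proof
  assume d: "dist (cen k) (curve e s) < 1 / 3"
  then obtain i where "curve e s = T k (\<i> ^ Suc i)" using curve_piece_in_disc[OF assms] by force
  then show False using d T_pow_sphere[of k i] by simp
qed

definition "labels = Inl ` {(j, e). piece j e} \<union> Inr ` ({..<N} \<times> edges H)"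
definition "lab_edge = case_sum (\<lambda>(j, e). {cur j e, tip j e}) (\<lambda>(j, x). nm j ` x)"
definition "lab_set = case_sum (\<lambda>(j, e). con j e) (\<lambda>(j, x). T j ` S x)"

lemma con_con:
  assumes p: "piece j e" "piece j' e'" and ne: "(j, e) \<noteq> (j', e')" and z: "z \<in> con j e" "z \<in> con j' e'"
  shows "z \<in> pos ` ({cur j e, tip j e} \<inter> {cur j' e', tip j' e'})"
proof -
  have cp: False if p: "piece j e" "piece j' e'" "(j, e) \<noteq> (j', e')" and s: "lo j e \<le> s" "s \<le> hi j e" "z = curve e s"
    and k: "(k, i) \<in> pend j' e'" "z \<in> pd k i" for j e j' e' s k i
  proof -
    note b = pend_bound[OF p(2) k(1)]
    have "dist (cen k) (curve e s) \<le> 1 / 3" using pd_in_disc'[OF _ k(2)] b s(3) by simp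
    then obtain i' where i': "(k, i') \<in> pend j e" "z = T k (\<i> ^ Suc i')"
      using curve_piece_in_disc[OF p(1) s(1,2), of k] b s(3) by blast
    have "z \<in> pd k i'" using T_pow_in_pd[of i' k] pend_bound[OF p(1) i'(1)] i'(2) by simp
    then have "i = i'" using pd_disjoint[OF k(2)] b pend_bound[OF p(1) i'(1)] by blast
    then show False using pend_disjoint[OF p(1,2) i'(1)] k(1) p(3) by simp
  qed
  from z(1) show ?thesis
  proof (cases rule: con_cases)
    case (1 s)
    from z(2) show ?thesis
    proof (cases rule: con_cases)
      case (1 s')
      from curves_meet[OF p ne \<open>lo j e \<le> s\<close> \<open>s \<le> hi j e\<close> 1(1,2)] 1(3) \<open>z = curve e s\<close>
      obtain b where b: "z = ptV b" by auto
      note v = curve_vertex[OF p(1) \<open>lo j e \<le> s\<close> \<open>s \<le> hi j e\<close>, of b] curve_vertex[OF p(2) 1(1,2), of b]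
      then have "b \<in> {1..n}" "V b \<in> {cur j e, tip j e} \<inter> {cur j' e', tip j' e'}"
        using b 1(3) \<open>z = curve e s\<close> by simp_all
      then show ?thesis using b pos_V by (metis image_eqI)
    next
      case (2 k i)
      then show ?thesis using cp[OF p ne 1] by blast
    qed
  next
    case (2 k i)
    from z(2) show ?thesis
    proof (cases rule: con_cases)
      case (1 s')
      then show ?thesis using cp[OF p(2,1) ne[symmetric] 1 2] by blast
    next
      case (2 k' i')
      have "k = k' \<and> i = i'"
        using pd_disjoint[OF \<open>z \<in> pd k i\<close> 2(2)] pend_bound[OF p(1) \<open>(k, i) \<in> pend j e\<close>] pend_bound[OF p(2) 2(1)] by blast
      then show ?thesis using pend_disjoint[OF p \<open>(k, i) \<in> pend j e\<close>] 2(1) ne by simp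
    qed
  qed
qed

lemma con_block:
  assumes p: "piece j e" and k: "k < N" "x \<in> edges H" and z: "z \<in> con j e" "z \<in> T k ` S x"
  shows "z \<in> pos ` ({cur j e, tip j e} \<inter> nm k ` x)"
  using z(1)
proof (cases rule: con_cases)
  case (1 s)
  then show ?thesis using curve_not_in_open_disc[OF p 1(1,2) k(1)] S_in_disc[OF k(2) z(2)] by simp
next
  case (2 l i)
  note b = pend_bound[OF p 2(1)]
  obtain w where w: "z = T k w" "w \<in> S x" using z(2) by auto
  note m = pd_meets_block[OF p 2 k(1) w(1)]
  have "w \<in> q ` verts H \<union> (\<Union>e\<in>edges H. S e)" using w(2) k(2) by auto
  then have kl: "k = l" "w = q (tt i)" using m by auto
  have tt: "tt i < h" using tt_less b by simp
  have "tt i \<in> x" using set_drawing_H(3)[OF k(2) tt] w(2) kl(2) by simp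
  then have "nm k (tt i) \<in> {cur j e, tip j e} \<inter> nm k ` x" using pend_terminal[OF p 2(1)] kl(1) by simp
  moreover have "z = pos (nm k (tt i))" using pos_nm[OF tt] w(1) kl by simp
  ultimately show ?thesis by (rule rev_image_eqI)
qed

lemma block_block:
  assumes "j < N" "x \<in> edges H" "k < N" "y \<in> edges H" "(j, x) \<noteq> (k, y)" "z \<in> T j ` S x" "z \<in> T k ` S y"
  shows "z \<in> pos ` (nm j ` x \<inter> nm k ` y)"
proof -
  have jk: "j = k"
    using centers_apart[OF assms(1,3)] S_in_disc[OF assms(2,6)] S_in_disc[OF assms(4,7)] by (meson less_imp_le)
  obtain w w' where w: "z = T j w" "w \<in> S x" "z = T k w'" "w' \<in> S y" using assms(6,7) by blast
  then have "w = w'" using T_inject jk by simp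
  then have "w \<in> q ` (x \<inter> y)" using set_drawing_H(4)[OF assms(2,4)] w assms(5) jk by blast
  then obtain u where u: "u \<in> x" "u \<in> y" "w = q u" by blast
  have "u < h" using edge_H[OF assms(2)] u(1) by auto
  then have "z = pos (nm j u)" using pos_nm w(1) u(3) by simp
  then show ?thesis using u jk by blast
qed

lemma planar_graph: "planar (graph N)"
proof (rule planar_labelled[of _ lab_edge labels pos lab_set])
  show "simple_graph (graph N)" using graph_simple_card[of N] by simp
  show "edges (graph N) = lab_edge ` labels"
  proof -
    have "lab_edge ` labels = (\<lambda>(j, e). {cur j e, tip j e}) ` {(j, e). piece j e} \<union> (\<lambda>(j, x). nm j ` x) ` ({..<N} \<times> edges H)"
      by (simp add: labels_def lab_edge_def image_Un image_image case_prod_unfold)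
    moreover have "(\<lambda>(j, e). {cur j e, tip j e}) ` {(j, e). piece j e} = {{cur j e, tip j e} |j e. piece j e}"
      by (simp add: image_def) metis
    moreover have "(\<lambda>(j, x). nm j ` x) ` ({..<N} \<times> edges H) = (\<Union>j<N. hed j)"
      by (auto simp: hed_def image_def)
    ultimately show ?thesis by (simp add: edges_graph_N)
  qed
  have verts: "verts (graph N) = V ` {1..n} \<union> {B..<B + N * h}" by (simp add: graph_def)
  have Vnm: "pos (V b) \<noteq> pos (nm j x)" if "b \<in> {1..n}" "j < N" "x < h" for b j x
    using pos_V[OF that(1)] pos_nm[OF that(3)] q_in_disc[OF that(3), of j] vertex_not_in_disc[OF that(2), of b] by auto
  have VV: "V b = V c" if "b \<in> {1..n}" "c \<in> {1..n}" "pos (V b) = pos (V c)" for b c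
    using that pos_V[OF that(1)] pos_V[OF that(2)] by (auto simp: ptV_def gr_def add_eq_0_iff)
  have nmnm: "nm j x = nm k y" if "j < N" "x < h" "k < N" "y < h" "pos (nm j x) = pos (nm k y)" for j x k y
  proof -
    have eq: "T j (q x) = T k (q y)" using that(5) pos_nm[OF that(2)] pos_nm[OF that(4)] by simp
    have "j = k" using centers_apart[OF that(1,3), of "T j (q x)"] q_in_disc[OF that(2), of j] q_in_disc[OF that(4), of k] eq by simp
    then have "q x = q y" using eq T_inject by simp
    then have "x = y" using inj_onD[OF set_drawing_H(1)] that(2,4) by blast
    then show ?thesis using \<open>j = k\<close> by simp
  qed
  show "inj_on pos (verts (graph N))"
  proof (rule inj_onI)
    fix x y assume xy: "x \<in> verts (graph N)" "y \<in> verts (graph N)" "pos x = pos y"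
    have c: "(\<exists>b\<in>{1..n}. x = V b) \<or> (\<exists>j x'. j < N \<and> x' < h \<and> x = nm j x')" if "x \<in> verts (graph N)" for x
      using that unfolding verts by (metis UnE imageE new_vertex)
    from c[OF xy(1)] c[OF xy(2)] show "x = y"
    proof (elim disjE bexE exE conjE)
      fix b c assume "b \<in> {1..n}" "x = V b" "c \<in> {1..n}" "y = V c"
      then show ?thesis using VV xy(3) by simp
    next
      fix b j x' assume "b \<in> {1..n}" "x = V b" "j < N" "x' < h" "y = nm j x'"
      then show ?thesis using Vnm xy(3) by simp
    next
      fix b j x' assume "b \<in> {1..n}" "y = V b" "j < N" "x' < h" "x = nm j x'"
      then show ?thesis using Vnm[of b j x'] xy(3) by simp
    next
      fix j x' k y' assume "j < N" "x' < h" "x = nm j x'" "k < N" "y' < h" "y = nm k y'"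
      then show ?thesis using nmnm xy(3) by simp
    qed
  qed
  show "\<exists>g. arc g \<and> {pathstart g, pathfinish g} = pos ` lab_edge l \<and> path_image g = lab_set l" if "l \<in> labels" for l
  proof -
    from that consider j e where "l = Inl (j, e)" "piece j e" | j x where "l = Inr (j, x)" "j < N" "x \<in> edges H"
      by (auto simp: labels_def)
    then show ?thesis
    proof cases
      case 1
      then show ?thesis using arc_con[OF 1(2)] by (force simp: lab_edge_def lab_set_def)
    next
      case 2
      obtain g where g: "arc g" "{pathstart g, pathfinish g} = q ` x" "path_image g = S x"
        using set_drawing_H(2)[OF 2(3)] by blast
      have "{pathstart (T j \<circ> g), pathfinish (T j \<circ> g)} = T j ` {pathstart g, pathfinish g}"
        by (simp add: pathstart_compose pathfinish_compose)
      also have "\<dots> = pos ` nm j ` x"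
        unfolding g(2) image_image using edge_H[OF 2(3)] pos_nm by (intro image_cong) auto
      finally have "{pathstart (T j \<circ> g), pathfinish (T j \<circ> g)} = pos ` nm j ` x" .
      then show ?thesis using arc_T[OF g(1)] g(3) 2(1)
        by (intro exI[of _ "T j \<circ> g"]) (simp add: lab_edge_def lab_set_def path_image_compose)
    qed
  qed
  show "y \<in> lab_edge l" if l: "l \<in> labels" and y: "y \<in> verts (graph N)" "pos y \<in> lab_set l" for l y
  proof -
    from l consider j e where "l = Inl (j, e)" "piece j e" | j x where "l = Inr (j, x)" "j < N" "x \<in> edges H"
      by (auto simp: labels_def)
    then show ?thesis
    proof cases
      case 1
      then have z: "pos y \<in> con j e" using y(2) by (simp add: lab_set_def)
      have "y \<in> {cur j e, tip j e}"
      proof (cases "y \<in> V ` {1..n}")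
        case True
        then obtain b where b: "b \<in> {1..n}" "y = V b" by blast
        from z show ?thesis
        proof (cases rule: con_cases)
          case (1 s)
          then show ?thesis using curve_vertex[OF \<open>piece j e\<close> 1(1,2), of b] pos_V[OF b(1)] b(2) by simp
        next
          case (2 k i)
          note B = pend_bound[OF \<open>piece j e\<close> 2(1)]
          then show ?thesis using pd_in_disc'[OF _ 2(2)] vertex_not_in_disc[of k b] pos_V[OF b(1)] b(2) by simp
        qed
      next
        case False
        then obtain k x where k: "k < N" "x < h" "y = nm k x" using y(1) new_vertex unfolding verts by blast
        have py: "pos y = T k (q x)" using pos_nm[OF k(2)] k(3) by simp
        from z show ?thesis
        proof (cases rule: con_cases)
          case (1 s)
          then show ?thesis using curve_not_in_open_disc[OF \<open>piece j e\<close> 1(1,2) k(1)] q_in_disc[OF k(2), of k] py by simp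
        next
          case (2 l i)
          note B = pend_bound[OF \<open>piece j e\<close> 2(1)]
          have "q x \<in> q ` verts H \<union> (\<Union>e\<in>edges H. S e)" using k(2) H(2) by blast
          then have kl: "k = l" "q x = q (tt i)" using pd_meets_block[OF \<open>piece j e\<close> 2 k(1) py] by auto
          have "tt i < h" using tt_less B by simp
          then have "x = tt i" using inj_onD[OF set_drawing_H(1) kl(2)] k(2) by simp
          then show ?thesis using pend_terminal[OF \<open>piece j e\<close> 2(1)] kl(1) k(3) by simp
        qed
      qed
      then show ?thesis using 1(1) by (simp add: lab_edge_def)
    next
      case 2
      then have z: "pos y \<in> T j ` S x" using y(2) by (simp add: lab_set_def)
      have d: "dist (cen j) (pos y) < 1 / 3" by (rule S_in_disc[OF 2(3) z])
      have "y \<notin> V ` {1..n}" 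
      proof
        assume "y \<in> V ` {1..n}"
        then obtain b where b: "b \<in> {1..n}" "y = V b" by blast
        then show False using d vertex_not_in_disc[OF 2(2), of b] pos_V[OF b(1)] by simp
      qed
      then obtain k x' where k: "k < N" "x' < h" "y = nm k x'" using y(1) new_vertex unfolding verts by blast
      have py: "pos y = T k (q x')" using pos_nm[OF k(2)] k(3) by simp
      have "j = k" using centers_apart[OF 2(2) k(1), of "pos y"] d q_in_disc[OF k(2), of k] py by simp
      then have "q x' \<in> S x" using z py T_inject by auto
      then have "x' \<in> x" using set_drawing_H(3)[OF 2(3) k(2)] by simp
      then show ?thesis using 2(1) k(3) \<open>j = k\<close> by (simp add: lab_edge_def)
    qed
  qed
  show "lab_set l \<inter> lab_set m \<subseteq> pos ` (lab_edge l \<inter> lab_edge m)" if l: "l \<in> labels" "m \<in> labels" "l \<noteq> m" for l m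
  proof
    fix z assume "z \<in> lab_set l \<inter> lab_set m"
    then have z: "z \<in> lab_set l" "z \<in> lab_set m" by auto
    have c: "(\<exists>j e. l = Inl (j, e) \<and> piece j e) \<or> (\<exists>j x. l = Inr (j, x) \<and> j < N \<and> x \<in> edges H)" if "l \<in> labels" for l
      using that by (auto simp: labels_def)
    from c[OF l(1)] c[OF l(2)] show "z \<in> pos ` (lab_edge l \<inter> lab_edge m)"
    proof (elim disjE exE conjE)
      fix j e j' e' assume a: "l = Inl (j, e)" "piece j e" "m = Inl (j', e')" "piece j' e'"
      then show ?thesis using con_con[OF a(2,4)] z l(3) by (simp add: lab_set_def lab_edge_def)
    next
      fix j e k x assume a: "l = Inl (j, e)" "piece j e" "m = Inr (k, x)" "k < N" "x \<in> edges H"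
      then show ?thesis using con_block[OF a(2,4,5)] z by (simp add: lab_set_def lab_edge_def)
    next
      fix j e k x assume a: "m = Inl (j, e)" "piece j e" "l = Inr (k, x)" "k < N" "x \<in> edges H"
      then show ?thesis using con_block[OF a(2,4,5)] z by (simp add: lab_set_def lab_edge_def Int_commute)
    next
      fix j x k y assume a: "l = Inr (j, x)" "j < N" "x \<in> edges H" "m = Inr (k, y)" "k < N" "y \<in> edges H"
      then show ?thesis using block_block[OF a(2,3,5,6)] z l(3) by (simp add: lab_set_def lab_edge_def)
    qed
  qed
qed

end

section \<open>Step counts for the random access machine\<close>

definition bnd :: "nat \<Rightarrow> state \<Rightarrow> bool" where
  "bnd W s \<longleftrightarrow> (\<forall>i. fst s i < 2 ^ W \<and> fst (snd s) i < 2 ^ W)"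

text \<open>A unit step at most doubles the largest number in the state, so a bound on the number
  of unit steps bounds the logarithmic cost.\<close>
definition run :: "com \<Rightarrow> state \<Rightarrow> nat \<Rightarrow> state \<Rightarrow> bool" where
  "run c s k s' \<longleftrightarrow> (\<forall>W. bnd W s \<longrightarrow> (\<exists>T. T \<le> k * (2 * (W + k) + 4) \<and> exec c s T s' \<and> bnd (W + k) s'))"

lemma bnd_mono: "bnd W s \<Longrightarrow> W \<le> W' \<Longrightarrow> bnd W' s"
  unfolding bnd_def by (meson less_le_trans one_le_numeral power_increasing)

lemma len_le: "x < 2 ^ W \<Longrightarrow> len x \<le> W + 1"
  using floorlog_leI[of x 2 W] by (simp add: len_def)

lemma less_2_len: "x < 2 ^ len x"
proof -
  have "x < 2 ^ floorlog 2 x" using floorlog_bounds[of x 2] by (cases "x = 0") (auto simp: floorlog_def)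
  also have "\<dots> \<le> 2 ^ len x" by (rule power_increasing) (simp_all add: len_def)
  finally show ?thesis .
qed

lemma run_mono:
  assumes "run c s k s'" "k \<le> k'"
  shows "run c s k' s'"
  unfolding run_def
proof (intro allI impI)
  fix W assume "bnd W s"
  then obtain T where T: "T \<le> k * (2 * (W + k) + 4)" "exec c s T s'" "bnd (W + k) s'"
    using assms(1) unfolding run_def by blast
  have "k * (2 * (W + k) + 4) \<le> k' * (2 * (W + k') + 4)" using assms(2) by (intro mult_le_mono) auto
  then show "\<exists>T. T \<le> k' * (2 * (W + k') + 4) \<and> exec c s T s' \<and> bnd (W + k') s'"
    using T bnd_mono[OF T(3), of "W + k'"] assms(2) by (intro exI[of _ T]) auto
qed

lemma run_Seq:
  assumes "run c1 s k1 s1" "run c2 s1 k2 s2"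
  shows "run (Seq c1 c2) s (k1 + k2) s2"
  unfolding run_def
proof (intro allI impI)
  fix W assume "bnd W s"
  then obtain T1 where 1: "T1 \<le> k1 * (2 * (W + k1) + 4)" "exec c1 s T1 s1" "bnd (W + k1) s1"
    using assms(1) unfolding run_def by blast
  obtain T2 where 2: "T2 \<le> k2 * (2 * (W + k1 + k2) + 4)" "exec c2 s1 T2 s2" "bnd (W + k1 + k2) s2"
    using assms(2) 1(3) unfolding run_def by blast
  have "k1 * (2 * (W + k1) + 4) \<le> k1 * (2 * (W + (k1 + k2)) + 4)" by (intro mult_le_mono) auto
  then have "T1 + T2 \<le> (k1 + k2) * (2 * (W + (k1 + k2)) + 4)"
    using 1(1) 2(1) unfolding distrib_right add.assoc by linarith
  then show "\<exists>T. T \<le> (k1 + k2) * (2 * (W + (k1 + k2)) + 4) \<and> exec (Seq c1 c2) s T s2 \<and> bnd (W + (k1 + k2)) s2"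
    using exec.Seq[OF 1(2) 2(2)] 2(3) by (auto simp: add.assoc)
qed

text \<open>Common part of the rules for conditionals and loops: one more step pays for inspecting a
  register.\<close>

lemma run_test:
  assumes "run c s k s'" and "\<And>T. exec c s T s' \<Longrightarrow> exec d s (len (fst s x) + T) s'"
  shows "run d s (k + 1) s'"
  unfolding run_def
proof (intro allI impI)
  fix W assume b: "bnd W s"
  then obtain T where T: "T \<le> k * (2 * (W + k) + 4)" "exec c s T s'" "bnd (W + k) s'"
    using assms(1) unfolding run_def by blast
  have "len (fst s x) \<le> W + 1" using b by (intro len_le) (simp add: bnd_def)
  moreover have "k * (2 * (W + k) + 4) \<le> k * (2 * (W + (k + 1)) + 4)" by (intro mult_le_mono) auto
  moreover have "(k + 1) * (2 * (W + (k + 1)) + 4) = k * (2 * (W + (k + 1)) + 4) + (2 * (W + (k + 1)) + 4)" by simp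
  moreover have "W + 1 \<le> 2 * (W + (k + 1)) + 4" by simp
  ultimately have "len (fst s x) + T \<le> (k + 1) * (2 * (W + (k + 1)) + 4)" using T(1) by linarith
  then show "\<exists>T. T \<le> (k + 1) * (2 * (W + (k + 1)) + 4) \<and> exec d s T s' \<and> bnd (W + (k + 1)) s'"
    using assms(2)[OF T(2)] bnd_mono[OF T(3), of "W + (k + 1)"] by auto
qed

lemma run_If_nonzero: "fst s x \<noteq> 0 \<Longrightarrow> run c1 s k s' \<Longrightarrow> run (IfNZ x c1 c2) s (k + 1) s'"
  by (rule run_test) (auto intro: If_nonzero)

lemma run_If_zero: "fst s x = 0 \<Longrightarrow> run c2 s k s' \<Longrightarrow> run (IfNZ x c1 c2) s (k + 1) s'"
  by (rule run_test) (auto intro: If_zero)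

lemma run_While_nonzero: "fst s x \<noteq> 0 \<Longrightarrow> run (Seq c (WhileNZ x c)) s k s' \<Longrightarrow> run (WhileNZ x c) s (k + 1) s'"
  by (rule run_test, assumption) (auto elim!: exec_elims(8) simp: add.assoc[symmetric] intro: While_nonzero)

lemma run_primitive:
  assumes "\<And>W. bnd W s \<Longrightarrow> T \<le> 2 * W + 2" "exec c s T s'" "\<And>W. bnd W s \<Longrightarrow> bnd (W + 1) s'"
  shows "run c s 1 s'"
  unfolding run_def
proof (intro allI impI)
  fix W assume "bnd W s"
  then show "\<exists>T. T \<le> 1 * (2 * (W + 1) + 4) \<and> exec c s T s' \<and> bnd (W + 1) s'"
    using assms by (intro exI[of _ T]) fastforce
qed

lemma run_While_zero: "fst s x = 0 \<Longrightarrow> run (WhileNZ x c) s 1 s"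
  by (rule run_primitive[OF _ While_zero]) (auto simp: len_def floorlog_def intro: bnd_mono)

text \<open>From here on the name refers to programs and no longer to paths.\<close>

fun loop_free :: "com \<Rightarrow> bool" where
  "loop_free (Seq c1 c2) \<longleftrightarrow> loop_free c1 \<and> loop_free c2"
| "loop_free (IfNZ x c1 c2) \<longleftrightarrow> loop_free c1 \<and> loop_free c2"
| "loop_free (WhileNZ x c) \<longleftrightarrow> False"
| "loop_free _ \<longleftrightarrow> True"

text \<open>Both branches are added up, so the bound does not depend on the state. A constant may
  exceed every number in the state; as one step may only double the largest number, loading it
  counts as many steps as its length.\<close>

fun cost :: "com \<Rightarrow> nat" where
  "cost (Const x k) = len k"
| "cost (Seq c1 c2) = cost c1 + cost c2"
| "cost (IfNZ x c1 c2) = cost c1 + cost c2 + 1"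
| "cost _ = 1"

text \<open>The last equation is a default value: \<open>ex\<close> describes a run only for
  loop-free programs.\<close>

fun ex :: "com \<Rightarrow> state \<Rightarrow> state" where
  "ex Skip s = s"
| "ex (Const x k) (r, m, ys) = (r(x := k), m, ys)"
| "ex (Add x y z) (r, m, ys) = (r(x := r y + r z), m, ys)"
| "ex (Sub x y z) (r, m, ys) = (r(x := r y - r z), m, ys)"
| "ex (Load x y) (r, m, ys) = (r(x := m (r y)), m, ys)"
| "ex (Store x y) (r, m, ys) = (r, m(r x := r y), ys)"
| "ex (Write x) (r, m, ys) = (r, m, ys @ [r x])"
| "ex (Seq c1 c2) s = ex c2 (ex c1 s)"
| "ex (IfNZ x c1 c2) s = (if fst s x \<noteq> 0 then ex c1 s else ex c2 s)"
| "ex (WhileNZ x c) s = s"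

lemma run_Const: "run (Const x v) (r, m, ys) (len v) (r(x := v), m, ys)"
  unfolding run_def
proof (intro allI impI)
  fix W assume b: "bnd W (r, m, ys)"
  have "v < 2 ^ (W + len v)"
    by (rule less_le_trans[OF less_2_len power_increasing]) simp_all
  then have "bnd (W + len v) (r(x := v), m, ys)"
    using bnd_mono[OF b, of "W + len v"] by (auto simp: bnd_def)
  moreover have "len v \<le> len v * (2 * (W + len v) + 4)" by simp
  ultimately show "\<exists>T. T \<le> len v * (2 * (W + len v) + 4) \<and> exec (Const x v) (r, m, ys) T (r(x := v), m, ys) \<and>
      bnd (W + len v) (r(x := v), m, ys)"
    using exec.Const by blast
qed

lemma run_ex: "loop_free c \<Longrightarrow> run c s (cost c) (ex c s)"
proof (induction c arbitrary: s)
  case Skip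
  have "run Skip s 1 s" by (rule run_primitive[OF _ exec.Skip]) (auto intro: bnd_mono)
  then show ?case by simp
next
  case (Const x k)
  show ?case using run_Const by (cases s) simp
next
  case (Add x y z)
  obtain r m ys where s: "s = (r, m, ys)" by (cases s)
  show ?case unfolding s ex.simps cost.simps
  proof (rule run_primitive[OF _ exec.Add])
    fix W assume b: "bnd W (r, m, ys)"
    then have "r y < 2 ^ W" "r z < 2 ^ W" by (auto simp: bnd_def)
    then show "len (r y) + len (r z) \<le> 2 * W + 2" using len_le[of "r y" W] len_le[of "r z" W] by simp
    show "bnd (W + 1) (r(x := r y + r z), m, ys)"
      using \<open>r y < 2 ^ W\<close> \<open>r z < 2 ^ W\<close> bnd_mono[OF b, of "W + 1"] by (auto simp: bnd_def)
  qed
next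
  case (Sub x y z)
  obtain r m ys where s: "s = (r, m, ys)" by (cases s)
  show ?case unfolding s ex.simps cost.simps
  proof (rule run_primitive[OF _ exec.Sub])
    fix W assume b: "bnd W (r, m, ys)"
    then have "r y < 2 ^ W" "r z < 2 ^ W" by (auto simp: bnd_def)
    then show "len (r y) + len (r z) \<le> 2 * W + 2" using len_le[of "r y" W] len_le[of "r z" W] by simp
    show "bnd (W + 1) (r(x := r y - r z), m, ys)"
      using \<open>r y < 2 ^ W\<close> bnd_mono[OF b, of "W + 1"] by (auto simp: bnd_def less_imp_diff_less)
  qed
next
  case (Load x y)
  obtain r m ys where s: "s = (r, m, ys)" by (cases s)
  show ?case unfolding s ex.simps cost.simps
  proof (rule run_primitive[OF _ exec.Load])
    fix W assume b: "bnd W (r, m, ys)"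
    then have "r y < 2 ^ W" "m (r y) < 2 ^ W" by (auto simp: bnd_def)
    then show "len (r y) + len (m (r y)) \<le> 2 * W + 2" using len_le[of "r y" W] len_le[of "m (r y)" W] by simp
    show "bnd (W + 1) (r(x := m (r y)), m, ys)"
      using bnd_mono[OF b, of "W + 1"] by (auto simp: bnd_def)
  qed
next
  case (Store x y)
  obtain r m ys where s: "s = (r, m, ys)" by (cases s)
  show ?case unfolding s ex.simps cost.simps
  proof (rule run_primitive[OF _ exec.Store])
    fix W assume b: "bnd W (r, m, ys)"
    then have "r x < 2 ^ W" "r y < 2 ^ W" by (auto simp: bnd_def)
    then show "len (r x) + len (r y) \<le> 2 * W + 2" using len_le[of "r x" W] len_le[of "r y" W] by simp
    show "bnd (W + 1) (r, m(r x := r y), ys)"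
      using bnd_mono[OF b, of "W + 1"] by (auto simp: bnd_def)
  qed
next
  case (Write x)
  obtain r m ys where s: "s = (r, m, ys)" by (cases s)
  show ?case unfolding s ex.simps cost.simps
  proof (rule run_primitive[OF _ exec.Write])
    fix W assume b: "bnd W (r, m, ys)"
    then have "r x < 2 ^ W" by (auto simp: bnd_def)
    then show "len (r x) \<le> 2 * W + 2" using len_le[of "r x" W] by simp
    show "bnd (W + 1) (r, m, ys @ [r x])"
      using bnd_mono[OF b, of "W + 1"] by (auto simp: bnd_def)
  qed
next
  case (Seq c1 c2)
  then have "run (Seq c1 c2) s (cost c1 + cost c2) (ex c2 (ex c1 s))"
    by (intro run_Seq[of c1 s "cost c1" "ex c1 s"]) simp_all
  then show ?case by simp
next
  case (IfNZ x c1 c2)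
  show ?case
  proof (cases "fst s x = 0")
    case True
    have "run c2 s (cost c2) (ex c2 s)" using IfNZ by simp
    from run_mono[OF run_If_zero[OF True this], of "cost (IfNZ x c1 c2)"] True show ?thesis by simp
  next
    case False
    have "run c1 s (cost c1) (ex c1 s)" using IfNZ by simp
    from run_mono[OF run_If_nonzero[OF False this], of "cost (IfNZ x c1 c2)"] False show ?thesis by simp
  qed
qed simp

text \<open>Total correctness together with a step count. By \<open>run_mono\<close> the count is an
  upper bound, so costs may be rounded up freely.\<close>

definition wp :: "com \<Rightarrow> nat \<Rightarrow> (state \<Rightarrow> bool) \<Rightarrow> state \<Rightarrow> bool" where
  "wp c k Q s \<longleftrightarrow> (\<exists>s'. run c s k s' \<and> Q s')"

lemma wp_mono: "wp c k Q s \<Longrightarrow> k \<le> k' \<Longrightarrow> (\<And>s. Q s \<Longrightarrow> Q' s) \<Longrightarrow> wp c k' Q' s"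
  unfolding wp_def using run_mono by blast

lemma wp_ex: "loop_free c \<Longrightarrow> Q (ex c s) \<Longrightarrow> wp c (cost c) Q s"
  unfolding wp_def using run_ex by blast

lemma wp_Seq: "wp c1 k1 Q1 s \<Longrightarrow> (\<And>s. Q1 s \<Longrightarrow> wp c2 k2 Q s) \<Longrightarrow> wp (Seq c1 c2) (k1 + k2) Q s"
  unfolding wp_def using run_Seq by blast

lemma wp_If:
  "(fst s x \<noteq> 0 \<Longrightarrow> wp c1 k Q s) \<Longrightarrow> (fst s x = 0 \<Longrightarrow> wp c2 k Q s) \<Longrightarrow> wp (IfNZ x c1 c2) (k + 1) Q s"
  unfolding wp_def using run_If_nonzero run_If_zero by (cases "fst s x = 0") blast+

lemma wp_While_down:
  assumes "\<And>i s. 0 < i \<Longrightarrow> i \<le> n \<Longrightarrow> fst s x = i \<Longrightarrow> I i s \<Longrightarrow> wp c k (\<lambda>s'. fst s' x = i - 1 \<and> I (i - 1) s') s"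
    and "fst s x = n" "I n s"
  shows "wp (WhileNZ x c) (n * (k + 1) + 1) (\<lambda>s'. fst s' x = 0 \<and> I 0 s') s"
proof -
  have "wp (WhileNZ x c) (i * (k + 1) + 1) (\<lambda>s'. fst s' x = 0 \<and> I 0 s') s" if "i \<le> n" "fst s x = i" "I i s" for i s
    using that
  proof (induction i arbitrary: s)
    case 0
    then have "run (WhileNZ x c) s 1 s" by (intro run_While_zero) simp
    then show ?case using 0 unfolding wp_def by (intro exI[of _ s]) simp
  next
    case (Suc i)
    obtain s1 where s1: "run c s k s1" "fst s1 x = i" "I i s1"
      using assms(1)[of "Suc i" s] Suc.prems unfolding wp_def by auto
    obtain s2 where s2: "run (WhileNZ x c) s1 (i * (k + 1) + 1) s2" "fst s2 x = 0 \<and> I 0 s2"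
      using Suc.IH[of s1] Suc.prems s1 unfolding wp_def by auto
    have "run (WhileNZ x c) s (k + (i * (k + 1) + 1) + 1) s2"
      by (rule run_While_nonzero[OF _ run_Seq[OF s1(1) s2(1)]]) (use Suc.prems in simp)
    moreover have "k + (i * (k + 1) + 1) + 1 = Suc i * (k + 1) + 1" by simp
    ultimately show ?case using s2(2) unfolding wp_def by metis
  qed
  then show ?thesis using assms(2,3) by blast
qed

text \<open>All programs below keep the constant 1 in register 3.\<close>

definition "copy x y = Seq (Const x 0) (Add x x y)"
definition "for_down x y c = Seq (copy x y) (WhileNZ x (Seq c (Sub x x 3)))"
definition "for_up i x y c = Seq (Seq (Const i 0) (copy x y)) (WhileNZ x (Seq (Add i i 3) (Seq c (Sub x x 3))))"

lemma wp_for_down: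
  assumes body: "\<And>i r m ys. 0 < i \<Longrightarrow> i \<le> n \<Longrightarrow> r x = i \<Longrightarrow> I i (r, m, ys) \<Longrightarrow>
      wp c k (\<lambda>s'. fst s' x = i \<and> fst s' 3 = 1 \<and> I (i - 1) s') (r, m, ys)"
    and stable: "\<And>i r m ys v. I i (r, m, ys) \<Longrightarrow> I i (r(x := v), m, ys)"
    and "x \<noteq> y" "r y = n" "I n (r, m, ys)"
  shows "wp (for_down x y c) (n * (k + 2) + 4) (\<lambda>s'. I 0 s') (r, m, ys)"
proof -
  have len0: "len 0 = 1" by (simp add: len_def floorlog_def)
  have "wp (WhileNZ x (Seq c (Sub x x 3))) (n * (k + 1 + 1) + 1) (\<lambda>s'. fst s' x = 0 \<and> I 0 s') (r(x := n), m, ys)"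
  proof (rule wp_While_down)
    fix i s assume i: "0 < i" "i \<le> n" "fst s x = i" "I i s"
    obtain r m ys where s: "s = (r, m, ys)" by (cases s)
    show "wp (Seq c (Sub x x 3)) (k + 1) (\<lambda>s'. fst s' x = i - 1 \<and> I (i - 1) s') s"
    proof (rule wp_Seq)
      show "wp c k (\<lambda>s'. fst s' x = i \<and> fst s' 3 = 1 \<and> I (i - 1) s') s"
        unfolding s by (rule body) (use i s in auto)
      fix s' assume q: "fst s' x = i \<and> fst s' 3 = 1 \<and> I (i - 1) s'"
      obtain r' m' ys' where s': "s' = (r', m', ys')" by (cases s')
      show "wp (Sub x x 3) 1 (\<lambda>s'. fst s' x = i - 1 \<and> I (i - 1) s') s'"
        using wp_ex[of "Sub x x 3" "\<lambda>s'. fst s' x = i - 1 \<and> I (i - 1) s'" s'] q stable unfolding s' by simp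
    qed
  qed (use assms in auto)
  moreover have "run (copy x y) (r, m, ys) 2 (r(x := n), m, ys)"
    using run_ex[of "copy x y" "(r, m, ys)"] assms(3,4) len0 by (simp add: copy_def numeral_2_eq_2)
  ultimately have "wp (for_down x y c) (2 + (n * (k + 1 + 1) + 1)) (\<lambda>s'. fst s' x = 0 \<and> I 0 s') (r, m, ys)"
    unfolding for_down_def wp_def using run_Seq by blast
  then show ?thesis by (rule wp_mono) auto
qed

text \<open>A loop can only test for zero, so \<open>x\<close> counts the remaining rounds down
  while \<open>i\<close> counts up. The invariant is indexed by the number of completed rounds,
  which is why \<open>J\<close> reverses the index.\<close>

lemma wp_for_up:
  assumes body: "\<And>j r m ys. 0 < j \<Longrightarrow> j \<le> n \<Longrightarrow> r i = j \<Longrightarrow> I (j - 1) (r, m, ys) \<Longrightarrow>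
      wp c k (\<lambda>s'. fst s' i = j \<and> fst s' x = r x \<and> fst s' 3 = 1 \<and> I j s') (r, m, ys)"
    and stable: "\<And>j r m ys v. I j (r, m, ys) \<Longrightarrow> I j (r(x := v), m, ys)"
      "\<And>j r m ys v. I j (r, m, ys) \<Longrightarrow> I j (r(i := v), m, ys)"
    and one: "\<And>j r m ys. I j (r, m, ys) \<Longrightarrow> r 3 = 1"
    and reg: "x \<noteq> y" "i \<noteq> y" "i \<noteq> x" "i \<noteq> 3" and "r y = n" "I 0 (r, m, ys)"
  shows "wp (for_up i x y c) (n * (k + 3) + 5) (\<lambda>s'. I n s') (r, m, ys)"
proof -
  have len0: "len 0 = 1" by (simp add: len_def floorlog_def)
  define J where "J l s \<longleftrightarrow> fst s i = n - l \<and> I (n - l) s" for l and s :: state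
  have "wp (WhileNZ x (Seq (Add i i 3) (Seq c (Sub x x 3)))) (n * (k + 2 + 1) + 1) (\<lambda>s'. fst s' x = 0 \<and> J 0 s') (r(i := 0, x := n), m, ys)"
  proof (rule wp_While_down)
    fix l s assume l: "0 < l" "l \<le> n" "fst s x = l" "J l s"
    obtain r m ys where s: "s = (r, m, ys)" by (cases s)
    have I: "r i = n - l" "I (n - l) (r, m, ys)" using l(4) s by (auto simp: J_def)
    define r1 where "r1 = r(i := n - l + 1)"
    have e1: "ex (Add i i 3) (r, m, ys) = (r1, m, ys)" using I one[OF I(2)] by (simp add: r1_def)
    have I1: "I (n - l) (r1, m, ys)" unfolding r1_def using stable(2)[OF I(2)] .
    have lj: "n - l + 1 - 1 = n - l" "n - (l - 1) = n - l + 1" using l by auto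
    have c: "wp c k (\<lambda>s'. fst s' i = n - l + 1 \<and> fst s' x = l \<and> fst s' 3 = 1 \<and> I (n - l + 1) s') (r1, m, ys)"
    proof (rule wp_mono[OF body[of "n - l + 1" r1 m ys] order_refl])
      show "I (n - l + 1 - 1) (r1, m, ys)" unfolding lj by (rule I1)
      fix s assume "fst s i = n - l + 1 \<and> fst s x = r1 x \<and> fst s 3 = 1 \<and> I (n - l + 1) s"
      moreover have "r1 x = l" using l(3) s reg(3) by (simp add: r1_def)
      ultimately show "fst s i = n - l + 1 \<and> fst s x = l \<and> fst s 3 = 1 \<and> I (n - l + 1) s" by simp
    qed (use l in \<open>auto simp: r1_def\<close>)
    have "wp (Seq (Add i i 3) (Seq c (Sub x x 3))) (1 + (k + 1)) (\<lambda>s'. fst s' x = l - 1 \<and> J (l - 1) s') s"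
    proof (rule wp_Seq)
      show "wp (Add i i 3) 1 (\<lambda>s'. s' = (r1, m, ys)) s"
        using wp_ex[of "Add i i 3" "\<lambda>s'. s' = (r1, m, ys)" s] e1 unfolding s by simp
      fix s' assume s': "s' = (r1, m, ys)"
      show "wp (Seq c (Sub x x 3)) (k + 1) (\<lambda>s'. fst s' x = l - 1 \<and> J (l - 1) s') s'"
        unfolding s'
      proof (rule wp_Seq[OF c])
        fix s2 assume q: "fst s2 i = n - l + 1 \<and> fst s2 x = l \<and> fst s2 3 = 1 \<and> I (n - l + 1) s2"
        obtain r2 m2 ys2 where s2: "s2 = (r2, m2, ys2)" by (cases s2)
        have "fst (ex (Sub x x 3) s2) x = l - 1 \<and> J (l - 1) (ex (Sub x x 3) s2)"
          using q reg(3) stable(1)[of "n - l + 1" r2 m2 ys2] unfolding s2 J_def lj by simp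
        then show "wp (Sub x x 3) 1 (\<lambda>s'. fst s' x = l - 1 \<and> J (l - 1) s') s2"
          using wp_ex[of "Sub x x 3" "\<lambda>s'. fst s' x = l - 1 \<and> J (l - 1) s'" s2] by simp
      qed
    qed
    then show "wp (Seq (Add i i 3) (Seq c (Sub x x 3))) (k + 2) (\<lambda>s'. fst s' x = l - 1 \<and> J (l - 1) s') s"
      by (rule wp_mono) auto
  next
    show "J n (r(i := 0, x := n), m, ys)" using reg assms(10) stable unfolding J_def by simp
  qed simp
  moreover have "run (Seq (Const i 0) (copy x y)) (r, m, ys) 3 (r(i := 0, x := n), m, ys)"
    using run_ex[of "Seq (Const i 0) (copy x y)" "(r, m, ys)"] reg assms(9) len0 by (simp add: copy_def numeral_3_eq_3)
  ultimately have "wp (for_up i x y c) (3 + (n * (k + 2 + 1) + 1)) (\<lambda>s'. fst s' x = 0 \<and> J 0 s') (r, m, ys)"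
    unfolding for_up_def wp_def using run_Seq by blast
  then show ?thesis by (rule wp_mono) (auto simp: J_def algebra_simps)
qed

fun seqs :: "com list \<Rightarrow> com" where
  "seqs [] = Skip"
| "seqs (c # cs) = Seq c (seqs cs)"

lemma loop_free_seqs: "loop_free (seqs cs) \<longleftrightarrow> (\<forall>c\<in>set cs. loop_free c)"
  by (induction cs) auto

section \<open>The sweep over all crossings\<close>

text \<open>Registers from 20 on are loop counters and scratch, while lasting data are kept below
  20. Invariants with this property survive the bookkeeping of all loops.\<close>

definition stab :: "(state \<Rightarrow> bool) \<Rightarrow> bool" where
  "stab I \<longleftrightarrow> (\<forall>r m ys r'. I (r, m, ys) \<longrightarrow> (\<forall>y<20. r' y = r y) \<longrightarrow> I (r', m, ys))"

abbreviation kept :: "nat set \<Rightarrow> state \<Rightarrow> state \<Rightarrow> bool" where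
  "kept K s s' \<equiv> \<forall>y\<in>K. fst s' y = fst s y"

lemma stabD: "stab I \<Longrightarrow> I (r, m, ys) \<Longrightarrow> 20 \<le> x \<Longrightarrow> I (r(x := v), m, ys)"
  unfolding stab_def by simp

text \<open>\<open>G p\<close> describes the state after the events \<open>p\<close>, a ghost
  history that no register holds. If round \<open>j\<close> performs the events \<open>f j\<close>,
  the loop performs their concatenation; nested loops then give nested concatenations.\<close>

lemma wp_up_events:
  assumes G: "\<And>p. stab (G p)" "\<And>p s. G p s \<Longrightarrow> fst s 3 = 1 \<and> fst s 1 = n"
    and reg: "20 \<le> i" "20 \<le> x" "i \<noteq> x" "i \<notin> K" "x \<notin> K"
    and body: "\<And>j p s. 0 < j \<Longrightarrow> j \<le> n \<Longrightarrow> fst s i = j \<Longrightarrow> kept K s0 s \<Longrightarrow> G p s \<Longrightarrow>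
      wp c k (\<lambda>s'. kept (insert i (insert x K)) s s' \<and> G (p @ f j) s') s"
    and s0: "G p s0"
  shows "wp (for_up i x 1 c) (n * (k + 3) + 5) (\<lambda>s'. kept K s0 s' \<and> G (p @ concat (map f [1..<n + 1])) s') s0"
proof -
  obtain r m ys where s: "s0 = (r, m, ys)" by (cases s0)
  define I where "I j s \<longleftrightarrow> kept K s0 s \<and> G (p @ concat (map f [1..<j + 1])) s" for j s
  have st: "I j (r(y := v), m, ys)" if "I j (r, m, ys)" "y = i \<or> y = x" for j r m ys y v
    using that stabD[OF G(1), of _ r m ys y v] reg unfolding I_def by auto
  have "wp (for_up i x 1 c) (n * (k + 3) + 5) (\<lambda>s'. I n s') (r, m, ys)"
  proof (rule wp_for_up)
    fix j r m ys assume j: "0 < j" "j \<le> n" "r i = j" "I (j - 1) (r, m, ys)"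
    let ?p = "p @ concat (map f [1..<j - 1 + 1])"
    have "[1..<j + 1] = [1..<j - 1 + 1] @ [j]" using j(1) by simp
    then have e: "?p @ f j = p @ concat (map f [1..<j + 1])" by simp
    have "wp c k (\<lambda>s'. kept (insert i (insert x K)) (r, m, ys) s' \<and> G (?p @ f j) s') (r, m, ys)"
      by (rule body) (use j in \<open>simp_all add: I_def\<close>)
    then show "wp c k (\<lambda>s'. fst s' i = j \<and> fst s' x = r x \<and> fst s' 3 = 1 \<and> I j s') (r, m, ys)"
    proof (rule wp_mono[OF _ order_refl])
      fix s assume *: "kept (insert i (insert x K)) (r, m, ys) s \<and> G (?p @ f j) s"
      then have "fst s 3 = 1" using G(2) by blast
      then show "fst s i = j \<and> fst s x = r x \<and> fst s 3 = 1 \<and> I j s"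
        using * j(3,4) unfolding e I_def by simp
    qed
  qed (use reg st s0 s G(2) in \<open>fastforce simp: I_def\<close>)+
  then show ?thesis unfolding s I_def .
qed

lemma wp_down_events:
  assumes G: "\<And>p. stab (G p)" "\<And>p s. G p s \<Longrightarrow> fst s 3 = 1 \<and> fst s 1 = n"
    and reg: "20 \<le> x" "x \<notin> K"
    and body: "\<And>j p s. 0 < j \<Longrightarrow> j \<le> n \<Longrightarrow> fst s x = j \<Longrightarrow> kept K s0 s \<Longrightarrow> G p s \<Longrightarrow>
      wp c k (\<lambda>s'. kept (insert x K) s s' \<and> G (p @ f j) s') s"
    and s0: "G p s0"
  shows "wp (for_down x 1 c) (n * (k + 2) + 4) (\<lambda>s'. kept K s0 s' \<and> G (p @ concat (map f (rev [1..<n + 1]))) s') s0"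
proof -
  obtain r m ys where s: "s0 = (r, m, ys)" by (cases s0)
  define I where "I j s \<longleftrightarrow> kept K s0 s \<and> G (p @ concat (map f (rev [j + 1..<n + 1]))) s" for j s
  have "wp (for_down x 1 c) (n * (k + 2) + 4) (\<lambda>s'. I 0 s') (r, m, ys)"
  proof (rule wp_for_down)
    fix j r m ys assume j: "0 < j" "j \<le> n" "r x = j" "I j (r, m, ys)"
    let ?p = "p @ concat (map f (rev [j + 1..<n + 1]))"
    have "[j - 1 + 1..<n + 1] = j # [j + 1..<n + 1]" using j(1,2) by (simp add: upt_rec)
    then have e: "?p @ f j = p @ concat (map f (rev [j - 1 + 1..<n + 1]))" by simp
    have "wp c k (\<lambda>s'. kept (insert x K) (r, m, ys) s' \<and> G (?p @ f j) s') (r, m, ys)"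
      by (rule body) (use j in \<open>simp_all add: I_def\<close>)
    then show "wp c k (\<lambda>s'. fst s' x = j \<and> fst s' 3 = 1 \<and> I (j - 1) s') (r, m, ys)"
    proof (rule wp_mono[OF _ order_refl])
      fix s assume *: "kept (insert x K) (r, m, ys) s \<and> G (?p @ f j) s"
      then have "fst s 3 = 1" using G(2) by blast
      then show "fst s x = j \<and> fst s 3 = 1 \<and> I (j - 1) s"
        using * j(3,4) unfolding e I_def by simp
    qed
  next
    fix i r m ys v assume "I i (r, m, ys)"
    then show "I i (r(x := v), m, ys)" using stabD[OF G(1), of _ r m ys x v] reg unfolding I_def by auto
  next
    show "x \<noteq> 1" using reg(1) by auto
    show "r 1 = n" using G(2) s0 s by fastforce
    show "I n (r, m, ys)" using s0 s by (simp add: I_def)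
  qed
  then show ?thesis unfolding s I_def by simp
qed

text \<open>The crossing of \<open>(a, b)\<close> and \<open>(c, d)\<close> is replaced; the last
  piece of edge \<open>(a, b)\<close> is complete; the old vertex at position \<open>b\<close> is
  placed.\<close>

datatype event = Cross nat nat nat nat | Finish nat nat | Vertex nat

text \<open>The directions of the loops here and in the next two definitions, up for
  \<open>b\<close> and \<open>c\<close> and down for \<open>a\<close> and \<open>d\<close>, produce
  exactly the order \<open>xless\<close>.\<close>

definition "crosses E n a b = concat (map (\<lambda>c. concat (map (\<lambda>d.
  if (c, d) \<in> E \<and> c < b \<and> a < c \<and> b < d then [Cross a b c d] else []) (rev [1..<n + 1]))) [1..<n + 1])"
text \<open>Vertex \<open>b\<close> comes last, so that all blocks of this phase are placed directly
  before it. An edge is finished right after its crossings with edges that end later, because those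
  with edges that end earlier belong to previous phases.\<close>

definition "phase E n b = concat (map (\<lambda>a. if (a, b) \<in> E then crosses E n a b @ [Finish a b] else []) (rev [1..<n + 1])) @ [Vertex b]"
definition "events E n = concat (map (phase E n) [1..<n + 1])"

text \<open>The row table at \<open>3S\<close> replaces a multiplication: row \<open>a\<close> of the matrix starts at \<open>(4 + a)S\<close>.\<close>
definition "look x y = seqs [Add 30 8 x, Load 30 30, Add 30 30 y, Load 30 30]"
text \<open>Registers 20, 22, 23 and 25 hold \<open>b\<close>, \<open>a\<close>, \<open>c\<close>
  and \<open>d\<close>. Truncated subtraction serves as comparison: registers 31 to 33 are nonzero
  exactly if \<open>c < b\<close>, \<open>a < c\<close> and \<open>b < d\<close>.\<close>

definition "sweep BX BF BV =
  for_up 20 21 1 (Seq (for_down 22 1 (Seq (look 22 20) (IfNZ 30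
    (Seq (for_up 23 24 1 (for_down 25 1 (Seq (look 23 25) (IfNZ 30
       (seqs [Sub 31 20 23, Sub 32 23 22, Sub 33 25 20, IfNZ 31 (IfNZ 32 (IfNZ 33 BX Skip) Skip) Skip]) Skip))))
     BF) Skip))) BV)"

definition matrix :: "nat \<Rightarrow> nat \<Rightarrow> (nat \<times> nat) set \<Rightarrow> state \<Rightarrow> bool" where
  "matrix S n E s \<longleftrightarrow> fst s 1 = n \<and> fst s 3 = 1 \<and> fst s 8 = 3 * S \<and>
    (\<forall>i\<in>{1..n}. fst (snd s) (3 * S + i) = (4 + i) * S) \<and>
    (\<forall>a\<in>{1..n}. \<forall>b\<in>{1..n}. fst (snd s) ((4 + a) * S + b) \<noteq> 0 \<longleftrightarrow> (a, b) \<in> E)"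

lemma ex_look:
  assumes "matrix S n E s" "x \<noteq> 30" "y \<noteq> 30" "fst s x \<in> {1..n}" "fst s y \<in> {1..n}"
  shows "\<exists>v. ex (look x y) s = ((fst s)(30 := v), snd s) \<and> (v \<noteq> 0 \<longleftrightarrow> (fst s x, fst s y) \<in> E)"
proof -
  obtain r m ys where s: "s = (r, m, ys)" by (cases s)
  have "ex (look x y) s = ((fst s)(30 := m ((4 + r x) * S + r y)), snd s)"
    using assms unfolding s look_def matrix_def by simp
  moreover have "m ((4 + r x) * S + r y) \<noteq> 0 \<longleftrightarrow> (r x, r y) \<in> E"
    using assms unfolding s matrix_def by (simp del: One_nat_def)
  ultimately show ?thesis unfolding s by auto
qed

lemma loop_free_look: "loop_free (look x y)"
  by (simp add: look_def)

definition "sweep_cost n x f v =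
  n * (n * (n * (n * (19 + x) + 7) + 13 + f) + 7 + v) + 5"

text \<open>One proof for all three sweeps of the algorithm, which differ only in the loop-free
  bodies that handle the three kinds of events.\<close>

lemma wp_sweep:
  assumes G: "\<And>p. stab (G p)" "\<And>p s. G p s \<Longrightarrow> matrix S n E s"
    and E: "\<And>a b. (a, b) \<in> E \<Longrightarrow> 1 \<le> a \<and> a < b \<and> b \<le> n"
    and free: "loop_free BX" "loop_free BF" "loop_free BV"
    and X: "\<And>a b c d p s. G p s \<Longrightarrow> fst s 22 = a \<Longrightarrow> fst s 20 = b \<Longrightarrow> fst s 23 = c \<Longrightarrow> fst s 25 = d \<Longrightarrow>
      (a, b) \<in> E \<Longrightarrow> (c, d) \<in> E \<Longrightarrow> a < c \<Longrightarrow> c < b \<Longrightarrow> b < d \<Longrightarrow>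
      kept {20..25} s (ex BX s) \<and> G (p @ [Cross a b c d]) (ex BX s)"
    and F: "\<And>a b p s. G p s \<Longrightarrow> fst s 22 = a \<Longrightarrow> fst s 20 = b \<Longrightarrow> (a, b) \<in> E \<Longrightarrow>
      kept {20..25} s (ex BF s) \<and> G (p @ [Finish a b]) (ex BF s)"
    and V: "\<And>b p s. G p s \<Longrightarrow> fst s 20 = b \<Longrightarrow> 1 \<le> b \<Longrightarrow> b \<le> n \<Longrightarrow>
      kept {20..25} s (ex BV s) \<and> G (p @ [Vertex b]) (ex BV s)"
    and s0: "G [] s0"
  shows "wp (sweep BX BF BV) (sweep_cost n (cost BX) (cost BF) (cost BV)) (\<lambda>s'. G (events E n) s') s0"
proof -
  let ?T = "Seq (look 23 25) (IfNZ 30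
    (seqs [Sub 31 20 23, Sub 32 23 22, Sub 33 25 20, IfNZ 31 (IfNZ 32 (IfNZ 33 BX Skip) Skip) Skip]) Skip)"
  have base: "fst s 3 = 1 \<and> fst s 1 = n" if "G p s" for p s
    using G(2)[OF that] unfolding matrix_def by blast
  have T: "kept {20..25} s (ex ?T s) \<and> G (p @ (if (c, d) \<in> E \<and> c < b \<and> a < c \<and> b < d then [Cross a b c d] else [])) (ex ?T s)"
    if s: "G p s" "fst s 22 = a" "fst s 20 = b" "fst s 23 = c" "fst s 25 = d" "(a, b) \<in> E" "c \<in> {1..n}" "d \<in> {1..n}"
    for p s a b c d
  proof -
    obtain r m ys where rs: "s = (r, m, ys)" by (cases s)
    obtain v where v: "ex (look 23 25) s = (r(30 := v), m, ys)" "v \<noteq> 0 \<longleftrightarrow> (c, d) \<in> E"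
      using ex_look[OF G(2)[OF s(1)], of 23 25] s rs by auto
    let ?r = "r(30 := v, 31 := b - c, 32 := c - a, 33 := d - b)"
    have st: "G p (?r, m, ys)" "G p (r(30 := v), m, ys)"
      using s(1) G(1)[of p] unfolding rs stab_def by fastforce+
    have "ex ?T s = (if (c, d) \<in> E \<and> c < b \<and> a < c \<and> b < d then ex BX (?r, m, ys) else if (c, d) \<in> E then (?r, m, ys) else (r(30 := v), m, ys))"
      using s(2-5) v unfolding ex.simps(8) v(1) by (simp add: rs)
    moreover have "kept {20..25} s (?r, m, ys)" "kept {20..25} s (r(30 := v), m, ys)" unfolding rs by auto
    moreover have "kept {20..25} (?r, m, ys) (ex BX (?r, m, ys)) \<and> G (p @ [Cross a b c d]) (ex BX (?r, m, ys))"
      if "(c, d) \<in> E \<and> c < b \<and> a < c \<and> b < d"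
      using X[OF st(1), of a b c d] s(2-6) that unfolding rs by auto
    ultimately show ?thesis using st by auto
  qed
  have freeT: "loop_free ?T" using free by (simp add: loop_free_look)
  have d: "wp (for_down 25 1 ?T) (n * (cost ?T + 2) + 4)
      (\<lambda>s'. kept {20..24} s s' \<and> G (p @ concat (map (\<lambda>d. if (c, d) \<in> E \<and> c < b \<and> a < c \<and> b < d then [Cross a b c d] else []) (rev [1..<n + 1]))) s') s"
    if s: "G p s" "fst s 22 = a" "fst s 20 = b" "fst s 23 = c" "(a, b) \<in> E" "c \<in> {1..n}" for p s a b c
  proof (rule wp_down_events[where G = G, OF G(1) base])
    fix j p s' assume *: "0 < j" "j \<le> n" "fst s' 25 = j" "kept {20..24} s s'" "G p s'"
    have "kept {20..25} s' (ex ?T s') \<and> G (p @ (if (c, j) \<in> E \<and> c < b \<and> a < c \<and> b < j then [Cross a b c j] else [])) (ex ?T s')"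
      by (rule T) (use * s in auto)
    moreover have "insert 25 {20..24} = {20..25::nat}" by auto
    ultimately show "wp ?T (cost ?T) (\<lambda>s''. kept (insert 25 {20..24}) s' s'' \<and>
        G (p @ (if (c, j) \<in> E \<and> c < b \<and> a < c \<and> b < j then [Cross a b c j] else [])) s'') s'"
      by (intro wp_ex[OF freeT]) simp
  qed (use s in auto)
  let ?C = "for_up 23 24 1 (for_down 25 1 ?T)" and ?kd = "n * (cost ?T + 2) + 4"
  have c: "wp ?C (n * (?kd + 3) + 5) (\<lambda>s'. kept {20..22} s s' \<and> G (p @ crosses E n a b) s') s"
    if s: "G p s" "fst s 22 = a" "fst s 20 = b" "(a, b) \<in> E" for p s a b
    unfolding crosses_def
  proof (rule wp_up_events[where G = G, OF G(1) base])
    fix j p s' assume *: "0 < j" "j \<le> n" "fst s' 23 = j" "kept {20..22} s s'" "G p s'"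
    show "wp (for_down 25 1 ?T) ?kd (\<lambda>s''. kept (insert 23 (insert 24 {20..22})) s' s'' \<and>
       G (p @ concat (map (\<lambda>d. if (j, d) \<in> E \<and> j < b \<and> a < j \<and> b < d then [Cross a b j d] else []) (rev [1..<n + 1]))) s'') s'"
      by (rule wp_mono[OF d[OF *(5)] order_refl]) (use * s in auto)
  qed (use s in auto)
  let ?A = "Seq (look 22 20) (IfNZ 30 (Seq ?C BF) Skip)"
  let ?ka = "cost (look 0 0) + (n * (?kd + 3) + 5 + cost BF + 1)"
  have cl: "cost (look x y) = cost (look 0 0)" for x y by (simp add: look_def)
  have a: "wp ?A ?ka (\<lambda>s'. kept {20..22} s s' \<and> G (p @ (if (a, b) \<in> E then crosses E n a b @ [Finish a b] else [])) s') s"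
    if s: "G p s" "fst s 22 = a" "fst s 20 = b" "a \<in> {1..n}" "b \<in> {1..n}" for p s a b
  proof (rule wp_Seq)
    show "wp (look 22 20) (cost (look 0 0)) (\<lambda>s'. (fst s' 30 \<noteq> 0 \<longleftrightarrow> (a, b) \<in> E) \<and> kept {20..22} s s' \<and> G p s') s"
    proof -
      obtain r m ys where rs: "s = (r, m, ys)" by (cases s)
      obtain v where v: "ex (look 22 20) s = (r(30 := v), m, ys)" "v \<noteq> 0 \<longleftrightarrow> (a, b) \<in> E"
        using ex_look[OF G(2)[OF s(1)], of 22 20] s rs by auto
      have "G p (r(30 := v), m, ys)" using s(1) G(1)[of p] unfolding rs stab_def by fastforce
      then show ?thesis using wp_ex[OF loop_free_look[of 22 20], of _ s] v rs cl[of 22 20] by auto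
    qed
    fix s1 assume s1: "(fst s1 30 \<noteq> 0 \<longleftrightarrow> (a, b) \<in> E) \<and> kept {20..22} s s1 \<and> G p s1"
    show "wp (IfNZ 30 (Seq ?C BF) Skip) (n * (?kd + 3) + 5 + cost BF + 1)
      (\<lambda>s'. kept {20..22} s s' \<and> G (p @ (if (a, b) \<in> E then crosses E n a b @ [Finish a b] else [])) s') s1"
    proof (rule wp_If)
      assume "fst s1 30 = 0"
      then show "wp Skip (n * (?kd + 3) + 5 + cost BF)
          (\<lambda>s'. kept {20..22} s s' \<and> G (p @ (if (a, b) \<in> E then crosses E n a b @ [Finish a b] else [])) s') s1"
        by (intro wp_mono[OF wp_ex[of Skip "\<lambda>s'. s' = s1"]]) (use s1 in auto)
    next
      assume "fst s1 30 \<noteq> 0"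
      then have ab: "(a, b) \<in> E" using s1 by blast
      show "wp (Seq ?C BF) (n * (?kd + 3) + 5 + cost BF)
          (\<lambda>s'. kept {20..22} s s' \<and> G (p @ (if (a, b) \<in> E then crosses E n a b @ [Finish a b] else [])) s') s1"
      proof (rule wp_Seq[OF c[of p s1 a b]])
        fix s2 assume s2: "kept {20..22} s1 s2 \<and> G (p @ crosses E n a b) s2"
        have "kept {20..25} s2 (ex BF s2) \<and> G ((p @ crosses E n a b) @ [Finish a b]) (ex BF s2)"
          by (rule F) (use s1 s2 s ab in auto)
        then show "wp BF (cost BF) (\<lambda>s'. kept {20..22} s s' \<and> G (p @ (if (a, b) \<in> E then crosses E n a b @ [Finish a b] else [])) s') s2"
          by (intro wp_ex[OF free(2)]) (use s1 s2 ab in simp)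
      qed (use s1 s ab in auto)
    qed
  qed
  let ?kA = "n * (?ka + 2) + 4"
  have k: "sweep_cost n (cost BX) (cost BF) (cost BV) = n * (?kA + cost BV + 3) + 5"
    unfolding sweep_cost_def by (simp add: look_def algebra_simps)
  have "wp (sweep BX BF BV) (n * (?kA + cost BV + 3) + 5) (\<lambda>s'. kept {} s0 s' \<and> G ([] @ events E n) s') s0"
    unfolding sweep_def events_def
  proof (rule wp_up_events[where G = G, OF G(1) base])
    fix b p s assume *: "0 < b" "b \<le> n" "fst s 20 = b" "kept {} s0 s" "G p s"
    let ?f = "\<lambda>a. if (a, b) \<in> E then crosses E n a b @ [Finish a b] else []"
    show "wp (Seq (for_down 22 1 ?A) BV) (?kA + cost BV)
      (\<lambda>s'. kept (insert 20 (insert 21 {})) s s' \<and> G (p @ phase E n b) s') s"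
    proof (rule wp_Seq)
      show "wp (for_down 22 1 ?A) ?kA (\<lambda>s'. kept {20, 21} s s' \<and> G (p @ concat (map ?f (rev [1..<n + 1]))) s') s"
      proof (rule wp_down_events[where G = G, OF G(1) base])
        fix a q s' assume **: "0 < a" "a \<le> n" "fst s' 22 = a" "kept {20, 21} s s'" "G q s'"
        show "wp ?A ?ka (\<lambda>s''. kept (insert 22 {20, 21}) s' s'' \<and> G (q @ ?f a) s'') s'"
          by (rule wp_mono[OF a[OF **(5)] order_refl]) (use * ** in auto)
      qed (use * in auto)
      fix s1 assume s1: "kept {20, 21} s s1 \<and> G (p @ concat (map ?f (rev [1..<n + 1]))) s1"
      have "kept {20..25} s1 (ex BV s1) \<and> G ((p @ concat (map ?f (rev [1..<n + 1]))) @ [Vertex b]) (ex BV s1)"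
        by (rule V) (use * s1 in auto)
      then show "wp BV (cost BV) (\<lambda>s'. kept (insert 20 (insert 21 {})) s s' \<and> G (p @ phase E n b) s') s1"
        by (intro wp_ex[OF free(3)]) (use s1 in \<open>simp add: phase_def\<close>)
    qed
  qed (use s0 in auto)
  then show ?thesis unfolding k by simp
qed

locale gadget_code =
  fixes h iu iu' iv iv' :: nat and EH :: "(nat \<times> nat) list"
begin

text \<open>The abstract effect of an event on the number of replaced crossings, the current left
  ends, the vertex list and the edge list. Each sweep of the program realises only some of these
  components.\<close>

fun estep :: "nat \<Rightarrow> (nat \<Rightarrow> nat) \<Rightarrow> event \<Rightarrow> nat \<times> (nat \<times> nat \<Rightarrow> nat) \<times> nat list \<times> (nat \<times> nat) list \<Rightarrow>
    nat \<times> (nat \<times> nat \<Rightarrow> nat) \<times> nat list \<times> (nat \<times> nat) list" where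
  "estep S V (Cross a b c d) (j, cu, vs, es) =
     (j + 1, cu((a, b) := S + j * h + iu', (c, d) := S + j * h + iv'), vs @ map (\<lambda>i. S + j * h + i) [0..<h],
      es @ [(cu (a, b), S + j * h + iu), (cu (c, d), S + j * h + iv)] @ map (\<lambda>(x, y). (S + j * h + x, S + j * h + y)) EH)"
| "estep S V (Finish a b) (j, cu, vs, es) = (j, cu, vs, es @ [(cu (a, b), V b)])"
| "estep S V (Vertex b) (j, cu, vs, es) = (j, cu, vs @ [V b], es)"

definition "history S V p = fold (estep S V) p (0, \<lambda>e. V (fst e), [], [])"

lemma history_simps [simp]: "history S V [] = (0, \<lambda>e. V (fst e), [], [])"
  "history S V (p @ [e]) = estep S V e (history S V p)"
  by (simp_all add: history_def)

abbreviation flat :: "(nat \<times> nat) list \<Rightarrow> nat list" where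
  "flat es \<equiv> concat (map (\<lambda>(a, b). [a, b]) es)"

definition "off i = seqs [Const 31 i, Add 31 31 15, Write 31]"
text \<open>The final constant gives register 31 the same value for the empty list as for any other,
  so \<open>ex_offs\<close> needs no cases.\<close>

definition "offs l = Seq (seqs (map off l)) (Const 31 0)"
definition "adr x y = seqs [Add 30 8 x, Load 30 30, Add 30 30 y]"
text \<open>A cell holds the current left end plus 1, so that the name 0 is not mistaken for a
  missing edge. Register 3 holds the 1 that is taken off here and put on again by
  \<open>renew\<close>.\<close>

definition "emit x y = seqs [adr x y, Load 31 30, Sub 31 31 3, Write 31]"
definition "renew x y i = seqs [adr x y, Const 31 i, Add 31 31 15, Add 31 31 3, Store 30 31]"
definition "next_copy = seqs [Const 31 h, Add 15 15 31]"

definition "count_cross = Add 14 14 3"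
definition "vertices_cross = Seq (offs [0..<h]) next_copy"
definition "edges_cross = seqs [emit 22 20, off iu, emit 23 25, off iv, offs (flat EH),
  renew 22 20 iu', renew 23 25 iv', next_copy]"
definition "write_name = seqs [Add 30 7 20, Load 31 30, Write 31]"
definition "edges_finish = Seq (emit 22 20) write_name"

lemma loop_free_code: "loop_free count_cross" "loop_free vertices_cross" "loop_free edges_cross" "loop_free write_name" "loop_free edges_finish"
  by (auto simp: count_cross_def vertices_cross_def edges_cross_def write_name_def edges_finish_def off_def offs_def adr_def emit_def renew_def
      next_copy_def loop_free_seqs)

lemma ex_offs: "ex (offs l) (r, m, ys) = (r(31 := 0), m, ys @ map (\<lambda>i. r 15 + i) l)"
proof -
  have "\<exists>v. ex (seqs (map off l)) (r, m, ys) = (r(31 := v), m, ys @ map (\<lambda>i. r 15 + i) l)"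
  proof (induction l arbitrary: r ys)
    case Nil
    show ?case by (rule exI[of _ "r 31"]) simp
  next
    case (Cons i l)
    let ?r = "r(31 := i + r 15)"
    obtain v where "ex (seqs (map off l)) (?r, m, ys @ [i + r 15]) =
        (?r(31 := v), m, (ys @ [i + r 15]) @ map (\<lambda>i. ?r 15 + i) l)"
      using Cons.IH by blast
    then have "ex (seqs (map off (i # l))) (r, m, ys) = (?r(31 := v), m, (ys @ [i + r 15]) @ map (\<lambda>i. ?r 15 + i) l)"
      by (simp add: off_def[of i])
    then show ?case by (intro exI[of _ v]) (simp add: add.commute fun_eq_iff)
  qed
  then obtain v where "ex (seqs (map off l)) (r, m, ys) = (r(31 := v), m, ys @ map (\<lambda>i. r 15 + i) l)" by blast
  then show ?thesis by (simp add: offs_def)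
qed

end

text \<open>\<open>r0\<close> and \<open>m0\<close> are registers and memory at the start of a
  sweep. The counting sweep and the vertex sweep leave the memory alone, the edge sweep changes only
  the cells of edges; hence every sweep finds the same tables.\<close>

locale tables = gadget_code +
  fixes S n :: nat and E :: "(nat \<times> nat) set" and V :: "nat \<Rightarrow> nat" and r0 m0 :: "nat \<Rightarrow> nat"
  assumes E: "\<And>a b. (a, b) \<in> E \<Longrightarrow> 1 \<le> a \<and> a < b \<and> b \<le> n"
    and n_less: "n < S"
    and reg: "r0 1 = n" "r0 3 = 1" "r0 7 = 2 * S" "r0 8 = 3 * S"
    and names: "\<And>b. 1 \<le> b \<Longrightarrow> b \<le> n \<Longrightarrow> m0 (2 * S + b) = V b"
    and rows: "\<And>i. 1 \<le> i \<Longrightarrow> i \<le> n \<Longrightarrow> m0 (3 * S + i) = (4 + i) * S"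
    and entries: "\<And>a b. 1 \<le> a \<Longrightarrow> a \<le> n \<Longrightarrow> 1 \<le> b \<Longrightarrow> b \<le> n \<Longrightarrow>
      m0 ((4 + a) * S + b) = (if (a, b) \<in> E then V a + 1 else 0)"
begin

lemma cell_inj:
  assumes "b < S" "d < S" "(4 + a) * S + b = (4 + c) * S + d"
  shows "a = c \<and> b = d"
proof -
  have "((4 + a) * S + b) div S = 4 + a" "((4 + c) * S + d) div S = 4 + c" using assms(1,2) by auto
  then have "a = c" using assms(3) by simp
  then show ?thesis using assms(3) by simp
qed

lemma matrix0:
  assumes "\<And>y. y < 14 \<Longrightarrow> fst s y = r0 y" "fst (snd s) = m0"
  shows "matrix S n E s"
  unfolding matrix_def using assms reg rows entries by (simp del: One_nat_def)

definition "count_inv ys p s \<longleftrightarrow> (\<forall>y<20. y \<noteq> 14 \<longrightarrow> fst s y = r0 y) \<and> fst s 14 = fst (history S V p) \<and> snd s = (m0, ys)"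

definition "vertex_inv ys p s \<longleftrightarrow> (\<forall>y<20. y \<noteq> 15 \<longrightarrow> fst s y = r0 y) \<and>
  fst s 15 = S + fst (history S V p) * h \<and> snd s = (m0, ys @ fst (snd (snd (history S V p))))"

definition "edge_inv ys p s \<longleftrightarrow> (\<forall>y<20. y \<noteq> 15 \<longrightarrow> fst s y = r0 y) \<and>
  (case history S V p of (j, cu, vs, es) \<Rightarrow> fst s 15 = S + j * h \<and> snd (snd s) = ys @ flat es \<and>
    (\<forall>(a, b)\<in>E. fst (snd s) ((4 + a) * S + b) = cu (a, b) + 1) \<and>
    (\<forall>x. (\<forall>(a, b)\<in>E. x \<noteq> (4 + a) * S + b) \<longrightarrow> fst (snd s) x = m0 x))"

lemma wp_count:
  assumes "\<And>y. y < 20 \<Longrightarrow> y \<noteq> 14 \<Longrightarrow> fst s y = r0 y" "fst s 14 = 0" "snd s = (m0, ys)"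
  shows "wp (sweep count_cross Skip Skip) (sweep_cost n (cost count_cross) (cost Skip) (cost Skip)) (count_inv ys (events E n)) s"
proof (rule wp_sweep)
  fix p s assume "count_inv ys p s"
  then show "matrix S n E s" by (intro matrix0) (auto simp: count_inv_def)
next
  fix a b c d p s assume g: "count_inv ys p s"
  obtain r m zs where s: "s = (r, m, zs)" by (cases s)
  obtain j cu vs es where t: "history S V p = (j, cu, vs, es)" by (cases "history S V p")
  show "kept {20..25} s (ex count_cross s) \<and> count_inv ys (p @ [Cross a b c d]) (ex count_cross s)"
    using g reg unfolding s count_inv_def count_cross_def by (auto simp: t)
next
  fix a b p s assume g: "count_inv ys p s"
  then show "kept {20..25} s (ex Skip s) \<and> count_inv ys (p @ [Finish a b]) (ex Skip s)"
    unfolding count_inv_def by (cases "history S V p") simp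
next
  fix b p s assume g: "count_inv ys p s"
  then show "kept {20..25} s (ex Skip s) \<and> count_inv ys (p @ [Vertex b]) (ex Skip s)"
    unfolding count_inv_def by (cases "history S V p") simp
qed (use assms E loop_free_code in \<open>auto simp: stab_def count_inv_def\<close>)

lemma wp_vertices:
  assumes "\<And>y. y < 20 \<Longrightarrow> y \<noteq> 15 \<Longrightarrow> fst s y = r0 y" "fst s 15 = S" "snd s = (m0, ys)"
  shows "wp (sweep vertices_cross Skip write_name) (sweep_cost n (cost vertices_cross) (cost Skip) (cost write_name)) (vertex_inv ys (events E n)) s"
proof (rule wp_sweep)
  fix p s assume "vertex_inv ys p s"
  then show "matrix S n E s" by (intro matrix0) (auto simp: vertex_inv_def)
next
  fix a b c d p s assume g: "vertex_inv ys p s"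
  obtain r m zs where s: "s = (r, m, zs)" by (cases s)
  obtain j cu vs es where t: "history S V p = (j, cu, vs, es)" by (cases "history S V p")
  show "kept {20..25} s (ex vertices_cross s) \<and> vertex_inv ys (p @ [Cross a b c d]) (ex vertices_cross s)"
    using g reg unfolding s vertex_inv_def vertices_cross_def next_copy_def by (auto simp: t ex_offs)
next
  fix a b p s assume g: "vertex_inv ys p s"
  then show "kept {20..25} s (ex Skip s) \<and> vertex_inv ys (p @ [Finish a b]) (ex Skip s)"
    unfolding vertex_inv_def by (cases "history S V p") simp
next
  fix b p s assume g: "vertex_inv ys p s" and b: "fst s 20 = b" "1 \<le> b" "b \<le> n"
  obtain r m zs where s: "s = (r, m, zs)" by (cases s)
  obtain j cu vs es where t: "history S V p = (j, cu, vs, es)" by (cases "history S V p")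
  show "kept {20..25} s (ex write_name s) \<and> vertex_inv ys (p @ [Vertex b]) (ex write_name s)"
    using g b reg names[OF b(2,3)] unfolding s vertex_inv_def write_name_def by (auto simp: t)
qed (use assms E loop_free_code in \<open>auto simp: stab_def vertex_inv_def\<close>)

lemma edge_inv_matrix:
  assumes "edge_inv ys p s"
  shows "matrix S n E s" "\<And>b. 1 \<le> b \<Longrightarrow> b \<le> n \<Longrightarrow> fst (snd s) (2 * S + b) = V b"
proof -
  obtain j cu vs es where t: "history S V p = (j, cu, vs, es)" by (cases "history S V p")
  have r: "\<And>y. y < 14 \<Longrightarrow> fst s y = r0 y" and cu: "\<And>a b. (a, b) \<in> E \<Longrightarrow> fst (snd s) ((4 + a) * S + b) = cu (a, b) + 1"
    using assms unfolding edge_inv_def t by (auto split: prod.splits)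
  have o: "fst (snd s) x = m0 x" if "\<And>a b. (a, b) \<in> E \<Longrightarrow> x \<noteq> (4 + a) * S + b" for x
  proof -
    have "\<forall>(a, b)\<in>E. x \<noteq> (4 + a) * S + b" using that by auto
    then show ?thesis using assms unfolding edge_inv_def t by simp
  qed
  have low: "fst (snd s) x = m0 x" if "x < 4 * S" for x
  proof (rule o)
    fix a b show "x \<noteq> (4 + a) * S + b" using that by (simp add: distrib_right)
  qed
  show "fst (snd s) (2 * S + b) = V b" if "1 \<le> b" "b \<le> n" for b
    using low[of "2 * S + b"] names[OF that] that n_less by simp
  show "matrix S n E s"
    unfolding matrix_def
  proof (intro conjI ballI)
    fix i assume "i \<in> {1..n}"
    then show "fst (snd s) (3 * S + i) = (4 + i) * S" using low[of "3 * S + i"] rows n_less by simp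
  next
    fix a b assume ab: "a \<in> {1..n}" "b \<in> {1..n}"
    show "(fst (snd s) ((4 + a) * S + b) \<noteq> 0) = ((a, b) \<in> E)"
    proof (cases "(a, b) \<in> E")
      case True
      then show ?thesis using cu by simp
    next
      case False
      have "fst (snd s) ((4 + a) * S + b) = m0 ((4 + a) * S + b)"
      proof (rule o)
        fix c d assume cd: "(c, d) \<in> E"
        show "(4 + a) * S + b \<noteq> (4 + c) * S + d"
          using cell_inj[of b d a c] E[OF cd] ab n_less False cd by auto
      qed
      then show ?thesis using entries ab False by simp
    qed
  qed (use r reg in auto)
qed

lemma wp_edges:
  assumes "\<And>y. y < 20 \<Longrightarrow> y \<noteq> 15 \<Longrightarrow> fst s y = r0 y" "fst s 15 = S" "snd s = (m0, ys)"
  shows "wp (sweep edges_cross edges_finish Skip) (sweep_cost n (cost edges_cross) (cost edges_finish) (cost Skip)) (edge_inv ys (events E n)) s"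
proof (rule wp_sweep)
  fix p s assume "edge_inv ys p s"
  then show "matrix S n E s" by (rule edge_inv_matrix)
next
  fix a b c d p s assume g: "edge_inv ys p s" and s4: "fst s 22 = a" "fst s 20 = b" "fst s 23 = c" "fst s 25 = d"
    and ab: "(a, b) \<in> E" and cd: "(c, d) \<in> E" and "a < c"
  obtain r m zs where s: "s = (r, m, zs)" by (cases s)
  obtain j cu vs es where t: "history S V p = (j, cu, vs, es)" by (cases "history S V p")
  define A C where "A = (4 + a) * S + b" and "C = (4 + c) * S + d"
  have row: "m (3 * S + a) = (4 + a) * S" "m (3 * S + c) = (4 + c) * S"
    using edge_inv_matrix(1)[OF g] E[OF ab] E[OF cd] unfolding s matrix_def by auto
  have cell: "(4 + a') * S + b' = (4 + c') * S + d' \<longleftrightarrow> a' = c' \<and> b' = d'" if "(a', b') \<in> E" "(c', d') \<in> E" for a' b' c' d'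
    using cell_inj[of b' d' a' c'] E[OF that(1)] E[OF that(2)] n_less by auto
  have "A \<noteq> C" using cell[OF ab cd] \<open>a < c\<close> unfolding A_def C_def by simp
  \<comment> \<open>\<open>A\<close> lies in the region of the cells, beyond the row table, so
    writing it leaves the row entry for the second access intact.\<close>
  have m3: "m (3 * S + a) = (4 + a) * S" "m (3 * S + c) = (4 + c) * S" "A \<noteq> 3 * S + c"
  proof -
    have "A \<ge> 5 * S" using E[OF ab] unfolding A_def by (simp add: trans_le_add1)
    then show "A \<noteq> 3 * S + c" using E[OF cd] n_less by linarith
  qed (fact row)+
  have r: "r 3 = 1" "r 8 = 3 * S" "r 15 = S + j * h" "zs = ys @ flat es"
    and mem: "m A = cu (a, b) + 1" "m C = cu (c, d) + 1"
    using g reg ab cd unfolding s edge_inv_def t A_def C_def by auto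
  let ?N = "S + j * h"
  let ?z = "ys @ flat (es @ [(cu (a, b), ?N + iu), (cu (c, d), ?N + iv)] @ map (\<lambda>(x, y). (?N + x, ?N + y)) EH)"
  have fl: "map (\<lambda>i. ?N + i) (flat l) = flat (map (\<lambda>(x, y). (?N + x, ?N + y)) l)" for l
    by (induction l) auto
  have e: "ex edges_cross (r, m, zs) = (r(30 := C, 31 := h, 15 := ?N + h), m(A := ?N + iu' + 1, C := ?N + iv' + 1), ?z)"
    unfolding edges_cross_def
    using s4 r mem m3 \<open>A \<noteq> C\<close>
    by (simp add: emit_def adr_def off_def ex_offs renew_def next_copy_def s fl A_def C_def fun_eq_iff)
  show "kept {20..25} s (ex edges_cross s) \<and> edge_inv ys (p @ [Cross a b c d]) (ex edges_cross s)"
    using g ab cd unfolding s e edge_inv_def t history_simps estep.simps prod.case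
    by (auto simp: A_def C_def cell)
next
  fix a b p s assume g: "edge_inv ys p s" and s4: "fst s 22 = a" "fst s 20 = b" and ab: "(a, b) \<in> E"
  obtain r m zs where s: "s = (r, m, zs)" by (cases s)
  obtain j cu vs es where t: "history S V p = (j, cu, vs, es)" by (cases "history S V p")
  have row: "m (3 * S + a) = (4 + a) * S"
    using edge_inv_matrix(1)[OF g] E[OF ab] unfolding s matrix_def by auto
  have V: "m (2 * S + b) = V b" using edge_inv_matrix(2)[OF g, of b] E[OF ab] unfolding s by simp
  have r: "r 3 = 1" "r 8 = 3 * S" "r 7 = 2 * S" "zs = ys @ flat es" "m ((4 + a) * S + b) = cu (a, b) + 1"
    using g reg ab unfolding s edge_inv_def t by auto
  have e: "ex edges_finish (r, m, zs) = (r(30 := 2 * S + b, 31 := V b), m, ys @ flat (es @ [(cu (a, b), V b)]))"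
    unfolding edges_finish_def write_name_def using s4 r row V by (simp add: emit_def adr_def s fun_eq_iff)
  show "kept {20..25} s (ex edges_finish s) \<and> edge_inv ys (p @ [Finish a b]) (ex edges_finish s)"
    using g unfolding s e edge_inv_def t history_simps estep.simps prod.case by auto
next
  fix b p s assume g: "edge_inv ys p s"
  then show "kept {20..25} s (ex Skip s) \<and> edge_inv ys (p @ [Vertex b]) (ex Skip s)"
    unfolding edge_inv_def by (cases "history S V p") simp
next
  show "edge_inv ys [] s"
    using assms E entries unfolding edge_inv_def by fastforce
qed (use E loop_free_code in \<open>auto simp: stab_def edge_inv_def\<close>)

end

section \<open>The algorithm\<close>

locale instance_code = gadget_code +
  fixes k :: int
begin

text \<open>
  Registers 1 and 2 hold the numbers of vertices and edges, 3 the constant 1, 4 a number \<open>S\<close> that exceeds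
  the length and all entries of the input, 5 and 6 sign and absolute value of the parameter, 7, 8 and 10 the numbers
  \<open>2S\<close>, \<open>3S\<close> and 3.  In memory, the position of vertex \<open>v\<close> is stored at \<open>S + v\<close>, the vertex at
  position \<open>b\<close> at \<open>2S + b\<close>, and the number \<open>(4 + a)S\<close> at \<open>3S + a\<close>.  The cell \<open>(4 + a)S + b\<close>
  is 0 if \<open>(a, b)\<close> is not an edge; otherwise it exceeds the current left end of this edge by 1.
  The new vertices are named from \<open>S\<close> onwards.
\<close>

definition "store_cell x y z = seqs [adr x y, Add 36 z 3, Store 30 36]"
text \<open>Summing all entries bounds each of them without any comparison. The sum may be large,
  but only its binary length is charged.\<close>

definition "measure_loop = for_down 20 0 (seqs [Sub 30 20 3, Load 30 30, Add 4 4 30])"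
definition "read_header = seqs [Const 30 0, Load 1 30, Load 2 3, Const 30 2, Load 5 30, Const 10 3, Load 6 10,
  Add 7 4 4, Add 8 7 4, Add 9 8 4]"
definition "row_body = seqs [Add 9 9 4, Add 30 8 20, Store 30 9]"
definition "vertex_body = seqs [Add 30 10 20, Load 31 30, Add 30 30 1, Load 32 30,
  Add 33 4 31, Store 33 32, Add 33 7 32, Store 33 31]"
text \<open>Edges are listed in either direction. The truncated difference in register 35 is nonzero
  exactly if the listed direction goes from the smaller to the larger position; the cell is chosen
  accordingly.\<close>

definition "edge_body = seqs [Load 31 11, Add 11 11 3, Load 32 11, Add 11 11 3, Add 33 4 31, Load 33 33,
  Add 34 4 32, Load 34 34, Sub 35 34 33, IfNZ 35 (store_cell 33 34 31) (store_cell 34 33 32)]"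
definition "ptr_init = seqs [Add 11 10 3, Add 11 11 1, Add 11 11 1]"
definition "setup = seqs [Const 3 1, Add 4 0 3, measure_loop, read_header,
  for_up 20 21 1 row_body, for_up 20 21 1 vertex_body,
  ptr_init, for_up 20 21 2 edge_body]"
definition "setup_cost l i j = l * 6 + i * (cost row_body + 3) + i * (cost vertex_body + 3) + j * (cost edge_body + 3) +
  (cost read_header + len 1 + 25)"

end

lemma length_flat: "length (concat (map (\<lambda>(a, b). [a, b]) es)) = 2 * length es"
  by (induction es) auto

lemma nth_flat:
  assumes "i < length es"
  shows "concat (map (\<lambda>(a, b). [a, b]) es) ! (2 * i) = fst (es ! i)"
    "concat (map (\<lambda>(a, b). [a, b]) es) ! (2 * i + 1) = snd (es ! i)"
  using assms
proof (induction es arbitrary: i)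
  case (Cons e es)
  {
    case 1
    then show ?case using Cons.IH by (cases e; cases i) auto
  next
    case 2
    then show ?case using Cons.IH by (cases e; cases i) auto
  }
qed auto

locale instance_word = instance_code +
  fixes vs :: "nat list" and es :: "(nat \<times> nat) list" and t :: int and \<pi> :: "nat \<Rightarrow> nat"
    and n m S :: nat and w :: "nat list" and V :: "nat \<Rightarrow> nat" and E :: "(nat \<times> nat) set"
  assumes vs: "distinct vs"
    and es: "distinct (map (\<lambda>(a, b). {a, b}) es)" "\<And>a b. (a, b) \<in> set es \<Longrightarrow> a \<in> set vs \<and> b \<in> set vs \<and> a \<noteq> b"
    and \<pi>: "bij_betw \<pi> (set vs) {1..length vs}"
  defines "n \<equiv> length vs" and "m \<equiv> length es"
    and "w \<equiv> [length vs, length es, if t < 0 then 1 else 0, nat \<bar>t\<bar>] @ vs @ map \<pi> vs @ flat es"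
    and "S \<equiv> length w + 1 + sum_list w"
    and "V \<equiv> the_inv_into (set vs) \<pi>"
    and "E \<equiv> (\<lambda>(a, b). if \<pi> a < \<pi> b then (\<pi> a, \<pi> b) else (\<pi> b, \<pi> a)) ` set es"
begin

definition "mw i = (if i < length w then w ! i else 0)"

lemma length_w: "length w = 4 + 2 * n + 2 * m"
  by (simp add: w_def n_def m_def length_flat)

lemma w_less: "x \<in> set w \<Longrightarrow> x < S"
  using member_le_sum_list[of x w] by (simp add: S_def)

lemma length_w_less: "length w < S"
  by (simp add: S_def)

lemma mw_header: "mw 0 = n" "mw 1 = m" "mw 2 = (if t < 0 then 1 else 0)" "mw 3 = nat \<bar>t\<bar>"
  using length_w by (auto simp: mw_def w_def n_def m_def)

lemma mw_vertex:
  assumes "i < n"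
  shows "mw (4 + i) = vs ! i" "mw (4 + i + n) = \<pi> (vs ! i)"
  using assms length_w by (auto simp: mw_def w_def n_def m_def nth_append)

lemma mw_edge:
  assumes "i < m"
  shows "mw (4 + 2 * n + 2 * i) = fst (es ! i)" "mw (4 + 2 * n + 2 * i + 1) = snd (es ! i)"
proof -
  define A where "A = [length vs, length es, if t < 0 then 1 else 0, nat \<bar>t\<bar>] @ vs @ map \<pi> vs"
  have A: "w = A @ flat es" "length A = 4 + 2 * n" by (simp_all add: w_def A_def n_def)
  have *: "mw (4 + 2 * n + j) = flat es ! j" if "j \<le> 2 * i + 1" for j
  proof -
    have "w ! (length A + j) = flat es ! j" unfolding A(1) by (rule nth_append_length_plus)
    then show ?thesis using that assms length_w unfolding mw_def A(2) by simp
  qed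
  then show "mw (4 + 2 * n + 2 * i) = fst (es ! i)" "mw (4 + 2 * n + 2 * i + 1) = snd (es ! i)"
    using nth_flat[of i es] assms *[of "2 * i"] *[of "2 * i + 1"] by (simp_all add: m_def add.assoc)
qed

lemma n_less: "n < S"
  by (rule w_less) (simp add: w_def n_def)

lemma name_less: "x \<in> set vs \<Longrightarrow> x < S"
  by (rule w_less) (simp add: w_def)

lemma \<pi>_in: "x \<in> set vs \<Longrightarrow> 1 \<le> \<pi> x \<and> \<pi> x \<le> n"
  using bij_betw_apply[OF \<pi>] by (auto simp: n_def)

lemma \<pi>_eq: "x \<in> set vs \<Longrightarrow> y \<in> set vs \<Longrightarrow> \<pi> x = \<pi> y \<longleftrightarrow> x = y"
  using \<pi> by (auto simp: bij_betw_def inj_on_def)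

lemma V_\<pi>: "x \<in> set vs \<Longrightarrow> V (\<pi> x) = x"
  using \<pi> unfolding V_def by (intro the_inv_into_f_f) (auto simp: bij_betw_def)

lemma \<pi>_V: "1 \<le> b \<Longrightarrow> b \<le> n \<Longrightarrow> \<pi> (V b) = b \<and> V b \<in> set vs"
proof -
  assume "1 \<le> b" "b \<le> n"
  then have "b \<in> \<pi> ` set vs" using \<pi> by (simp add: bij_betw_def n_def)
  then show ?thesis using V_\<pi> by auto
qed

lemma E: "(a, b) \<in> E \<Longrightarrow> 1 \<le> a \<and> a < b \<and> b \<le> n"
  using es(2) \<pi>_in \<pi>_eq unfolding E_def by (fastforce split: if_splits)

definition "fixed s \<longleftrightarrow> fst s 1 = n \<and> fst s 2 = m \<and> fst s 3 = 1 \<and> fst s 4 = S \<and>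
  fst s 5 = (if t < 0 then 1 else 0) \<and> fst s 6 = nat \<bar>t\<bar> \<and> fst s 7 = 2 * S \<and> fst s 8 = 3 * S \<and> fst s 10 = 3"

lemma fixedD: "fixed (r, mem, ys) \<Longrightarrow> r 1 = n \<and> r 2 = m \<and> r 3 = 1 \<and> r 4 = S \<and>
    r 5 = (if t < 0 then 1 else 0) \<and> r 6 = nat \<bar>t\<bar> \<and> r 7 = 2 * S \<and> r 8 = 3 * S \<and> r 10 = 3"
  by (simp add: fixed_def)

lemma wp_measure:
  "wp measure_loop (length w * (3 + 1 + 2) + 4) (\<lambda>s. fst s 3 = 1 \<and> fst s 4 = S \<and> snd s = (mw, []))
     ((\<lambda>_. 0)(0 := length w, 3 := 1, 4 := length w + 1), mw, [])"
proof -
  define I where "I i s \<longleftrightarrow> fst s 3 = 1 \<and> fst s 4 = length w + 1 + sum_list (drop i w) \<and> snd s = (mw, [])"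
    for i and s :: state
  have "wp measure_loop (length w * (3 + 1 + 2) + 4) (\<lambda>s. I 0 s) ((\<lambda>_. 0)(0 := length w, 3 := 1, 4 := length w + 1), mw, [])"
    unfolding measure_loop_def
  proof (rule wp_for_down)
    fix i r mem ys assume i: "0 < i" "i \<le> length w" "r 20 = i" "I i (r, mem, ys)"
    let ?c = "seqs [Sub 30 20 3, Load 30 30, Add 4 4 30]"
    have "drop (i - 1) w = w ! (i - 1) # drop i w"
      using i(1,2) Cons_nth_drop_Suc[of "i - 1" w] by simp
    then have "fst (ex ?c (r, mem, ys)) 20 = i \<and> fst (ex ?c (r, mem, ys)) 3 = 1 \<and> I (i - 1) (ex ?c (r, mem, ys))"
      using i unfolding I_def by (auto simp: mw_def)
    then have "wp ?c (cost ?c) (\<lambda>s'. fst s' 20 = i \<and> fst s' 3 = 1 \<and> I (i - 1) s') (r, mem, ys)"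
      by (intro wp_ex) auto
    then show "wp ?c (3 + 1) (\<lambda>s'. fst s' 20 = i \<and> fst s' 3 = 1 \<and> I (i - 1) s') (r, mem, ys)"
      by (rule wp_mono) simp_all
  qed (auto simp: I_def)
  then show ?thesis unfolding I_def S_def by simp
qed

definition "m1 x = (if 3 * S < x \<and> x \<le> 3 * S + n then (x - 3 * S + 4) * S else mw x)"

lemma wp_rows:
  assumes "fixed s" "fst s 9 = 4 * S" "snd s = (mw, [])"
  shows "wp (for_up 20 21 1 row_body) (n * (cost row_body + 3) + 5) (\<lambda>s. fixed s \<and> snd s = (m1, [])) s"
proof -
  define I where "I j s \<longleftrightarrow> fixed s \<and> fst s 9 = (4 + j) * S \<and>
    snd s = (\<lambda>x. if 3 * S < x \<and> x \<le> 3 * S + j then (x - 3 * S + 4) * S else mw x, [])" for j and s :: state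
  obtain r mem ys where s: "s = (r, mem, ys)" by (cases s)
  have "wp (for_up 20 21 1 row_body) (n * (cost row_body + 3) + 5) (\<lambda>s. I n s) (r, mem, ys)"
  proof (rule wp_for_up)
    fix j r mem ys assume j: "0 < j" "j \<le> n" "r 20 = j" "I (j - 1) (r, mem, ys)"
    then have f: "fixed (r, mem, ys)" by (simp add: I_def fixed_def)
    have "(4 + (j - 1)) * S + S = (4 + j) * S" using j(1) by (cases j) (auto simp: algebra_simps)
    then have e: "ex row_body (r, mem, ys) = (r(9 := (4 + j) * S, 30 := 3 * S + j), mem(3 * S + j := (4 + j) * S), ys)"
      using j fixedD[OF f] by (simp add: row_body_def I_def)
    have "mem(3 * S + j := (4 + j) * S) = (\<lambda>x. if 3 * S < x \<and> x \<le> 3 * S + j then (x - 3 * S + 4) * S else mw x)"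
      using j by (auto simp: I_def fun_eq_iff add.commute)
    then have "I j (ex row_body (r, mem, ys))"
      unfolding e I_def using f j(4) by (simp add: fixed_def I_def)
    then show "wp row_body (cost row_body) (\<lambda>s'. fst s' 20 = j \<and> fst s' 21 = r 21 \<and> fst s' 3 = 1 \<and> I j s') (r, mem, ys)"
      using j(3) fixedD[OF f] by (intro wp_ex) (simp_all add: e row_body_def)
  qed (use assms s in \<open>auto simp: I_def fixed_def\<close>)
  then show ?thesis unfolding s I_def m1_def by (rule wp_mono) auto
qed

lemma wp_names:
  assumes "fixed s" "snd s = (m1, [])"
  shows "wp (for_up 20 21 1 vertex_body) (n * (cost vertex_body + 3) + 5) (\<lambda>s. fixed s \<and> snd (snd s) = [] \<and>
    (\<forall>x\<in>set vs. fst (snd s) (S + x) = \<pi> x \<and> fst (snd s) (2 * S + \<pi> x) = x) \<and>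
    (\<forall>x. x < S \<or> 3 * S \<le> x \<longrightarrow> fst (snd s) x = m1 x)) s"
proof -
  define I where "I j s \<longleftrightarrow> fixed s \<and> snd (snd s) = [] \<and>
    (\<forall>x\<in>set (take j vs). fst (snd s) (S + x) = \<pi> x \<and> fst (snd s) (2 * S + \<pi> x) = x) \<and>
    (\<forall>x. x < S \<or> 3 * S \<le> x \<longrightarrow> fst (snd s) x = m1 x)" for j and s :: state
  obtain r mem ys where s: "s = (r, mem, ys)" by (cases s)
  have "wp (for_up 20 21 1 vertex_body) (n * (cost vertex_body + 3) + 5) (\<lambda>s. I n s) (r, mem, ys)"
  proof (rule wp_for_up)
    fix j r mem ys assume j: "0 < j" "j \<le> n" "r 20 = j" "I (j - 1) (r, mem, ys)"
    then have f: "fixed (r, mem, ys)" by (simp add: I_def fixed_def)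
    have low: "mem x = mw x" if "x < S" for x
      using j(4) that by (auto simp: I_def m1_def)
    define v where "v = vs ! (j - 1)"
    have v: "v \<in> set vs" using j by (simp add: v_def n_def)
    have tk: "set (take j vs) = insert v (set (take (j - 1) vs))"
      using j take_Suc_conv_app_nth[of "j - 1" vs] by (auto simp: v_def n_def)
    have sub: "set (take (j - 1) vs) \<subseteq> set vs" by (rule set_take_subset)
    \<comment> \<open>The input lies below address \<open>S\<close>, where the name tables begin, so
      this entry has not been overwritten.\<close>
    have a: "3 + j + n < S" using j(2) length_w length_w_less by linarith
    have w: "mem (3 + j) = v" "mem (3 + j + n) = \<pi> v"
      using low[of "3 + j"] low[OF a] a mw_vertex[of "j - 1"] j(1,2) by (simp_all add: v_def)
    have e: "ex vertex_body (r, mem, ys) = (r(30 := 3 + j + n, 31 := v, 32 := \<pi> v, 33 := 2 * S + \<pi> v),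
        mem(S + v := \<pi> v, 2 * S + \<pi> v := v), ys)"
      using j(3) fixedD[OF f] w by (simp add: vertex_body_def fun_eq_iff)
    have vS: "v < S" "\<pi> v < S" using name_less[OF v] \<pi>_in[OF v] n_less by auto
    have "I j (ex vertex_body (r, mem, ys))"
      unfolding I_def tk
    proof (intro conjI ballI allI impI)
      fix x assume x: "x \<in> insert v (set (take (j - 1) vs))"
      then have x': "x \<in> set vs" using v sub by blast
      have xS: "x < S" "\<pi> x < S" using name_less[OF x'] \<pi>_in[OF x'] n_less by auto
      show "fst (snd (ex vertex_body (r, mem, ys))) (S + x) = \<pi> x"
        "fst (snd (ex vertex_body (r, mem, ys))) (2 * S + \<pi> x) = x"
        using x xS vS j(4) \<pi>_eq[OF x' v] unfolding e I_def by auto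
    next
      fix x assume "x < S \<or> 3 * S \<le> x"
      then show "fst (snd (ex vertex_body (r, mem, ys))) x = m1 x"
        using j(4) vS unfolding e I_def by auto
    next
      show "fixed (ex vertex_body (r, mem, ys))" using f unfolding e fixed_def by simp
      show "snd (snd (ex vertex_body (r, mem, ys))) = []" using j(4) unfolding e I_def by simp
    qed
    moreover have "fst (ex vertex_body (r, mem, ys)) 20 = j \<and> fst (ex vertex_body (r, mem, ys)) 21 = r 21 \<and> fst (ex vertex_body (r, mem, ys)) 3 = 1"
      unfolding e using j(3) fixedD[OF f] by simp
    ultimately show "wp vertex_body (cost vertex_body) (\<lambda>s'. fst s' 20 = j \<and> fst s' 21 = r 21 \<and> fst s' 3 = 1 \<and> I j s') (r, mem, ys)"
      by (intro wp_ex) (simp_all add: vertex_body_def)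
  qed (use assms s in \<open>auto simp: I_def fixed_def\<close>)
  then show ?thesis unfolding s I_def n_def by (rule wp_mono) auto
qed

lemma wp_cells:
  assumes "fixed s" "fst s 11 = 4 + 2 * n" "snd (snd s) = []"
    "\<And>x. x \<in> set vs \<Longrightarrow> fst (snd s) (S + x) = \<pi> x" "\<And>x. x \<in> set vs \<Longrightarrow> fst (snd s) (2 * S + \<pi> x) = x"
    "\<And>x. x < S \<or> 3 * S \<le> x \<Longrightarrow> fst (snd s) x = m1 x"
  shows "wp (for_up 20 21 2 edge_body) (m * (cost edge_body + 3) + 5)
    (\<lambda>s. fixed s \<and> snd (snd s) = [] \<and> tables S n E V (fst s) (fst (snd s))) s"
proof -
  define pe where "pe = (\<lambda>(a, b). if \<pi> a < \<pi> b then (\<pi> a, \<pi> b) else (\<pi> b, \<pi> a))"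
  obtain r2 m2 ys2 where s: "s = (r2, m2, ys2)" by (cases s)
  define I where "I j s \<longleftrightarrow> fixed s \<and> fst s 11 = 4 + 2 * n + 2 * j \<and> snd (snd s) = [] \<and>
    (\<forall>x<5 * S. fst (snd s) x = m2 x) \<and>
    (\<forall>a\<in>{1..n}. \<forall>b\<in>{1..n}. fst (snd s) ((4 + a) * S + b) = (if (a, b) \<in> pe ` set (take j es) then V a + 1 else 0))"
    for j and s :: state
  have loop_free_edge_body: "loop_free edge_body" by (simp add: edge_body_def store_cell_def adr_def)
  have cell: "(4 + a) * S + b = (4 + c) * S + d \<longleftrightarrow> a = c \<and> b = d" if "b \<le> n" "d \<le> n" for a b c d
  proof -
    have "((4 + a) * S + b) div S = 4 + a" "((4 + c) * S + d) div S = 4 + c" using that n_less by auto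
    then show ?thesis by (metis add_left_cancel)
  qed
  have big: "5 * S \<le> (4 + a) * S + b" if "1 \<le> a" for a b
  proof -
    have "5 * S \<le> (4 + a) * S" using that by (intro mult_le_mono) auto
    then show ?thesis by linarith
  qed
  have low: "m2 x = mw x" if "x < S" for x
    using assms(6)[of x] that unfolding s by (simp add: m1_def)
  have row: "m2 (3 * S + i) = (4 + i) * S" if "1 \<le> i" "i \<le> n" for i
    using assms(6)[of "3 * S + i"] that n_less unfolding s by (simp add: m1_def add.commute)
  have "wp (for_up 20 21 2 edge_body) (m * (cost edge_body + 3) + 5) (\<lambda>s. I m s) (r2, m2, ys2)"
  proof (rule wp_for_up)
    fix j r mem ys assume j: "0 < j" "j \<le> m" "r 20 = j" "I (j - 1) (r, mem, ys)"
    then have f: "fixed (r, mem, ys)" by (simp add: I_def fixed_def)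
    obtain x y where xy: "es ! (j - 1) = (x, y)" by (cases "es ! (j - 1)")
    have mem: "(x, y) \<in> set es" using j(1,2) xy nth_mem[of "j - 1" es] by (simp add: m_def)
    then have xy': "x \<in> set vs" "y \<in> set vs" "x \<noteq> y" using es(2) by auto
    note px = \<pi>_in[OF xy'(1)] and py = \<pi>_in[OF xy'(2)]
    have ne: "\<pi> x \<noteq> \<pi> y" using xy' \<pi>_eq by simp
    have tk: "pe ` set (take j es) = insert (pe (x, y)) (pe ` set (take (j - 1) es))"
      using j(1,2) xy take_Suc_conv_app_nth[of "j - 1" es] by (auto simp: m_def)
    have m: "\<And>x. x < 5 * S \<Longrightarrow> mem x = m2 x" and r11: "r 11 = 4 + 2 * n + 2 * (j - 1)"
      using j(4) by (auto simp: I_def)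
    have a: "4 + 2 * n + 2 * (j - 1) + 1 < S" using j(1,2) length_w length_w_less by linarith
    have w: "mem (4 + 2 * n + 2 * (j - 1)) = x" "mem (4 + 2 * n + 2 * (j - 1) + 1) = y"
      using m a low mw_edge[of "j - 1"] j(1,2) xy by simp_all
    have p: "mem (S + x) = \<pi> x" "mem (S + y) = \<pi> y"
      using m[of "S + x"] m[of "S + y"] name_less xy' assms(4) unfolding s by force+
    have rw: "mem (3 * S + i) = (4 + i) * S" if "1 \<le> i" "i \<le> n" for i
      using row[OF that] m[of "3 * S + i"] that n_less by simp
    obtain a b where ab: "pe (x, y) = (a, b)" by (cases "pe (x, y)")
    have ab': "1 \<le> a" "a < b" "b \<le> n" "V a = (if \<pi> x < \<pi> y then x else y)"
      using ab px py ne V_\<pi> xy' by (auto simp: pe_def split: if_splits)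
    have r11': "r 11 + 1 + 1 = 4 + 2 * n + 2 * j" using r11 j(1) by simp
    define A where "A = r 11"
    have wA: "mem A = x" "mem (A + 1) = y" using w r11 by (simp_all add: A_def)
    have r: "r 3 = 1" "r 4 = S" "r 8 = 3 * S" using fixedD[OF f] by auto
    let ?r = "r(11 := A + 1 + 1, 30 := (4 + a) * S + b, 31 := x, 32 := y, 33 := \<pi> x, 34 := \<pi> y, 35 := \<pi> y - \<pi> x, 36 := V a + 1)"
    have e: "ex edge_body (r, mem, ys) = (?r, mem((4 + a) * S + b := V a + 1), ys)"
    proof (cases "\<pi> x < \<pi> y")
      case True
      then have "a = \<pi> x" "b = \<pi> y" "V a = x" using ab ab'(4) by (auto simp: pe_def)
      then show ?thesis
        using wA p r rw[of "\<pi> x"] px True A_def[symmetric] by (simp add: edge_body_def store_cell_def adr_def fun_eq_iff)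
    next
      case False
      then have "a = \<pi> y" "b = \<pi> x" "V a = y" using ab ab'(4) by (auto simp: pe_def)
      then show ?thesis
        using wA p r rw[of "\<pi> y"] py False A_def[symmetric] by (simp add: edge_body_def store_cell_def adr_def fun_eq_iff)
    qed
    have "I j (ex edge_body (r, mem, ys))"
      unfolding I_def tk ab
    proof (intro conjI ballI allI impI)
      fix x assume "x < 5 * S"
      then show "fst (snd (ex edge_body (r, mem, ys))) x = m2 x"
        using m[of x] big[OF ab'(1), of b] unfolding e by auto
    next
      fix c d assume "c \<in> {1..n}" "d \<in> {1..n}"
      then show "fst (snd (ex edge_body (r, mem, ys))) ((4 + c) * S + d) =
          (if (c, d) \<in> insert (a, b) (pe ` set (take (j - 1) es)) then V c + 1 else 0)"
        using j(4) cell[of d b c a] ab' unfolding e I_def by auto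
    next
      show "fixed (ex edge_body (r, mem, ys))" using f unfolding e fixed_def by simp
      show "snd (snd (ex edge_body (r, mem, ys))) = []" using j(4) unfolding e I_def by simp
      show "fst (ex edge_body (r, mem, ys)) 11 = 4 + 2 * n + 2 * j" unfolding e using r11' by (simp add: A_def)
    qed
    moreover have "fst (ex edge_body (r, mem, ys)) 20 = j \<and> fst (ex edge_body (r, mem, ys)) 21 = r 21 \<and> fst (ex edge_body (r, mem, ys)) 3 = 1"
      unfolding e using j(3) r by simp
    ultimately show "wp edge_body (cost edge_body) (\<lambda>s'. fst s' 20 = j \<and> fst s' 21 = r 21 \<and> fst s' 3 = 1 \<and> I j s') (r, mem, ys)"
      by (intro wp_ex) (simp_all add: loop_free_edge_body)
  next
    show "I 0 (r2, m2, ys2)"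
    proof -
      have "m2 ((4 + a) * S + b) = 0" if "a \<in> {1..n}" "b \<in> {1..n}" for a b
      proof -
        have "5 * S \<le> (4 + a) * S + b" using big that by simp
        then have "3 * S + n < (4 + a) * S + b" "\<not> (4 + a) * S + b < length w" "3 * S \<le> (4 + a) * S + b"
          using n_less length_w_less by linarith+
        then show ?thesis using assms(6)[of "(4 + a) * S + b"] unfolding s m1_def mw_def by simp
      qed
      then show ?thesis using assms(1-3) unfolding I_def s by simp
    qed
  qed (use assms s in \<open>auto simp: I_def fixed_def\<close>)
  then show ?thesis
    unfolding s
  proof (rule wp_mono[OF _ order_refl])
    fix s' assume i: "I m s'"
    have "pe ` set (take m es) = E" by (simp add: m_def pe_def E_def)
    then have mem: "\<And>x. x < 5 * S \<Longrightarrow> fst (snd s') x = m2 x"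
      "\<And>a b. 1 \<le> a \<Longrightarrow> a \<le> n \<Longrightarrow> 1 \<le> b \<Longrightarrow> b \<le> n \<Longrightarrow> fst (snd s') ((4 + a) * S + b) = (if (a, b) \<in> E then V a + 1 else 0)"
      using i by (auto simp: I_def)
    have "tables S n E V (fst s') (fst (snd s'))"
    proof
      fix b assume b: "1 \<le> b" "b \<le> n"
      show "fst (snd s') (2 * S + b) = V b"
        using mem(1)[of "2 * S + b"] assms(5)[of "V b"] \<pi>_V[OF b] b n_less unfolding s by simp
      show "fst (snd s') (3 * S + b) = (4 + b) * S"
        using mem(1)[of "3 * S + b"] row[OF b] b n_less by simp
    qed (use E n_less mem(2) i in \<open>auto simp: I_def fixed_def\<close>)
    then show "fixed s' \<and> snd (snd s') = [] \<and> tables S n E V (fst s') (fst (snd s'))"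
      using i by (simp add: I_def)
  qed
qed

lemma wp_setup:
  "wp setup (setup_cost (length w) n m)
    (\<lambda>s. fixed s \<and> snd (snd s) = [] \<and> tables S n E V (fst s) (fst (snd s))) (initial_state w)"
proof -
  let ?Q = "\<lambda>s. fixed s \<and> snd (snd s) = [] \<and> tables S n E V (fst s) (fst (snd s))"
  have one: "wp (Const 3 1) (len 1) (\<lambda>s. s = ((\<lambda>_. 0)(0 := length w, 3 := 1), mw, [])) (initial_state w)"
    using wp_ex[of "Const 3 1" "\<lambda>s. s = ((\<lambda>_. 0)(0 := length w, 3 := 1), mw, [])" "initial_state w"]
    by (simp add: initial_state_def mw_def[abs_def])
  have two: "wp (Add 4 0 3) 1 (\<lambda>s. s = ((\<lambda>_. 0)(0 := length w, 3 := 1, 4 := length w + 1), mw, [])) s"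
    if "s = ((\<lambda>_. 0)(0 := length w, 3 := 1), mw, [])" for s
    using wp_ex[of "Add 4 0 3" "\<lambda>s. s = ((\<lambda>_. 0)(0 := length w, 3 := 1, 4 := length w + 1), mw, [])" s] that by simp
  have header: "wp read_header (cost read_header) (\<lambda>s. fixed s \<and> fst s 9 = 4 * S \<and> snd s = (mw, [])) s"
    if "fst s 3 = 1 \<and> fst s 4 = S \<and> snd s = (mw, [])" for s
  proof (rule wp_ex)
    obtain r mem ys where s: "s = (r, mem, ys)" by (cases s)
    show "fixed (ex read_header s) \<and> fst (ex read_header s) 9 = 4 * S \<and> snd (ex read_header s) = (mw, [])"
      using that mw_header unfolding s by (simp add: read_header_def fixed_def)
  qed (simp add: read_header_def)
  have ptr: "wp ptr_init 4 (\<lambda>s. fixed s \<and> fst s 11 = 4 + 2 * n \<and> snd (snd s) = [] \<and>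
      (\<forall>x\<in>set vs. fst (snd s) (S + x) = \<pi> x \<and> fst (snd s) (2 * S + \<pi> x) = x) \<and>
      (\<forall>x. x < S \<or> 3 * S \<le> x \<longrightarrow> fst (snd s) x = m1 x)) s"
    if *: "fixed s \<and> snd (snd s) = [] \<and> (\<forall>x\<in>set vs. fst (snd s) (S + x) = \<pi> x \<and> fst (snd s) (2 * S + \<pi> x) = x) \<and>
      (\<forall>x. x < S \<or> 3 * S \<le> x \<longrightarrow> fst (snd s) x = m1 x)" for s
  proof -
    obtain r mem ys where s: "s = (r, mem, ys)" by (cases s)
    have r: "r 1 = n" "r 3 = 1" "r 10 = 3" using * unfolding s fixed_def by auto
    have e: "ex ptr_init s = (r(11 := 4 + 2 * n), mem, ys)" unfolding s using r by (simp add: ptr_init_def fun_eq_iff)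
    have "fixed (r(11 := 4 + 2 * n), mem, ys)" using * unfolding s fixed_def by simp
    then have "fixed (ex ptr_init s) \<and> fst (ex ptr_init s) 11 = 4 + 2 * n \<and> snd (snd (ex ptr_init s)) = [] \<and>
      (\<forall>x\<in>set vs. fst (snd (ex ptr_init s)) (S + x) = \<pi> x \<and> fst (snd (ex ptr_init s)) (2 * S + \<pi> x) = x) \<and>
      (\<forall>x. x < S \<or> 3 * S \<le> x \<longrightarrow> fst (snd (ex ptr_init s)) x = m1 x)"
      using * unfolding e unfolding s snd_conv fst_conv fun_upd_same by blast
    then show ?thesis
      using wp_ex[of ptr_init _ s] by (simp add: ptr_init_def numeral_eq_Suc)
  qed
  have rows: "wp (for_up 20 21 1 row_body) (n * (cost row_body + 3) + 5) (\<lambda>s. fixed s \<and> snd s = (m1, [])) s"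
    if "fixed s \<and> fst s 9 = 4 * S \<and> snd s = (mw, [])" for s
    by (rule wp_rows) (use that in blast)+
  have names: "wp (for_up 20 21 1 vertex_body) (n * (cost vertex_body + 3) + 5) (\<lambda>s. fixed s \<and> snd (snd s) = [] \<and>
    (\<forall>x\<in>set vs. fst (snd s) (S + x) = \<pi> x \<and> fst (snd s) (2 * S + \<pi> x) = x) \<and>
    (\<forall>x. x < S \<or> 3 * S \<le> x \<longrightarrow> fst (snd s) x = m1 x)) s" if "fixed s \<and> snd s = (m1, [])" for s
    by (rule wp_names) (use that in blast)+
  have measure: "wp measure_loop (length w * (3 + 1 + 2) + 4) (\<lambda>s. fst s 3 = 1 \<and> fst s 4 = S \<and> snd s = (mw, [])) s"
    if "s = ((\<lambda>_. 0)(0 := length w, 3 := 1, 4 := length w + 1), mw, [])" for s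
    unfolding that by (rule wp_measure)
  have cells: "wp (for_up 20 21 2 edge_body) (m * (cost edge_body + 3) + 5) ?Q s"
    if "fixed s \<and> fst s 11 = 4 + 2 * n \<and> snd (snd s) = [] \<and>
      (\<forall>x\<in>set vs. fst (snd s) (S + x) = \<pi> x \<and> fst (snd s) (2 * S + \<pi> x) = x) \<and>
      (\<forall>x. x < S \<or> 3 * S \<le> x \<longrightarrow> fst (snd s) x = m1 x)" for s
    by (rule wp_cells) (use that in blast)+
  have skip: "?Q s \<Longrightarrow> wp Skip 1 ?Q s" for s
    using wp_ex[of Skip ?Q s] by simp
  have "wp setup (len 1 + (1 + ((length w * (3 + 1 + 2) + 4) + (cost read_header + ((n * (cost row_body + 3) + 5) +
      ((n * (cost vertex_body + 3) + 5) + (4 + ((m * (cost edge_body + 3) + 5) + 1)))))))) ?Q (initial_state w)"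
    unfolding setup_def seqs.simps
    apply (rule wp_Seq, rule one)
    apply (rule wp_Seq, erule two)
    apply (rule wp_Seq, erule measure)
    apply (rule wp_Seq, erule header)
    apply (rule wp_Seq, erule rows)
    apply (rule wp_Seq, erule names)
    apply (rule wp_Seq, erule ptr)
    apply (rule wp_Seq, erule cells)
    apply (erule skip)
    done
  then show ?thesis
    by (rule wp_mono) (auto simp: setup_cost_def)
qed

end

lemma ex_replicate_Add:
  "x \<noteq> y \<Longrightarrow> ex (seqs (replicate i (Add x x y))) (r, m, ys) = (r(x := r x + i * r y), m, ys)"
  by (induction i arbitrary: r) (simp_all add: fun_eq_iff)

lemma loop_free_replicate_Add: "loop_free (seqs (replicate i (Add x x y)))"
  by (simp add: loop_free_seqs)

context instance_code
begin

text \<open>The sign of \<open>k\<close> is known when the program is built, that of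
  \<open>t\<close> is tested in register 5. When the two signs differ, a difference that truncates
  to 0 is computed again the other way round, and a target 0 gets sign 0.\<close>

definition "write_target = (if 0 \<le> k
  then IfNZ 5 (seqs [Sub 17 6 16, IfNZ 17 (seqs [Write 3, Write 17]) (seqs [Sub 17 16 6, Write 18, Write 17])])
         (seqs [Add 17 6 16, Write 18, Write 17])
  else IfNZ 5 (seqs [Add 17 6 16, Write 3, Write 17])
         (seqs [Sub 17 16 6, IfNZ 17 (seqs [Write 3, Write 17]) (seqs [Sub 17 6 16, Write 18, Write 17])]))"
text \<open>The machine has no multiplication, so the products of the number of crossings with
  \<open>h\<close>, with \<open>length EH + 2\<close> and with the absolute value of
  \<open>k\<close> are unrolled into repeated additions.\<close>

definition "write_header = seqs [Const 12 0, Add 12 12 1, seqs (replicate h (Add 12 12 14)),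
  Const 13 0, Add 13 13 2, seqs (replicate (length EH + 2) (Add 13 13 14)),
  Const 16 0, seqs (replicate (nat \<bar>k\<bar>) (Add 16 16 14)), Const 18 0, Write 12, Write 13, write_target]"
definition "first_name = Seq (Const 15 0) (Add 15 15 4)"
text \<open>The first sweep only counts the crossings, because the numbers of vertices and edges are written first.\<close>

definition "algorithm = seqs [setup, Const 14 0, sweep count_cross Skip Skip, write_header,
  first_name, sweep vertices_cross Skip write_name, for_up 20 21 12 (Write 20),
  first_name, sweep edges_cross edges_finish Skip]"
definition "algorithm_cost l i j z = setup_cost l i j + (1 + (sweep_cost i (cost count_cross) (cost Skip) (cost Skip) +
  (cost write_header + (2 + (sweep_cost i (cost vertices_cross) (cost Skip) (cost write_name) + ((z * (1 + 3) + 5) +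
  (2 + (sweep_cost i (cost edges_cross) (cost edges_finish) (cost Skip) + 1))))))))"

lemma loop_free_write_header: "loop_free write_header"
  by (simp add: write_header_def write_target_def loop_free_replicate_Add)

end

context instance_word
begin

definition "N = fst (history S V (events E n))"
definition "vertex_list = fst (snd (snd (history S V (events E n))))"
definition "edge_list = snd (snd (snd (history S V (events E n))))"
definition "target = t + int N * k"
definition "header = [n + h * N, m + (length EH + 2) * N, if target < 0 then 1 else 0, nat \<bar>target\<bar>]"

lemma ex_write_target:
  assumes "r 3 = 1" "r 5 = (if t < 0 then 1 else 0)" "r 6 = nat \<bar>t\<bar>" "r 16 = nat \<bar>k\<bar> * N" "r 18 = 0"
  shows "\<exists>v. ex write_target (r, mem, zs) = (r(17 := v), mem, zs @ [if target < 0 then 1 else 0, nat \<bar>target\<bar>])"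
proof (cases "0 \<le> k")
  case True
  define q where "q = nat \<bar>k\<bar> * N"
  have q: "target = t + int q" using True by (simp add: q_def target_def)
  show ?thesis
    using True assms unfolding write_target_def q q_def[symmetric]
    by (cases "t < 0"; cases "int q < \<bar>t\<bar>") (auto simp: nat_diff_distrib' nat_add_distrib intro!: exI)
next
  case False
  define q where "q = nat \<bar>k\<bar> * N"
  have q: "target = t - int q" using False by (simp add: q_def target_def)
  show ?thesis
    using False assms unfolding write_target_def q q_def[symmetric]
    by (cases "t < 0"; cases "int q \<le> \<bar>t\<bar>") (auto simp: nat_diff_distrib' nat_add_distrib intro!: exI)
qed

lemma ex_write_header:
  assumes "fixed (r, mem, [])" "r 14 = N"
  shows "\<exists>r'. ex write_header (r, mem, []) = (r', mem, header) \<and> r' 12 = n + h * N \<and>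
    (\<forall>y<11. r' y = r y)"
proof -
  have r: "r 1 = n" "r 2 = m" "r 3 = 1" "r 5 = (if t < 0 then 1 else 0)" "r 6 = nat \<bar>t\<bar>"
    using fixedD[OF assms(1)] by auto
  let ?r = "r(12 := n + h * N, 13 := m + (length EH + 2) * N, 16 := nat \<bar>k\<bar> * N, 18 := 0)"
  have "ex write_header (r, mem, []) = ex write_target (?r, mem, [n + h * N, m + (length EH + 2) * N])"
    using r assms(2) by (simp add: write_header_def ex_replicate_Add fun_upd_twist algebra_simps)
  moreover obtain v where "ex write_target (?r, mem, [n + h * N, m + (length EH + 2) * N]) =
      (?r(17 := v), mem, [n + h * N, m + (length EH + 2) * N] @ [if target < 0 then 1 else 0, nat \<bar>target\<bar>])"
    using ex_write_target[of ?r mem "[n + h * N, m + (length EH + 2) * N]"] r by auto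
  ultimately show ?thesis by (intro exI[of _ "?r(17 := v)"]) (simp add: header_def)
qed

lemma tables_regs:
  "tables S n E V r mem \<Longrightarrow> r' 1 = r 1 \<Longrightarrow> r' 3 = r 3 \<Longrightarrow> r' 7 = r 7 \<Longrightarrow> r' 8 = r 8 \<Longrightarrow> tables S n E V r' mem"
  unfolding tables_def by simp

definition "ready ys s \<longleftrightarrow> fixed s \<and> tables S n E V (fst s) (fst (snd s)) \<and> snd (snd s) = ys"

lemma ready_regs:
  assumes "ready ys s" "\<And>y. y < 11 \<Longrightarrow> fst s' y = fst s y" "snd s' = (fst (snd s), zs)"
  shows "ready zs s'"
  using assms tables_regs[of "fst s" "fst (snd s)" "fst s'"] unfolding ready_def fixed_def by simp

lemma wp_algorithm:
  "wp algorithm (algorithm_cost (length w) n m (n + h * N))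
     (\<lambda>s. snd (snd s) = header @ vertex_list @ [1..<n + h * N + 1] @ concat (map (\<lambda>(a, b). [a, b]) edge_list)) (initial_state w)"
proof -
  let ?M = "n + h * N"
  have 1: "wp setup (setup_cost (length w) n m) (ready []) (initial_state w)"
    using wp_setup by (rule wp_mono) (auto simp: ready_def)
  have 2: "wp (Const 14 0) 1 (\<lambda>s. ready [] s \<and> fst s 14 = 0) s" if "ready [] s" for s
  proof -
    obtain r mem ys where s: "s = (r, mem, ys)" by (cases s)
    have "ready [] (ex (Const 14 0) s)" by (rule ready_regs[OF that]) (use that s in \<open>auto simp: ready_def\<close>)
    then show ?thesis using wp_ex[of "Const 14 0" "\<lambda>s. ready [] s \<and> fst s 14 = 0" s] s by (simp add: len_def floorlog_def)
  qed
  have 3: "wp (sweep count_cross Skip Skip) (sweep_cost n (cost count_cross) (cost Skip) (cost Skip))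
      (\<lambda>s. ready [] s \<and> fst s 14 = N) s" if s: "ready [] s \<and> fst s 14 = 0" for s
  proof -
    interpret tables h iu iu' iv iv' EH S n E V "fst s" "fst (snd s)" using s by (simp add: ready_def)
    show ?thesis
    proof (rule wp_mono[OF wp_count[of s "[]"] order_refl])
      fix s' assume *: "count_inv [] (events E n) s'"
      have "ready [] s'" by (rule ready_regs[of "[]" s]) (use s * in \<open>auto simp: count_inv_def\<close>)
      then show "ready [] s' \<and> fst s' 14 = N" using * by (simp add: count_inv_def N_def)
    qed (use s in \<open>auto simp: ready_def prod_eq_iff\<close>)
  qed
  have 4: "wp write_header (cost write_header) (\<lambda>s. ready header s \<and> fst s 12 = ?M) s" if s: "ready [] s \<and> fst s 14 = N" for s
  proof (rule wp_ex[OF loop_free_write_header])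
    obtain r mem where rs: "s = (r, mem, [])" using s by (cases s) (simp add: ready_def)
    obtain r' where r': "ex write_header (r, mem, []) = (r', mem, header)" "r' 12 = ?M" "\<And>y. y < 11 \<Longrightarrow> r' y = r y"
      using ex_write_header[of r mem] s by (auto simp: rs ready_def)
    have "ready header (r', mem, header)" by (rule ready_regs[of "[]" s]) (use s r'(3) rs in auto)
    then show "ready header (ex write_header s) \<and> fst (ex write_header s) 12 = ?M" using r' rs by simp
  qed
  have 5: "wp first_name 2 (\<lambda>s. (ready ys s \<and> fst s 12 = z) \<and> fst s 15 = S) s" if "ready ys s \<and> fst s 12 = z" for s ys z
  proof -
    obtain r mem zs where s: "s = (r, mem, zs)" by (cases s)
    have "ready ys (ex first_name s)" by (rule ready_regs[of ys s]) (use that s in \<open>auto simp: ready_def first_name_def\<close>)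
    moreover have "r 4 = S" using that unfolding s ready_def fixed_def by simp
    ultimately show ?thesis
      using wp_ex[of first_name "\<lambda>s. (ready ys s \<and> fst s 12 = z) \<and> fst s 15 = S" s] s that
      by (simp add: first_name_def len_def floorlog_def numeral_eq_Suc)
  qed
  have 6: "wp (sweep vertices_cross Skip write_name) (sweep_cost n (cost vertices_cross) (cost Skip) (cost write_name))
      (\<lambda>s. ready (header @ vertex_list) s \<and> fst s 12 = ?M) s" if s: "(ready header s \<and> fst s 12 = ?M) \<and> fst s 15 = S" for s
  proof -
    interpret tables h iu iu' iv iv' EH S n E V "fst s" "fst (snd s)" using s by (simp add: ready_def)
    show ?thesis
    proof (rule wp_mono[OF wp_vertices[of s header] order_refl])
      fix s' assume *: "vertex_inv header (events E n) s'"
      have "ready (header @ vertex_list) s'"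
        by (rule ready_regs[of header s]) (use s * in \<open>auto simp: vertex_inv_def vertex_list_def\<close>)
      then show "ready (header @ vertex_list) s' \<and> fst s' 12 = ?M" using s * by (simp add: vertex_inv_def)
    qed (use s in \<open>auto simp: ready_def prod_eq_iff\<close>)
  qed
  \<comment> \<open>The vertices have been written in layout order, so the layout values are the
    numbers from 1 to \<open>?M\<close>.\<close>
  have 7: "wp (for_up 20 21 12 (Write 20)) (?M * (1 + 3) + 5) (\<lambda>s. ready (header @ vertex_list @ [1..<?M + 1]) s \<and> fst s 12 = ?M) s"
    if s: "ready (header @ vertex_list) s \<and> fst s 12 = ?M" for s
  proof -
    define I where "I j s \<longleftrightarrow> ready (header @ vertex_list @ [1..<j + 1]) s \<and> fst s 12 = ?M" for j and s :: state
    have upd: "I j (r(y := v), mem, ys)" if "I j (r, mem, ys)" "20 \<le> y" for j r mem ys y v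
      using that ready_regs[of "header @ vertex_list @ [1..<j + 1]" "(r, mem, ys)" "(r(y := v), mem, ys)"]
      unfolding I_def by (auto simp: ready_def)
    obtain r mem ys where rs: "s = (r, mem, ys)" by (cases s)
    have "wp (for_up 20 21 12 (Write 20)) (?M * (1 + 3) + 5) (\<lambda>s. I ?M s) (r, mem, ys)"
    proof (rule wp_for_up)
      fix j r mem ys assume j: "0 < j" "j \<le> ?M" "r 20 = j" "I (j - 1) (r, mem, ys)"
      have ys: "ys @ [j] = header @ vertex_list @ [1..<j + 1]" using j unfolding I_def ready_def by simp
      have "ready (header @ vertex_list @ [1..<j + 1]) (r, mem, ys @ [j])"
        by (rule ready_regs[of "header @ vertex_list @ [1..<j - 1 + 1]" "(r, mem, ys)"]) (use j ys in \<open>auto simp: I_def\<close>)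
      then show "wp (Write 20) 1 (\<lambda>s'. fst s' 20 = j \<and> fst s' 21 = r 21 \<and> fst s' 3 = 1 \<and> I j s') (r, mem, ys)"
        using wp_ex[of "Write 20" "\<lambda>s'. fst s' 20 = j \<and> fst s' 21 = r 21 \<and> fst s' 3 = 1 \<and> I j s'" "(r, mem, ys)"] j
        by (simp add: I_def ready_def fixed_def)
    qed (use upd s rs in \<open>auto simp: I_def ready_def fixed_def\<close>)
    then show ?thesis unfolding I_def rs .
  qed
  let ?out = "header @ vertex_list @ [1..<?M + 1]"
  have 8: "wp (sweep edges_cross edges_finish Skip) (sweep_cost n (cost edges_cross) (cost edges_finish) (cost Skip))
      (\<lambda>s. snd (snd s) = ?out @ flat edge_list) s" if s: "(ready ?out s \<and> fst s 12 = ?M) \<and> fst s 15 = S" for s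
  proof -
    interpret tables h iu iu' iv iv' EH S n E V "fst s" "fst (snd s)" using s by (simp add: ready_def)
    show ?thesis
    proof (rule wp_mono[OF wp_edges[of s ?out] order_refl])
      fix s' assume *: "edge_inv ?out (events E n) s'"
      then show "snd (snd s') = ?out @ flat edge_list"
        by (simp add: edge_inv_def edge_list_def split: prod.splits)
    qed (use s in \<open>auto simp: ready_def prod_eq_iff\<close>)
  qed
  have skip: "wp Skip 1 Q s" if "Q s" for Q s
    using wp_ex[of Skip Q s] that by simp
  have "wp algorithm (algorithm_cost (length w) n m ?M) (\<lambda>s. snd (snd s) = ?out @ flat edge_list) (initial_state w)"
    unfolding algorithm_def algorithm_cost_def seqs.simps
    apply (rule wp_Seq, rule 1)
    apply (rule wp_Seq, erule 2)
    apply (rule wp_Seq, erule 3)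
    apply (rule wp_Seq, erule 4)
    apply (rule wp_Seq, erule 5)
    apply (rule wp_Seq, erule 6)
    apply (rule wp_Seq, erule 7)
    apply (rule wp_Seq, erule 5)
    apply (rule wp_Seq, erule 8)
    apply (erule skip)
    done
  then show ?thesis by simp
qed

end

section \<open>The output as a graph\<close>

text \<open>This collects what the later arguments need to know when one event precedes another; the
  remaining pairs are unconstrained. The rule for \<open>Finish\<close> and \<open>Cross\<close>
  says that an edge is not cut after its last piece is written, and the rules for
  \<open>Vertex\<close> and \<open>Cross\<close> put the block of a crossing directly before
  \<open>bet\<close>.\<close>

fun before :: "event \<Rightarrow> event \<Rightarrow> bool" where
  "before (Cross a b c d) (Cross a' b' c' d') \<longleftrightarrow> xless ((a, b), (c, d)) ((a', b'), (c', d'))"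
| "before (Finish a b) (Cross a' b' c' d') \<longleftrightarrow> (a, b) \<noteq> (a', b') \<and> (a, b) \<noteq> (c', d')"
| "before (Finish a b) (Finish a' b') \<longleftrightarrow> (a, b) \<noteq> (a', b')"
| "before (Vertex b) (Cross a' b' c' d') \<longleftrightarrow> b < b'"
| "before (Cross a b c d) (Vertex b') \<longleftrightarrow> b \<le> b'"
| "before _ _ \<longleftrightarrow> True"

lemma sorted_wrt_concat_map:
  assumes "sorted_wrt P xs" "\<And>x. x \<in> set xs \<Longrightarrow> sorted_wrt R (f x)"
    "\<And>x y e e'. x \<in> set xs \<Longrightarrow> y \<in> set xs \<Longrightarrow> P x y \<Longrightarrow> e \<in> set (f x) \<Longrightarrow> e' \<in> set (f y) \<Longrightarrow> R e e'"
  shows "sorted_wrt R (concat (map f xs))"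
  using assms
proof (induction xs)
  case (Cons x xs)
  have "sorted_wrt R (concat (map f xs))"
    by (rule Cons.IH) (use Cons.prems in \<open>auto intro: Cons.prems(3)\<close>)
  moreover have "R e e'" if "e \<in> set (f x)" "y \<in> set xs" "e' \<in> set (f y)" for e y e'
    using Cons.prems(1) that by (intro Cons.prems(3)[of x y]) auto
  ultimately show ?case using Cons.prems(2) by (auto simp: sorted_wrt_append)
qed simp

lemma mem_crosses:
  "e \<in> set (crosses E n a b) \<longleftrightarrow> (\<exists>c d. e = Cross a b c d \<and> (c, d) \<in> E \<and> a < c \<and> c < b \<and> b < d \<and> c \<in> {1..n} \<and> d \<in> {1..n})"
  unfolding crosses_def by auto

lemma mem_phase:
  "e \<in> set (phase E n b) \<longleftrightarrow> e = Vertex b \<or>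
    (\<exists>a\<in>{1..n}. (a, b) \<in> E \<and> (e = Finish a b \<or> e \<in> set (crosses E n a b)))"
  unfolding phase_def by auto

lemma mem_events: "e \<in> set (events E n) \<longleftrightarrow> (\<exists>b\<in>{1..n}. e \<in> set (phase E n b))"
  unfolding events_def by auto

lemma sorted_wrt_rev_upt: "sorted_wrt (>) (rev [i..<j::nat])"
  by (simp add: sorted_wrt_rev)

lemma sorted_events: "sorted_wrt before (events E n)"
proof -
  have c: "sorted_wrt before (crosses E n a b)" for a b
    unfolding crosses_def
  proof (rule sorted_wrt_concat_map[OF sorted_wrt_upt])
    fix c
    show "sorted_wrt before (concat (map (\<lambda>d. if (c, d) \<in> E \<and> c < b \<and> a < c \<and> b < d then [Cross a b c d] else []) (rev [1..<n + 1])))"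
      by (rule sorted_wrt_concat_map[OF sorted_wrt_rev_upt]) (auto split: if_splits)
  qed (auto split: if_splits)
  have p: "sorted_wrt before (phase E n b)" for b
  proof -
    have "sorted_wrt before (concat (map (\<lambda>a. if (a, b) \<in> E then crosses E n a b @ [Finish a b] else []) (rev [1..<n + 1])))"
    proof (rule sorted_wrt_concat_map[OF sorted_wrt_rev_upt])
      fix a show "sorted_wrt before (if (a, b) \<in> E then crosses E n a b @ [Finish a b] else [])"
        using c[of a b] by (auto simp: sorted_wrt_append mem_crosses)
    qed (auto simp: mem_crosses split: if_splits)
    then show ?thesis unfolding phase_def by (auto simp: sorted_wrt_append mem_crosses)
  qed
  show ?thesis
    unfolding events_def
    by (rule sorted_wrt_concat_map[OF sorted_wrt_upt p]) (auto simp: mem_phase mem_crosses)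
qed

section \<open>The crossings, vertices and edges recorded by the events\<close>

definition "crossing_list p = concat (map (\<lambda>e. case e of Cross a b c d \<Rightarrow> [((a, b), (c, d))] | _ \<Rightarrow> []) p)"
definition "vertices_of p = concat (map (\<lambda>e. case e of Vertex b \<Rightarrow> [b] | _ \<Rightarrow> []) p)"
definition "finished p = concat (map (\<lambda>e. case e of Finish a b \<Rightarrow> [(a, b)] | _ \<Rightarrow> []) p)"

lemma lists_of_append [simp]:
  "crossing_list (p @ q) = crossing_list p @ crossing_list q"
  "vertices_of (p @ q) = vertices_of p @ vertices_of q"
  "finished (p @ q) = finished p @ finished q"
  by (simp_all add: crossing_list_def vertices_of_def finished_def)

lemma lists_of_simps [simp]:
  "crossing_list [] = []" "vertices_of [] = []" "finished [] = []"
  "crossing_list (Cross a b c d # p) = ((a, b), (c, d)) # crossing_list p" "crossing_list (Finish a b # p) = crossing_list p"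
  "crossing_list (Vertex b # p) = crossing_list p"
  "vertices_of (Cross a b c d # p) = vertices_of p" "vertices_of (Finish a b # p) = vertices_of p"
  "vertices_of (Vertex b # p) = b # vertices_of p"
  "finished (Cross a b c d # p) = finished p" "finished (Finish a b # p) = (a, b) # finished p"
  "finished (Vertex b # p) = finished p"
  by (simp_all add: crossing_list_def vertices_of_def finished_def)

lemma set_lists_of:
  "((a, b), (c, d)) \<in> set (crossing_list p) \<longleftrightarrow> Cross a b c d \<in> set p"
  "b \<in> set (vertices_of p) \<longleftrightarrow> Vertex b \<in> set p"
  "(a, b) \<in> set (finished p) \<longleftrightarrow> Finish a b \<in> set p"
  by (auto simp: crossing_list_def vertices_of_def finished_def split: event.splits)

lemma vertices_events: "vertices_of (events E n) = [1..<n + 1]"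
proof -
  have c: "vertices_of (crosses E n a b) = []" for a b
  proof -
    have "x \<notin> set (vertices_of (crosses E n a b))" for x by (auto simp: set_lists_of mem_crosses)
    then show ?thesis by (metis all_not_in_conv set_empty)
  qed
  have 1: "vertices_of (concat (map f l)) = concat (map (vertices_of \<circ> f) l)" for f :: "nat \<Rightarrow> event list" and l
    by (induction l) auto
  have 2: "vertices_of (phase E n b) = [b]" for b
    unfolding phase_def by (simp add: 1 c comp_def if_distrib cong: if_cong)
  show ?thesis unfolding events_def 1 comp_def 2 by simp
qed

locale event_graph = gadget_code +
  fixes n :: nat and V :: "nat \<Rightarrow> nat" and E :: "(nat \<times> nat) set" and B :: nat and H :: "nat graph"
  assumes E: "\<And>a b. (a, b) \<in> E \<Longrightarrow> 1 \<le> a \<and> a < b \<and> b \<le> n"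
    and V: "inj_on V {1..n}" "\<And>b. b \<in> {1..n} \<Longrightarrow> V b < B"
    and H: "simple_graph H" "verts H = {..<h}"
    and ter: "iu < h" "iu' < h" "iv < h" "iv' < h" "distinct [iu, iu', iv, iv']"
    and EH: "distinct (map (\<lambda>(a, b). {a, b}) EH)" "(\<lambda>(a, b). {a, b}) ` set EH = edges H"
begin

lemma mem_events_iff:
  "Cross a b c d \<in> set (events E n) \<longleftrightarrow> (a, b) \<in> E \<and> (c, d) \<in> E \<and> a < c \<and> c < b \<and> b < d"
  "Finish a b \<in> set (events E n) \<longleftrightarrow> (a, b) \<in> E"
  "Vertex b \<in> set (events E n) \<longleftrightarrow> 1 \<le> b \<and> b \<le> n"
  unfolding mem_events mem_phase using E by (fastforce simp: mem_crosses)+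

text \<open>With this instance the abstract chain of replacements takes the crossings in the order
  in which the program meets them.\<close>

sublocale crossings n V E B "crossing_list (events E n)" H h iu iu' iv iv'
proof
  show "set (crossing_list (events E n)) = {((a, b), (c, d)). (a, b) \<in> E \<and> (c, d) \<in> E \<and> a < c \<and> c < b \<and> b < d}"
    using set_lists_of(1)[of _ _ _ _ "events E n"] mem_events_iff(1) by auto
  have "sorted_wrt xless (crossing_list p)" if "sorted_wrt before p" for p
    using that
  proof (induction p)
    case (Cons e p)
    then show ?case by (cases e) (fastforce simp: set_lists_of simp del: xless.simps)+
  qed simp
  then show "sorted_wrt xless (crossing_list (events E n))" using sorted_events by blast
qed (use E V H ter in auto)

lemma event_split:
  assumes "events E n = p @ e # q"
  shows "\<And>e'. e' \<in> set p \<Longrightarrow> before e' e" "\<And>e'. e' \<in> set q \<Longrightarrow> before e e'"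
    "e \<in> set (events E n)" "N = length (crossing_list p) + length (crossing_list (e # q))"
  using sorted_events[of E n] unfolding N_def unfolding assms by (auto simp: sorted_wrt_append)

lemma nth_crossing:
  assumes "events E n = p @ Cross a b c d # q"
  shows "fe (length (crossing_list p)) = (a, b)" "fs (length (crossing_list p)) = (c, d)" "length (crossing_list p) < N"
  unfolding fe_def fs_def N_def unfolding assms by (simp_all add: nth_append)

section \<open>The written lists against the abstract sequence of graphs\<close>

lemma history_cur:
  "events E n = p @ q \<Longrightarrow> fst (history B V p) = length (crossing_list p) \<and>
     fst (snd (history B V p)) = cur (length (crossing_list p))"
proof (induction p arbitrary: q rule: rev_induct)
  case Nil
  show ?case by auto
next
  case (snoc e p)
  then have s: "events E n = p @ e # q" by simp
  obtain j cu vs es where h: "history B V p = (j, cu, vs, es)" by (cases "history B V p")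
  have j: "j = length (crossing_list p)" and cu: "cu = cur j" using snoc.IH[OF s] h by auto
  show ?case
  proof (cases e)
    case (Cross a b c d)
    have "(a, b) \<noteq> (c, d)" using event_split(3)[OF s] unfolding Cross mem_events_iff by auto
    then have "cur (Suc j) = cu((a, b) := B + j * h + iu', (c, d) := B + j * h + iv')"
      using nth_crossing[OF s[unfolded Cross]] unfolding j[symmetric] by (auto simp: fun_eq_iff nm_def cu)
    then show ?thesis using j by (simp add: h Cross)
  qed (use j cu in \<open>simp_all add: h\<close>)
qed

text \<open>The old vertices are placed in increasing order, and a crossing whose first edge ends at
  \<open>b\<close> is treated after all smaller vertices and before \<open>b\<close>. So exactly
  \<open>b - 1\<close> old vertices precede either kind of event.\<close>

lemma vertices_before:
  assumes "events E n = p @ e # q" "e = Vertex b \<or> e = Cross a b c d"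
  shows "b = length (vertices_of p) + 1"
proof -
  have all: "vertices_of p @ vertices_of (e # q) = [1..<n + 1]"
    using vertices_events[of E n] unfolding assms(1) by simp
  have "b \<le> n" "1 \<le> b" using event_split(3)[OF assms(1)] assms(2) mem_events_iff E by fastforce+
  have p: "x < b" if "x \<in> set (vertices_of p)" for x
    using assms(2)
  proof
    assume e: "e = Vertex b"
    have "sorted_wrt (<) (vertices_of p @ vertices_of (e # q))" unfolding all by (rule sorted_wrt_upt)
    then show ?thesis using that by (auto simp: e sorted_wrt_append)
  next
    assume "e = Cross a b c d"
    then show ?thesis using event_split(1)[OF assms(1), of "Vertex x"] that by (simp add: set_lists_of)
  qed
  have q: "b \<le> x" if "x \<in> set (vertices_of (e # q))" for x
    using assms(2)
  proof
    assume e: "e = Vertex b"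
    have "sorted_wrt (<) (vertices_of p @ vertices_of (e # q))" unfolding all by (rule sorted_wrt_upt)
    then show ?thesis using that by (auto simp: e sorted_wrt_append)
  next
    assume "e = Cross a b c d"
    then show ?thesis using event_split(2)[OF assms(1), of "Vertex x"] that by (simp add: set_lists_of)
  qed
  have "set (vertices_of p) \<union> set (vertices_of (e # q)) = {1..<n + 1}"
    using arg_cong[OF all, of set] by (simp del: upt_Suc)
  then have "set (vertices_of p) = {1..<b}" using p q \<open>b \<le> n\<close> by fastforce
  moreover have "distinct (vertices_of p)" using arg_cong[OF all, of distinct] by (simp del: upt_Suc)
  ultimately have "length (vertices_of p) = b - 1" using distinct_card[of "vertices_of p"] by simp
  then show ?thesis using \<open>1 \<le> b\<close> by simp
qed

text \<open>This turns the number of blocks in \<open>posV b\<close> into the number of blocks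
  already written when \<open>b\<close> is placed.\<close>

lemma crossings_before_vertex:
  assumes "events E n = p @ Vertex b # q"
  shows "card {j. j < N \<and> bet j \<le> b} = length (crossing_list p)"
proof -
  have xs: "crossing_list (events E n) = crossing_list p @ crossing_list q" using assms by simp
  have lN: "N = length (crossing_list p) + length (crossing_list q)" using event_split(4)[OF assms] by simp
  have "bet j \<le> b \<longleftrightarrow> j < length (crossing_list p)" if "j < N" for j
  proof -
    obtain a' b' c' d' where x: "crossing_list (events E n) ! j = ((a', b'), (c', d'))"
      by (cases "crossing_list (events E n) ! j") auto
    then have bet: "bet j = b'" by (simp add: bet_def fe_def)
    note x' = x[unfolded xs nth_append]
    show ?thesis
    proof (cases "j < length (crossing_list p)")
      case True
      then have "Cross a' b' c' d' \<in> set p"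
        using x' nth_mem[OF True] by (simp add: set_lists_of)
      then show ?thesis using event_split(1)[OF assms] True bet by fastforce
    next
      case False
      then have "j - length (crossing_list p) < length (crossing_list q)" using that lN by linarith
      from nth_mem[OF this] have "Cross a' b' c' d' \<in> set q"
        using x' False by (simp add: set_lists_of)
      then show ?thesis using event_split(2)[OF assms] False bet by fastforce
    qed
  qed
  then have "{j. j < N \<and> bet j \<le> b} = {..<length (crossing_list p)}"
    using lN by auto
  then show ?thesis by simp
qed

definition "vl p = fst (snd (snd (history B V p)))"
definition "el p = snd (snd (snd (history B V p)))"

text \<open>Every event appends at the place that \<open>L\<close> prescribes:
  \<open>vertices_before\<close> makes the next free position \<open>start j\<close> for a block,
  and together with \<open>crossings_before_vertex\<close> it makes it \<open>posV b\<close> for an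
  old vertex. The written list is therefore the layout itself.\<close>

lemma history_vertices:
  assumes L: "\<And>b. b \<in> {1..n} \<Longrightarrow> L (V b) = posV b" "\<And>j x. j < N \<Longrightarrow> x < h \<Longrightarrow> L (nm j x) = start j + x"
  shows "events E n = p @ q \<Longrightarrow> length (vl p) = h * length (crossing_list p) + length (vertices_of p) \<and>
    map L (vl p) = [1..<length (vl p) + 1] \<and>
    set (vl p) = V ` set (vertices_of p) \<union> {B..<B + length (crossing_list p) * h}"
proof (induction p arbitrary: q rule: rev_induct)
  case Nil
  show ?case by (simp add: vl_def)
next
  case (snoc e p)
  then have s: "events E n = p @ e # q" by simp
  obtain j cu vs es where h: "history B V p = (j, cu, vs, es)" by (cases "history B V p")
  have j: "j = length (crossing_list p)" using history_cur[OF s] h by simp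
  have vs: "vl p = vs" by (simp add: vl_def h)
  note IH = snoc.IH[OF s, unfolded vs j[symmetric]]
  show ?case
  proof (cases e)
    case (Cross a b c d)
    note nth = nth_crossing[OF s[unfolded Cross], folded j]
    have "bet j = length (vertices_of p) + 1"
      using vertices_before[OF s, of b a c d] nth Cross by (simp add: bet_def)
    then have st: "start j = length vs + 1" using IH by (simp add: start_def)
    define new where "new = map (\<lambda>i. B + j * h + i) [0..<h]"
    have "map L new = map (\<lambda>i. start j + i) [0..<h]"
      using L(2)[OF nth(3)] by (simp add: nm_def new_def)
    also have "\<dots> = [length vs + 1..<length vs + 1 + h]"
      unfolding st using map_add_upt[of "length vs + 1" h] by (simp add: add.commute)
    finally have "map L (vs @ new) = [1..<length vs + 1] @ [length vs + 1..<length vs + 1 + h]"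
      using IH by (simp del: upt_Suc)
    also have "\<dots> = [1..<length (vs @ new) + 1]"
      using upt_add_eq_append[of 1 "length vs + 1" h] by (simp add: new_def del: upt_Suc)
    finally have map: "map L (vs @ new) = [1..<length (vs @ new) + 1]" .
    have "set new = {B + j * h..<B + j * h + h}"
      using image_add_atLeastLessThan[of "B + j * h" 0 h] by (simp add: add.commute new_def)
    moreover have "{B..<B + j * h} \<union> {B + j * h..<B + j * h + h} = {B..<B + Suc j * h}"
      by auto
    ultimately have set: "set (vs @ new) = V ` set (vertices_of p) \<union> {B..<B + Suc j * h}"
      using IH by (simp add: Un_assoc)
    have "vl (p @ [e]) = vs @ new" "length (crossing_list (p @ [e])) = Suc j" "vertices_of (p @ [e]) = vertices_of p"
      by (simp_all add: vl_def h Cross j new_def)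
    moreover have "length (vs @ new) = h * Suc j + length (vertices_of p)" using IH by (simp add: new_def)
    ultimately show ?thesis using map set by (simp only:)
  next
    case (Finish a b)
    have "vl (p @ [e]) = vs" "crossing_list (p @ [e]) = crossing_list p" "vertices_of (p @ [e]) = vertices_of p"
      by (simp_all add: vl_def h Finish)
    then show ?thesis using IH j by (simp only:)
  next
    case (Vertex b)
    have b: "b = length (vertices_of p) + 1" using vertices_before[OF s, of b] Vertex by blast
    have "b \<in> {1..n}" using event_split(3)[OF s] unfolding Vertex mem_events_iff by simp
    then have "L (V b) = posV b" by (rule L)
    also have "\<dots> = length vs + 1"
      using crossings_before_vertex[OF s[unfolded Vertex]] IH b j by (simp add: posV_def)
    finally have "map L (vs @ [V b]) = [1..<length (vs @ [V b]) + 1]"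
      using IH by simp
    moreover have "vl (p @ [e]) = vs @ [V b]" "crossing_list (p @ [e]) = crossing_list p"
      "vertices_of (p @ [e]) = vertices_of p @ [b]"
      by (simp_all add: vl_def h Vertex)
    moreover have "length (vs @ [V b]) = h * j + length (vertices_of p @ [b])" using IH by simp
    moreover have "set (vs @ [V b]) = V ` set (vertices_of p @ [b]) \<union> {B..<B + j * h}" using IH by auto
    ultimately show ?thesis using j by (simp only:)
  qed
qed

lemma cur_stable:
  assumes "\<And>i. j \<le> i \<Longrightarrow> i < N \<Longrightarrow> \<not> on e i" "j \<le> N"
  shows "cur N e = cur j e"
proof -
  have "i \<le> N \<Longrightarrow> cur i e = cur j e" if "j \<le> i" for i
    using that
  proof (induction i rule: dec_induct)
    case (step i)
    then show ?case using assms(1)[of i] by (simp add: on_def)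
  qed simp
  from this[of N] show ?thesis using assms(2) by blast
qed

text \<open>A last piece is written with the left end that is current at that time. By
  \<open>before\<close> no later crossing involves its edge, so this is also the final left end
  \<open>cur N\<close>.\<close>

lemma history_edges:
  "events E n = p @ q \<Longrightarrow> length (el p) = length (crossing_list p) * (length EH + 2) + length (finished p) \<and>
    (\<lambda>(a, b). {a, b}) ` set (el p) = (\<Union>i<length (crossing_list p). inc i \<union> hed i) \<union>
      (\<lambda>e. {cur N e, V (snd e)}) ` set (finished p)"
proof (induction p arbitrary: q rule: rev_induct)
  case Nil
  show ?case by (simp add: el_def)
next
  case (snoc e p)
  then have s: "events E n = p @ e # q" by simp
  obtain j cu vs es where h: "history B V p = (j, cu, vs, es)" by (cases "history B V p")
  have j: "j = length (crossing_list p)" and cu: "cu = cur j" using history_cur[OF s] h by simp_all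
  have es: "el p = es" by (simp add: el_def h)
  note IH = snoc.IH[OF s, unfolded es j[symmetric]]
  show ?case
  proof (cases e)
    case (Cross a b c d)
    note nth = nth_crossing[OF s[unfolded Cross], folded j]
    define new where "new = [(cu (a, b), B + j * h + iu), (cu (c, d), B + j * h + iv)] @
      map (\<lambda>(x, y). (B + j * h + x, B + j * h + y)) EH"
    let ?pair = "\<lambda>(a, b). {a, b}"
    have 1: "hed j = (\<lambda>x. nm j ` ?pair x) ` set EH"
      unfolding hed_def EH(2)[symmetric] image_image ..
    have 2: "?pair ` set (map (\<lambda>(x, y). (B + j * h + x, B + j * h + y)) EH) = (\<lambda>x. nm j ` ?pair x) ` set EH"
      unfolding set_map image_image by (rule image_cong) (auto simp: nm_def)
    have 3: "inc j = {{cu (a, b), B + j * h + iu}, {cu (c, d), B + j * h + iv}}"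
      unfolding inc_def nth cu nm_def ..
    have "?pair ` set new = inc j \<union> hed j"
      unfolding new_def set_append image_Un 2 1 3 by simp
    then have im: "?pair ` set (es @ new) = ?pair ` set es \<union> (inc j \<union> hed j)"
      by (simp only: set_append image_Un)
    have un: "(\<Union>i<Suc j. inc i \<union> hed i) = (inc j \<union> hed j) \<union> (\<Union>i<j. inc i \<union> hed i)"
      unfolding lessThan_Suc by (rule UN_insert)
    have e: "el (p @ [e]) = es @ new" "length (crossing_list (p @ [e])) = Suc j" "finished (p @ [e]) = finished p"
      by (simp_all add: el_def h Cross j new_def)
    have "length (es @ new) = Suc j * (length EH + 2) + length (finished p)" using IH by (simp add: new_def)
    moreover have "?pair ` set (es @ new) = (\<Union>i<Suc j. inc i \<union> hed i) \<union> (\<lambda>e. {cur N e, V (snd e)}) ` set (finished p)"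
      unfolding im un conjunct2[OF IH] by (simp only: Un_ac)
    ultimately show ?thesis unfolding e by (rule conjI)
  next
    case (Finish a b)
    have c: "cur N (a, b) = cu (a, b)"
      unfolding cu
    proof (rule cur_stable)
      fix i assume i: "j \<le> i" "i < N"
      have xs: "crossing_list (events E n) = crossing_list p @ crossing_list q" using s Finish by simp
      obtain a' b' c' d' where x: "crossing_list (events E n) ! i = ((a', b'), (c', d'))"
        by (cases "crossing_list (events E n) ! i") auto
      have "i - j < length (crossing_list q)" using i event_split(4)[OF s] j Finish by simp
      from nth_mem[OF this] have "Cross a' b' c' d' \<in> set q"
        using x[unfolded xs nth_append] i(1) by (simp add: set_lists_of j)
      then have "before (Finish a b) (Cross a' b' c' d')" using event_split(2)[OF s] Finish by blast
      then show "\<not> on (a, b) i" by (auto simp: on_def fe_def fs_def x)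
    qed (use event_split(4)[OF s] j in simp)
    have e: "el (p @ [e]) = es @ [(cu (a, b), V b)]" "crossing_list (p @ [e]) = crossing_list p"
      "finished (p @ [e]) = finished p @ [(a, b)]"
      by (simp_all add: el_def h Finish)
    have "(\<lambda>(a, b). {a, b}) ` set (es @ [(cu (a, b), V b)]) = (\<Union>i<j. inc i \<union> hed i) \<union>
        (\<lambda>e. {cur N e, V (snd e)}) ` set (finished p @ [(a, b)])"
      unfolding set_append image_Un conjunct2[OF IH] using c by simp
    moreover have "length (es @ [(cu (a, b), V b)]) = j * (length EH + 2) + length (finished p @ [(a, b)])"
      using IH by simp
    ultimately show ?thesis unfolding e j by (rule conjI[rotated])
  next
    case (Vertex b)
    have "el (p @ [e]) = es" "crossing_list (p @ [e]) = crossing_list p" "finished (p @ [e]) = finished p"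
      by (simp_all add: el_def h Vertex)
    then show ?thesis using IH j by (simp only:)
  qed
qed

lemma finished_events: "distinct (finished (events E n))" "set (finished (events E n)) = E"
proof -
  have "distinct (finished p)" if "sorted_wrt before p" for p
    using that
  proof (induction p)
    case (Cons e p)
    then show ?case by (cases e) (auto simp: set_lists_of)
  qed simp
  then show "distinct (finished (events E n))" using sorted_events by blast
  show "set (finished (events E n)) = E"
    using set_lists_of(3)[of _ _ "events E n"] mem_events_iff(2) by auto
qed

text \<open>The list covers the edge set and has as many entries as the graph has edges, so no edge
  is repeated.\<close>

theorem edge_list_graph:
  "distinct (map (\<lambda>(a, b). {a, b}) (el (events E n)))"
  "(\<lambda>(a, b). {a, b}) ` set (el (events E n)) = edges (graph N)"
  "length (el (events E n)) = card E + (length EH + 2) * N"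
proof -
  have N: "N = length (crossing_list (events E n))" by (simp add: N_def)
  have l: "length (finished (events E n)) = card E" using finished_events by (metis distinct_card)
  note he = history_edges[of "events E n" "[]", unfolded N[symmetric] l finished_events(2)]
  show len: "length (el (events E n)) = card E + (length EH + 2) * N" using he by simp
  show im: "(\<lambda>(a, b). {a, b}) ` set (el (events E n)) = edges (graph N)"
    using he by (auto simp: graph_def fin_def)
  have "length EH = card (edges H)"
    using EH by (metis (no_types, lifting) distinct_card length_map set_map)
  then have "card (edges (graph N)) = length (map (\<lambda>(a, b). {a, b}) (el (events E n)))"
    using graph_simple_card[of N] len by simp
  then show "distinct (map (\<lambda>(a, b). {a, b}) (el (events E n)))"
    by (intro card_distinct) (simp add: im)
qed

theorem vertex_list_graph:
  assumes \<pi>: "\<And>b. b \<in> {1..n} \<Longrightarrow> \<pi> (V b) = b"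
  obtains L where "distinct (vl (events E n))" "set (vl (events E n)) = verts (graph N)"
    "map L (vl (events E n)) = [1..<n + h * N + 1]" "length (vl (events E n)) = n + h * N"
    "linear_layout (graph N) L" "layout_cutwidth (graph N) L \<le> layout_cutwidth G0 \<pi> + layout_cutwidth H Suc + 4"
proof
  \<comment> \<open>Names below \<open>B\<close> are old vertices; from a new name, division by
    \<open>h\<close> recovers the copy and the remainder the vertex in it.\<close>
  define L where "L x = (if x < B then posV (\<pi> x) else start ((x - B) div h) + (x - B) mod h)" for x
  have LV: "L (V b) = posV b" if "b \<in> {1..n}" for b
    using V(2)[OF that] \<pi>[OF that] by (simp add: L_def)
  have Lnm: "L (nm j x) = start j + x" if "j < N" "x < h" for j x
    using that by (simp add: L_def nm_def)
  have N: "N = length (crossing_list (events E n))" by (simp add: N_def)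
  let ?l = "vl (events E n)"
  have hv: "length ?l = h * N + n" "map L ?l = [1..<length ?l + 1]" "set ?l = V ` {1..n} \<union> {B..<B + N * h}"
    using history_vertices[of L "events E n" "[]", OF LV Lnm] unfolding N[symmetric] vertices_events
    by (auto simp: atLeastLessThanSuc_atLeastAtMost)
  show len: "length ?l = n + h * N" using hv by simp
  show map: "map L ?l = [1..<n + h * N + 1]" using hv(2) len by simp
  show v: "set ?l = verts (graph N)" using hv(3) by (simp add: graph_def)
  have "distinct (map L ?l)" unfolding map by (rule distinct_upt)
  then show d: "distinct ?l" by (simp add: distinct_map)
  have "L ` set ?l = {1..n + h * N}" using arg_cong[OF map, of set] by (simp del: upt_Suc add: atLeastLessThanSuc_atLeastAtMost)
  moreover have "inj_on L (set ?l)" using \<open>distinct (map L ?l)\<close> by (simp add: distinct_map)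
  moreover have "card (set ?l) = n + h * N" using d len by (simp add: distinct_card)
  ultimately show "linear_layout (graph N) L" unfolding linear_layout_def bij_betw_def v[symmetric] by simp
  show "layout_cutwidth (graph N) L \<le> layout_cutwidth G0 \<pi> + layout_cutwidth H Suc + 4"
    by (rule layout_cutwidth_graph[OF LV Lnm \<pi>])
qed

end

section \<open>Relabelling the gadget\<close>

lemma relabel_edge_iff:
  assumes "inj_on f V" "e \<subseteq> V" "e' \<subseteq> V"
  shows "f ` e = f ` e' \<longleftrightarrow> e = e'"
  using assms by (rule inj_on_image_eq_iff)

text \<open>Relabelling the gadget by an optimal layout makes \<open>Suc\<close> the layout, so the
  order of the names in a block is already optimal and needs no table.\<close>

lemma layout_cutwidth_relabel:
  assumes H: "simple_graph H" and f: "bij_betw f (verts H) {..<h::nat}" and \<sigma>: "\<And>x. x \<in> verts H \<Longrightarrow> Suc (f x) = \<sigma> x"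
  shows "layout_cutwidth (Graph {..<h} ((\<lambda>e. f ` e) ` edges H)) Suc = layout_cutwidth H \<sigma>"
proof -
  let ?K = "Graph {..<h} ((\<lambda>e. f ` e) ` edges H)"
  have sub: "e \<subseteq> verts H" if "e \<in> edges H" for e using H that by (auto simp: simple_graph_def)
  have inj: "inj_on f (verts H)" using f by (simp add: bij_betw_def)
  have cut: "cut_edges ?K Suc i = (\<lambda>e. f ` e) ` cut_edges H \<sigma> i" for i
  proof (intro set_eqI iffI)
    fix e' assume "e' \<in> cut_edges ?K Suc i"
    then obtain e x y where e: "e \<in> edges H" "e' = f ` e" "f ` e = {x, y}" "Suc x \<le> i" "i < Suc y"
      unfolding cut_edges_def by auto
    obtain a b where ab: "a \<in> e" "b \<in> e" "x = f a" "y = f b" using e(3) by blast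
    then have "f ` e = f ` {a, b}" using e(3) by simp
    then have "e = {a, b}" using relabel_edge_iff[OF inj sub[OF e(1)], of "{a, b}"] ab sub[OF e(1)] by blast
    moreover have "\<sigma> a \<le> i" "i < \<sigma> b" using e(4,5) ab sub[OF e(1)] \<sigma>[of a] \<sigma>[of b] by auto
    ultimately show "e' \<in> (\<lambda>e. f ` e) ` cut_edges H \<sigma> i" using e(1,2) unfolding cut_edges_def by blast
  next
    fix e' assume "e' \<in> (\<lambda>e. f ` e) ` cut_edges H \<sigma> i"
    then obtain e a b where e: "e \<in> edges H" "e' = f ` e" "e = {a, b}" "\<sigma> a \<le> i" "i < \<sigma> b"
      unfolding cut_edges_def by auto
    have "Suc (f a) \<le> i" "i < Suc (f b)" using e sub[OF e(1)] \<sigma>[of a] \<sigma>[of b] by auto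
    moreover have "e' = {f a, f b}" using e by simp
    ultimately show "e' \<in> cut_edges ?K Suc i" using e(1,2) unfolding cut_edges_def by auto
  qed
  have "card (cut_edges ?K Suc i) = card (cut_edges H \<sigma> i)" for i
    unfolding cut
  proof (rule card_image, rule inj_onI)
    fix e e' assume "e \<in> cut_edges H \<sigma> i" "e' \<in> cut_edges H \<sigma> i" "f ` e = f ` e'"
    then show "e = e'" using relabel_edge_iff[OF inj sub sub, of e e'] by (auto simp: cut_edges_def)
  qed
  moreover have "card (verts H) = h" using bij_betw_same_card[OF f] by simp
  ultimately show ?thesis by (simp add: layout_cutwidth_def)
qed

text \<open>The infimum of a nonempty set of natural numbers is attained.\<close>

lemma optimal_layout:
  assumes "simple_graph H"
  obtains \<sigma> where "linear_layout H \<sigma>" "layout_cutwidth H \<sigma> = cutwidth H"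
proof -
  have "\<exists>\<sigma>. linear_layout H \<sigma>"
    using ex_bij_betw_nat_finite_1[of "verts H"] assms bij_betw_inv_into
    unfolding linear_layout_def simple_graph_def by blast
  then have "cutwidth H \<in> layout_cutwidth H ` {\<sigma>. linear_layout H \<sigma>}"
    unfolding cutwidth_def by (intro Inf_nat_def1) auto
  then show ?thesis using that by auto
qed

lemma simple_graph_relabel:
  assumes H: "simple_graph H" and f: "bij_betw f (verts H) {..<h::nat}"
  shows "simple_graph (Graph {..<h} ((\<lambda>e. f ` e) ` edges H))"
proof -
  have "f ` e \<subseteq> {..<h} \<and> card (f ` e) = 2" if "e \<in> edges H" for e
  proof -
    have e: "e \<subseteq> verts H" "card e = 2" using H that by (auto simp: simple_graph_def)
    then have "card (f ` e) = card e" using f by (intro card_image) (auto simp: bij_betw_def intro: inj_on_subset)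
    then show ?thesis using e f by (auto simp: bij_betw_def)
  qed
  then show ?thesis by (auto simp: simple_graph_def)
qed

text \<open>Composing the embedding with \<open>f\<close> embeds the original gadget. So usefulness
  passes to the relabelled gadget with the same constant.\<close>

lemma replacement_relabel:
  assumes H: "simple_graph H" "{u, u', v, v'} \<subseteq> verts H" and f: "bij_betw f (verts H) {..<h::nat}"
    and R: "replacement (Graph {..<h} ((\<lambda>e. f ` e) ` edges H)) (f u) (f u') (f v) (f v') G a b c d G'"
  shows "replacement H u u' v v' G a b c d G'"
proof -
  have fH: "f ` verts H = {..<h}" "inj_on f (verts H)" using f by (auto simp: bij_betw_def)
  obtain \<phi> where e: "{a, b} \<in> edges G" "{c, d} \<in> edges G" "{a, b} \<inter> {c, d} = {}"
    and \<phi>: "inj_on \<phi> {..<h}" "\<phi> ` {..<h} \<inter> verts G = {}"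
      "G' = Graph (verts G \<union> \<phi> ` {..<h}) ((edges G - {{a, b}, {c, d}}) \<union> (\<lambda>e. \<phi> ` e) ` (\<lambda>e. f ` e) ` edges H \<union>
                {{a, \<phi> (f u)}, {\<phi> (f u'), b}, {c, \<phi> (f v)}, {\<phi> (f v'), d}})"
    using R unfolding replacement_def graph.sel by metis
  have "(\<lambda>e. \<phi> ` e) ` (\<lambda>e. f ` e) ` edges H = (\<lambda>e. (\<phi> \<circ> f) ` e) ` edges H"
    by (simp add: image_image image_comp)
  moreover have "(\<phi> \<circ> f) ` verts H = \<phi> ` {..<h}" unfolding image_comp[symmetric] fH(1) ..
  moreover have "inj_on (\<phi> \<circ> f) (verts H)" using \<phi>(1) fH by (simp add: comp_inj_on)
  ultimately have "inj_on (\<phi> \<circ> f) (verts H) \<and> (\<phi> \<circ> f) ` verts H \<inter> verts G = {} \<and>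
      G' = Graph (verts G \<union> (\<phi> \<circ> f) ` verts H) ((edges G - {{a, b}, {c, d}}) \<union> (\<lambda>e. (\<phi> \<circ> f) ` e) ` edges H \<union>
                {{a, (\<phi> \<circ> f) u}, {(\<phi> \<circ> f) u', b}, {c, (\<phi> \<circ> f) v}, {(\<phi> \<circ> f) v', d}})"
    using \<phi>(2,3) by simp
  then show ?thesis unfolding replacement_def using e by blast
qed

lemma set_drawing_relabel:
  assumes H: "simple_graph H" and f: "bij_betw f (verts H) {..<h::nat}" and d: "set_drawing H p S"
  defines "g \<equiv> the_inv_into (verts H) f"
  shows "set_drawing (Graph {..<h} ((\<lambda>e. f ` e) ` edges H)) (p \<circ> g) (\<lambda>e. S (g ` e))"
proof -
  have fH: "f ` verts H = {..<h}" "inj_on f (verts H)" using f by (auto simp: bij_betw_def)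
  have gf: "g (f x) = x" if "x \<in> verts H" for x using fH(2) that by (simp add: g_def the_inv_into_f_f)
  have sub: "e \<subseteq> verts H" if "e \<in> edges H" for e using H that by (auto simp: simple_graph_def)
  have gfe: "g ` f ` e = e" if "e \<in> edges H" for e using sub[OF that] gf by (force simp: image_iff)
  have pg: "(p \<circ> g) ` (f ` e) = p ` e" if "e \<in> edges H" for e
    unfolding image_comp[symmetric] gfe[OF that] ..
  have int: "(p \<circ> g) ` (f ` e \<inter> f ` e') = p ` (e \<inter> e')" if "e \<in> edges H" "e' \<in> edges H" for e e'
  proof -
    have "f ` e \<inter> f ` e' = f ` (e \<inter> e')" using fH(2) sub that by (intro inj_on_image_Int[symmetric]) auto
    moreover have "g ` f ` (e \<inter> e') = e \<inter> e'" using sub[OF that(1)] gf by (force simp: image_iff)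
    ultimately show ?thesis unfolding image_comp[symmetric] by simp
  qed
  show ?thesis
    unfolding set_drawing_def graph.sel
  proof (intro conjI)
    have "inj_on g {..<h}" using bij_betw_the_inv_into[OF f] by (simp add: g_def bij_betw_def)
    moreover have "g ` {..<h} = verts H" using bij_betw_the_inv_into[OF f] by (simp add: g_def bij_betw_def)
    ultimately show "inj_on (p \<circ> g) {..<h}" using d by (simp add: set_drawing_def comp_inj_on)
    show "\<forall>e\<in>(\<lambda>e. f ` e) ` edges H. \<exists>\<gamma>. arc \<gamma> \<and> {pathstart \<gamma>, pathfinish \<gamma>} = (p \<circ> g) ` e \<and> path_image \<gamma> = S (g ` e)"
    proof
      fix e' assume "e' \<in> (\<lambda>e. f ` e) ` edges H"
      then obtain e where e: "e \<in> edges H" "e' = f ` e" by blast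
      show "\<exists>\<gamma>. arc \<gamma> \<and> {pathstart \<gamma>, pathfinish \<gamma>} = (p \<circ> g) ` e' \<and> path_image \<gamma> = S (g ` e')"
        using bspec[OF conjunct1[OF conjunct2[OF d[unfolded set_drawing_def]]] e(1)] unfolding e(2) pg[OF e(1)] gfe[OF e(1)] .
    qed
    show "\<forall>e\<in>(\<lambda>e. f ` e) ` edges H. \<forall>x\<in>{..<h}. (p \<circ> g) x \<in> S (g ` e) \<longrightarrow> x \<in> e"
    proof (intro ballI impI)
      fix e' x assume "e' \<in> (\<lambda>e. f ` e) ` edges H" "x \<in> {..<h}" and x: "(p \<circ> g) x \<in> S (g ` e')"
      then obtain e y where e: "e \<in> edges H" "e' = f ` e" and y: "y \<in> verts H" "x = f y" using fH(1) by blast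
      have "p y \<in> S e" using x unfolding e(2) y(2) gfe[OF e(1)] comp_apply gf[OF y(1)] .
      moreover have "\<forall>e\<in>edges H. \<forall>x\<in>verts H. p x \<in> S e \<longrightarrow> x \<in> e" using d unfolding set_drawing_def by (elim conjE)
      ultimately have "y \<in> e" using e(1) y(1) by blast
      then show "x \<in> e'" unfolding e(2) y(2) by (rule imageI)
    qed
    show "\<forall>e\<in>(\<lambda>e. f ` e) ` edges H. \<forall>e'\<in>(\<lambda>e. f ` e) ` edges H. e \<noteq> e' \<longrightarrow> S (g ` e) \<inter> S (g ` e') \<subseteq> (p \<circ> g) ` (e \<inter> e')"
    proof (intro ballI impI)
      fix a b assume "a \<in> (\<lambda>e. f ` e) ` edges H" "b \<in> (\<lambda>e. f ` e) ` edges H" and ne: "a \<noteq> b"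
      then obtain e e' where e: "e \<in> edges H" "a = f ` e" "e' \<in> edges H" "b = f ` e'" by blast
      then have "e \<noteq> e'" using ne by blast
      moreover have "\<forall>e\<in>edges H. \<forall>f\<in>edges H. e \<noteq> f \<longrightarrow> S e \<inter> S f \<subseteq> p ` (e \<inter> f)"
        using d unfolding set_drawing_def by (elim conjE)
      ultimately have "S e \<inter> S e' \<subseteq> p ` (e \<inter> e')" using e(1,3) by blast
      then show "S (g ` a) \<inter> S (g ` b) \<subseteq> (p \<circ> g) ` (a \<inter> b)"
        unfolding e(2,4) gfe[OF e(1)] gfe[OF e(3)] int[OF e(1,3)] .
    qed
  qed
qed

lemma edge_pairs:
  assumes "simple_graph (H :: 'a graph)"
  obtains es where "distinct (map (\<lambda>(a, b). {a, b}) es)" "(\<lambda>(a, b). {a, b}) ` set es = edges H"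
proof -
  have "finite (edges H)"
    using assms by (auto simp: simple_graph_def intro: finite_subset[of _ "Pow (verts H)"])
  then obtain l where l: "distinct l" "set l = edges H" using finite_distinct_list by blast
  have "\<forall>e\<in>set l. \<exists>ab. e = (\<lambda>(a, b). {a, b}) ab"
    using assms l by (fastforce simp: simple_graph_def card_2_iff)
  then obtain s where s: "\<forall>e\<in>set l. e = (\<lambda>(a, b). {a, b}) (s e)" by metis
  have "map (\<lambda>(a, b). {a, b}) (map s l) = l"
    using s by (simp add: map_idI)
  then show thesis using that[of "map s l"] l by (metis set_map)
qed

section \<open>The reduction\<close>

definition polynomial :: "(nat \<Rightarrow> nat) \<Rightarrow> bool" where
  "polynomial f \<longleftrightarrow> (\<exists>q. \<forall>x. f x = poly q x)"

lemma polynomial_intros: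
  "polynomial (\<lambda>_. c)" "polynomial (\<lambda>x. x)"
  "polynomial f \<Longrightarrow> polynomial g \<Longrightarrow> polynomial (\<lambda>x. f x + g x)"
  "polynomial f \<Longrightarrow> polynomial g \<Longrightarrow> polynomial (\<lambda>x. f x * g x)"
proof -
  show "polynomial (\<lambda>_. c)" unfolding polynomial_def by (intro exI[of _ "[:c:]"]) simp
  show "polynomial (\<lambda>x. x)" unfolding polynomial_def by (intro exI[of _ "[:0, 1:]"]) simp
  show "polynomial (\<lambda>x. f x + g x)" if "polynomial f" "polynomial g"
    using that unfolding polynomial_def by (metis poly_add)
  show "polynomial (\<lambda>x. f x * g x)" if "polynomial f" "polynomial g"
    using that unfolding polynomial_def by (metis poly_mult)
qed

lemma len_pos: "1 \<le> len x" by (simp add: len_def)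

lemma length_le_word_size: "length w \<le> word_size w"
proof (induction w)
  case (Cons x w)
  then show ?case using len_pos[of x] by (simp add: word_size_def)
qed simp

lemma len_le_word_size: "x \<in> set w \<Longrightarrow> len x \<le> word_size w"
  unfolding word_size_def by (rule member_le_sum_list) auto

text \<open>The size of the input word is thus a valid initial bit bound \<open>W\<close> for
  turning step counts into logarithmic cost.\<close>

lemma bnd_initial_state: "bnd (word_size w) (initial_state w)"
proof -
  have "length w < 2 ^ word_size w"
    by (rule le_less_trans[OF length_le_word_size]) simp
  moreover have "w ! i < 2 ^ word_size w" if "i < length w" for i
    by (rule less_le_trans[OF less_2_len power_increasing]) (use that in \<open>auto intro: len_le_word_size\<close>)
  ultimately show ?thesis by (auto simp: bnd_def initial_state_def)
qed

text \<open>The order \<open>xless\<close> is irreflexive, so a sorted list has no repetitions and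
  is no longer than the set of quadruples of positions.\<close>

lemma (in crossings) N_le: "N \<le> n * n * (n * n)"
proof -
  have irrefl: "\<not> xless x x" for x
    by (cases x; cases "fst x"; cases "snd x") auto
  have "distinct ys" if "sorted_wrt xless ys" for ys
    using that by (induction ys) (use irrefl in auto)
  then have "N = card (set xs)" using sorted by (simp add: N_def distinct_card)
  also have "\<dots> \<le> card (({1..n} \<times> {1..n}) \<times> ({1..n} \<times> {1..n}))"
  proof (rule card_mono)
    show "set xs \<subseteq> ({1..n} \<times> {1..n}) \<times> ({1..n} \<times> {1..n})"
    proof
      fix x assume "x \<in> set xs"
      then obtain a b c d where "x = ((a, b), (c, d))" "(a, b) \<in> E" "(c, d) \<in> E" unfolding xs by auto
      then show "x \<in> ({1..n} \<times> {1..n}) \<times> ({1..n} \<times> {1..n})" using E[of a b] E[of c d] by simp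
    qed
  qed simp
  finally show ?thesis by (simp add: card_cartesian_product)
qed

locale gadget_reduction = instance_code +
  fixes H :: "nat graph" and P :: graph_problem
    and q :: "nat \<Rightarrow> complex" and C :: "nat set \<Rightarrow> complex set" and A :: "nat \<Rightarrow> real \<Rightarrow> complex"
  assumes H: "simple_graph H" "verts H = {..<h}"
    and ter: "iu < h" "iu' < h" "iv < h" "iv' < h" "distinct [iu, iu', iv, iv']"
    and EH: "distinct (map (\<lambda>(a, b). {a, b}) EH)" "(\<lambda>(a, b). {a, b}) ` set EH = edges H"
    and useful: "\<And>G t a b c d G'. simple_graph G \<Longrightarrow> replacement H iu iu' iv iv' G a b c d G' \<Longrightarrow>
      ((G, t) \<in> P \<longleftrightarrow> (G', t + k) \<in> P)"
    and C: "set_drawing H q C"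
    and qC: "q ` verts H \<union> (\<Union>e\<in>edges H. C e) \<subseteq> ball 0 1"
    and A: "\<And>i. i < 4 \<Longrightarrow> arc (A i) \<and> pathstart (A i) = q ([iu, iv, iu', iv'] ! i) \<and> pathfinish (A i) = \<i> ^ Suc i \<and>
       path_image (A i) \<subseteq> insert (\<i> ^ Suc i) (ball 0 1) \<and>
       path_image (A i) \<inter> (q ` verts H \<union> (\<Union>e\<in>edges H. C e)) \<subseteq> {q ([iu, iv, iu', iv'] ! i)}"
    and AA: "\<And>i j. i < 4 \<Longrightarrow> j < 4 \<Longrightarrow> i \<noteq> j \<Longrightarrow> path_image (A i) \<inter> path_image (A j) = {}"
begin

text \<open>The cost is monotone in the input sizes and in the number of output vertices, which is
  at most \<open>n + h * (n * n * (n * n))\<close>; all of them are bounded through the word size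
  \<open>x\<close>. The next definition inserts \<open>steps\<close> into the cost bound of
  \<open>run\<close> with \<open>x\<close> as initial bit bound.\<close>

definition "steps x = algorithm_cost x x x (x + h * (x * x * (x * x)))"
definition "time x = steps x * (2 * (x + steps x) + 4)"

lemma polynomial_time: "polynomial time"
  unfolding time_def[abs_def] steps_def algorithm_cost_def setup_cost_def sweep_cost_def
  by (intro polynomial_intros)

lemma algorithm_cost_mono:
  assumes "l \<le> x" "i \<le> x" "j \<le> x" "z \<le> x + h * (x * x * (x * x))"
  shows "algorithm_cost l i j z \<le> steps x"
  unfolding steps_def algorithm_cost_def setup_cost_def sweep_cost_def
  by (intro add_mono mult_mono assms) simp_all

lemma reduction:
  assumes "simple_graph G" "linear_layout G \<pi>" "encodes w G t \<pi>"
  shows "\<exists>out G' t' \<pi>'. (\<exists>T r m. exec algorithm (initial_state w) T (r, m, out) \<and> T \<le> time (word_size w)) \<and>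
    simple_graph G' \<and> linear_layout G' \<pi>' \<and> encodes out G' t' \<pi>' \<and> planar G' \<and>
    layout_cutwidth G' \<pi>' \<le> layout_cutwidth G \<pi> + layout_cutwidth H Suc + 4 \<and>
    ((G, t) \<in> P \<longleftrightarrow> (G', t') \<in> P)"
proof -
  obtain vs es where vs: "distinct vs" "set vs = verts G"
    and es: "distinct (map (\<lambda>(a, b). {a, b}) es)" "(\<lambda>(a, b). {a, b}) ` set es = edges G"
    and w: "w = [length vs, length es, if t < 0 then 1 else 0, nat \<bar>t\<bar>]
              @ vs @ map \<pi> vs @ concat (map (\<lambda>(a, b). [a, b]) es)"
    using assms(3) unfolding encodes_def by blast
  have lvs: "card (verts G) = length vs" using vs by (metis distinct_card)
  define S where "S = length w + 1 + sum_list w"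
  define V where "V = the_inv_into (set vs) \<pi>"
  define E where "E = (\<lambda>(a, b). if \<pi> a < \<pi> b then (\<pi> a, \<pi> b) else (\<pi> b, \<pi> a)) ` set es"
  interpret I: instance_word h iu iu' iv iv' EH k vs es t \<pi> "length vs" "length es" S w V E
  proof unfold_locales
    show "distinct vs" by fact
    show "distinct (map (\<lambda>(a, b). {a, b}) es)" by fact
    show "a \<in> set vs \<and> b \<in> set vs \<and> a \<noteq> b" if "(a, b) \<in> set es" for a b
    proof -
      have "{a, b} \<in> edges G" using that unfolding es(2)[symmetric] by force
      then show ?thesis using assms(1) vs(2) unfolding simple_graph_def by fastforce
    qed
    show "bij_betw \<pi> (set vs) {1..length vs}" using assms(2) lvs vs by (simp add: linear_layout_def)
  qed (simp_all add: S_def V_def E_def w)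
  let ?n = "length vs"
  interpret X: event_graph h iu iu' iv iv' EH ?n V E S H
  proof
    show "1 \<le> a \<and> a < b \<and> b \<le> ?n" if "(a, b) \<in> E" for a b using I.E[OF that] .
    show "inj_on V {1..?n}" by (rule inj_onI) (metis I.\<pi>_V atLeastAtMost_iff)
    show "V b < S" if "b \<in> {1..?n}" for b using I.\<pi>_V[of b] I.name_less that by simp
  qed (use H ter EH in auto)
  interpret D: drawn_crossings ?n V E S "crossing_list (events E ?n)" H h iu iu' iv iv' q C A
    by unfold_locales (fact C, fact qC, fact A, fact AA)
  let ?ev = "events E ?n" and ?G = "X.graph X.N"
  have N: "I.N = X.N"
    using X.history_cur[of ?ev "[]"] by (simp add: I.N_def X.N_def)
  have vl: "I.vertex_list = X.vl ?ev" by (simp add: I.vertex_list_def X.vl_def)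
  have el: "I.edge_list = X.el ?ev" by (simp add: I.edge_list_def X.el_def)
  have V\<pi>: "\<pi> (V b) = b" if "b \<in> {1..?n}" for b using I.\<pi>_V[of b] that by simp
  have G0: "X.G0 = G"
  proof (rule graph.expand, intro conjI)
    have "V ` {1..?n} = set vs"
    proof
      show "V ` {1..?n} \<subseteq> set vs" using I.\<pi>_V by auto
      show "set vs \<subseteq> V ` {1..?n}"
      proof
        fix x assume "x \<in> set vs"
        then show "x \<in> V ` {1..?n}" using I.\<pi>_in[of x] I.V_\<pi>[of x] by (intro image_eqI[of _ _ "\<pi> x"]) simp_all
      qed
    qed
    then show "verts X.G0 = verts G" using vs(2) by (simp add: X.G0_def)
    have "(\<lambda>(a, b). {V a, V b}) (if \<pi> a < \<pi> b then (\<pi> a, \<pi> b) else (\<pi> b, \<pi> a)) = {a, b}" if "(a, b) \<in> set es" for a b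
    proof -
      have "a \<in> set vs" "b \<in> set vs" using I.es(2)[OF that] by auto
      then show ?thesis using I.V_\<pi>[of a] I.V_\<pi>[of b] by auto
    qed
    then have "(\<lambda>(a, b). {V a, V b}) ` E = (\<lambda>(a, b). {a, b}) ` set es"
      unfolding E_def image_image by (intro image_cong refl) (clarsimp simp only: split_paired_all prod.case)
    then show "edges X.G0 = edges G" using es(2) by (simp add: X.G0_def)
  qed
  have "card (edges X.G0) = card E"
    using X.inj_edge by (simp add: X.G0_def card_image)
  moreover have "card (edges G) = length es"
    unfolding es(2)[symmetric] using distinct_card[OF es(1)] by simp
  ultimately have cE: "card E = length es" using G0 by simp
  obtain L where L: "distinct (X.vl ?ev)" "set (X.vl ?ev) = verts ?G"
    "map L (X.vl ?ev) = [1..<?n + h * X.N + 1]" "length (X.vl ?ev) = ?n + h * X.N"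
    "linear_layout ?G L" "layout_cutwidth ?G L \<le> layout_cutwidth X.G0 \<pi> + layout_cutwidth H Suc + 4"
    by (rule X.vertex_list_graph[OF V\<pi>])
  let ?out = "I.header @ I.vertex_list @ [1..<?n + h * I.N + 1] @ concat (map (\<lambda>(a, b). [a, b]) I.edge_list)"
  have enc: "encodes ?out ?G I.target L"
    unfolding encodes_def
  proof (intro exI conjI)
    show "distinct (X.vl ?ev)" "set (X.vl ?ev) = verts ?G" by fact+
    show "distinct (map (\<lambda>(a, b). {a, b}) (X.el ?ev))" "(\<lambda>(a, b). {a, b}) ` set (X.el ?ev) = edges ?G"
      by (fact X.edge_list_graph)+
    show "?out = [length (X.vl ?ev), length (X.el ?ev), if I.target < 0 then 1 else 0, nat \<bar>I.target\<bar>] @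
        X.vl ?ev @ map L (X.vl ?ev) @ concat (map (\<lambda>(a, b). [a, b]) (X.el ?ev))"
      unfolding I.header_def vl el N L(3) L(4) X.edge_list_graph(3) cE ..
  qed
  have time: "\<exists>T r m. exec algorithm (initial_state w) T (r, m, ?out) \<and> T \<le> time (word_size w)"
  proof -
    let ?W = "word_size w"
    have le: "length w \<le> ?W" "?n \<le> ?W" "length es \<le> ?W"
      using length_le_word_size[of w] I.length_w by auto
    have "X.N \<le> ?W * ?W * (?W * ?W)"
      by (rule order_trans[OF X.N_le]) (intro mult_le_mono le)
    then have "?n + h * I.N \<le> ?W + h * (?W * ?W * (?W * ?W))"
      unfolding N by (intro add_mono mult_le_mono le order_refl)
    then have "algorithm_cost (length w) ?n (length es) (?n + h * I.N) \<le> steps ?W"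
      by (intro algorithm_cost_mono le)
    then have "wp algorithm (steps ?W) (\<lambda>s. snd (snd s) = ?out) (initial_state w)"
      by (intro wp_mono[OF I.wp_algorithm]) auto
    then obtain s where s: "run algorithm (initial_state w) (steps ?W) s" "snd (snd s) = ?out"
      unfolding wp_def by blast
    obtain T where T: "T \<le> steps ?W * (2 * (?W + steps ?W) + 4)" "exec algorithm (initial_state w) T s"
      using s(1) bnd_initial_state[of w] unfolding run_def by blast
    obtain r m where "s = (r, m, ?out)" using s(2) by (cases s) auto
    then show ?thesis using T unfolding time_def by blast
  qed
  have "simple_graph ?G" using X.graph_simple_card[of X.N] by simp
  moreover have "planar ?G" using D.planar_graph .
  moreover have "(G, t) \<in> P \<longleftrightarrow> (?G, I.target) \<in> P"
    using X.useful_iterate[OF useful, where j = X.N and t = t] unfolding G0 I.target_def N by simp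
  ultimately show ?thesis
    using time L(5,6) enc unfolding G0 by blast
qed

end

theorem theorem6:
  fixes P :: graph_problem
    and H :: "'h graph"
    and u u' v v' :: 'h
  assumes "crossover_gadget H u u' v v'"
    and "useful H u u' v v' P"
  shows "\<exists>F. polytime_on
               {w. \<exists>G t \<pi>. simple_graph G \<and> linear_layout G \<pi> \<and> encodes w G t \<pi>} F \<and>
             (\<forall>w G t \<pi>. simple_graph G \<and> linear_layout G \<pi> \<and> encodes w G t \<pi> \<longrightarrow>
                (\<exists>G' t' \<pi>'. simple_graph G' \<and> linear_layout G' \<pi>' \<and> encodes (F w) G' t' \<pi>' \<and>
                   planar G' \<and>
                   layout_cutwidth G' \<pi>' \<le> layout_cutwidth G \<pi> + cutwidth H + 4 \<and>
                   ((G, t) \<in> P \<longleftrightarrow> (G', t') \<in> P)))"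
proof -
  have H: "simple_graph H" "{u, u', v, v'} \<subseteq> verts H" "distinct [u, u', v, v']"
    using assms(1) unfolding crossover_gadget_def by blast+
  obtain k where k: "\<And>G t a b c d G'. simple_graph G \<Longrightarrow> replacement H u u' v v' G a b c d G' \<Longrightarrow>
      ((G, t) \<in> P \<longleftrightarrow> (G', t + k) \<in> P)"
    using assms(2) unfolding useful_def by metis
  obtain \<sigma> where \<sigma>: "linear_layout H \<sigma>" "layout_cutwidth H \<sigma> = cutwidth H"
    using optimal_layout[OF H(1)] by blast
  define h where "h = card (verts H)"
  \<comment> \<open>Layout positions start at 1, the labels \<open>{..<h}\<close> at 0.\<close>
  define f where "f x = \<sigma> x - 1" for x
  have \<sigma>b: "bij_betw \<sigma> (verts H) {1..h}" using \<sigma>(1) by (simp add: linear_layout_def h_def)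
  have Suc_f: "Suc (f x) = \<sigma> x" if "x \<in> verts H" for x
    using bij_betw_apply[OF \<sigma>b that] by (simp add: f_def)
  have "bij_betw (\<lambda>i. i - 1) {1..h} {..<h}"
    by (rule bij_betw_byWitness[where f' = Suc]) auto
  from bij_betw_trans[OF \<sigma>b this] have f: "bij_betw f (verts H) {..<h}"
    by (simp add: comp_def f_def[abs_def])
  define g where "g = the_inv_into (verts H) f"
  have gf: "g (f x) = x" if "x \<in> verts H" for x
    using f that by (simp add: g_def bij_betw_def the_inv_into_f_f)
  let ?K = "Graph {..<h} ((\<lambda>e. f ` e) ` edges H)"
  have K: "simple_graph ?K" by (rule simple_graph_relabel[OF H(1) f])
  obtain EH where EH: "distinct (map (\<lambda>(a, b). {a, b}) EH)" "(\<lambda>(a, b). {a, b}) ` set EH = edges ?K"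
    using edge_pairs[OF K] by blast
  obtain p S A where d: "set_drawing H p S" "p ` verts H \<union> (\<Union>e\<in>edges H. S e) \<subseteq> ball 0 1"
    and A: "\<And>i. i < 4 \<Longrightarrow> arc (A i) \<and> pathstart (A i) = p ([u, v, u', v'] ! i) \<and> pathfinish (A i) = \<i> ^ Suc i \<and>
       path_image (A i) \<subseteq> insert (\<i> ^ Suc i) (ball 0 1) \<and>
       path_image (A i) \<inter> (p ` verts H \<union> (\<Union>e\<in>edges H. S e)) \<subseteq> {p ([u, v, u', v'] ! i)}"
    and AA: "\<And>i j. i < 4 \<Longrightarrow> j < 4 \<Longrightarrow> i \<noteq> j \<Longrightarrow> path_image (A i) \<inter> path_image (A j) = {}"
  proof (rule gadget_disc_drawing[OF assms(1)])
    fix p S A assume *: "set_drawing H p S" "p ` verts H \<union> (\<Union>e\<in>edges H. S e) \<subseteq> ball 0 1"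
      "\<And>i. i < 4 \<Longrightarrow> arc (A i) \<and> pathstart (A i) = p ([u, v, u', v'] ! i) \<and> pathfinish (A i) = \<i> ^ Suc i \<and>
       path_image (A i) \<subseteq> insert (\<i> ^ Suc i) (ball 0 1) \<and>
       path_image (A i) \<inter> (p ` verts H \<union> (\<Union>e\<in>edges H. S e)) \<subseteq> {p ([u, v, u', v'] ! i)}"
      "\<And>i j. i < 4 \<Longrightarrow> j < 4 \<Longrightarrow> i \<noteq> j \<Longrightarrow> path_image (A i) \<inter> path_image (A j) = {}"
    show thesis by (rule that[OF *])
  qed
  have sub: "e \<subseteq> verts H" if "e \<in> edges H" for e using H(1) that by (auto simp: simple_graph_def)
  have gfe: "g ` f ` e = e" if "e \<subseteq> verts H" for e using that gf by (force simp: image_iff)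
  have Kp: "(p \<circ> g) ` verts ?K = p ` verts H"
  proof -
    have "g ` {..<h} = verts H" using gfe[of "verts H"] f by (simp add: bij_betw_def)
    then show ?thesis unfolding graph.sel image_comp[symmetric] by simp
  qed
  have KS: "(\<Union>e\<in>edges ?K. S (g ` e)) = (\<Union>e\<in>edges H. S e)"
    using gfe sub by simp
  have ter: "f u \<in> {..<h}" "f u' \<in> {..<h}" "f v \<in> {..<h}" "f v' \<in> {..<h}"
    using f H(2) by (auto simp: bij_betw_def)
  have inj: "inj_on f (verts H)" using f by (simp add: bij_betw_def)
  have nth: "(p \<circ> g) ([f u, f v, f u', f v'] ! i) = p ([u, v, u', v'] ! i)" if "i < 4" for i
    using H(2) gf that by (auto simp: less_Suc_eq numeral_eq_Suc)
  interpret R: gadget_reduction h "f u" "f u'" "f v" "f v'" EH k ?K P "p \<circ> g" "\<lambda>e. S (g ` e)" A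
  proof
    show "distinct [f u, f u', f v, f v']"
      using H(2,3) inj by (auto simp: inj_on_def)
    show "((G, t) \<in> P) = ((G', t + k) \<in> P)"
      if "simple_graph G" "replacement ?K (f u) (f u') (f v) (f v') G a b c d G'" for G t a b c d G'
      by (rule k[OF that(1) replacement_relabel[OF H(1,2) f that(2)]])
    show "set_drawing ?K (p \<circ> g) (\<lambda>e. S (g ` e))"
      unfolding g_def by (rule set_drawing_relabel[OF H(1) f d(1)])
    show "(p \<circ> g) ` verts ?K \<union> (\<Union>e\<in>edges ?K. S (g ` e)) \<subseteq> ball 0 1"
      unfolding Kp KS by (rule d(2))
    show "arc (A i) \<and> pathstart (A i) = (p \<circ> g) ([f u, f v, f u', f v'] ! i) \<and> pathfinish (A i) = \<i> ^ Suc i \<and>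
       path_image (A i) \<subseteq> insert (\<i> ^ Suc i) (ball 0 1) \<and>
       path_image (A i) \<inter> ((p \<circ> g) ` verts ?K \<union> (\<Union>e\<in>edges ?K. S (g ` e))) \<subseteq> {(p \<circ> g) ([f u, f v, f u', f v'] ! i)}"
      if "i < 4" for i
      unfolding Kp KS nth[OF that] by (rule A[OF that])
  qed (use K EH ter AA in auto)
  have cw: "layout_cutwidth ?K Suc = cutwidth H"
    using layout_cutwidth_relabel[OF H(1) f Suc_f] \<sigma>(2) by simp
  \<comment> \<open>The machine is deterministic, so on valid words \<open>F\<close> is the output
    of the algorithm; where it does not halt the value is arbitrary.\<close>
  define F where "F w = (SOME out. \<exists>T r m. exec R.algorithm (initial_state w) T (r, m, out))" for w
  have F: "F w = out" if "exec R.algorithm (initial_state w) T (r, m, out)" for w T r m out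
    unfolding F_def
  proof (rule some_equality)
    show "\<exists>T r m. exec R.algorithm (initial_state w) T (r, m, out)" using that by blast
    fix z assume "\<exists>T r m. exec R.algorithm (initial_state w) T (r, m, z)"
    then show "z = out" using exec_deterministic[OF that] by blast
  qed
  obtain q where q: "\<And>x. R.time x = poly q x" using R.polynomial_time unfolding polynomial_def by blast
  let ?D = "{w. \<exists>G t \<pi>. simple_graph G \<and> linear_layout G \<pi> \<and> encodes w G t \<pi>}"
  have poly: "polytime_on ?D F"
    unfolding polytime_on_def
  proof (rule exI[of _ R.algorithm], rule exI[of _ q], rule ballI)
    fix w assume "w \<in> ?D"
    then obtain G t \<pi> where "simple_graph G" "linear_layout G \<pi>" "encodes w G t \<pi>" by blast
    from R.reduction[OF this] obtain out T r m where
      e: "exec R.algorithm (initial_state w) T (r, m, out)" "T \<le> R.time (word_size w)" by blast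
    then show "\<exists>T r m. exec R.algorithm (initial_state w) T (r, m, F w) \<and> T \<le> poly q (word_size w)"
      unfolding F[OF e(1)] q by blast
  qed
  have main: "\<exists>G' t' \<pi>'. simple_graph G' \<and> linear_layout G' \<pi>' \<and> encodes (F w) G' t' \<pi>' \<and> planar G' \<and>
      layout_cutwidth G' \<pi>' \<le> layout_cutwidth G \<pi> + cutwidth H + 4 \<and> ((G, t) \<in> P \<longleftrightarrow> (G', t') \<in> P)"
    if "simple_graph G \<and> linear_layout G \<pi> \<and> encodes w G t \<pi>" for w G t \<pi>
  proof -
    have "simple_graph G" "linear_layout G \<pi>" "encodes w G t \<pi>" using that by auto
    from R.reduction[OF this, unfolded cw] obtain out G' t' \<pi>' T r m
      where e: "exec R.algorithm (initial_state w) T (r, m, out)"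
        and o: "simple_graph G' \<and> linear_layout G' \<pi>' \<and> encodes out G' t' \<pi>' \<and> planar G' \<and>
          layout_cutwidth G' \<pi>' \<le> layout_cutwidth G \<pi> + cutwidth H + 4 \<and> ((G, t) \<in> P \<longleftrightarrow> (G', t') \<in> P)"
      by blast
    show ?thesis unfolding F[OF e] using o by blast
  qed
  show ?thesis
    by (rule exI[of _ F], rule conjI[OF poly], intro allI impI, erule main)
qed

end
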